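(* Let $M>1$, let $\rho_0>0$, $c_0=c(\rho_0)$, and let $\overline U$ be the constant supersonic state with density $\rho_0$ and velocity $(Mc_0,0)$. Let $\mu=\arcsin(1/M)\in(0,\pi/2)$, $\lambda_0=0$, $\lambda_\pm=\pm\tan\mu=\pm 1/\sqrt{M^2-1}$. For $\delta>0$ and $a\in\{0,+,-\}$ put $I_a=(\lambda_a-\delta,\lambda_a+\delta)$, and define the six sectors: forward sector $F_a=\{(x,y):x>0,\ y/x\in I_a\}$ and backward sector $B_a=\{(x,y):x<0,\ y/x\in I_a\}$ (their center lines are $(1:0)$, $(\cos\mu:\sin\mu)$, $(\cos\mu:-\sin\mu)$). For every sufficiently small $\delta>0$ there are $\epsilon>0$ and $\kappa>0$ such that every steady, self-similar, entropy-admissible weak solution $U\in L^\infty$ of the 2-d isentropic compressible Euler equations with $\|U-\overline U\|_{L^\infty}\le\epsilon$ has, after modification on a null set, the following properties: 1. $U$, as a function of the polar angle, is of bounded variation. 2. $U$ is constant on each connected component of the complement in $\mathbb R^2\setminus\{0\}$ of the six sectors. 3. In $F_0$, and likewise in $B_0$, $U$ is constant on each side of a single contact discontinuity (which may vanish, i.e. $U$ may be constant there). 4. In each of the forward sectors $F_+$ and $F_-$, $U$ is constant on each side of a single shock or of a single rarefaction wave (either of which may vanish). 5. In each of the backward sectors $B_\pm$ (with $U$ regarded as a function of $\xi=y/x\in I_\pm$): (a) two consecutive compression (simple) waves separated by a gap are not possible: on every open subinterval of $I_\pm$ on which $U$ is continuous, $U$ is either constant, or constant on each side of a single simple wave; (b)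 all discontinuities are shocks, the set of shock locations is discrete (each of its points is isolated), and if $\xi_0$ is a shock location with jump size $J=|U(\xi_0+)-U(\xi_0-)|$, then $U$ is constant on $(\xi_0-\kappa J,\xi_0)$ and constant on $(\xi_0,\xi_0+\kappa J)$.
   Context: The 2-d isentropic compressible Euler equations are $U_t+f^x(U)_x+f^y(U)_y=0$ with $U=(\rho,m,n)$, $\rho>0$ the density, $(m,n)=\rho\vec v$ the momentum density, $\vec v$ the velocity, $f^x(U)=(m,\ m^2/\rho+p,\ mn/\rho)$, $f^y(U)=(n,\ mn/\rho,\ n^2/\rho+p)$. The pressure $p=p(\rho)$ is smooth with $c(\rho)^2=p'(\rho)>0$ for $\rho>0$ ($c>0$ is the sound speed), and it is assumed that $\frac{d}{d\rho}(\rho c(\rho))>0$. Weak solutions are understood in the sense of distributions. A triple of smooth functions $(\eta,\psi^x,\psi^y)$ of $U$ is an entropy-flux pair if $\psi^x_U=\eta_Uf^x_U$ and $\psi^y_U=\eta_Uf^y_U$. A weak solution $U$ is entropy-admissible if $\eta(U)_t+\psi^x(U)_x+\psi^y(U)_y\le0$ in the sense of distributions for all entropy-flux pairs with convex $\eta$. Steady: $U$ is (a.e. equal to a function) independent of $t$. Self-similar: $U$ is a.e. equal to a function constant on each open ray $\{s(x,y):s>0\}$, $(x,y)\ne0$; so on $x>0$ and on $x<0$ it is a function of $\xi=y/x$. The generalized eigenvalues of the system, i.e. the roots $\xi$ of $\det(f^y_U(U)-\xi f^x_U(U))=0$, are $\lambda_0(U)=n/m$ and $\lambda_\pm(U)=\frac{mn\pm\rho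 c\sqrt{m^2+n^2-(\rho c)^2}}{m^2-(\rho c)^2}$; $\lambda_a=\lambda_a(\overline U)$. A discontinuity at $\xi_0$ is a jump between $U^-=U(\xi_0-)$ and $U^+=U(\xi_0+)$ with $f^y(U^+)-f^y(U^-)=\xi_0(f^x(U^+)-f^x(U^-))$; it is called a contact discontinuity if it belongs to the $0$-field (then $\lambda_0(U^-)=\xi_0=\lambda_0(U^+)$) and a shock if it belongs to a $\pm$-field. A simple wave of the $\pm$-field is the restriction of $U$ to an interval of $\xi$ of positive length on which $U$ is Lipschitz, $\lambda_\pm(U(\xi))=\xi$, and $U_\xi$ lies in the kernel of $f^y_U(U)-\xi f^x_U(U)$; simple waves in forward sectors are called rarefaction (expansion) waves, those in backward sectors compression waves. *)

theory Defs
  imports "HOL-Analysis.Analysis"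
begin

section \<open>Smooth functions, distributions, bounded variation\<close>

text \<open>In finite dimensions continuity of all directional derivatives is continuity of the
  derivative, so for open \<open>S\<close> this is the usual class of \<open>k\<close> times continuously differentiable
  functions.\<close>

primrec Ck_on :: "nat \<Rightarrow> 'a::euclidean_space set \<Rightarrow> ('a \<Rightarrow> 'b::euclidean_space) \<Rightarrow> bool" where
  "Ck_on 0 S f \<longleftrightarrow> continuous_on S f"
| "Ck_on (Suc k) S f \<longleftrightarrow>
     (\<forall>x\<in>S. f differentiable (at x)) \<and> (\<forall>v. Ck_on k S (\<lambda>x. frechet_derivative f (at x) v))"

definition smooth_on :: "'a::euclidean_space set \<Rightarrow> ('a \<Rightarrow> 'b::euclidean_space) \<Rightarrow> bool" where
  "smooth_on S f \<longleftrightarrow> (\<forall>k. Ck_on k S f)"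

definition test_function :: "('a::euclidean_space \<Rightarrow> real) \<Rightarrow> bool" where
  "test_function \<phi> \<longleftrightarrow> smooth_on UNIV \<phi> \<and> compact (closure {z. \<phi> z \<noteq> 0})"

definition locally_integrable :: "('a::euclidean_space \<Rightarrow> 'b::euclidean_space) \<Rightarrow> bool" where
  "locally_integrable f \<longleftrightarrow> (\<forall>K. compact K \<longrightarrow> set_integrable lebesgue K f)"

text \<open>Points of space-time are triples \<open>(t, x, y)\<close>.\<close>

type_synonym spacetime = "real \<times> real \<times> real"

definition div_pairing ::
  "(spacetime \<Rightarrow> 'b::euclidean_space) \<Rightarrow> (spacetime \<Rightarrow> 'b) \<Rightarrow> (spacetime \<Rightarrow> 'b) \<Rightarrow>
   (spacetime \<Rightarrow> real) \<Rightarrow> 'b" where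
  "div_pairing g h k \<phi> =
     - (LINT z|lebesgue. frechet_derivative \<phi> (at z) (1, 0, 0) *\<^sub>R g z
                       + frechet_derivative \<phi> (at z) (0, 1, 0) *\<^sub>R h z
                       + frechet_derivative \<phi> (at z) (0, 0, 1) *\<^sub>R k z)"

text \<open>\<open>g\<^sub>t + h\<^sub>x + k\<^sub>y = 0\<close>, respectively \<open>\<le> 0\<close>, in the sense of distributions on space-time.\<close>

definition distrib_div_zero ::
  "(spacetime \<Rightarrow> 'b::euclidean_space) \<Rightarrow> (spacetime \<Rightarrow> 'b) \<Rightarrow> (spacetime \<Rightarrow> 'b) \<Rightarrow> bool" where
  "distrib_div_zero g h k \<longleftrightarrow>
     locally_integrable g \<and> locally_integrable h \<and> locally_integrable k \<and>
     (\<forall>\<phi>. test_function \<phi> \<longrightarrow> div_pairing g h k \<phi> = 0)"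

definition distrib_div_nonpos ::
  "(spacetime \<Rightarrow> real) \<Rightarrow> (spacetime \<Rightarrow> real) \<Rightarrow> (spacetime \<Rightarrow> real) \<Rightarrow> bool" where
  "distrib_div_nonpos g h k \<longleftrightarrow>
     locally_integrable g \<and> locally_integrable h \<and> locally_integrable k \<and>
     (\<forall>\<phi>. test_function \<phi> \<and> (\<forall>z. 0 \<le> \<phi> z) \<longrightarrow> div_pairing g h k \<phi> \<le> 0)"

definition in_Linf :: "('a::euclidean_space \<Rightarrow> 'b::euclidean_space) \<Rightarrow> bool" where
  "in_Linf f \<longleftrightarrow> f \<in> borel_measurable lebesgue \<and> (\<exists>B. AE z in lebesgue. norm (f z) \<le> B)"

definition bounded_variation_on :: "real set \<Rightarrow> (real \<Rightarrow> 'b::real_normed_vector) \<Rightarrow> bool" where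
  "bounded_variation_on S f \<longleftrightarrow>
     (\<exists>B. \<forall>(n::nat) t. (\<forall>i\<le>n. t i \<in> S) \<and> (\<forall>i<n. t i \<le> t (Suc i)) \<longrightarrow>
        (\<Sum>i<n. norm (f (t (Suc i)) - f (t i))) \<le> B)"


section \<open>The isentropic Euler equations\<close>

text \<open>A state is the vector \<open>(\<rho>, m, n)\<close>.\<close>

type_synonym state = "real ^ 3"

definition sound_speed :: "(real \<Rightarrow> real) \<Rightarrow> real \<Rightarrow> real" where
  "sound_speed p \<rho> = sqrt (deriv p \<rho>)"

definition flux_x :: "(real \<Rightarrow> real) \<Rightarrow> state \<Rightarrow> state" where
  "flux_x p U = vector [U $ 2, (U $ 2)\<^sup>2 / U $ 1 + p (U $ 1), U $ 2 * U $ 3 / U $ 1]"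

definition flux_y :: "(real \<Rightarrow> real) \<Rightarrow> state \<Rightarrow> state" where
  "flux_y p U = vector [U $ 3, U $ 2 * U $ 3 / U $ 1, (U $ 3)\<^sup>2 / U $ 1 + p (U $ 1)]"

definition states :: "state set" where
  "states = {U. 0 < U $ 1}"

definition weak_solution :: "(real \<Rightarrow> real) \<Rightarrow> (spacetime \<Rightarrow> state) \<Rightarrow> bool" where
  "weak_solution p U \<longleftrightarrow>
     U \<in> borel_measurable lebesgue \<and> (AE z in lebesgue. U z \<in> states) \<and>
     distrib_div_zero U (\<lambda>z. flux_x p (U z)) (\<lambda>z. flux_y p (U z))"

definition entropy_flux_pair ::
  "(real \<Rightarrow> real) \<Rightarrow> (state \<Rightarrow> real) \<Rightarrow> (state \<Rightarrow> real) \<Rightarrow> (state \<Rightarrow> real) \<Rightarrow> bool" where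
  "entropy_flux_pair p \<eta> \<psi>x \<psi>y \<longleftrightarrow>
     smooth_on states \<eta> \<and> smooth_on states \<psi>x \<and> smooth_on states \<psi>y \<and>
     (\<forall>U\<in>states. \<forall>v.
        frechet_derivative \<psi>x (at U) v
          = frechet_derivative \<eta> (at U) (frechet_derivative (flux_x p) (at U) v) \<and>
        frechet_derivative \<psi>y (at U) v
          = frechet_derivative \<eta> (at U) (frechet_derivative (flux_y p) (at U) v))"

definition entropy_admissible :: "(real \<Rightarrow> real) \<Rightarrow> (spacetime \<Rightarrow> state) \<Rightarrow> bool" where
  "entropy_admissible p U \<longleftrightarrow>
     (\<forall>\<eta> \<psi>x \<psi>y. entropy_flux_pair p \<eta> \<psi>x \<psi>y \<and> convex_on states \<eta> \<longrightarrow>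
        distrib_div_nonpos (\<lambda>z. \<eta> (U z)) (\<lambda>z. \<psi>x (U z)) (\<lambda>z. \<psi>y (U z)))"

definition steady :: "(spacetime \<Rightarrow> state) \<Rightarrow> bool" where
  "steady U \<longleftrightarrow> (\<exists>V. AE z in lebesgue. U z = V (snd z))"

definition ray_constant :: "(real \<times> real \<Rightarrow> 'b) \<Rightarrow> bool" where
  "ray_constant V \<longleftrightarrow> (\<forall>w s. w \<noteq> 0 \<and> 0 < s \<longrightarrow> V (s *\<^sub>R w) = V w)"

definition self_similar :: "(spacetime \<Rightarrow> state) \<Rightarrow> bool" where
  "self_similar U \<longleftrightarrow>
     (\<exists>W. (AE z in lebesgue. U z = W z) \<and> (\<forall>t. ray_constant (\<lambda>w. W (t, w))))"


section \<open>Fields, discontinuities and simple waves\<close>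

datatype wave_field = FMinus | FZero | FPlus

fun eigenvalue :: "(real \<Rightarrow> real) \<Rightarrow> wave_field \<Rightarrow> state \<Rightarrow> real" where
  "eigenvalue p FZero U = U $ 3 / U $ 2"
| "eigenvalue p FPlus U =
     (let \<rho> = U $ 1; m = U $ 2; n = U $ 3; c = sound_speed p \<rho>
      in (m * n + \<rho> * c * sqrt (m\<^sup>2 + n\<^sup>2 - (\<rho> * c)\<^sup>2)) / (m\<^sup>2 - (\<rho> * c)\<^sup>2))"
| "eigenvalue p FMinus U =
     (let \<rho> = U $ 1; m = U $ 2; n = U $ 3; c = sound_speed p \<rho>
      in (m * n - \<rho> * c * sqrt (m\<^sup>2 + n\<^sup>2 - (\<rho> * c)\<^sup>2)) / (m\<^sup>2 - (\<rho> * c)\<^sup>2))"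

text \<open>Averaged Jacobian: \<open>f U\<^sup>+ - f U\<^sup>-\<close> equals this matrix applied to \<open>U\<^sup>+ - U\<^sup>-\<close>, so the
  Rankine-Hugoniot condition makes \<open>\<xi>\<^sub>0\<close> a generalized eigenvalue of the two averaged Jacobians.
  A discontinuity belongs to the field which this eigenvalue belongs to. In the regime of states
  with \<open>m > \<rho> c\<close> the three eigenvalues are ordered as \<open>\<lambda>\<^sub>- < \<lambda>\<^sub>0 < \<lambda>\<^sub>+\<close>.\<close>

definition avg_jacobian :: "(state \<Rightarrow> state) \<Rightarrow> state \<Rightarrow> state \<Rightarrow> real ^ 3 ^ 3" where
  "avg_jacobian f Um Up = integral {0..1} (\<lambda>s. jacobian f (at (Um + s *\<^sub>R (Up - Um))))"

definition belongs_to_field ::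
  "(real \<Rightarrow> real) \<Rightarrow> wave_field \<Rightarrow> real \<Rightarrow> state \<Rightarrow> state \<Rightarrow> bool" where
  "belongs_to_field p a \<xi>0 Um Up \<longleftrightarrow>
     (\<exists>l1 l2 l3. l1 < l2 \<and> l2 < l3 \<and>
        {\<xi>. det (avg_jacobian (flux_y p) Um Up - \<xi> *\<^sub>R avg_jacobian (flux_x p) Um Up) = 0}
          = {l1, l2, l3} \<and>
        \<xi>0 = (case a of FMinus \<Rightarrow> l1 | FZero \<Rightarrow> l2 | FPlus \<Rightarrow> l3))"

definition discontinuity_at ::
  "(real \<Rightarrow> real) \<Rightarrow> (real \<Rightarrow> state) \<Rightarrow> real \<Rightarrow> state \<Rightarrow> state \<Rightarrow> bool" where
  "discontinuity_at p u \<xi>0 Um Up \<longleftrightarrow>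
     (u \<longlongrightarrow> Um) (at_left \<xi>0) \<and> (u \<longlongrightarrow> Up) (at_right \<xi>0) \<and> Um \<noteq> Up \<and>
     Um \<in> states \<and> Up \<in> states \<and>
     flux_y p Up - flux_y p Um = \<xi>0 *\<^sub>R (flux_x p Up - flux_x p Um)"

definition contact_at ::
  "(real \<Rightarrow> real) \<Rightarrow> (real \<Rightarrow> state) \<Rightarrow> real \<Rightarrow> state \<Rightarrow> state \<Rightarrow> bool" where
  "contact_at p u \<xi>0 Um Up \<longleftrightarrow>
     discontinuity_at p u \<xi>0 Um Up \<and> belongs_to_field p FZero \<xi>0 Um Up \<and>
     eigenvalue p FZero Um = \<xi>0 \<and> eigenvalue p FZero Up = \<xi>0"

definition shock_at ::
  "(real \<Rightarrow> real) \<Rightarrow> wave_field \<Rightarrow> (real \<Rightarrow> state) \<Rightarrow> real \<Rightarrow> state \<Rightarrow> state \<Rightarrow> bool" where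
  "shock_at p a u \<xi>0 Um Up \<longleftrightarrow>
     a \<in> {FPlus, FMinus} \<and> discontinuity_at p u \<xi>0 Um Up \<and> belongs_to_field p a \<xi>0 Um Up"

text \<open>A Lipschitz function is differentiable almost everywhere, which is where the kernel condition
  is imposed.\<close>

definition simple_wave ::
  "(real \<Rightarrow> real) \<Rightarrow> wave_field \<Rightarrow> (real \<Rightarrow> state) \<Rightarrow> real set \<Rightarrow> bool" where
  "simple_wave p a u J \<longleftrightarrow>
     a \<in> {FPlus, FMinus} \<and> is_interval J \<and> (\<exists>r\<in>J. \<exists>s\<in>J. r < s) \<and>
     (\<exists>L. L-lipschitz_on J u) \<and>
     (\<forall>\<xi>\<in>J. u \<xi> \<in> states \<and> eigenvalue p a (u \<xi>) = \<xi>) \<and>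
     (AE \<xi> in lebesgue. \<xi> \<in> J \<longrightarrow>
        (\<exists>D. (u has_vector_derivative D) (at \<xi>) \<and>
             (jacobian (flux_y p) (at (u \<xi>)) - \<xi> *\<^sub>R jacobian (flux_x p) (at (u \<xi>))) *v D = 0))"

definition const_off_jump :: "(real \<Rightarrow> state) \<Rightarrow> real set \<Rightarrow> real \<Rightarrow> bool" where
  "const_off_jump u I \<xi>0 \<longleftrightarrow>
     \<xi>0 \<in> I \<and> u constant_on {\<xi>\<in>I. \<xi> < \<xi>0} \<and> u constant_on {\<xi>\<in>I. \<xi>0 < \<xi>}"

text \<open>Continuity rules out jumps at the edges of the wave; \<open>J\<close> may reach the ends of \<open>I\<close>.\<close>

definition const_off_wave ::
  "(real \<Rightarrow> real) \<Rightarrow> wave_field \<Rightarrow> (real \<Rightarrow> state) \<Rightarrow> real set \<Rightarrow> bool" where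
  "const_off_wave p a u I \<longleftrightarrow>
     continuous_on I u \<and>
     (\<exists>J\<subseteq>I. simple_wave p a u J \<and>
        u constant_on {\<xi>\<in>I. \<forall>\<zeta>\<in>J. \<xi> < \<zeta>} \<and> u constant_on {\<xi>\<in>I. \<forall>\<zeta>\<in>J. \<zeta> < \<xi>})"


section \<open>Background state and sectors\<close>

definition background :: "(real \<Rightarrow> real) \<Rightarrow> real \<Rightarrow> real \<Rightarrow> state" where
  "background p \<rho>0 M = vector [\<rho>0, \<rho>0 * (M * sound_speed p \<rho>0), 0]"

fun center_slope :: "real \<Rightarrow> wave_field \<Rightarrow> real" where
  "center_slope M FZero = 0"
| "center_slope M FPlus = tan (arcsin (1 / M))"
| "center_slope M FMinus = - tan (arcsin (1 / M))"

definition slopes :: "real \<Rightarrow> real \<Rightarrow> wave_field \<Rightarrow> real set" where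
  "slopes M \<delta> a = {center_slope M a - \<delta><..<center_slope M a + \<delta>}"

definition forward_sector :: "real \<Rightarrow> real \<Rightarrow> wave_field \<Rightarrow> (real \<times> real) set" where
  "forward_sector M \<delta> a = {(x, y). 0 < x \<and> y / x \<in> slopes M \<delta> a}"

definition backward_sector :: "real \<Rightarrow> real \<Rightarrow> wave_field \<Rightarrow> (real \<times> real) set" where
  "backward_sector M \<delta> a = {(x, y). x < 0 \<and> y / x \<in> slopes M \<delta> a}"

text \<open>A ray-constant function as a function of \<open>\<xi> = y / x\<close> on \<open>x > 0\<close> and on \<open>x < 0\<close>.\<close>

definition forward_part :: "(real \<times> real \<Rightarrow> state) \<Rightarrow> real \<Rightarrow> state" where
  "forward_part V \<xi> = V (1, \<xi>)"

definition backward_part :: "(real \<times> real \<Rightarrow> state) \<Rightarrow> real \<Rightarrow> state" where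
  "backward_part V \<xi> = V (-1, - \<xi>)"

lemma forward_part_eq:
  assumes "ray_constant V" "0 < x"
  shows "V (x, y) = forward_part V (y / x)"
proof -
  have "V (x *\<^sub>R (1, y / x)) = V (1, y / x)"
    using assms unfolding ray_constant_def by (metis fst_conv fst_zero zero_neq_one)
  then show ?thesis using assms by (simp add: forward_part_def)
qed

lemma backward_part_eq:
  assumes "ray_constant V" "x < 0"
  shows "V (x, y) = backward_part V (y / x)"
proof -
  have "V ((- x) *\<^sub>R (- 1, - (y / x))) = V (- 1, - (y / x))"
    using assms unfolding ray_constant_def
    by (metis fst_conv fst_zero neg_0_less_iff_less zero_neq_neg_one)
  then show ?thesis using assms by (simp add: backward_part_def)
qed

lemma eigenvalue_background:
  assumes "1 < M" "0 < \<rho>0" "0 < deriv p \<rho>0"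
  shows "eigenvalue p a (background p \<rho>0 M) = center_slope M a"
    and "center_slope M FPlus = 1 / sqrt (M\<^sup>2 - 1)"
proof -
  define c where "c = sound_speed p \<rho>0"
  have c: "0 < c" using assms by (simp add: c_def sound_speed_def)
  define k where "k = \<rho>0 * c"
  have k: "0 < k" using c assms by (simp add: k_def)
  have M2: "1 < M\<^sup>2" using assms by (simp add: one_less_power)
  define r where "r = sqrt (M\<^sup>2 - 1)"
  have r: "0 < r" "r\<^sup>2 = M\<^sup>2 - 1" using M2 by (auto simp: r_def)
  have "sqrt (1 - (1 / M)\<^sup>2) = r / M"
  proof -
    have "1 - (1 / M)\<^sup>2 = (r / M)\<^sup>2"
      using assms by (simp add: power_divide r(2) diff_divide_distrib)
    then show ?thesis using r assms by (simp add: real_sqrt_unique)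
  qed
  moreover have "cos (arcsin (1 / M)) = sqrt (1 - (1 / M)\<^sup>2)"
    using assms by (intro cos_arcsin) (auto simp: field_simps)
  moreover have "sin (arcsin (1 / M)) = 1 / M"
    using assms by (intro sin_arcsin) (auto simp: field_simps)
  ultimately have tan: "tan (arcsin (1 / M)) = 1 / r"
    using assms by (simp add: tan_def)
  then show "center_slope M FPlus = 1 / sqrt (M\<^sup>2 - 1)" by (simp add: r_def)
  have e: "(\<rho>0 * (M * c))\<^sup>2 - k\<^sup>2 = (k * r)\<^sup>2"
    by (simp add: power_mult_distrib r(2) k_def algebra_simps)
  have q: "k * (k * r) / (k * r)\<^sup>2 = 1 / r"
    using k r(1) by (simp add: power2_eq_square)
  have s: "sqrt ((k * r)\<^sup>2) = k * r" using k r(1) by simp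
  show "eigenvalue p a (background p \<rho>0 M) = center_slope M a"
    using q
    by (cases a) (simp_all add: background_def vector_3 Let_def c_def[symmetric] e s tan
        k_def[symmetric] del: real_sqrt_abs power_mult_distrib)
qed

end

theory Submission imports Defs begin

text \<open>
  A steady self-similar solution is, on each of the half planes \<open>x > 0\<close> and \<open>x < 0\<close>, a profile \<open>v\<close> of the
  slope \<open>xi = y / x\<close>. In the coordinates \<open>(x, xi)\<close> the equations say that the flux \<open>f\<^sup>y(v) - xi f\<^sup>x(v)\<close> through the
  ray of slope \<open>xi\<close> has the bounded derivative \<open>- f\<^sup>x(v)\<close>. It therefore has a Lipschitz representative
  \<open>Flux\<close>, and \<open>v xi\<close> is a root \<open>U\<close> of the algebraic equation \<open>ray_flux xi U = Flux xi\<close> for almost every \<open>xi\<close>.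

  The algebra of this equation is that of a one-dimensional flow across the ray. If the mass flux
  \<open>N = n - xi m\<close> is not zero, the velocity along the ray is determined, and what remains is an equation
  for the density, \<open>N\<^sup>2 / \<rho> + (1 + xi\<^sup>2) p(\<rho>) = const\<close>. By the monotonicity of \<open>\<rho> c\<close> the left side first
  decreases and then increases; the turning point is the zero of
  \<open>sonic xi U = (1 + xi\<^sup>2) (\<rho> c)\<^sup>2 - N\<^sup>2\<close>. So there are at most two roots, a supersonic one of lower and a subsonic one of
  higher density (\<open>ray_flux_roots\<close>). At a root that is not sonic the equation is strictly
  invertible, whence the profile is constant on each side of every slope with no sonic root
  (\<open>locally_constant_near\<close>, \<open>w_piecewise_constant\<close>); at a sonic root both roots coincide and the profile is
  continuous. The energy is a convex entropy, and its inequality admits only one order of the two roots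
  at a jump (\<open>forbidden_order\<close>).

  For states near the background \<open>N\<close> decreases in \<open>xi\<close> and has one zero, near slope \<open>0\<close>. There the balance
  of momentum forces equal pressures on both sides: a contact. Away from this zero and from the
  Mach slopes \<open>\<plusminus>lam\<close> no state is sonic, so the profile is constant. Near a Mach slope \<open>sonic\<close> is strictly
  monotone in \<open>xi\<close> along constant states, and its jumps have the sign of the direction of the flow (locale
  \<open>fan\<close>). In a forward sector that sign agrees with the monotonicity. So a state that has left the sonic
  set never meets it again, and there is only one jump or one interval of sonic slopes (\<open>patterns\<close>). In a
  backward sector the signs are opposite. Then a jump of size \<open>J\<close> puts both neighbouring states off
  the sonic set by an amount proportional to \<open>J\<close>, and they persist over a comparable distance
  (\<open>jump_gap\<close>). Infinitely many jumps are possible, but all density jumps have the same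
  sign and the density is Lipschitz on the sonic set, which bounds the variation (\<open>one_sided_lipschitz\<close>,
  \<open>w_controlled\<close>).

  A sonic interval is a simple wave: the density is there the inverse image of a differentiable function under
  the mass speed \<open>\<rho> c\<close>, and the kernel condition is the derivative of the algebraic equation
  (\<open>wave_derivative\<close>). The two half planes fit together since the horizontal flux has no jump across the
  vertical axis (\<open>vertical_join\<close>), and a discontinuity belongs to the field of its sector because the
  characteristic cubic polynomial of the averaged Jacobians changes sign on each of the three intervals
  of slopes (\<open>jump_field\<close>).
\<close>


section \<open>Calculus of smooth functions\<close>

lemma frechet_derivative_cong_open:
 assumes "open S" "x : S" "ALL y:S. f y = g y"
 shows "frechet_derivative f (at x) = frechet_derivative g (at x)"
proof -
 have "(f has_derivative D) (at x) \<longleftrightarrow> (g has_derivative D) (at x)" for D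
  using assms(3) has_derivative_transform_within_open[OF _ assms(1,2), of f D UNIV g]
   has_derivative_transform_within_open[OF _ assms(1,2), of g D UNIV f] by auto
 then show ?thesis unfolding frechet_derivative_def by simp
qed

lemma Ck_on_cong:
 assumes "open S" "ALL y:S. f y = g y" "Ck_on k S f"
 shows "Ck_on k S g"
 using assms(2,3)
proof (induction k arbitrary: f g)
 case 0
 then show ?case using continuous_on_cong[OF refl, of S f g] by auto
next
 case (Suc k)
 have d: "g differentiable at x" if "x : S" for x
 proof -
  have "f differentiable (at x)" using Suc.prems(2) that by simp
  then obtain D where "(f has_derivative D) (at x)" unfolding differentiable_def ..
  then have "(g has_derivative D) (at x)"
   by (rule has_derivative_transform_within_open[OF _ assms(1) that]) (use Suc.prems(1) in auto)
  then show ?thesis by (auto simp: differentiable_def)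
 qed
 have "Ck_on k S (%x. frechet_derivative g (at x) v)" for v
 proof (rule Suc.IH)
  show "Ck_on k S (%x. frechet_derivative f (at x) v)" using Suc.prems(2) by simp
  show "ALL x:S. frechet_derivative f (at x) v = frechet_derivative g (at x) v"
   using frechet_derivative_cong_open[OF assms(1) _ Suc.prems(1)] by simp
 qed
 then show ?case using d by simp
qed

lemma smooth_on_cong:
 assumes "open S" "ALL y:S. f y = g y" "smooth_on S f"
 shows "smooth_on S g"
 using assms(3) Ck_on_cong[OF assms(1,2)] unfolding smooth_on_def by blast

text \<open>Smoothness is the largest property that is inherited by directional derivatives; so it is
 proved by exhibiting a class of functions closed under directional differentiation.\<close>

lemma smooth_on_coinduct:
 fixes R :: "('a::euclidean_space => 'b::euclidean_space) set"
 assumes S: "open S" and f: "f : R"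
  and step: "!!g. g : R ==> EX g'. (ALL x:S. (g has_derivative g' x) (at x)) &
           (ALL v. EX h:R. ALL x:S. g' x v = h x)"
 shows "smooth_on S f"
proof -
 have "ALL g:R. Ck_on k S g" for k
 proof (induction k)
  case 0
  show ?case
  proof
   fix g assume "g : R"
   then obtain g' where "ALL x:S. (g has_derivative g' x) (at x)" using step by blast
   then have "ALL x:S. isCont g x" using has_derivative_continuous by blast
   then show "Ck_on 0 S g" by (simp add: continuous_at_imp_continuous_on)
  qed
 next
  case (Suc k)
  show ?case
  proof
   fix g assume "g : R"
   then obtain g' where g': "ALL x:S. (g has_derivative g' x) (at x)"
    "ALL v. EX h:R. ALL x:S. g' x v = h x" using step by blast
   have e: "ALL x:S. frechet_derivative g (at x) = g' x"
    using g'(1) by (metis frechet_derivative_at)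
   have "Ck_on k S (%x. frechet_derivative g (at x) v)" for v
   proof -
    obtain h where h: "h : R" "ALL x:S. g' x v = h x" using g'(2) by blast
    have h1: "ALL x:S. h x = frechet_derivative g (at x) v" using e h(2) by simp
    have h2: "Ck_on k S h" using Suc h(1) ..
    show ?thesis by (rule Ck_on_cong[OF S h1 h2])
   qed
   then show "Ck_on (Suc k) S g" using g'(1) by (auto simp: differentiable_def)
  qed
 qed
 then show ?thesis using f by (simp add: smooth_on_def)
qed

lemma smooth_onD:
 assumes "smooth_on S f"
 shows "ALL x:S. f differentiable (at x)" "ALL v. smooth_on S (%x. frechet_derivative f (at x) v)"
proof -
 have "Ck_on (Suc k) S f" for k using assms unfolding smooth_on_def by blast
 then show "ALL x:S. f differentiable (at x)" "ALL v. smooth_on S (%x. frechet_derivative f (at x) v)"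
  unfolding smooth_on_def by auto
qed

lemma smooth_on_step:
 assumes f: "smooth_on S f" and R: "!!g. smooth_on S g ==> g : R"
 shows "EX f'. (ALL x:S. (f has_derivative f' x) (at x)) & (ALL v. EX h:R. ALL x:S. f' x v = h x)"
proof (intro exI conjI ballI allI)
 show "(f has_derivative frechet_derivative f (at x)) (at x)" if "x : S" for x
  using smooth_onD(1)[OF f] that frechet_derivative_works by blast
 show "EX h:R. ALL x:S. frechet_derivative f (at x) v = h x" for v
  by (rule bexI[of _ "%x. frechet_derivative f (at x) v"])
    (simp_all add: R smooth_onD(2)[OF f, rule_format])
qed

lemma smooth_on_imp_continuous_on: "smooth_on S f ==> continuous_on S f"
 unfolding smooth_on_def by (auto dest: spec[of _ 0])

lemma smooth_on_Un:
 assumes "smooth_on S f" "smooth_on T f" "open S" "open T"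
 shows "smooth_on (S \<union> T) f"
proof -
 have "Ck_on k S f ==> Ck_on k T f ==> Ck_on k (S \<union> T) f" for k
 proof (induction k arbitrary: f)
  case 0 then show ?case using assms continuous_on_open_Un by auto
 next
  case (Suc k) then show ?case by auto
 qed
 then show ?thesis using assms unfolding smooth_on_def by blast
qed

lemma DERIV_imp_has_derivative:
 assumes "(g has_real_derivative D) (at x)" "!!v. E v = D * v"
 shows "(g has_derivative E) (at x)"
proof -
 have "E = (*) D" using assms(2) by auto
 then show ?thesis using assms(1) by (simp add: has_field_derivative_def)
qed

lemma smooth_on_const: "open S ==> smooth_on S (%x. c)"
 by (rule smooth_on_coinduct[where R = "range (%c x. c)"])
   (auto intro!: exI[of _ "%x v. 0"])

lemma smooth_on_linear:
 fixes f :: "'a::euclidean_space => 'b::euclidean_space"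
 assumes "open S" "bounded_linear f"
 shows "smooth_on S f"
proof (rule smooth_on_coinduct[where R = "insert f (range (%c x. c))"])
 fix g assume "g : insert f (range (%c x. c))"
 then consider "g = f" | c where "g = (%x. c)" by blast
 then show "EX g'. (ALL x:S. (g has_derivative g' x) (at x)) &
    (ALL v. EX h:insert f (range (%c x. c)). ALL x:S. g' x v = h x)"
 proof cases
  case 1
  then show ?thesis using assms(2)
   by (auto intro!: exI[of _ "%x. f"] bounded_linear_imp_has_derivative)
 next
  case 2
  then show ?thesis by (auto intro!: exI[of _ "%x v. 0"])
 qed
qed (use assms in auto)

inductive_set algebra_of :: "('a => real) set => ('a => real) set" for A where
 base: "f : A ==> f : algebra_of A"
| add: "f : algebra_of A ==> g : algebra_of A ==> (%x. f x + g x) : algebra_of A"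
| mult: "f : algebra_of A ==> g : algebra_of A ==> (%x. f x * g x) : algebra_of A"

text \<open>The product rule: an algebra generated by functions with derivatives in the algebra is
 closed under differentiation.\<close>

lemma smooth_on_algebra_of:
 fixes A :: "('a::euclidean_space => real) set"
 assumes S: "open S" and f: "f : algebra_of A"
  and step: "!!a. a : A ==> EX a'. (ALL x:S. (a has_derivative a' x) (at x)) &
           (ALL v. EX h:algebra_of A. ALL x:S. a' x v = h x)"
 shows "smooth_on S f"
proof (rule smooth_on_coinduct[OF S f])
 fix g assume "g : algebra_of A"
 then show "EX g'. (ALL x:S. (g has_derivative g' x) (at x)) &
           (ALL v. EX h:algebra_of A. ALL x:S. g' x v = h x)"
 proof induction
  case (base f)
  then show ?case using step by blast
 next
  case (add f g)
  then obtain f' g' where *: "ALL x:S. (f has_derivative f' x) (at x)"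
    "ALL v. EX h:algebra_of A. ALL x:S. f' x v = h x" "ALL x:S. (g has_derivative g' x) (at x)"
    "ALL v. EX h:algebra_of A. ALL x:S. g' x v = h x" by blast
  have "EX h:algebra_of A. ALL x:S. f' x v + g' x v = h x" for v
  proof -
   obtain h1 h2 where "h1 : algebra_of A" "h2 : algebra_of A" "ALL x:S. f' x v = h1 x"
    "ALL x:S. g' x v = h2 x" using * by metis
   then show ?thesis by (intro bexI[OF _ algebra_of.add[of h1 _ h2]]) auto
  qed
  then show ?case using *(1,3)
   by (intro exI[of _ "%x v. f' x v + g' x v"]) (auto intro: has_derivative_add)
 next
  case (mult f g)
  then obtain f' g' where *: "ALL x:S. (f has_derivative f' x) (at x)"
    "ALL v. EX h:algebra_of A. ALL x:S. f' x v = h x" "ALL x:S. (g has_derivative g' x) (at x)"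
    "ALL v. EX h:algebra_of A. ALL x:S. g' x v = h x" by blast
  have "EX h:algebra_of A. ALL x:S. f x * g' x v + f' x v * g x = h x" for v
  proof -
   obtain h1 h2 where "h1 : algebra_of A" "h2 : algebra_of A" "ALL x:S. f' x v = h1 x"
    "ALL x:S. g' x v = h2 x" using * by metis
   then show ?thesis using mult.hyps
    by (intro bexI[of _ "%x. f x * h2 x + h1 x * g x"] algebra_of.add algebra_of.mult) auto
  qed
  then show ?case using *(1,3)
   by (intro exI[of _ "%x v. f x * g' x v + f' x v * g x"]) (auto intro: has_derivative_mult)
 qed
qed

lemma smooth_on_add_mult:
 fixes f g :: "'a::euclidean_space => real"
 assumes S: "open S" and f: "smooth_on S f" and g: "smooth_on S g"
 shows smooth_on_add: "smooth_on S (%x. f x + g x)" and smooth_on_mult: "smooth_on S (%x. f x * g x)"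
proof -
 let ?A = "{f :: 'a => real. smooth_on S f}"
 have step: "EX a'. (ALL x:S. (a has_derivative a' x) (at x)) & (ALL v. EX h:algebra_of ?A. ALL x:S. a' x v = h x)"
  if "a : ?A" for a
  using that by (intro smooth_on_step) (auto intro: algebra_of.base)
 have A: "f : algebra_of ?A" "g : algebra_of ?A" using f g by (auto intro: algebra_of.base)
 show "smooth_on S (%x. f x + g x)"
  by (rule smooth_on_algebra_of[OF S algebra_of.add[OF A] step])
 show "smooth_on S (%x. f x * g x)"
  by (rule smooth_on_algebra_of[OF S algebra_of.mult[OF A] step])
qed

lemma real_linear_eq: "linear D ==> D v = v * D (1::real)" for D :: "real => real"
 using linear_cmul[of D v 1] by simp

lemma smooth_on_compose:
 fixes f :: "real => real" and g :: "'a::euclidean_space => real"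
 assumes S: "open S" and T: "open T" and f: "smooth_on T f" and g: "smooth_on S g" and sub: "g ` S \<subseteq> T"
 shows "smooth_on S (%x. f (g x))"
proof -
 let ?A = "{%x. f (g x) |f. smooth_on T f} \<union> {f. smooth_on S f}"
 have step: "EX a'. (ALL x:S. (a has_derivative a' x) (at x)) & (ALL v. EX h:algebra_of ?A. ALL x:S. a' x v = h x)"
  if "a : ?A" for a
  using that
 proof
  assume a: "a : {f. smooth_on S f}"
  then show ?thesis by (intro smooth_on_step) (auto intro: algebra_of.base)
 next
  assume "a : {%x. f (g x) |f. smooth_on T f}"
  then obtain f where a: "a = (%x. f (g x))" and f: "smooth_on T f" by auto
  let ?d = "%x v. frechet_derivative f (at (g x)) (frechet_derivative g (at x) v)"
  have e: "?d x v = frechet_derivative g (at x) v * frechet_derivative f (at (g x)) 1"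
   if "x : S" for x v
  proof -
   have "f differentiable at (g x)" using smooth_onD(1)[OF f] that sub by blast
   then show ?thesis by (intro real_linear_eq linear_frechet_derivative)
  qed
  show ?thesis
  proof (intro exI conjI ballI allI)
   show "(a has_derivative ?d x) (at x)" if "x : S" for x
   proof -
    have 1: "(g has_derivative frechet_derivative g (at x)) (at x)"
     using smooth_onD(1)[OF g] that frechet_derivative_works by blast
    have 2: "(f has_derivative frechet_derivative f (at (g x))) (at (g x))"
     using smooth_onD(1)[OF f] that sub frechet_derivative_works by blast
    show ?thesis using has_derivative_compose[OF 1 2] by (simp add: a o_def)
   qed
   have "(%x. (%y. frechet_derivative f (at y) 1) (g x)) : ?A"
    by (intro UnI1 CollectI exI[of _ "%y. frechet_derivative f (at y) 1"] conjI refl)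
      (simp add: smooth_onD(2)[OF f])
   moreover have "(%x. frechet_derivative g (at x) v) : ?A" for v
    using smooth_onD(2)[OF g] by blast
   ultimately show "EX h:algebra_of ?A. ALL x:S. ?d x v = h x" for v
    using e by (intro bexI[of _ "%x. frechet_derivative g (at x) v * frechet_derivative f (at (g x)) 1"]
      algebra_of.mult algebra_of.base) simp_all
  qed
 qed
 show ?thesis
  by (rule smooth_on_algebra_of[OF S _ step]) (use f in \<open>auto intro!: algebra_of.base\<close>)
qed

lemma smooth_on_real_derivI:
 fixes f :: "real => real"
 assumes S: "open S" and d: "!!x. x : S ==> (f has_real_derivative f' x) (at x)" and f': "smooth_on S f'"
 shows "smooth_on S f"
proof (rule smooth_on_coinduct[OF S, of _ "insert f {f. smooth_on S f}"])
 fix g assume "g : insert f {f. smooth_on S f}"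
 then consider "g = f" | "smooth_on S g" by blast
 then show "EX g'. (ALL x:S. (g has_derivative g' x) (at x)) &
    (ALL v. EX h:insert f {f. smooth_on S f}. ALL x:S. g' x v = h x)"
 proof cases
  case 1
  have "ALL x:S. (g has_derivative (%v. f' x * v)) (at x)"
   using d 1 by (auto intro: DERIV_imp_has_derivative)
  moreover have "EX h:insert f {f. smooth_on S f}. ALL x:S. f' x * v = h x" for v
   using smooth_on_mult[OF S f' smooth_on_const[OF S]] by (intro bexI[of _ "%x. f' x * v"]) auto
  ultimately show ?thesis by (intro exI[of _ "%x v. f' x * v"] conjI allI) auto
 next
  case 2
  then show ?thesis by (intro smooth_on_step) auto
 qed
qed simp

lemma smooth_on_real_derivE:
 fixes f :: "real => real"
 assumes f: "smooth_on S f"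
 obtains f' where "!!x. x : S ==> (f has_real_derivative f' x) (at x)" "smooth_on S f'"
proof
 show "smooth_on S (%x. frechet_derivative f (at x) 1)" using smooth_onD(2)[OF f] by blast
 fix x assume "x : S"
 then have d: "f differentiable at x" using smooth_onD(1)[OF f] by blast
 then have "(f has_derivative frechet_derivative f (at x)) (at x)"
  using frechet_derivative_works by blast
 moreover have "frechet_derivative f (at x) = (%v. frechet_derivative f (at x) 1 * v)"
 proof
  fix v show "frechet_derivative f (at x) v = frechet_derivative f (at x) 1 * v"
   using real_linear_eq[OF linear_frechet_derivative[OF d], of v] by (simp only: mult.commute)
 qed
 ultimately show "(f has_real_derivative frechet_derivative f (at x) 1) (at x)"
  unfolding has_field_derivative_def by simp
qed

lemma smooth_on_inverse: "smooth_on {0<..} (inverse :: real => real)"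
proof (rule smooth_on_coinduct[where R = "range (%(c, n) x. c * inverse x ^ n)"])
 show "inverse : range (%(c, n) (x::real). c * inverse x ^ n)"
  by (rule image_eqI[of _ _ "(1, 1)"]) auto
 fix g :: "real => real" assume "g : range (%(c, n) x. c * inverse x ^ n)"
 then obtain c n where g: "g = (%x. c * inverse x ^ n)" by auto
 let ?d = "%x v. (- c * real n * v) * inverse x ^ (n + 1)"
 show "EX g'. (ALL x:{0<..}. (g has_derivative g' x) (at x)) &
     (ALL v. EX h:range (%(c, n) x. c * inverse x ^ n). ALL x:{0<..}. g' x v = h x)"
 proof (intro exI[of _ ?d] conjI ballI allI)
  fix x :: real assume "x : {0<..}"
  then have "(g has_real_derivative c * (real n * (- (inverse x ^ Suc (Suc 0)) * inverse x ^ (n - Suc 0)))) (at x)"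
   unfolding g by (intro DERIV_cmult DERIV_power DERIV_inverse) auto
  moreover have "c * (real n * (- (inverse x ^ Suc (Suc 0)) * inverse x ^ (n - Suc 0)))
    = (- c * real n) * inverse x ^ (n + 1)"
   by (cases n) (auto simp: algebra_simps)
  ultimately have "(g has_real_derivative (- c * real n) * inverse x ^ (n + 1)) (at x)" by metis
  then show "(g has_derivative ?d x) (at x)"
   by (rule DERIV_imp_has_derivative) simp
 next
  fix v show "EX h:range (%(c, n) x. c * inverse x ^ n). ALL x:{0<..}. ?d x v = h x"
   by (rule bexI[of _ "%x. (- c * real n * v) * inverse x ^ (n + 1)"])
     (auto intro: image_eqI[of _ _ "(- c * real n * v, n + 1)"])
 qed
qed auto

lemma smooth_on_exp: "smooth_on UNIV (exp :: real => real)"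
proof (rule smooth_on_coinduct[where R = "range (%c x. c * exp x)"])
 show "exp : range (%c (x::real). c * exp x)" by (rule image_eqI[of _ _ 1]) auto
 fix g :: "real => real" assume "g : range (%c x. c * exp x)"
 then obtain c where g: "g = (%x. c * exp x)" by auto
 show "EX g'. (ALL x:UNIV. (g has_derivative g' x) (at x)) &
     (ALL v. EX h:range (%c x. c * exp x). ALL x:UNIV. g' x v = h x)"
 proof (intro exI[of _ "%x v. (c * v) * exp x"] conjI ballI allI)
  fix x :: real
  have "(g has_real_derivative c * exp x) (at x)" unfolding g by (auto intro!: derivative_eq_intros)
  then show "(g has_derivative (%v. (c * v) * exp x)) (at x)"
   by (rule DERIV_imp_has_derivative) simp
 qed auto
qed auto

subsection \<open>Bump functions\<close>

definition flat :: "real poly => real => real" where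
 "flat q x = (if 0 < x then poly q (1 / x) * exp (- (1 / x)) else 0)"

lemma poly_times_exp_tendsto_0: "((%y::real. y ^ k * poly q y * exp (- y)) \<longlongrightarrow> 0) at_top"
proof (induction q arbitrary: k)
 case 0
 then show ?case by simp
next
 case (pCons a q)
 have "((%y::real. a * (y ^ k / exp y) + y ^ Suc k * poly q y * exp (- y)) \<longlongrightarrow> a * 0 + 0) at_top"
  by (intro tendsto_intros tendsto_power_div_exp_0 pCons.IH)
 then show ?case
  by (simp add: exp_minus field_simps)
qed

lemma flat_deriv:
 "(flat q has_real_derivative flat (monom 1 2 * (q - pderiv q)) x) (at x)"
proof -
 consider "x < 0" | "x = 0" | "0 < x" by linarith
 then show ?thesis
 proof cases
  case 1
  have "((%x. 0) has_real_derivative 0) (at x)" by simp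
  moreover have "open {..<0::real}" "x : {..<0}" using 1 by auto
  moreover have "!!y. y : {..<0} ==> 0 = flat q y" by (auto simp: flat_def)
  ultimately have "(flat q has_real_derivative 0) (at x)"
   using has_field_derivative_transform_within_open[of "%x. 0" 0 x "{..<0}" "flat q"] by blast
  then show ?thesis using 1 by (simp add: flat_def)
 next
  case 3
  let ?f = "%x. poly q (1 / x) * exp (- (1 / x))"
  have "(?f has_real_derivative flat (monom 1 2 * (q - pderiv q)) x) (at x)"
   using 3 by (auto intro!: derivative_eq_intros DERIV_chain'[where g = "poly q", OF _ poly_DERIV]
     simp: flat_def poly_monom power2_eq_square field_simps)
  moreover have "!!y. y : {0<..} ==> ?f y = flat q y" by (auto simp: flat_def)
  ultimately show ?thesis
   using has_field_derivative_transform_within_open[of ?f _ x "{0<..}" "flat q"] 3 by auto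
 next
  case 2
  have r: "((%h. flat q h / h) \<longlongrightarrow> 0) (at_right 0)"
  proof -
   have "((%h. (%y. y ^ 1 * poly q y * exp (- y)) (inverse h)) \<longlongrightarrow> 0) (at_right 0)"
    using poly_times_exp_tendsto_0[of 1 q] filterlim_inverse_at_top_right
    by (rule filterlim_compose)
   then show ?thesis
   proof (rule Lim_transform_eventually)
    show "\<forall>\<^sub>F h in at_right 0. inverse h ^ 1 * poly q (inverse h) * exp (- inverse h) = flat q h / h"
     using eventually_at_right_less[of 0]
     by eventually_elim (auto simp: flat_def inverse_eq_divide)
   qed
  qed
  have l: "((%h. flat q h / h) \<longlongrightarrow> 0) (at_left 0)"
  proof (rule Lim_transform_eventually[OF tendsto_const])
   show "\<forall>\<^sub>F h in at_left 0. 0 = flat q h / h"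
    using eventually_at_left[of "-1" "0::real"] by (auto simp: flat_def intro!: exI[of _ "-1"])
  qed
  have "((%h. flat q h / h) \<longlongrightarrow> 0) (at 0)" using l r filterlim_split_at by blast
  then show ?thesis using 2 by (simp add: DERIV_def flat_def)
 qed
qed

lemma smooth_on_flat: "smooth_on UNIV (flat q)"
proof (rule smooth_on_coinduct[where R = "range (%(c, q) x. c * flat q x)"])
 show "flat q : range (%(c, q) x. c * flat q x)" by (rule image_eqI[of _ _ "(1, q)"]) auto
 fix g assume "g : range (%(c, q) x. c * flat q x)"
 then obtain c q where g: "g = (%x. c * flat q x)" by auto
 let ?q = "monom 1 2 * (q - pderiv q)"
 show "EX g'. (ALL x:UNIV. (g has_derivative g' x) (at x)) &
     (ALL v. EX h:range (%(c, q) x. c * flat q x). ALL x:UNIV. g' x v = h x)"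
 proof (intro exI[of _ "%x v. (c * v) * flat ?q x"] conjI ballI allI)
  fix x :: real
  have "(g has_real_derivative c * flat ?q x) (at x)" unfolding g by (intro DERIV_cmult flat_deriv)
  then show "(g has_derivative (%v. (c * v) * flat ?q x)) (at x)"
   by (rule DERIV_imp_has_derivative) simp
 next
  fix v show "EX h:range (%(c, q) x. c * flat q x). ALL x:UNIV. c * v * flat ?q x = h x"
   by (rule bexI[of _ "%x. c * v * flat ?q x"]) (auto intro: image_eqI[of _ _ "(c * v, ?q)"])
 qed
qed auto

definition bump :: "real => real => real => real" where
 "bump a b x = flat 1 (x - a) * flat 1 (b - x)"

lemma bump_nonneg: "0 <= bump a b x"
 and bump_pos_iff: "0 < bump a b x \<longleftrightarrow> a < x & x < b"
 by (auto simp: bump_def flat_def zero_less_mult_iff)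

lemma bump_eq_0: "\<not> (a < x & x < b) ==> bump a b x = 0"
 using bump_nonneg[of a b x] bump_pos_iff[of a b x] by linarith

lemma smooth_on_bump: "smooth_on UNIV (bump a b)"
proof -
 have 1: "smooth_on UNIV (%x. x - a)"
  by (rule smooth_on_real_derivI[where f' = "%x. 1"]) (auto intro!: derivative_eq_intros smooth_on_const)
 have 2: "smooth_on UNIV (%x. b - x)"
  by (rule smooth_on_real_derivI[where f' = "%x. -1"]) (auto intro!: derivative_eq_intros smooth_on_const)
 show ?thesis unfolding bump_def[abs_def]
  by (intro smooth_on_mult smooth_on_compose[OF _ _ smooth_on_flat] 1 2) auto
qed

section \<open>Weak differential inequalities on the line\<close>

lemma borel_bounded_set_integrable:
 fixes f :: "real => real"
 assumes [measurable]: "f : borel_measurable borel" and B: "!!x. x : {a..b} ==> (abs (f x)) <= B"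
 shows "set_integrable lborel {a..b} f"
 unfolding set_integrable_def
 by (rule integrableI_bounded_set_indicator[where B = B]) (use B in \<open>auto simp: emeasure_lborel_Icc_eq\<close>)

lemma borel_bounded_integrable_on:
 fixes f :: "real => real"
 assumes "f : borel_measurable borel" and "!!x. x : {a..b} ==> (abs (f x)) <= B"
 shows "f integrable_on {a..b}"
  and "(LINT x|lborel. indicator {a..b} x * f x) = integral {a..b} f"
 using set_borel_integral_eq_integral[OF borel_bounded_set_integrable[OF assms]]
 by (auto simp: set_lebesgue_integral_def)

lemma AE_eq_of_integrals_nonneg:
 fixes f g :: "real => real"
 assumes [measurable]: "f : borel_measurable borel" "g : borel_measurable borel"
  and B: "!!x. x : {L..R} ==> 0 <= f x & f x <= B" "!!x. x : {L..R} ==> 0 <= g x & g x <= B"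
  and eq: "!!a. L <= a ==> a <= R ==> integral {a..R} f = integral {a..R} g"
 shows "AE x in lborel. x : {L..R} --> f x = g x"
proof -
 let ?d = "%f x. ennreal (f x) * indicator {L..R} x"
 have m: "emeasure (density lborel (?d f)) {y<..} =
   (if L <= R & y <= R then ennreal (integral {max y L..R} f) else 0)"
  if [measurable]: "f : borel_measurable borel" and B: "!!x. x : {L..R} ==> 0 <= f x & f x <= B" for f :: "real => real" and y
 proof -
  have i: "f integrable_on {max y L..R}"
   by (rule borel_bounded_integrable_on(1)[where B = B]) (use B in \<open>fastforce+\<close>)
  have "emeasure (density lborel (?d f)) {y<..} = (\<integral>\<^sup>+x. ?d f x * indicator {y<..} x \<partial>lborel)"
   by (rule emeasure_density) auto
  also have "... = (\<integral>\<^sup>+x. ennreal (f x) * indicator {max y L..R} x \<partial>lborel)"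
   by (rule nn_integral_cong_AE, use AE_lborel_singleton[of "max y L"] in eventually_elim)
     (auto simp: indicator_def max_def split: if_splits)
  also have "... = ennreal (integral {max y L..R} f)"
   using i B by (intro nn_integral_has_integral_lebesgue') (auto simp: has_integral_integral)
  finally show ?thesis by auto
 qed
 have "density lborel (?d f) = density lborel (?d g)"
 proof (rule measure_eqI_lessThan)
  fix y show "emeasure (density lborel (?d f)) {y<..} = emeasure (density lborel (?d g)) {y<..}"
   using m[of f y] m[of g y] B eq[of "max y L"] by auto
  show "emeasure (density lborel (?d f)) {y<..} < \<infinity>" using m[of f y] B by auto
 qed auto
 then have "AE x in lborel. ?d f x = ?d g x"
  by (subst (asm) sigma_finite_measure.density_unique_iff[OF sigma_finite_lborel]) auto
 then show ?thesis
  by eventually_elim (use B in \<open>auto simp: indicator_def\<close>)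
qed

text \<open>The derivative of \<open>D\<close> would vanish up to the size of the monotone \<open>w\<close>; the error telescopes
 along a uniform partition.\<close>

lemma constant_if_increments_telescope:
 fixes D w :: "real => real"
 assumes "a <= b" and inc: "!!x y. a <= x ==> x <= y ==> y <= b ==> (abs (D y - D x)) <= (y - x) * (w x - w y)"
 shows "D b = D a"
proof -
 have bound: "(abs (D b - D a)) <= (b - a) * (w a - w b) / real (Suc n)" for n
 proof -
  define h where "h = (b - a) / real (Suc n)"
  define x where "x i = a + real i * h" for i
  have h: "0 <= h" "real (Suc n) * h = b - a" using assms(1) by (auto simp: h_def)
  have x: "a <= x i" "x (Suc i) = x i + h" for i using h by (auto simp: x_def algebra_simps)
  have xb: "x i <= b" if "i <= Suc n" for i
   using mult_right_mono[of "real i" "real (Suc n)" h] that h by (simp add: x_def)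
  have "D (x (Suc n)) - D (x 0) = (\<Sum>i<Suc n. D (x (Suc i)) - D (x i))"
   by (rule sum_lessThan_telescope[symmetric])
  then have "(abs (D (x (Suc n)) - D (x 0))) <= (\<Sum>i<Suc n. (abs (D (x (Suc i)) - D (x i))))"
   by (metis sum_abs)
  also have "... <= (\<Sum>i<Suc n. h * (w (x i) - w (x (Suc i))))"
  proof (rule sum_mono)
   fix i assume "i : {..<Suc n}"
   then have "x (Suc i) <= b" by (intro xb) auto
   then show "(abs (D (x (Suc i)) - D (x i))) <= h * (w (x i) - w (x (Suc i)))"
    using inc[of "x i" "x (Suc i)"] x h by auto
  qed
  also have "... = h * (w (x 0) - w (x (Suc n)))"
   unfolding sum_distrib_left[symmetric]
   using sum_lessThan_telescope'[of "%i. w (x i)" "Suc n"] by presburger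
  finally show ?thesis using h by (simp add: x_def h_def)
 qed
 have "(%n. (b - a) * (w a - w b) / real (Suc n)) \<longlonglongrightarrow> 0"
  by (intro real_tendsto_divide_at_top[OF tendsto_const] filterlim_compose[OF filterlim_real_sequentially filterlim_Suc])
 then have "(abs (D b - D a)) <= 0" by (rule LIMSEQ_le_const) (use bound in auto)
 then show ?thesis by simp
qed

text \<open>The monotone representative is the supremum of the later means; on each interval its integral
 and that of \<open>W\<close> lie between the same multiples of its values at the end points.\<close>

lemma AE_antimono_of_means:
 fixes W :: "real => real"
 assumes W[measurable]: "W : borel_measurable borel"
  and bd: "!!R. EX B. ALL x:{-R..R}. (abs (W x)) <= B"
  and means: "!!a b c d. a < b ==> b <= c ==> c < d ==>
   integral {c..d} W / (d - c) <= integral {a..b} W / (b - a)"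
 shows "EX w. antimono w & (AE x in lborel. W x = w x)"
proof -
 define m where "m a b = integral {a..b} W / (b - a)" for a b
 define w where "w x = Sup {m c d |c d. x <= c & c < d}" for x
 have bdd: "bdd_above {m c d |c d. x <= c & c < d}" for x
  using means[of "x - 1" x] by (intro bdd_aboveI[of _ "m (x - 1) x"]) (auto simp: m_def)
 have ne: "{m c d |c d. x <= c & c < d} ~= {}" for x :: real
 proof -
  have "m x (x + 1) : {m c d |c d. x <= c & c < d}" by (intro CollectI exI conjI refl) auto
  then show ?thesis by blast
 qed
 have anti: "antimono w"
 proof (rule antimonoI)
  fix x y :: real assume "x <= y"
  then show "w y <= w x" unfolding w_def by (intro cSup_subset_mono ne bdd) force
 qed
 have up: "m x y <= w x" if "x < y" for x y
  unfolding w_def by (rule cSup_upper[OF _ bdd]) (use that in auto)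
 have lo: "w y <= m x y" if "x < y" for x y
  unfolding w_def by (rule cSup_least[OF ne]) (use that means in \<open>auto simp: m_def\<close>)
 have "mono (%x. - w x)" using anti by (auto simp: mono_def antimono_def)
 from borel_measurable_mono[OF this] have "(%x. - (- w x)) : borel_measurable borel"
  by (rule borel_measurable_uminus)
 then have wm: "w : borel_measurable borel" by simp
 have Wi: "W integrable_on {x..y}" for x y
 proof -
  obtain B where "ALL z:{-max (abs x) (abs y)..max (abs x) (abs y)}. (abs (W z)) <= B" using bd by blast
  moreover have "z : {-max (abs x) (abs y)..max (abs x) (abs y)}" if "z : {x..y}" for z
   using that by (smt (verit) max.cobounded1 max.cobounded2 atLeastAtMost_iff abs_ge_self abs_ge_minus_self)
  ultimately show ?thesis by (intro borel_bounded_integrable_on(1)[OF W, where B = B]) blast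
 qed
 have wbd: "(abs (w z)) <= max (abs (w x)) (abs (w y))" if "z : {x..y}" for x y z
  using that anti unfolding antimono_def by (smt (verit) atLeastAtMost_iff)
 have wi: "w integrable_on {x..y}" for x y
  using wbd by (intro borel_bounded_integrable_on(1)[OF wm]) auto
 have ieq: "integral {a..b} W = integral {a..b} w" if "a <= b" for a b
 proof -
  define D where "D x = integral {a..x} W - integral {a..x} w" for x
  have "D b = D a"
  proof (rule constant_if_increments_telescope[OF that, of _ w])
   fix x y assume xy: "a <= x" "x <= y" "y <= b"
   have "D y - D x = integral {x..y} W - integral {x..y} w"
    using Henstock_Kurzweil_Integration.integral_combine[of a x y W]
     Henstock_Kurzweil_Integration.integral_combine[of a x y w] xy Wi wi by (simp add: D_def)
   moreover have "(y - x) * w y <= integral {x..y} W & integral {x..y} W <= (y - x) * w x"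
    using up[of x y] lo[of x y] xy by (cases "x = y") (auto simp: m_def field_simps)
   moreover have "integral {x..y} (%z. w y) <= integral {x..y} w"
    by (intro integral_le wi) (use anti in \<open>auto simp: antimono_def\<close>)
   moreover have "integral {x..y} w <= integral {x..y} (%z. w x)"
    by (intro integral_le wi) (use anti in \<open>auto simp: antimono_def\<close>)
   ultimately have "integral {x..y} W <= (y - x) * w x" "(y - x) * w y <= integral {x..y} W"
    "integral {x..y} w <= (y - x) * w x" "(y - x) * w y <= integral {x..y} w"
    "D y - D x = integral {x..y} W - integral {x..y} w"
    using xy by auto
   then show "(abs (D y - D x)) <= (y - x) * (w x - w y)"
    unfolding right_diff_distrib abs_le_iff by linarith
  qed
  then show ?thesis by (simp add: D_def)
 qed
 have "AE x in lborel. ALL n::nat. x : {- real n..real n} --> W x = w x"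
 proof (subst AE_all_countable, rule allI)
  fix n :: nat
  obtain B where B: "ALL z:{-real n..real n}. (abs (W z)) <= B" using bd by blast
  define C where "C = max B (max (abs (w (-real n))) (abs (w (real n))))"
  have WC: "(abs (W z)) <= C" "(abs (w z)) <= C" if "z : {-real n..real n}" for z
  proof -
   have "(abs (W z)) <= B" using B that by blast
   then show "(abs (W z)) <= C" "(abs (w z)) <= C"
    using wbd[of z "-real n" "real n"] that unfolding C_def by linarith+
  qed
  have "AE x in lborel. x : {-real n..real n} --> W x + C = w x + C"
  proof (rule AE_eq_of_integrals_nonneg[where B = "2 * C"])
   fix a assume a: "-real n <= a" "a <= real n"
   show "integral {a..real n} (%x. W x + C) = integral {a..real n} (%x. w x + C)"
    using ieq[of a "real n"] a
    by (simp add: Henstock_Kurzweil_Integration.integral_add[OF Wi integrable_const_ivl]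
      Henstock_Kurzweil_Integration.integral_add[OF wi integrable_const_ivl])
  qed (use wm WC in \<open>fastforce simp: abs_le_iff\<close>)+
  then show "AE x in lborel. x : {-real n..real n} --> W x = w x" by simp
 qed
 then have "AE x in lborel. W x = w x"
 proof eventually_elim
  fix x assume *: "ALL n::nat. x : {- real n..real n} --> W x = w x"
  obtain n :: nat where "(abs x) <= real n" using real_arch_simple by blast
  then show "W x = w x" using * by (auto simp: abs_le_iff)
 qed
 then show ?thesis using anti by blast
qed

definition primitive :: "(real => real) => real => real" where
 "primitive h x = integral {0..x} h - integral {x..0} h"

lemma primitive_diff:
 assumes h: "!!a b. h integrable_on {a..b}" and "x <= y"
 shows "primitive h y - primitive h x = integral {x..y} h"
proof -
 note c = Henstock_Kurzweil_Integration.integral_combine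
 consider "0 <= x" | "x < 0" "0 <= y" | "y < 0" by linarith
 then show ?thesis
 proof cases
  case 1 then show ?thesis using c[of 0 x y h] assms
   by (cases "x = 0"; cases "y = 0") (auto simp: primitive_def)
 next
  case 2 then show ?thesis using c[of x 0 y h] assms by (cases "y = 0") (auto simp: primitive_def)
 next
  case 3 then show ?thesis using c[of x y 0 h] assms by (auto simp: primitive_def)
 qed
qed

lemma primitive_lipschitz:
 assumes h: "h : borel_measurable borel" and B: "!!x. (abs (h x)) <= B"
 shows "(abs (primitive h y - primitive h x)) <= B * (abs (y - x))"
proof -
 have i: "h integrable_on {a..b}" for a b
  by (rule borel_bounded_integrable_on(1)[OF h B])
 have "(abs (primitive h y - primitive h x)) <= B * (y - x)" if "x <= y" for x y
 proof -
  have "0 <= B" using B[of 0] abs_ge_zero order_trans by blast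
  then have "norm (integral {x..y} h) <= B * measure lborel {x..y}"
   by (rule has_integral_bound_real[OF _ finite.emptyI integrable_integral]) (use B i B[of 0] in auto)
  then show ?thesis using primitive_diff[of h x y] i that by auto
 qed
 from this[of x y] this[of y x] show ?thesis by (cases "x <= y") (auto simp: abs_minus_commute)
qed

lemma primitive_deriv:
 assumes c: "continuous_on UNIV h"
 shows "(primitive h has_real_derivative h x) (at x)"
proof -
 have i: "h integrable_on {a..b}" for a b
  using c by (intro integrable_continuous_real) (auto intro: continuous_on_subset)
 have 1: "((%y. integral {x-1..y} h) has_real_derivative h x) (at x within {x-1..x+1})"
  by (rule integral_has_real_derivative) (use c in \<open>auto intro: continuous_on_subset\<close>)
 have "at x within {x-1..x+1} = at x"
  by (rule at_within_interior) auto
 with 1 have "((%y. integral {x-1..y} h + primitive h (x-1)) has_real_derivative h x) (at x)"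
  by (auto intro!: derivative_eq_intros)
 then show ?thesis
 proof (rule has_field_derivative_transform_within_open)
  show "open {x-1<..}" "x : {x-1<..}" by auto
  show "integral {x-1..y} h + primitive h (x-1) = primitive h y" if "y : {x-1<..}" for y
   using primitive_diff[of h "x-1" y] i that by auto
 qed
qed

text \<open>Integration by parts when one factor is merely the primitive of a bounded function: Fubini on
 the triangle below the diagonal.\<close>

lemma integral_by_parts_primitive:
 fixes gam gam' h :: "real => real"
 assumes d: "!!x. (gam has_real_derivative gam' x) (at x)" and c: "continuous_on UNIV gam'"
  and supp: "!!x. R <= (abs x) ==> gam x = 0" and R: "0 < R"
  and h[measurable]: "h : borel_measurable borel" and B: "!!x. (abs (h x)) <= B"
 shows "(LINT x|lborel. gam' x * primitive h x) = - (LINT x|lborel. gam x * h x)"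
proof -
 have hi: "h integrable_on {a..b}" for a b by (rule borel_bounded_integrable_on(1)[OF h B])
 have gam'0: "gam' x = 0" if "R < (abs x)" for x
 proof -
  have "open ({R<..} \<union> {..<-R})" by (intro open_Un) auto
  moreover have "x : {R<..} \<union> {..<-R}" using that by auto
  moreover have "gam y = 0" if "y : {R<..} \<union> {..<-R}" for y using supp[of y] that by auto
  ultimately have "((%x. 0) has_real_derivative gam' x) (at x)"
   using has_field_derivative_transform_within_open[OF d[of x], of _ "%x. 0"] by metis
  then show ?thesis using DERIV_unique[OF _ DERIV_const] by blast
 qed
 have [measurable]: "gam' : borel_measurable borel" using c by (rule borel_measurable_continuous_onI)
 have gamc: "continuous_on UNIV gam" using d DERIV_isCont by (intro continuous_at_imp_continuous_on) blast
 have [measurable]: "gam : borel_measurable borel" using gamc by (rule borel_measurable_continuous_onI)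
 have Hc: "continuous_on UNIV (primitive h)"
 proof -
  have "(max B 1)-lipschitz_on UNIV (primitive h)"
  proof (rule lipschitz_onI)
   fix x y
   have "(abs (primitive h x - primitive h y)) <= B * (abs (x - y))" by (rule primitive_lipschitz[OF h B])
   also have "... <= max B 1 * (abs (x - y))" by (intro mult_right_mono) auto
   finally show "dist (primitive h x) (primitive h y) <= max B 1 * dist x y" by (simp add: dist_real_def)
  qed auto
  then show ?thesis by (rule lipschitz_on_continuous_on)
 qed
 have [measurable]: "primitive h : borel_measurable borel"
  using Hc by (rule borel_measurable_continuous_onI)
 obtain C where C: "ALL x:{-R..R}. (abs (gam' x)) <= C"
  using compact_imp_bounded[OF compact_continuous_image[OF continuous_on_subset[OF c] compact_Icc[of "-R" R]]]
  by (auto simp: bounded_iff)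
 let ?I = "indicator {-R..R} :: real => real"
 let ?f = "%x s. gam' x * h s * (?I x * ?I s * (if s <= x then 1 else 0))"
 have int: "integrable (lborel \<Otimes>\<^sub>M lborel) (case_prod ?f)"
 proof (rule integrableI_bounded_set[where A = "{-R..R} \<times> {-R..R}" and B = "C * B"])
  show "AE z in lborel \<Otimes>\<^sub>M lborel. z : {-R..R} \<times> {-R..R} --> norm (case z of (x, s) => ?f x s) <= C * B"
  proof (rule AE_I2, clarify)
   fix x s assume "x : {-R..R}" "s : {-R..R}"
   then have "(abs (gam' x)) <= C" "(abs (h s)) <= B" using C B by auto
   then have "(abs (gam' x)) * (abs (h s)) <= C * B" by (intro mult_mono) auto
   moreover have "0 <= C * B" using calculation by (smt (verit) mult_nonneg_nonneg abs_ge_zero)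
   ultimately show "norm (?f x s) <= C * B" by (auto simp: abs_mult indicator_def)
  qed
  show "emeasure (lborel \<Otimes>\<^sub>M lborel) ({-R..R} \<times> {-R..R}) < \<infinity>"
   using R by (subst lborel.emeasure_pair_measure_Times) (auto simp: ennreal_mult_less_top)
  show "AE x in lborel \<Otimes>\<^sub>M lborel. x \<notin> {-R..R} \<times> {-R..R} --> (case x of (x, s) => ?f x s) = 0"
   by (auto simp: indicator_def)
 qed measurable
 have F: "(LINT s|lborel. LINT x|lborel. ?f x s) = (LINT x|lborel. LINT s|lborel. ?f x s)"
  by (rule lborel_pair.Fubini_integral[OF int])
 have L: "(LINT x|lborel. ?f x s) = - (gam s * h s)" for s
 proof (cases "s : {-R..R}")
  case True
  have "(LINT x|lborel. ?f x s) = (LINT x|lborel. h s * (indicator {s..R} x * gam' x))"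
   using True by (intro Bochner_Integration.integral_cong) (auto simp: indicator_def)
  also have "... = h s * integral {s..R} gam'"
   using borel_bounded_integrable_on(2)[of gam' s R C] C True by auto
  also have "integral {s..R} gam' = gam R - gam s"
   using True d by (intro integral_unique fundamental_theorem_of_calculus)
    (auto simp: has_real_derivative_iff_has_vector_derivative[symmetric] intro: DERIV_subset)
  finally show ?thesis using supp[of R] R by simp
 next
  case False
  then have "gam s = 0" using supp[of s] by auto
  then show ?thesis using False by simp
 qed
 have Rr: "(LINT s|lborel. ?f x s) = gam' x * primitive h x - gam' x * primitive h (-R)" for x
 proof (cases "x : {-R..R}")
  case True
  have "(LINT s|lborel. ?f x s) = (LINT s|lborel. gam' x * (indicator {-R..x} s * h s))"
   using True by (intro Bochner_Integration.integral_cong) (auto simp: indicator_def)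
  also have "... = gam' x * integral {-R..x} h"
   using borel_bounded_integrable_on(2)[of h "-R" x B] B by auto
  finally show ?thesis using primitive_diff[of h "-R" x] hi True by (auto simp: algebra_simps)
 next
  case False
  then have "gam' x = 0" using gam'0[of x] by auto
  then show ?thesis by simp
 qed
 have ig: "integrable lborel (%x. gam' x * g x)" if "continuous_on UNIV g" for g :: "real => real"
 proof -
  have [measurable]: "g : borel_measurable borel" using that by (rule borel_measurable_continuous_onI)
  have "continuous_on {-R..R} (%x. gam' x * g x)"
   using c that by (intro continuous_on_mult) (auto intro: continuous_on_subset)
  then obtain D where D: "ALL x:{-R..R}. (abs (gam' x * g x)) <= D"
   using compact_imp_bounded[OF compact_continuous_image[OF _ compact_Icc[of "-R" R]]]
   by (fastforce simp: bounded_iff)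
  show ?thesis
   by (rule integrableI_bounded_set[where A = "{-R..R}" and B = D]) (use D gam'0 R in \<open>auto simp: not_le\<close>)
 qed
 have z: "(LINT x|lborel. gam' x * k) = 0" for k
 proof -
  have "gam' x * k = indicator {-R..R} x * (gam' x * k)" for x
   using gam'0[of x] by (cases "R < (abs x)") (auto simp: indicator_def)
  then have "(LINT x|lborel. gam' x * k) = (LINT x|lborel. indicator {-R..R} x * (gam' x * k))"
   by presburger
  also have "... = integral {-R..R} (%x. gam' x * k)"
   by (rule borel_bounded_integrable_on(2)[where B = "C * (abs k)"])
     (use C in \<open>auto simp: abs_mult intro!: mult_right_mono\<close>)
  also have "... = gam R * k - gam (-R) * k"
   using R d by (intro integral_unique fundamental_theorem_of_calculus)
    (auto simp: has_real_derivative_iff_has_vector_derivative[symmetric]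
     intro!: derivative_eq_intros intro: DERIV_subset)
  finally show ?thesis using supp[of R] supp[of "-R"] R by simp
 qed
 have "- (LINT x|lborel. gam x * h x) = (LINT x|lborel. gam' x * primitive h x - gam' x * primitive h (-R))"
  using F unfolding L Rr by simp
 also have "... = (LINT x|lborel. gam' x * primitive h x) - (LINT x|lborel. gam' x * primitive h (-R))"
  by (intro Bochner_Integration.integral_diff ig Hc continuous_on_const)
 finally show ?thesis using z by simp
qed

definition plateau :: "nat => real => real => real => real" where
 "plateau n a b x = 1 - exp (- (real n * bump a b x))"

lemma plateau_bounds: "0 <= plateau n a b x" "plateau n a b x <= 1"
 using bump_nonneg[of a b x] by (auto simp: plateau_def)

lemma plateau_eq_0: "\<not> (a < x & x < b) ==> plateau n a b x = 0"
 by (simp add: plateau_def bump_eq_0)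

lemma smooth_on_plateau: "smooth_on UNIV (plateau n a b)"
proof -
 have "smooth_on UNIV (%x. exp ((- real n) * bump a b x))"
  by (intro smooth_on_compose[OF _ _ smooth_on_exp] smooth_on_mult smooth_on_const smooth_on_bump) auto
 then have "smooth_on UNIV (%x. 1 + (- 1) * exp ((- real n) * bump a b x))"
  by (intro smooth_on_add smooth_on_mult smooth_on_const) auto
 moreover have "plateau n a b = (%x. 1 + (- 1) * exp ((- real n) * bump a b x))"
  by (auto simp: plateau_def)
 ultimately show ?thesis by simp
qed

lemma continuous_plateau: "continuous_on UNIV (plateau n a b)"
 by (rule smooth_on_imp_continuous_on[OF smooth_on_plateau])

lemma plateau_measurable[measurable]: "plateau n a b : borel_measurable borel"
 by (rule borel_measurable_continuous_onI[OF continuous_plateau])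

lemma plateau_tendsto: "(%n. plateau n a b x) \<longlonglongrightarrow> indicator {a<..<b} x"
proof (cases "x : {a<..<b}")
 case True
 then have "0 < bump a b x" by (simp add: bump_pos_iff)
 then have "filterlim (%n. real n * bump a b x) at_top sequentially"
  by (intro filterlim_at_top_mult_tendsto_pos[OF tendsto_const] filterlim_real_sequentially) auto
 then have "(%n. exp (- (real n * bump a b x))) \<longlonglongrightarrow> 0"
  by (intro filterlim_compose[OF exp_at_bot] filterlim_compose[OF filterlim_uminus_at_bot_at_top])
 then have "(%n. 1 - exp (- (real n * bump a b x))) \<longlonglongrightarrow> 1 - 0" by (intro tendsto_intros)
 then show ?thesis using True by (simp add: plateau_def)
next
 case False
 then show ?thesis by (simp add: plateau_eq_0)
qed

lemma integral_plateau_tendsto: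
 assumes W[measurable]: "W : borel_measurable borel" and B: "!!x. x : {a..b} ==> (abs (W x)) <= B"
 shows "(%n. LINT x|lborel. plateau n a b x * W x) \<longlonglongrightarrow> integral {a..b} W"
  and "integrable lborel (%x. plateau n a b x * W x)"
proof -
 have e: "integral {a..b} W = (LINT x|lborel. indicator {a<..<b} x * W x)"
 proof -
  have "(LINT x|lborel. indicator {a..b} x * W x) = (LINT x|lborel. indicator {a<..<b} x * W x)"
   by (rule integral_cong_AE, simp, simp,
     use AE_lborel_singleton[of a] AE_lborel_singleton[of b] in eventually_elim)
     (auto simp: indicator_def)
  then show ?thesis using borel_bounded_integrable_on(2)[OF W B] by simp
 qed
 have bound: "norm (plateau n a b x * W x) <= indicator {a..b} x * B" for n x
 proof (cases "a < x & x < b")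
  case True
  then have "plateau n a b x * (abs (W x)) <= 1 * B"
   using B[of x] plateau_bounds[of n a b x] by (intro mult_mono) auto
  then show ?thesis using True plateau_bounds(1)[of n a b x] by (simp add: abs_mult)
 next
  case False
  then show ?thesis using B[of x] by (auto simp: plateau_eq_0 indicator_def intro: order_trans[OF abs_ge_zero])
 qed
 have i: "integrable lborel (%x. indicator {a..b} x * B)"
  by (intro integrable_mult_left integrable_real_indicator) (auto simp: emeasure_lborel_Icc_eq)
 show "(%n. LINT x|lborel. plateau n a b x * W x) \<longlonglongrightarrow> integral {a..b} W"
  unfolding e
  by (rule integral_dominated_convergence[where w = "%x. indicator {a..b} x * B"])
    (use i bound plateau_tendsto in \<open>auto intro!: tendsto_mult_right AE_I2\<close>)
 show "integrable lborel (%x. plateau n a b x * W x)"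
  by (rule Bochner_Integration.integrable_bound[OF i]) (use bound in \<open>auto intro!: AE_I2 order_trans[OF bound[unfolded real_norm_def] abs_ge_self]\<close>)
qed

text \<open>Test functions whose derivative is a normalised plateau minus a later normalised plateau turn
 the weak inequality into a comparison of means of \<open>W\<close>, the sum of the flux and a primitive of the source.\<close>

proposition AE_decreasing_of_weak:
 fixes h k :: "real => real"
 assumes h[measurable]: "h : borel_measurable borel" and k[measurable]: "k : borel_measurable borel"
  and hB: "!!x. (abs (h x)) <= B" and kB: "!!x. (abs (k x)) <= B"
  and weak: "!!gam gam' R. smooth_on UNIV gam ==> smooth_on UNIV gam' ==>
    (!!x. (gam has_real_derivative gam' x) (at x)) ==> 0 < R ==>
    (!!x. R <= (abs x) ==> gam x = 0) ==> (!!x. 0 <= gam x) ==>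
    0 <= (LINT x|lborel. gam' x * (k x - x * h x) - gam x * h x)"
 shows "EX G. (AE x in lborel. x : G) &
   (ALL x:G. ALL y:G. x < y --> (k y - y * h y) - (k x - x * h x) <= - integral {x..y} h)"
proof -
 define W where "W x = k x - x * h x + primitive h x" for x
 have hi: "h integrable_on {a..b}" for a b by (rule borel_bounded_integrable_on(1)[OF h hB])
 have B0: "0 <= B" using hB[of 0] abs_ge_zero order_trans by blast
 have Hb: "(abs (primitive h x)) <= B * (abs x)" for x
  using primitive_lipschitz[OF h hB, of 0 x] by (simp add: primitive_def)
 have Hc: "continuous_on UNIV (primitive h)"
 proof -
  have "B-lipschitz_on UNIV (primitive h)"
   by (rule lipschitz_onI) (use primitive_lipschitz[OF h hB] B0 in \<open>auto simp: dist_real_def\<close>)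
  then show ?thesis by (rule lipschitz_on_continuous_on)
 qed
 have [measurable]: "primitive h : borel_measurable borel"
  using Hc by (rule borel_measurable_continuous_onI)
 have Wm[measurable]: "W : borel_measurable borel" unfolding W_def by measurable
 have Wb: "(abs (W x)) <= B + 2 * (R * B)" if "(abs x) <= R" for x R
 proof -
  have "(abs (W x)) <= (abs (k x)) + (abs x) * (abs (h x)) + (abs (primitive h x))" unfolding W_def abs_mult[symmetric] by linarith
  moreover have "(abs x) * (abs (h x)) <= R * B" using that hB[of x] by (intro mult_mono) auto
  moreover have "B * (abs x) <= R * B" using that B0 by (simp add: mult.commute mult_left_mono)
  ultimately show ?thesis using kB[of x] Hb[of x] by linarith
 qed
 have means: "integral {c..d} W / (d - c) <= integral {a..b} W / (b - a)"
  if ord: "a < b" "b <= c" "c < d" for a b c d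
 proof -
  define K where "K = B + 2 * (max (abs a) (abs d) * B)"
  have WK: "(abs (W x)) <= K" if "x : {a..d}" for x
   unfolding K_def by (rule Wb) (use that in \<open>auto simp: abs_le_iff le_max_iff_disj\<close>)
  define m1 where "m1 n = integral {a..b} (plateau n a b)" for n
  define m2 where "m2 n = integral {c..d} (plateau n c d)" for n
  have m1: "m1 \<longlonglongrightarrow> b - a" and m2: "m2 \<longlonglongrightarrow> d - c"
  proof -
   have *: "(%n. integral {a..b} (plateau n a b)) \<longlonglongrightarrow> b - a" if "a < b" for a b
   proof -
    have 1: "(%n. LINT x|lborel. plateau n a b x * 1) \<longlonglongrightarrow> integral {a..b} (%x. 1)"
     by (rule integral_plateau_tendsto(1)[where B = 1]) auto
    have 2: "(LINT x|lborel. plateau n a b x * 1) = integral {a..b} (plateau n a b)" for n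
    proof -
     have "plateau n a b x * 1 = indicator {a..b} x * plateau n a b x" for x
      using plateau_eq_0[of a x b n] by (cases "a < x & x < b") (auto simp: indicator_def)
     then have "(LINT x|lborel. plateau n a b x * 1) = (LINT x|lborel. indicator {a..b} x * plateau n a b x)"
      by presburger
     also have "... = integral {a..b} (plateau n a b)"
      by (rule borel_bounded_integrable_on(2)[where B = 1]) (use plateau_bounds[of n a b] in auto)
     finally show ?thesis .
    qed
    show ?thesis using 1 that unfolding 2 by simp
   qed
   show "m1 \<longlonglongrightarrow> b - a" "m2 \<longlonglongrightarrow> d - c" unfolding m1_def m2_def using ord by (auto intro!: *)
  qed
  have ev: "\<forall>\<^sub>F n in sequentially. 0 < m1 n & 0 < m2 n"
   using order_tendstoD(1)[OF m1, of 0] order_tendstoD(1)[OF m2, of 0] ord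
   by (auto simp: eventually_conj_iff)
  have key: "(LINT x|lborel. plateau n c d x * W x) / m2 n <= (LINT x|lborel. plateau n a b x * W x) / m1 n"
   if pos: "0 < m1 n" "0 < m2 n" for n
  proof -
   define gam' where "gam' x = (1 / m1 n) * plateau n a b x + (- 1 / m2 n) * plateau n c d x" for x
   define gam where "gam x = primitive gam' x - primitive gam' a" for x
   have s': "smooth_on UNIV gam'" unfolding gam'_def[abs_def]
    by (intro smooth_on_add smooth_on_mult smooth_on_const smooth_on_plateau) auto
   have c': "continuous_on UNIV gam'" by (rule smooth_on_imp_continuous_on[OF s'])
   have i': "gam' integrable_on {x..y}" for x y
    using c' by (intro integrable_continuous_real) (auto intro: continuous_on_subset)
   have ip: "plateau n u v integrable_on {x..y}" for u v x y
    using continuous_plateau by (intro integrable_continuous_real) (auto intro: continuous_on_subset)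
   have d: "(gam has_real_derivative gam' x) (at x)" for x
    unfolding gam_def using primitive_deriv[OF c', of x] by (auto intro!: derivative_eq_intros)
   have s: "smooth_on UNIV gam" by (rule smooth_on_real_derivI[OF _ d s']) auto
   have zero: "integral {x..y} gam' = 0" if "!!z. x <= z ==> z <= y ==> gam' z = 0" for x y
    using that by (intro integral_unique has_integral_is_0) auto
   have left: "gam x = 0" if "x <= a" for x
    using primitive_diff[OF i' that] zero[of x a] that ord
    by (auto simp: gam_def gam'_def plateau_eq_0)
   have mid: "gam x = integral {a..x} (plateau n a b) / m1 n" if "a <= x" "x <= c" for x
   proof -
    have "integral {a..x} gam' = integral {a..x} (%z. (1 / m1 n) * plateau n a b z)"
     using that by (intro Henstock_Kurzweil_Integration.integral_cong) (auto simp: gam'_def plateau_eq_0)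
    then show ?thesis using primitive_diff[OF i' that(1)] by (simp add: gam_def)
   qed
   have "integral {a..c} (plateau n a b) = m1 n"
   proof -
    have "integral {b..c} (plateau n a b) = 0"
     by (intro integral_unique has_integral_is_0) (auto simp: plateau_eq_0)
    then show ?thesis unfolding m1_def
     using Henstock_Kurzweil_Integration.integral_combine[of a b c "plateau n a b"] ip ord by auto
   qed
   then have atc: "gam c = 1" using mid[of c] ord pos by auto
   have right: "gam x = 1 - integral {c..x} (plateau n c d) / m2 n" if "c <= x" for x
   proof -
    have "integral {c..x} gam' = integral {c..x} (%z. (- 1 / m2 n) * plateau n c d z)"
     using that ord by (intro Henstock_Kurzweil_Integration.integral_cong) (auto simp: gam'_def plateau_eq_0)
    then show ?thesis using primitive_diff[OF i' that] atc by (simp add: gam_def)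
   qed
   have pnn: "0 <= integral {x..y} (plateau n u v)" for x y u v
    using plateau_bounds by (intro integral_nonneg ip) auto
   have far: "gam x = 0" if "d <= x" for x
   proof -
    have "integral {d..x} (plateau n c d) = 0"
     by (intro integral_unique has_integral_is_0) (auto simp: plateau_eq_0)
    then have "integral {c..x} (plateau n c d) = m2 n" unfolding m2_def
     using Henstock_Kurzweil_Integration.integral_combine[of c d x "plateau n c d"] ip ord that by auto
    then show ?thesis using right[of x] that ord pos by auto
   qed
   have nn: "0 <= gam x" for x
   proof -
    consider "x <= a" | "a <= x" "x <= c" | "c <= x" "x <= d" | "d <= x" by linarith
    then show ?thesis
    proof cases
     case 3
     have "integral {c..d} (plateau n c d) = integral {c..x} (plateau n c d) + integral {x..d} (plateau n c d)"
      using Henstock_Kurzweil_Integration.integral_combine[of c x d "plateau n c d"] ip 3 by auto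
     then have "integral {c..x} (plateau n c d) <= m2 n" using pnn[of x d c d] by (simp add: m2_def)
     then have "integral {c..x} (plateau n c d) / m2 n <= 1" using pos by simp
     then show ?thesis using right[of x] 3 by simp
    qed (use left mid far pnn pos in auto)
   qed
   define R where "R = (abs a) + (abs d) + 1"
   have R: "0 < R" "!!x. R <= (abs x) ==> gam x = 0"
   proof -
    fix x assume "R <= (abs x)"
    then have "x <= a \<or> d <= x" unfolding R_def by arith
    then show "gam x = 0" using left far by blast
   qed (auto simp: R_def)
   have "0 <= (LINT x|lborel. gam' x * (k x - x * h x) - gam x * h x)"
    by (rule weak[OF s s' d R nn])
   moreover have "(LINT x|lborel. gam' x * primitive h x) = - (LINT x|lborel. gam x * h x)"
    by (rule integral_by_parts_primitive[OF d c' R(2) R(1) h hB])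
   moreover have 1: "integrable lborel (%x. gam' x * g x)"
    if [measurable]: "g : borel_measurable borel" and "!!x. x : {a..d} ==> (abs (g x)) <= C" for g C
   proof -
    have "integrable lborel (%x. (1 / m1 n) * (plateau n a b x * g x) + (- 1 / m2 n) * (plateau n c d x * g x))"
     using that ord by (intro Bochner_Integration.integrable_add integrable_mult_right integral_plateau_tendsto(2)[where B = C]) auto
    then show ?thesis by (simp add: gam'_def algebra_simps)
   qed
   moreover have "integrable lborel (%x. gam x * h x)"
   proof -
    have cg: "continuous_on UNIV gam" by (rule smooth_on_imp_continuous_on[OF s])
    have [measurable]: "gam : borel_measurable borel" by (rule borel_measurable_continuous_onI[OF cg])
    obtain C where C: "ALL x:{-R..R}. (abs (gam x)) <= C"
     using compact_imp_bounded[OF compact_continuous_image[OF continuous_on_subset[OF cg] compact_Icc[of "-R" R]]]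
     by (auto simp: bounded_iff)
    show ?thesis
    proof (rule integrableI_bounded_set[where A = "{-R..R}" and B = "C * B"])
     show "AE x in lborel. x : {-R..R} --> norm (gam x * h x) <= C * B"
      using C hB by (intro AE_I2 impI) (auto simp: abs_mult intro!: mult_mono intro: order_trans[OF abs_ge_zero])
     show "AE x in lborel. x \<notin> {-R..R} --> gam x * h x = 0"
      using R(2) by (intro AE_I2 impI) (auto simp: abs_if not_le)
    qed (auto simp: emeasure_lborel_Icc_eq)
   qed
   moreover have iP: "integrable lborel (%x. gam' x * primitive h x)"
   proof (rule 1[where C = "B * ((abs a) + (abs d))"])
    fix x assume "x : {a..d}"
    then have "(abs x) <= (abs a) + (abs d)" by auto
    then show "(abs (primitive h x)) <= B * ((abs a) + (abs d))"
     using Hb[of x] B0 mult_left_mono[of "(abs x)" "(abs a) + (abs d)" B] by linarith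
   qed simp
   moreover have iW: "integrable lborel (%x. gam' x * W x)" by (rule 1[OF Wm WK])
   moreover have iF: "integrable lborel (%x. gam' x * (k x - x * h x))"
    using Bochner_Integration.integrable_diff[OF iW iP] by (simp add: W_def algebra_simps)
   ultimately have "0 <= (LINT x|lborel. gam' x * (k x - x * h x)) + (LINT x|lborel. gam' x * primitive h x)"
    by (simp add: Bochner_Integration.integral_diff)
   also have "... = (LINT x|lborel. gam' x * W x)"
    unfolding Bochner_Integration.integral_add[OF iF iP, symmetric] by (simp add: W_def algebra_simps)
   also have "... = (LINT x|lborel. (1 / m1 n) * (plateau n a b x * W x) + (- 1 / m2 n) * (plateau n c d x * W x))"
    by (simp add: gam'_def algebra_simps)
   also have "... = (1 / m1 n) * (LINT x|lborel. plateau n a b x * W x) + (- 1 / m2 n) * (LINT x|lborel. plateau n c d x * W x)"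
   proof -
    have "integrable lborel (%x. plateau n a b x * W x)" "integrable lborel (%x. plateau n c d x * W x)"
     using WK ord by (auto intro!: integral_plateau_tendsto(2)[OF Wm, where B = K])
    then show ?thesis by (simp add: Bochner_Integration.integral_add integrable_mult_right del: mult_minus_left)
   qed
   finally show ?thesis by simp
  qed
  show ?thesis
  proof (rule tendsto_le)
   show "(%n. (LINT x|lborel. plateau n a b x * W x) / m1 n) \<longlonglongrightarrow> integral {a..b} W / (b - a)"
    using WK ord by (intro tendsto_divide m1 integral_plateau_tendsto(1)[OF Wm, where B = K]) auto
   show "(%n. (LINT x|lborel. plateau n c d x * W x) / m2 n) \<longlonglongrightarrow> integral {c..d} W / (d - c)"
    using WK ord by (intro tendsto_divide m2 integral_plateau_tendsto(1)[OF Wm, where B = K]) auto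
   show "\<forall>\<^sub>F n in sequentially. (LINT x|lborel. plateau n c d x * W x) / m2 n <= (LINT x|lborel. plateau n a b x * W x) / m1 n"
    using ev by eventually_elim (use key in auto)
  qed simp
 qed
 have "EX C. ALL x:{-R..R}. (abs (W x)) <= C" for R
  by (rule exI[of _ "B + 2 * (R * B)"]) (auto intro!: Wb)
 from AE_antimono_of_means[OF Wm this means] obtain w
  where w: "antimono w" "AE x in lborel. W x = w x" by blast
 show ?thesis
 proof (intro exI[of _ "{x. W x = w x}"] conjI ballI impI)
  show "AE x in lborel. x : {x. W x = w x}" using w(2) by simp
  fix x y assume "x : {x. W x = w x}" "y : {x. W x = w x}" "x < y"
  then have "W y <= W x" using w(1) by (auto simp: antimono_def)
  then show "(k y - y * h y) - (k x - x * h x) <= - integral {x..y} h"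
   using primitive_diff[of h x y] hi \<open>x < y\<close> by (simp add: W_def)
 qed
qed

section \<open>The equations along rays\<close>

lemma spacetime_coord_linear:
 "bounded_linear (%z::spacetime. fst z)" "bounded_linear (%z::spacetime. fst (snd z))"
 "bounded_linear (%z::spacetime. snd (snd z))"
 by (auto intro: bounded_linear_fst bounded_linear_compose[OF bounded_linear_fst bounded_linear_snd]
   bounded_linear_compose[OF bounded_linear_snd bounded_linear_snd])

lemma spacetime_coord_measurable[measurable]:
 "(%z::spacetime. fst z) : borel_measurable borel"
 "(%z::spacetime. fst (snd z)) : borel_measurable borel"
 "(%z::spacetime. snd (snd z)) : borel_measurable borel"
 by (auto intro!: borel_measurable_continuous_onI continuous_intros)

definition chart_test :: "real => (real => real) => spacetime => real" where
 "chart_test sig gam z = bump 0 1 (fst z) * (bump 1 2 (sig * fst (snd z)) * gam (snd (snd z) / fst (snd z)))"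

lemma open_slab: "open {z::spacetime. c < sig * fst (snd z)}" "open {z::spacetime. sig * fst (snd z) < c}"
 by (auto intro!: open_Collect_less continuous_intros)

lemma chart_test_smooth:
 assumes gam: "smooth_on UNIV gam" and sig: "sig : {1, -1}"
 shows "smooth_on UNIV (chart_test sig gam)"
proof -
 let ?S = "{z::spacetime. 0 < sig * fst (snd z)}"
 let ?T = "{z::spacetime. sig * fst (snd z) < 1}"
 have S: "open ?S" and T: "open ?T" by (rule open_slab)+
 have lin: "smooth_on ?S (%z. fst z)" "smooth_on ?S (%z. fst (snd z))" "smooth_on ?S (%z. snd (snd z))"
  "smooth_on ?S (%z. sig * fst (snd z))"
  by (intro smooth_on_linear S spacetime_coord_linear smooth_on_mult smooth_on_const)+
 have "smooth_on ?S (%z. inverse (sig * fst (snd z)))"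
  by (rule smooth_on_compose[OF S _ smooth_on_inverse lin(4)]) auto
 then have "smooth_on ?S (%z. snd (snd z) * (sig * inverse (sig * fst (snd z))))"
  by (intro smooth_on_mult S smooth_on_const lin)
 moreover have "snd (snd z) * (sig * inverse (sig * fst (snd z))) = snd (snd z) / fst (snd z)" for z :: spacetime
  using sig by (auto simp: divide_inverse)
 ultimately have q: "smooth_on ?S (%z. snd (snd z) / fst (snd z))" by simp
 have "smooth_on ?S (chart_test sig gam)" unfolding chart_test_def[abs_def]
  by (intro smooth_on_mult S smooth_on_compose[OF S open_UNIV smooth_on_bump]
    smooth_on_compose[OF S open_UNIV gam] lin q) auto
 moreover have "smooth_on ?T (chart_test sig gam)"
  by (rule smooth_on_cong[OF T _ smooth_on_const[OF T, of 0]]) (auto simp: chart_test_def bump_eq_0)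
 ultimately have "smooth_on (?S \<union> ?T) (chart_test sig gam)" by (rule smooth_on_Un) (intro S T)+
 moreover have "?S \<union> ?T = UNIV" by auto
 ultimately show ?thesis by simp
qed

lemma chart_test_deriv:
 assumes gam: "!!x. (gam has_real_derivative gam' x) (at x)" and sig: "sig : {1, -1}"
  and alf: "!!x. (bump 0 1 has_real_derivative alf' x) (at x)"
  and bet: "!!x. (bump 1 2 has_real_derivative bet' x) (at x)"
 shows "frechet_derivative (chart_test sig gam) (at (t, x, y)) (1, 0, 0) = alf' t * (bump 1 2 (sig * x) * gam (y / x))"
  and "frechet_derivative (chart_test sig gam) (at (t, x, y)) (0, 1, 0) =
   sig * (bump 0 1 t * (bet' (sig * x) * gam (y / x))) - sig * (bump 0 1 t * (bump 1 2 (sig * x) / (sig * x) * (y / x * gam' (y / x))))"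
  and "frechet_derivative (chart_test sig gam) (at (t, x, y)) (0, 0, 1) =
   sig * (bump 0 1 t * (bump 1 2 (sig * x) / (sig * x) * gam' (y / x)))"
proof -
 define D where "D v = fst v * alf' t * (bump 1 2 (sig * x) * gam (y / x)) +
   bump 0 1 t * (sig * fst (snd v) * bet' (sig * x) * gam (y / x) +
   bump 1 2 (sig * x) * ((snd (snd v) / x - y * fst (snd v) / (x * x)) * gam' (y / x)))" for v :: spacetime
 have D: "(chart_test sig gam has_derivative D) (at (t, x, y))"
 proof (cases "0 < sig * x")
  case True
  then have x0: "x ~= 0" by auto
  let ?z = "(t, x, y)"
  have 1: "((%z. bump 0 1 (fst z)) has_derivative (%v. fst v * alf' t)) (at ?z)"
   using DERIV_compose_FDERIV[OF _ bounded_linear_imp_has_derivative[OF spacetime_coord_linear(1)],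
     of "bump 0 1" "alf' t" ?z UNIV] alf[of t] by simp
  have 2: "((%z::spacetime. bump 1 2 (sig * fst (snd z))) has_derivative (%v. (sig * fst (snd v)) * bet' (sig * x))) (at ?z)"
   using DERIV_compose_FDERIV[OF _ bounded_linear_imp_has_derivative[OF
      bounded_linear_const_mult[OF spacetime_coord_linear(2)]],
     of "bump 1 2" "bet' (sig * x)" sig ?z UNIV] bet[of "sig * x"] by simp
  have 3: "((%z::spacetime. snd (snd z) / fst (snd z)) has_derivative
    (%v. snd (snd v) / x - y * fst (snd v) / (x * x))) (at ?z)"
   using x0 by (auto intro!: derivative_eq_intros bounded_linear_imp_has_derivative spacetime_coord_linear
     simp: field_simps)
  have 4: "((%z::spacetime. gam (snd (snd z) / fst (snd z))) has_derivative
    (%v. (snd (snd v) / x - y * fst (snd v) / (x * x)) * gam' (y / x))) (at ?z)"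
   using DERIV_compose_FDERIV[OF _ 3, of gam "gam' (y / x)"] gam[of "y / x"] by simp
  show ?thesis unfolding chart_test_def[abs_def]
   by (rule has_derivative_eq_rhs[OF has_derivative_mult[OF 1 has_derivative_mult[OF 2 4]]])
     (auto simp: D_def fun_eq_iff algebra_simps)
 next
  case False
  have nz: "bump 1 2 u = 0" if "u < 1" for u by (rule bump_eq_0) (use that in auto)
  have "((%x. 0) has_real_derivative bet' (sig * x)) (at (sig * x))"
   by (rule has_field_derivative_transform_within_open[OF bet, of "{..<1}"]) (use False nz in auto)
  then have b0: "bet' (sig * x) = 0" using DERIV_unique[OF _ DERIV_const] by blast
  have "D = (%v. 0)" unfolding D_def using False b0 nz[of "sig * x"] by (auto simp: fun_eq_iff)
  moreover have "(chart_test sig gam has_derivative (%v. 0)) (at (t, x, y))"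
   by (rule has_derivative_transform_within_open[OF has_derivative_const open_slab(2)[of sig 1]])
     (use False nz in \<open>auto simp: chart_test_def\<close>)
  ultimately show ?thesis by simp
 qed
 then have e: "frechet_derivative (chart_test sig gam) (at (t, x, y)) = D"
  by (rule frechet_derivative_at[symmetric])
 have si: "1 / x = sig / (sig * x)" using sig by auto
 show "frechet_derivative (chart_test sig gam) (at (t, x, y)) (1, 0, 0) = alf' t * (bump 1 2 (sig * x) * gam (y / x))"
  unfolding e D_def by simp
 show "frechet_derivative (chart_test sig gam) (at (t, x, y)) (0, 1, 0) =
   sig * (bump 0 1 t * (bet' (sig * x) * gam (y / x))) - sig * (bump 0 1 t * (bump 1 2 (sig * x) / (sig * x) * (y / x * gam' (y / x))))"
  unfolding e D_def using sig by (auto simp: algebra_simps)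
 show "frechet_derivative (chart_test sig gam) (at (t, x, y)) (0, 0, 1) =
   sig * (bump 0 1 t * (bump 1 2 (sig * x) / (sig * x) * gam' (y / x)))"
  unfolding e D_def using sig by (auto simp: algebra_simps)
qed

lemma chart_test_is_test:
 assumes gam: "smooth_on UNIV gam" and sig: "sig : {1, -1}" and supp: "!!x. R <= (abs x) ==> gam x = 0"
 shows "test_function (chart_test sig gam)"
 unfolding test_function_def
proof
 have "{z. chart_test sig gam z ~= 0} \<subseteq> cbox (0, -2, -2 * (abs R)) (1, 2, 2 * (abs R))"
 proof
  fix z :: spacetime assume z: "z : {z. chart_test sig gam z ~= 0}"
  obtain t x y where zt: "z = (t, x, y)" by (cases z)
  have *: "bump 0 1 t ~= 0" "bump 1 2 (sig * x) ~= 0" "gam (y / x) ~= 0"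
   using z by (auto simp: zt chart_test_def)
  have t: "0 < t" "t < 1" and x: "1 < sig * x" "sig * x < 2"
   using *(1,2) bump_eq_0[of 0 t 1] bump_eq_0[of 1 "sig * x" 2] by blast+
  have "(abs (y / x)) < R" using *(3) supp[of "y / x"] by linarith
  then have "(abs (y / x)) * (abs x) <= R * 2" using x sig order.strict_trans1[OF abs_ge_zero \<open>(abs (y / x)) < R\<close>]
   by (intro mult_mono) auto
  moreover have "(abs (y / x)) * (abs x) = (abs y)" using x by (cases "x = 0") auto
  ultimately have "(abs y) <= 2 * (abs R)" by linarith
  then show "z : cbox (0, -2, -2 * (abs R)) (1, 2, 2 * (abs R))"
   using t x sig unfolding zt cbox_Pair_iff by auto
 qed
 then have "bounded {z. chart_test sig gam z ~= 0}" by (rule bounded_subset[OF bounded_cbox])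
 then show "compact (closure {z. chart_test sig gam z ~= 0})" by (rule compact_closure[THEN iffD2])
qed (rule chart_test_smooth[OF gam sig])

lemma integral_chart_product:
 fixes alf bet q :: "real => real"
 assumes [measurable]: "alf : borel_measurable borel" "bet : borel_measurable borel" "q : borel_measurable borel"
  and alf: "!!x. (abs (alf x)) <= A" "!!x. \<not> (0 < x & x < 1) ==> alf x = 0"
  and bet: "!!x. (abs (bet x)) <= B" "!!x. \<not> (1 < x & x < 2) ==> bet x = 0"
  and q: "!!x. (abs (q x)) <= Q" "!!x. R <= (abs x) ==> q x = 0"
  and sig: "sig : {1, -1}"
 defines "P \<equiv> %z::spacetime. alf (fst z) * (bet (sig * fst (snd z)) * q (snd (snd z) / fst (snd z)))"
 shows "integrable lborel P" "P : borel_measurable borel"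
  and "(LINT z|lborel. P z) = (LINT t|lborel. alf t) * ((LINT x|lborel. bet x * x) * (LINT xi|lborel. q xi))"
proof -
 show Pm[measurable]: "P : borel_measurable borel" unfolding P_def by measurable
 have A0: "0 <= A" "0 <= B" "0 <= Q" using alf(1)[of 0] bet(1)[of 0] q(1)[of 0] by linarith+
 let ?C = "cbox (0, -2, -2 * (abs R)) (1, 2, 2 * (abs R)) :: spacetime set"
 have out: "P z = 0" if "z \<notin> ?C" for z
 proof (rule ccontr)
  assume nz: "P z ~= 0"
  obtain t x y where zt: "z = (t, x, y)" by (cases z)
  have *: "alf t ~= 0" "bet (sig * x) ~= 0" "q (y / x) ~= 0" using nz by (auto simp: zt P_def)
  have t: "0 < t" "t < 1" and x: "1 < sig * x" "sig * x < 2" using *(1,2) alf(2) bet(2) by blast+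
  have "(abs (y / x)) < R" using *(3) q(2)[of "y / x"] by linarith
  then have "(abs (y / x)) * (abs x) <= R * 2" using x sig order.strict_trans1[OF abs_ge_zero \<open>(abs (y / x)) < R\<close>]
   by (intro mult_mono) auto
  moreover have "(abs (y / x)) * (abs x) = (abs y)" using x by (cases "x = 0") auto
  ultimately have "(abs y) <= 2 * (abs R)" by linarith
  then show False using that t x sig unfolding zt cbox_Pair_iff by auto
 qed
 have Pb: "(abs (P z)) <= A * (B * Q)" for z
  unfolding P_def abs_mult by (intro mult_mono alf bet q mult_nonneg_nonneg abs_ge_zero A0)
 show Pi: "integrable lborel P"
  by (rule integrableI_bounded_set[where A = ?C and B = "A * (B * Q)"])
    (use out Pb emeasure_lborel_cbox_finite in auto)
 let ?Q = "%w::real\<times>real. bet (sig * fst w) * q (snd w / fst w)"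
 have fm[measurable]: "(%w::real\<times>real. fst w) : borel_measurable borel" "(%w::real\<times>real. snd w) : borel_measurable borel"
  by (auto intro!: borel_measurable_continuous_onI continuous_intros)
 have Qi: "integrable lborel ?Q"
 proof (rule integrableI_bounded_set[where A = "cbox (-2, -2 * (abs R)) (2, 2 * (abs R))" and B = "B * Q"])
  show "AE w in lborel. w : cbox (-2, -2 * (abs R)) (2, 2 * (abs R)) --> norm (?Q w) <= B * Q"
   unfolding real_norm_def abs_mult by (intro AE_I2 impI mult_mono bet q abs_ge_zero A0)
  show "AE w in lborel. w \<notin> cbox (-2, -2 * (abs R)) (2, 2 * (abs R)) --> ?Q w = 0"
  proof (intro AE_I2 impI, rule ccontr)
   fix w :: "real \<times> real" assume w: "w \<notin> cbox (-2, -2 * (abs R)) (2, 2 * (abs R))" "?Q w ~= 0"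
   obtain x y where wt: "w = (x, y)" by (cases w)
   have *: "bet (sig * x) ~= 0" "q (y / x) ~= 0" using w(2) by (auto simp: wt)
   have x: "1 < sig * x" "sig * x < 2" using *(1) bet(2) by blast+
   have "(abs (y / x)) < R" using *(2) q(2)[of "y / x"] by linarith
   then have "(abs (y / x)) * (abs x) <= R * 2" using x sig order.strict_trans1[OF abs_ge_zero \<open>(abs (y / x)) < R\<close>]
   by (intro mult_mono) auto
   moreover have "(abs (y / x)) * (abs x) = (abs y)" using x by (cases "x = 0") auto
   ultimately have "(abs y) <= 2 * (abs R)" by linarith
   then show False using w(1) x sig unfolding wt cbox_Pair_iff by auto
  qed
  show "emeasure lborel (cbox (-2, -2 * (abs R)) (2, 2 * (abs R)) :: (real \<times> real) set) < \<infinity>"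
   by (rule emeasure_lborel_cbox_finite)
 qed auto
 have inner: "(LINT y|lborel. bet (sig * x) * q (y / x)) = bet (sig * x) * (sig * x) * (LINT xi|lborel. q xi)" for x
 proof (cases "1 < sig * x")
  case True
  then have x: "x ~= 0" "(abs x) = sig * x" using sig by auto
  have "(LINT xi|lborel. q xi) = (abs (1 / x)) *\<^sub>R (LINT y|lborel. q (0 + 1 / x * y))"
   by (rule lborel_integral_real_affine) (use x in auto)
  then have "(LINT y|lborel. q (y / x)) = (sig * x) * (LINT xi|lborel. q xi)"
   using x sig by (auto simp: field_simps)
  then show ?thesis by simp
 next
  case False
  then show ?thesis using bet(2)[of "sig * x"] by simp
 qed
 have "(LINT w|lborel. ?Q w) = (LINT x|lborel. LINT y|lborel. ?Q (x, y))"
  using lborel_pair.integral_fst'[of ?Q] Qi unfolding lborel_prod by simp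
 also have "... = (LINT x|lborel. bet (sig * x) * (sig * x)) * (LINT xi|lborel. q xi)"
  by (simp only: fst_conv snd_conv inner integral_mult_left_zero)
 also have "(LINT x|lborel. bet (sig * x) * (sig * x)) = (LINT x|lborel. bet x * x)"
  using lborel_integral_real_affine[of sig "%x. bet x * x" 0] sig by auto
 finally have Qv: "(LINT w|lborel. ?Q w) = (LINT x|lborel. bet x * x) * (LINT xi|lborel. q xi)" .
 have "(LINT z|lborel. P z) = (LINT t|lborel. LINT w|lborel. P (t, w))"
  using lborel_pair.integral_fst'[of P] Pi unfolding lborel_prod by simp
 also have "... = (LINT t|lborel. alf t * (LINT w|lborel. ?Q w))" by (simp add: P_def)
 finally show "(LINT z|lborel. P z) = (LINT t|lborel. alf t) * ((LINT x|lborel. bet x * x) * (LINT xi|lborel. q xi))"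
  by (simp add: Qv)
qed

lemma bump_integral_pos:
 assumes "a < b" shows "0 < (LINT x|lborel. bump a b x)"
proof -
 have c: "continuous_on {a..b} (bump a b)"
  using smooth_on_imp_continuous_on[OF smooth_on_bump] continuous_on_subset by blast
 obtain C where C: "ALL x:{a..b}. (abs (bump a b x)) <= C"
  using compact_imp_bounded[OF compact_continuous_image[OF c compact_Icc]] by (auto simp: bounded_iff)
 have [measurable]: "bump a b : borel_measurable borel"
  by (rule borel_measurable_continuous_onI[OF smooth_on_imp_continuous_on[OF smooth_on_bump]])
 have "bump a b x = indicator {a..b} x * bump a b x" for x
  using bump_eq_0[of a x b] by (cases "a < x & x < b") (auto simp: indicator_def)
 then have "(LINT x|lborel. bump a b x) = (LINT x|lborel. indicator {a..b} x * bump a b x)"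
  by presburger
 also have "... = integral {a..b} (bump a b)"
  by (rule borel_bounded_integrable_on(2)[where B = C]) (use C in auto)
 finally have e: "(LINT x|lborel. bump a b x) = integral {a..b} (bump a b)" .
 have "0 <= integral {a..b} (bump a b)"
  by (intro integral_nonneg integrable_continuous_real c bump_nonneg)
 moreover have "integral {a..b} (bump a b) ~= 0"
 proof
  assume "integral {a..b} (bump a b) = 0"
  then have "ALL x:{a..b}. bump a b x = 0"
   using integral_eq_0_iff[OF c] bump_nonneg assms by blast
  then have "bump a b ((a + b) / 2) = 0" using assms by auto
  then show False using bump_pos_iff[of a b "(a+b)/2"] assms by simp
 qed
 ultimately show ?thesis using e by linarith
qed

lemma smooth_bounded_of_support:
 fixes f :: "real => real"
 assumes f: "smooth_on UNIV f" and 0: "!!x. R <= (abs x) ==> f x = (0::real)"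
 obtains B where "!!x. (abs (f x)) <= B"
proof -
 have "compact (f ` {-R..R})"
  by (intro compact_continuous_image continuous_on_subset[OF smooth_on_imp_continuous_on[OF f]] compact_Icc) auto
 then obtain B where B: "ALL x:{-R..R}. (abs (f x)) <= B"
  using compact_imp_bounded by (fastforce simp: bounded_iff)
 show ?thesis
 proof (rule that)
  fix x show "(abs (f x)) <= max B 0"
  proof (cases "R <= (abs x)")
   case False
   then have "x : {-R..R}" by auto
   then show ?thesis using B by (force simp: le_max_iff_disj)
  qed (simp add: 0)
 qed
qed

lemma deriv_zero_of_zero_near:
 assumes "(f has_real_derivative f') (at x)" "open S" "x : S" "!!y. y : S ==> f y = 0"
 shows "f' = 0"
proof -
 have "((%x. 0) has_real_derivative f') (at x)"
  by (rule has_field_derivative_transform_within_open[OF assms(1-3)]) (use assms(4) in auto)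
 then show ?thesis using DERIV_unique[OF _ DERIV_const] by blast
qed

text \<open>Polar-type coordinates \<open>(x, y / x)\<close> separate the variables: the radial factor integrates to a
 constant, with the orientation \<open>sig\<close> of the half plane as its sign.\<close>

lemma chart_pairing:
 fixes G H K :: "spacetime => real" and g h k :: "real => real"
 assumes gam: "smooth_on UNIV gam" and gam': "smooth_on UNIV gam'"
  and d: "!!x. (gam has_real_derivative gam' x) (at x)"
  and supp: "!!x. R <= (abs x) ==> gam x = 0" and sig: "sig : {1, -1}"
  and GHK: "G : borel_measurable lebesgue" "H : borel_measurable lebesgue" "K : borel_measurable lebesgue"
  and ae: "AE z in lebesgue. 0 < sig * fst (snd z) --> G z = g (snd (snd z) / fst (snd z)) &
    H z = h (snd (snd z) / fst (snd z)) & K z = k (snd (snd z) / fst (snd z))"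
  and m[measurable]: "g : borel_measurable borel" "h : borel_measurable borel" "k : borel_measurable borel"
  and B: "!!x. (abs (g x)) <= B" "!!x. (abs (h x)) <= B" "!!x. (abs (k x)) <= B"
 defines "\<phi> \<equiv> chart_test sig gam"
 defines "I \<equiv> %z. frechet_derivative \<phi> (at z) (1, 0, 0) * G z
     + frechet_derivative \<phi> (at z) (0, 1, 0) * H z + frechet_derivative \<phi> (at z) (0, 0, 1) * K z"
 shows "integrable lebesgue I"
  and "(LINT z|lebesgue. I z) = sig * ((LINT x|lborel. bump 0 1 x) * (LINT x|lborel. bump 1 2 x)) *
    (LINT xi|lborel. gam' xi * (k xi - xi * h xi) - gam xi * h xi)"
proof -
 obtain alf' where alf': "!!x. (bump 0 1 has_real_derivative alf' x) (at x)" "smooth_on UNIV alf'"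
  using smooth_on_real_derivE[OF smooth_on_bump] by (metis UNIV_I)
 obtain bet' where bet': "!!x. (bump 1 2 has_real_derivative bet' x) (at x)" "smooth_on UNIV bet'"
  using smooth_on_real_derivE[OF smooth_on_bump] by (metis UNIV_I)
 have sm: "f : borel_measurable borel" if "smooth_on UNIV f" for f :: "real => real"
  by (rule borel_measurable_continuous_onI[OF smooth_on_imp_continuous_on[OF that]])
 have [measurable]: "gam : borel_measurable borel" "gam' : borel_measurable borel"
  "alf' : borel_measurable borel" "bet' : borel_measurable borel"
  "bump a b : borel_measurable borel" for a b
  using gam gam' alf'(2) bet'(2) smooth_on_bump sm by auto
 have supp': "gam' x = 0" if "R < (abs x)" for x
 proof (rule deriv_zero_of_zero_near[OF d, where S = "{y. R < (abs y)}"])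
  show "open {y. R < (abs y)}" by (intro open_Collect_less continuous_intros)
 qed (use that supp in auto)
 have supp1: "gam' x = 0" if "R + 1 <= (abs x)" for x using supp'[of x] that by auto
 have supp2: "gam x = 0" if "R + 1 <= (abs x)" for x using supp[of x] that by auto
 have dz: "f' x = 0" if fd: "!!x. (bump a b has_real_derivative f' x) (at x)" and fc: "smooth_on UNIV f'"
  and x: "\<not> (a < x & x < b)" and ab: "a < b" for f' a b x
 proof (rule ccontr)
  assume nz: "f' x ~= 0"
  have "isCont f' x" using smooth_on_imp_continuous_on[OF fc] by (simp add: continuous_on_eq_continuous_at)
  then obtain e where e: "e > 0" "ALL y. dist y x < e --> f' y ~= 0"
   using continuous_at_avoid[of x f' 0] nz by (auto simp: dist_commute)
  define y where "y = (if x <= a then x - e/2 else x + e/2)"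
  have "dist y x < e" using e(1) by (auto simp: y_def dist_real_def)
  moreover have "f' y = 0"
  proof (rule deriv_zero_of_zero_near[OF fd, where S = "{..<a} \<union> {b<..}"])
   show "y : {..<a} \<union> {b<..}" using x e(1) ab by (auto simp: y_def)
   show "bump a b z = 0" if "z : {..<a} \<union> {b<..}" for z
    by (rule bump_eq_0) (use that ab in auto)
  qed auto
  ultimately show False using e(2) by blast
 qed
 have s0: "bump 0 1 x = 0" "alf' x = 0" if "3 <= (abs x)" for x
  by (rule bump_eq_0 dz[OF alf'], use that in arith, simp?)+
 have s1: "bump 1 2 x = 0" "bet' x = 0" if "3 <= (abs x)" for x
  by (rule bump_eq_0 dz[OF bet'], use that in arith, simp?)+
 obtain A where A: "!!x. (abs (bump 0 1 x)) <= A"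
  using smooth_bounded_of_support[OF smooth_on_bump s0(1)] by blast
 obtain A1 where A1: "!!x. (abs (alf' x)) <= A1"
  using smooth_bounded_of_support[OF alf'(2) s0(2)] by blast
 obtain A2 where A2: "!!x. (abs (bump 1 2 x)) <= A2"
  using smooth_bounded_of_support[OF smooth_on_bump s1(1)] by blast
 obtain A3 where A3: "!!x. (abs (bet' x)) <= A3"
  using smooth_bounded_of_support[OF bet'(2) s1(2)] by blast
 obtain C where C: "!!x. (abs (gam x)) <= C" using smooth_bounded_of_support[OF gam supp] by blast
 obtain C' where C': "!!x. (abs (gam' x)) <= C'" using smooth_bounded_of_support[OF gam' supp1] by blast
 have B0: "0 <= B" "0 <= C" "0 <= C'" "0 <= A2" using B(1)[of 0] C[of 0] C'[of 0] A2[of 0] by linarith+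
 have A4: "(abs (bump 1 2 x / x)) <= A2" for x
 proof (cases "1 < x & x < 2")
  case True
  then have "(abs (bump 1 2 x)) / (abs x) <= (abs (bump 1 2 x)) / 1" by (intro divide_left_mono) auto
  then show ?thesis using A2[of x] by (simp add: abs_divide)
 next
  case False
  then show ?thesis using B0 by (simp add: bump_eq_0)
 qed
 define P where "P alf bet q z = alf (fst z) * (bet (sig * fst (snd z)) * q (snd (snd z) / fst (snd z)))"
  for alf bet q :: "real => real" and z :: spacetime
 let ?b0 = "bump 0 1" and ?b1 = "bump 1 2" and ?b2 = "%x. bump 1 2 x / x"
 let ?q1 = "%xi. gam xi * g xi" and ?q2 = "%xi. gam xi * h xi" and ?q3 = "%xi. xi * gam' xi * h xi" and ?q4 = "%xi. gam' xi * k xi"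
 have q3b: "(abs (xi * gam' xi * h xi)) <= (((abs R) + 1) * C') * B" for xi
 proof (cases "R + 1 <= (abs xi)")
  case True then show ?thesis using supp1[of xi] B0 by (simp add: mult_nonneg_nonneg)
 next
  case False
  then show ?thesis unfolding abs_mult by (intro mult_mono B C' mult_nonneg_nonneg) (use B0 in auto)
 qed
 have qb: "(abs (?q1 xi)) <= C * B" "(abs (?q2 xi)) <= C * B" "(abs (?q4 xi)) <= C' * B" for xi
  unfolding abs_mult by (intro mult_mono B C C' B0 abs_ge_zero)+
 have Pf: "P alf bet q = (%z. alf (fst z) * (bet (sig * fst (snd z)) * q (snd (snd z) / fst (snd z))))" for alf bet q
  by (simp add: P_def fun_eq_iff)
 note prod = integral_chart_product[OF _ _ _ _ _ _ _ _ _ sig, where R = "R + 1"]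
 have z0: "bump 0 1 x = 0" if "\<not> (0 < x & x < 1)" for x :: real using that by (rule bump_eq_0)
 have z1: "bump 1 2 x = 0" "bump 1 2 x / x = 0" if "\<not> (1 < x & x < 2)" for x :: real
  using bump_eq_0[OF that] by auto
 have T1': "integrable lborel (P alf' ?b1 ?q1) & P alf' ?b1 ?q1 : borel_measurable borel &
  (LINT z|lborel. P alf' ?b1 ?q1 z) = (LINT t|lborel. alf' t) * ((LINT x|lborel. ?b1 x * x) * (LINT xi|lborel. ?q1 xi))"
  unfolding Pf by (intro conjI; rule prod[where A = A1 and B = A2 and Q = "C * B"];
    ((use A1 A2 dz[OF alf'] z1 qb supp2 in \<open>simp; fail\<close>) | measurable))
 note T1 = T1'[THEN conjunct1] T1'[THEN conjunct2, THEN conjunct1] T1'[THEN conjunct2, THEN conjunct2]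
 have T2': "integrable lborel (P ?b0 bet' ?q2) & P ?b0 bet' ?q2 : borel_measurable borel &
  (LINT z|lborel. P ?b0 bet' ?q2 z) = (LINT t|lborel. ?b0 t) * ((LINT x|lborel. bet' x * x) * (LINT xi|lborel. ?q2 xi))"
  unfolding Pf by (intro conjI; rule prod[where A = A and B = A3 and Q = "C * B"];
    ((use A A3 dz[OF bet'] z0 qb supp2 in \<open>simp; fail\<close>) | measurable))
 note T2 = T2'[THEN conjunct1] T2'[THEN conjunct2, THEN conjunct1] T2'[THEN conjunct2, THEN conjunct2]
 have T3': "integrable lborel (P ?b0 ?b2 ?q3) & P ?b0 ?b2 ?q3 : borel_measurable borel &
  (LINT z|lborel. P ?b0 ?b2 ?q3 z) = (LINT t|lborel. ?b0 t) * ((LINT x|lborel. ?b2 x * x) * (LINT xi|lborel. ?q3 xi))"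
  unfolding Pf by (intro conjI; rule prod[where A = A and B = A2 and Q = "(((abs R) + 1) * C') * B"];
    (rule q3b A4 | (use A A4 z0 z1 q3b supp1 in \<open>simp; fail\<close>) | measurable))
 note T3 = T3'[THEN conjunct1] T3'[THEN conjunct2, THEN conjunct1] T3'[THEN conjunct2, THEN conjunct2]
 have T4': "integrable lborel (P ?b0 ?b2 ?q4) & P ?b0 ?b2 ?q4 : borel_measurable borel &
  (LINT z|lborel. P ?b0 ?b2 ?q4 z) = (LINT t|lborel. ?b0 t) * ((LINT x|lborel. ?b2 x * x) * (LINT xi|lborel. ?q4 xi))"
  unfolding Pf by (intro conjI; rule prod[where A = A and B = A2 and Q = "C' * B"];
    (rule A4 | (use A A4 z0 z1 qb supp1 in \<open>simp; fail\<close>) | measurable))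
 note T4 = T4'[THEN conjunct1] T4'[THEN conjunct2, THEN conjunct1] T4'[THEN conjunct2, THEN conjunct2]
 define J where "J z = P alf' ?b1 ?q1 z + (sig * P ?b0 bet' ?q2 z - sig * P ?b0 ?b2 ?q3 z) + sig * P ?b0 ?b2 ?q4 z" for z
 have fd: "frechet_derivative \<phi> (at z) (1, 0, 0) = alf' (fst z) * (?b1 (sig * fst (snd z)) * gam (snd (snd z) / fst (snd z)))"
  "frechet_derivative \<phi> (at z) (0, 1, 0) = sig * (?b0 (fst z) * (bet' (sig * fst (snd z)) * gam (snd (snd z) / fst (snd z))))
   - sig * (?b0 (fst z) * (?b2 (sig * fst (snd z)) * (snd (snd z) / fst (snd z) * gam' (snd (snd z) / fst (snd z)))))"
  "frechet_derivative \<phi> (at z) (0, 0, 1) = sig * (?b0 (fst z) * (?b2 (sig * fst (snd z)) * gam' (snd (snd z) / fst (snd z))))" for z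
  using chart_test_deriv[OF d sig alf'(1) bet'(1), of "fst z" "fst (snd z)" "snd (snd z)"] by (simp_all add: \<phi>_def)
 have IJ: "AE z in lebesgue. I z = J z"
  using ae
 proof eventually_elim
  fix z :: spacetime
  assume *: "0 < sig * fst (snd z) --> G z = g (snd (snd z) / fst (snd z)) &
    H z = h (snd (snd z) / fst (snd z)) & K z = k (snd (snd z) / fst (snd z))"
  show "I z = J z"
  proof (cases "0 < sig * fst (snd z)")
   case True
   then show ?thesis using * unfolding I_def J_def P_def fd by (simp add: algebra_simps)
  next
   case False
   then have "?b1 (sig * fst (snd z)) = 0" "bet' (sig * fst (snd z)) = 0"
    using z1(1) dz[OF bet'] by auto
   then show ?thesis unfolding I_def J_def P_def fd by simp
  qed
 qed
 have Jm[measurable]: "J : borel_measurable borel" unfolding J_def using T1(2) T2(2) T3(2) T4(2) by measurable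
 have Ji: "integrable lborel J" unfolding J_def
  by (intro Bochner_Integration.integrable_add Bochner_Integration.integrable_diff integrable_mult_right T1 T2 T3 T4)
 have [measurable]: "G : borel_measurable lebesgue" "H : borel_measurable lebesgue" "K : borel_measurable lebesgue"
  by (fact GHK)+
 have cm: "f : borel_measurable lebesgue" if "f : borel_measurable borel" for f :: "spacetime => real"
  using that by (intro measurable_completion) simp
 have Im: "I : borel_measurable lebesgue"
 proof -
  have "(%z. frechet_derivative \<phi> (at z) v) : borel_measurable lebesgue" if "v : {(1,0,0),(0,1,0),(0,0,1)}" for v
   using that unfolding fd by (auto simp only: fd insert_iff empty_iff intro!: cm) measurable
  then show ?thesis unfolding I_def by (intro borel_measurable_add borel_measurable_times GHK) auto
 qed
 have Ji': "integrable lebesgue J" using Ji Jm by (simp add: integrable_completion)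
 show "integrable lebesgue I"
  by (rule integrable_cong_AE_imp[OF Ji' Im]) (use IJ in eventually_elim, simp)
 have "(LINT z|lebesgue. I z) = (LINT z|lebesgue. J z)"
  by (rule integral_cong_AE[OF Im cm[OF Jm] IJ])
 also have "... = (LINT z|lborel. J z)" using Jm by (simp add: integral_completion)
 also have "... = (LINT z|lborel. P alf' ?b1 ?q1 z) + (sig * (LINT z|lborel. P ?b0 bet' ?q2 z) -
   sig * (LINT z|lborel. P ?b0 ?b2 ?q3 z)) + sig * (LINT z|lborel. P ?b0 ?b2 ?q4 z)"
  unfolding J_def using T1(1) T2(1) T3(1) T4(1) by simp
 finally have main: "(LINT z|lebesgue. I z) = ..." .
 have i1: "(LINT x|lborel. f' x * x) = - (LINT x|lborel. f x)" if
  fd: "!!x. (f has_real_derivative f' x) (at x)" and fs: "smooth_on UNIV f'" and s: "!!x. 3 <= (abs x) ==> f x = 0"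
  for f f' :: "real => real"
 proof -
  have p: "primitive (%x. 1) x = x" for x by (cases "0 <= x") (auto simp: primitive_def)
  show ?thesis
   using integral_by_parts_primitive[OF fd smooth_on_imp_continuous_on[OF fs] s, where h = "%x. 1" and B = 1]
   by (simp add: p)
 qed
 have i0: "(LINT t|lborel. alf' t) = 0"
 proof -
  have "alf' x = indicator {0..1} x * alf' x" for x
   using dz[OF alf', of x] by (cases "0 < x & x < 1") (auto simp: indicator_def)
  then have "(LINT x|lborel. alf' x) = (LINT x|lborel. indicator {0..1} x * alf' x)" by presburger
  also have "... = integral {0..1} alf'"
   by (rule borel_bounded_integrable_on(2)[where B = A1]) (use A1 in auto)
  also have "... = bump 0 1 1 - bump 0 1 0"
   by (intro integral_unique fundamental_theorem_of_calculus)
     (auto simp: has_real_derivative_iff_has_vector_derivative[symmetric] intro: DERIV_subset[OF alf'(1)])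
  finally show ?thesis by (simp add: bump_eq_0)
 qed
 have b2: "(LINT x|lborel. ?b2 x * x) = (LINT x|lborel. ?b1 x)"
  by (intro Bochner_Integration.integral_cong) (auto simp: bump_eq_0)
 have b1: "(LINT x|lborel. bet' x * x) = - (LINT x|lborel. ?b1 x)"
  by (rule i1[OF bet']) (rule s1(1))
 have iq: "integrable lborel f" if [measurable]: "f : borel_measurable borel" and "!!x. (abs (f x)) <= D"
  "!!x. R + 1 <= (abs x) ==> f x = 0" for f :: "real => real" and D
  by (rule integrableI_bounded_set[where A = "{-(R+1)..R+1}" and B = D])
    (use that in \<open>auto simp: emeasure_lborel_Icc_eq not_le abs_le_iff intro!: AE_I2\<close>)
 have iq2: "integrable lborel ?q2" by (rule iq[OF _ qb(2)]) (simp_all add: supp2)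
 have iq3: "integrable lborel ?q3" by (rule iq[OF _ q3b]) (simp_all add: supp1)
 have iq4: "integrable lborel ?q4" by (rule iq[OF _ qb(3)]) (simp_all add: supp1)
 have "(LINT xi|lborel. gam' xi * (k xi - xi * h xi) - gam xi * h xi) = (LINT xi|lborel. ?q4 xi - ?q3 xi - ?q2 xi)"
  by (simp add: algebra_simps)
 also have "... = (LINT xi|lborel. ?q4 xi) - (LINT xi|lborel. ?q3 xi) - (LINT xi|lborel. ?q2 xi)"
  using iq2 iq3 iq4 by simp
 finally have e: "(LINT xi|lborel. gam' xi * (k xi - xi * h xi) - gam xi * h xi) = ..." .
 show "(LINT z|lebesgue. I z) = sig * ((LINT x|lborel. bump 0 1 x) * (LINT x|lborel. bump 1 2 x)) *
    (LINT xi|lborel. gam' xi * (k xi - xi * h xi) - gam xi * h xi)"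
  unfolding main T1(3) T2(3) T3(3) T4(3) i0 b1 b2 e by algebra
qed

section \<open>Algebra of the Euler fluxes\<close>

locale gas =
 fixes p :: "real => real"
 assumes p_smooth: "smooth_on {0<..} p"
  and p_deriv: "!!\<rho>. 0 < \<rho> ==> 0 < deriv p \<rho>"
  and rho_c: "!!\<rho>. 0 < \<rho> ==> 0 < deriv (%r. r * sound_speed p r) \<rho>"
begin

lemma p_has_deriv: "0 < r ==> (p has_real_derivative deriv p r) (at r)"
 using smooth_on_real_derivE[OF p_smooth] by (metis DERIV_deriv_iff_real_differentiable
   greaterThan_iff real_differentiable_def)

lemma smooth_deriv_p: "smooth_on {0<..} (deriv p)"
proof -
 obtain f' where f': "!!x. x : {0<..} ==> (p has_real_derivative f' x) (at x)" "smooth_on {0<..} f'"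
  using smooth_on_real_derivE[OF p_smooth] by blast
 have "ALL x:{0<..}. f' x = deriv p x" using f'(1) DERIV_imp_deriv by metis
 then show ?thesis using smooth_on_cong[OF _ _ f'(2)] by auto
qed

definition mass_speed :: "real => real" where "mass_speed r = r * sound_speed p r"

lemma mass_speed_pos: "0 < r ==> 0 < mass_speed r"
 using p_deriv by (simp add: mass_speed_def sound_speed_def)

lemma mass_speed_sq: "0 < r ==> (mass_speed r)\<^sup>2 = r\<^sup>2 * deriv p r"
 using p_deriv[of r] by (simp add: mass_speed_def sound_speed_def power_mult_distrib)

lemma mass_speed_deriv:
 obtains k' where "!!r. 0 < r ==> (mass_speed has_real_derivative k' r) (at r)"
  "!!r. 0 < r ==> 0 < k' r" "continuous_on {0<..} k'"
proof -
 obtain q where q: "!!x. x : {0<..} ==> (deriv p has_real_derivative q x) (at x)" "smooth_on {0<..} q"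
  using smooth_on_real_derivE[OF smooth_deriv_p] by blast
 define k' where "k' r = sqrt (deriv p r) + r * (q r / (2 * sqrt (deriv p r)))" for r
 have d: "(mass_speed has_real_derivative k' r) (at r)" if "0 < r" for r
 proof -
  have 1: "((%r. sqrt (deriv p r)) has_real_derivative q r / (2 * sqrt (deriv p r))) (at r)"
   using DERIV_chain'[OF q(1) DERIV_real_sqrt, of r] p_deriv[of r] that
   by (simp add: field_simps)
  show ?thesis unfolding mass_speed_def[abs_def] sound_speed_def k'_def
   by (rule derivative_eq_intros 1 refl | simp)+
 qed
 have "mass_speed = (%r. r * sound_speed p r)" by (simp add: mass_speed_def fun_eq_iff)
 then have "0 < k' r" if "0 < r" for r
  using rho_c[OF that] DERIV_imp_deriv[OF d[OF that]] by simp
 moreover have "continuous_on {0<..} k'" unfolding k'_def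
  using smooth_on_imp_continuous_on[OF smooth_deriv_p] smooth_on_imp_continuous_on[OF q(2)] p_deriv
  by (intro continuous_intros) (auto simp: less_imp_neq[symmetric] dest: p_deriv)
 ultimately show ?thesis using that d by blast
qed

lemma mass_speed_strict_mono: "0 < r ==> r < s ==> mass_speed r < mass_speed s"
proof -
 obtain k' where k': "!!r. 0 < r ==> (mass_speed has_real_derivative k' r) (at r)"
  "!!r. 0 < r ==> 0 < k' r" using mass_speed_deriv by metis
 show "mass_speed r < mass_speed s" if "0 < r" "r < s"
 proof (rule DERIV_pos_imp_increasing[OF that(2)])
  show "EX y. DERIV mass_speed x :> y & 0 < y" if "r <= x" for x
   using k'[of x] that \<open>0 < r\<close> by auto
 qed
qed

definition enthalpy :: "real => real" where
 "enthalpy = (SOME h. ALL r>0. (h has_real_derivative deriv p r / r) (at r))"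

lemma enthalpy_deriv: "0 < r ==> (enthalpy has_real_derivative deriv p r / r) (at r)"
proof -
 have "EX F. ALL x::real. 0 < ereal x --> ereal x < \<infinity> --> (F has_vector_derivative deriv p x / x) (at x)"
 proof (rule einterval_antiderivative)
  fix x :: real assume "0 < ereal x" "ereal x < \<infinity>"
  then have x: "x : {0<..}" by simp
  have "continuous_on {0<..} (%x. deriv p x / x)"
   by (intro continuous_intros smooth_on_imp_continuous_on[OF smooth_deriv_p]) auto
  then show "isCont (%x. deriv p x / x) x" using x by (simp add: continuous_on_eq_continuous_at)
 qed simp
 then have "EX h. ALL r>0. (h has_real_derivative deriv p r / r) (at r)"
  by (auto simp: has_real_derivative_iff_has_vector_derivative)
 from someI_ex[OF this] show "0 < r ==> (enthalpy has_real_derivative deriv p r / r) (at r)"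
  unfolding enthalpy_def by blast
qed

lemma smooth_enthalpy: "smooth_on {0<..} enthalpy"
proof (rule smooth_on_real_derivI)
 show "smooth_on {0<..} (%r. deriv p r * inverse r)"
  by (intro smooth_on_mult smooth_deriv_p smooth_on_inverse) auto
 show "x : {0<..} ==> (enthalpy has_real_derivative deriv p x * inverse x) (at x)" for x
  using enthalpy_deriv[of x] by (simp add: divide_inverse)
qed auto

text \<open>The flux through the ray of slope \<open>xi\<close>. Its components amount to the mass flux \<open>N\<close>, to
 \<open>N\<close> times the velocity along the ray, and to the momentum flux normal to the ray.\<close>

definition ray_flux :: "real => state => state" where
 "ray_flux xi U = flux_y p U - xi *\<^sub>R flux_x p U"

definition mass_flux :: "real => state => real" where
 "mass_flux xi U = U $ 3 - xi * U $ 2"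

text \<open>Positive for a subsonic, negative for a supersonic velocity normal to the ray.\<close>

definition sonic :: "real => state => real" where
 "sonic xi U = (1 + xi\<^sup>2) * (mass_speed (U $ 1))\<^sup>2 - (mass_flux xi U)\<^sup>2"

definition bernoulli :: "state => real" where
 "bernoulli U = ((U $ 2)\<^sup>2 + (U $ 3)\<^sup>2) / (2 * (U $ 1)\<^sup>2) + enthalpy (U $ 1)"

lemma ray_flux_nth:
 "ray_flux xi U $ 1 = mass_flux xi U"
 "ray_flux xi U $ 2 = U $ 2 * mass_flux xi U / U $ 1 - xi * p (U $ 1)"
 "ray_flux xi U $ 3 = U $ 3 * mass_flux xi U / U $ 1 + p (U $ 1)"
 by (simp_all add: ray_flux_def flux_x_def flux_y_def mass_flux_def power2_eq_square
   diff_divide_distrib algebra_simps)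

lemma ray_flux_tangential:
 "ray_flux xi U $ 2 + xi * ray_flux xi U $ 3 = mass_flux xi U * ((U $ 2 + xi * U $ 3) / U $ 1)"
 by (simp add: ray_flux_nth add_divide_distrib algebra_simps)

lemma ray_flux_normal:
 "ray_flux xi U $ 3 - xi * ray_flux xi U $ 2 = (mass_flux xi U)\<^sup>2 / U $ 1 + (1 + xi\<^sup>2) * p (U $ 1)"
proof -
 have "U $ 3 * mass_flux xi U / U $ 1 - xi * (U $ 2 * mass_flux xi U / U $ 1) = (mass_flux xi U)\<^sup>2 / U $ 1"
  by (simp add: mass_flux_def diff_divide_distrib[symmetric] power2_eq_square algebra_simps)
 then show ?thesis by (simp add: ray_flux_nth power2_eq_square algebra_simps)
qed

lemma state_eqI:
 assumes "U $ 1 = V $ 1" "mass_flux xi U = mass_flux xi V" "U $ 2 + xi * U $ 3 = V $ 2 + xi * V $ 3"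
 shows "U = (V :: state)"
proof -
 have "(U $ 2 + xi * U $ 3) - xi * mass_flux xi U = (V $ 2 + xi * V $ 3) - xi * mass_flux xi V"
  using assms by simp
 then have "(1 + xi\<^sup>2) * U $ 2 = (1 + xi\<^sup>2) * V $ 2"
  by (simp add: mass_flux_def power2_eq_square algebra_simps)
 moreover have "1 + xi\<^sup>2 ~= 0" by (smt (verit) zero_le_power2)
 ultimately have 2: "U $ 2 = V $ 2" by simp
 then have "U $ 3 = V $ 3" using assms(2) by (simp add: mass_flux_def)
 with 2 assms(1) show ?thesis by (simp add: vec_eq_iff forall_3)
qed

lemma thrust_deriv:
 "0 < r ==> ((%r. N\<^sup>2 / r + S * p r) has_real_derivative (S * (mass_speed r)\<^sup>2 - N\<^sup>2) / r\<^sup>2) (at r)"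
proof -
 assume r: "0 < r"
 have "((%r. N\<^sup>2 / r + S * p r) has_real_derivative (- N\<^sup>2 / r\<^sup>2 + S * deriv p r)) (at r)"
 proof -
  have "((%r. N\<^sup>2 * inverse r + S * p r) has_real_derivative
    (N\<^sup>2 * (- (inverse r ^ Suc (Suc 0))) + S * deriv p r)) (at r)"
   by (intro DERIV_add DERIV_cmult DERIV_inverse p_has_deriv r) (use r in simp)
  then show ?thesis by (simp add: divide_inverse power2_eq_square)
 qed
 moreover have "- N\<^sup>2 / r\<^sup>2 + S * deriv p r = (S * (mass_speed r)\<^sup>2 - N\<^sup>2) / r\<^sup>2"
  using r unfolding mass_speed_sq[OF r] by (simp add: field_simps)
 ultimately show ?thesis by simp
qed

lemma ray_flux_eqD:
 assumes "ray_flux xi U = ray_flux xi V" "mass_flux xi U ~= 0"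
 shows "mass_flux xi V = mass_flux xi U" "(U $ 2 + xi * U $ 3) / U $ 1 = (V $ 2 + xi * V $ 3) / V $ 1"
  "(mass_flux xi U)\<^sup>2 / U $ 1 + (1 + xi\<^sup>2) * p (U $ 1) = (mass_flux xi U)\<^sup>2 / V $ 1 + (1 + xi\<^sup>2) * p (V $ 1)"
proof -
 show N: "mass_flux xi V = mass_flux xi U" using assms(1) ray_flux_nth(1) by metis
 show "(U $ 2 + xi * U $ 3) / U $ 1 = (V $ 2 + xi * V $ 3) / V $ 1"
 proof -
  have "mass_flux xi U * ((U $ 2 + xi * U $ 3) / U $ 1) = mass_flux xi U * ((V $ 2 + xi * V $ 3) / V $ 1)"
   by (metis ray_flux_tangential assms(1) N)
  then show ?thesis using assms(2) by (metis mult_left_cancel)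
 qed
 show "(mass_flux xi U)\<^sup>2 / U $ 1 + (1 + xi\<^sup>2) * p (U $ 1) = (mass_flux xi U)\<^sup>2 / V $ 1 + (1 + xi\<^sup>2) * p (V $ 1)"
  using ray_flux_normal[of xi U] ray_flux_normal[of xi V] assms N by auto
qed

text \<open>With mass flux and tangential velocity given, the normal momentum flux is a function of the
 density alone, decreasing up to the sonic density and increasing after it, because
 \<open>\<rho> c\<close> increases.\<close>

lemma ray_flux_two_roots:
 assumes U: "U : states" and V: "V : states" and eq: "ray_flux xi U = ray_flux xi V"
  and N: "mass_flux xi U ~= 0" and less: "U $ 1 < V $ 1"
 shows "sonic xi U < 0" "0 < sonic xi V" "bernoulli V < bernoulli U"
proof -
 define n where "n = mass_flux xi U"
 define S where "S = 1 + xi\<^sup>2"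
 define T where "T = (U $ 2 + xi * U $ 3) / U $ 1"
 have S: "0 < S" unfolding S_def by (smt (verit) zero_le_power2)
 have pos: "0 < U $ 1" "0 < V $ 1" using U V by (auto simp: states_def)
 have e: "mass_flux xi V = n" "T = (V $ 2 + xi * V $ 3) / V $ 1"
  "n\<^sup>2 / U $ 1 + S * p (U $ 1) = n\<^sup>2 / V $ 1 + S * p (V $ 1)"
  using ray_flux_eqD[OF eq N] by (simp_all add: n_def T_def S_def)
 let ?G = "%r. n\<^sup>2 / r + S * p r"
 have Gd: "(?G has_real_derivative (S * (mass_speed r)\<^sup>2 - n\<^sup>2) / r\<^sup>2) (at r)" if "0 < r" for r
  using thrust_deriv[OF that] .
 have "EX z>U $ 1. z < V $ 1 & (%v. v * ((S * (mass_speed z)\<^sup>2 - n\<^sup>2) / z\<^sup>2)) = (%v. 0)"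
 proof (rule Rolle_deriv[OF less])
  show "?G (U $ 1) = ?G (V $ 1)" by (fact e(3))
  show "continuous_on {U $ 1..V $ 1} ?G"
   by (intro continuous_at_imp_continuous_on ballI DERIV_isCont[OF Gd]) (use pos in auto)
  show "(?G has_derivative (%v. v * ((S * (mass_speed z)\<^sup>2 - n\<^sup>2) / z\<^sup>2))) (at z)"
   if "U $ 1 < z" "z < V $ 1" for z
   using Gd[of z] that pos by (intro DERIV_imp_has_derivative) (auto simp: mult.commute)
 qed
 then obtain z where z: "U $ 1 < z" "z < V $ 1" "S * (mass_speed z)\<^sup>2 = n\<^sup>2"
  using pos by (force dest: fun_cong[of _ _ 1])
 have sq: "S * (mass_speed r)\<^sup>2 < S * (mass_speed s)\<^sup>2" if "0 < r" "r < s" for r s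
  using mass_speed_strict_mono[OF that] mass_speed_pos[of r] that S
  by (intro mult_strict_left_mono power_strict_mono) auto
 show "sonic xi U < 0" using sq[of "U $ 1" z] z pos by (simp add: sonic_def S_def n_def)
 show "0 < sonic xi V" using sq[of z "V $ 1"] z pos e(1) by (simp add: sonic_def S_def)
 define F where "F r = (T\<^sup>2 + n\<^sup>2 / r\<^sup>2) / 2 + S * enthalpy r - ?G r / z" for r
 text \<open>The derivative of the Bernoulli function is that of the momentum flux divided by the density;
  subtracting the latter, divided by the sonic density, leaves a decreasing function.\<close>
 have Fd: "(F has_real_derivative ((S * (mass_speed r)\<^sup>2 - n\<^sup>2) / r\<^sup>2) * (1 / r - 1 / z)) (at r)" if "0 < r" for r
 proof -
  have "(F has_real_derivative - n\<^sup>2 / r ^ 3 + S * (deriv p r / r) - ((S * (mass_speed r)\<^sup>2 - n\<^sup>2) / r\<^sup>2) / z) (at r)"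
  proof -
   have "((%r. (T\<^sup>2 + n\<^sup>2 * inverse r ^ 2) / 2 + S * enthalpy r - ?G r / z) has_real_derivative
     (0 + n\<^sup>2 * (real 2 * (- (inverse r ^ Suc (Suc 0)) * inverse r ^ (2 - Suc 0)))) / 2 + S * (deriv p r / r)
      - ((S * (mass_speed r)\<^sup>2 - n\<^sup>2) / r\<^sup>2) / z) (at r)"
    by (intro DERIV_diff DERIV_add DERIV_cdivide DERIV_cmult DERIV_power DERIV_inverse enthalpy_deriv that
      Gd DERIV_const) (use that in simp)
   moreover have "(0 + n\<^sup>2 * (real 2 * (- (inverse r ^ Suc (Suc 0)) * inverse r ^ (2 - Suc 0)))) / 2 = - n\<^sup>2 / r ^ 3"
    using that by (simp add: field_simps power2_eq_square power3_eq_cube)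
   moreover have "F = (%r. (T\<^sup>2 + n\<^sup>2 * inverse r ^ 2) / 2 + S * enthalpy r - ?G r / z)"
    by (simp only: F_def[abs_def] divide_inverse power_inverse)
   ultimately show ?thesis by simp
  qed
  moreover have "- n\<^sup>2 / r ^ 3 + S * (deriv p r / r) = ((S * (mass_speed r)\<^sup>2 - n\<^sup>2) / r\<^sup>2) / r"
   using that unfolding mass_speed_sq[OF that] by (simp add: field_simps power2_eq_square power3_eq_cube)
  ultimately show ?thesis by (simp only: right_diff_distrib times_divide_eq_right mult_1_right)
 qed
 have neg: "((S * (mass_speed r)\<^sup>2 - n\<^sup>2) / r\<^sup>2) * (1 / r - 1 / z) < 0" if r: "0 < r" "r ~= z" for r
 proof (cases "r < z")
  case True
  then have "S * (mass_speed r)\<^sup>2 - n\<^sup>2 < 0" "1 / r - 1 / z > 0" using sq[of r z] z r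
   by (auto simp: frac_less2)
  then show ?thesis using r by (intro mult_neg_pos divide_neg_pos) auto
 next
  case False
  then have "S * (mass_speed r)\<^sup>2 - n\<^sup>2 > 0" "1 / r - 1 / z < 0" using sq[of z r] z r pos
   by (auto simp: frac_less2)
  then show ?thesis using r by (intro mult_pos_neg divide_pos_pos) auto
 qed
 have "F z < F (U $ 1)"
 proof (rule DERIV_neg_imp_decreasing_open[OF z(1)])
  show "EX y. DERIV F x :> y & y < 0" if "U $ 1 < x" "x < z" for x
   using Fd[of x] neg[of x] that pos by auto
  show "continuous_on {U $ 1..z} F"
   by (intro continuous_at_imp_continuous_on ballI DERIV_isCont[OF Fd]) (use pos in auto)
 qed
 moreover have "F (V $ 1) < F z"
 proof (rule DERIV_neg_imp_decreasing_open[OF z(2)])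
  show "EX y. DERIV F x :> y & y < 0" if "z < x" "x < V $ 1" for x
   using Fd[of x] neg[of x] that pos z by auto
  show "continuous_on {z..V $ 1} F"
   by (intro continuous_at_imp_continuous_on ballI DERIV_isCont[OF Fd]) (use pos z in auto)
 qed
 ultimately have "F (V $ 1) < F (U $ 1)" by linarith
 then have lt: "(T\<^sup>2 + n\<^sup>2 / (V $ 1)\<^sup>2) / 2 + S * enthalpy (V $ 1) < (T\<^sup>2 + n\<^sup>2 / (U $ 1)\<^sup>2) / 2 + S * enthalpy (U $ 1)"
  using e(3) by (simp add: F_def)
 have b: "S * bernoulli W = (T\<^sup>2 + n\<^sup>2 / (W $ 1)\<^sup>2) / 2 + S * enthalpy (W $ 1)"
  if "0 < W $ 1" "mass_flux xi W = n" "T = (W $ 2 + xi * W $ 3) / W $ 1" for W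
 proof -
  have "T\<^sup>2 + n\<^sup>2 / (W $ 1)\<^sup>2 = ((W $ 2 + xi * W $ 3)\<^sup>2 + (W $ 3 - xi * W $ 2)\<^sup>2) / (W $ 1)\<^sup>2"
  proof -
   have "T\<^sup>2 = (W $ 2 + xi * W $ 3)\<^sup>2 / (W $ 1)\<^sup>2" by (simp only: that(3) power_divide)
   moreover have "n\<^sup>2 = (W $ 3 - xi * W $ 2)\<^sup>2" using that(2) by (simp add: mass_flux_def)
   ultimately show ?thesis by (simp add: add_divide_distrib)
  qed
  also have "(W $ 2 + xi * W $ 3)\<^sup>2 + (W $ 3 - xi * W $ 2)\<^sup>2 = S * ((W $ 2)\<^sup>2 + (W $ 3)\<^sup>2)"
   by (simp add: S_def power2_eq_square algebra_simps)
  finally show ?thesis unfolding bernoulli_def by (simp add: distrib_left field_simps)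
 qed
 have "S * bernoulli V < S * bernoulli U"
  using b[of U] b[of V] pos e lt by (simp add: n_def T_def)
 then show "bernoulli V < bernoulli U" using S by simp
qed

lemma ray_flux_roots:
 assumes "U : states" "V : states" "ray_flux xi U = ray_flux xi V" "mass_flux xi U ~= 0"
 obtains "U = V" | "U $ 1 < V $ 1" "sonic xi U < 0" "0 < sonic xi V" "bernoulli V < bernoulli U"
  | "V $ 1 < U $ 1" "sonic xi V < 0" "0 < sonic xi U" "bernoulli U < bernoulli V"
proof -
 note e = ray_flux_eqD[OF assms(3,4)]
 consider "U $ 1 = V $ 1" | "U $ 1 < V $ 1" | "V $ 1 < U $ 1" by linarith
 then show thesis
 proof cases
  case 1
  then have "U = V" using e assms(1) by (intro state_eqI[of U V xi]) (auto simp: states_def)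
  then show ?thesis by (rule that(1))
 next
  case 2
  then show ?thesis using ray_flux_two_roots[OF assms(1-4)] that(2) by blast
 next
  case 3
  then show ?thesis using ray_flux_two_roots[OF assms(2,1) assms(3)[symmetric]] assms(4) e(1) that(3) by auto
 qed
qed

end

lemma vector_3_sum: "vector [a, b, c] = a *\<^sub>R axis 1 1 + b *\<^sub>R axis 2 1 + c *\<^sub>R (axis 3 1 :: real^3)"
 unfolding vec_eq_iff forall_3
 by (simp only: vector_3 vector_add_component vector_scaleR_component axis_def vec_lambda_beta) simp

lemma has_derivative_vector_3:
 assumes "(f has_derivative f') F" "(g has_derivative g') F" "(h has_derivative h') F"
 shows "((%x. vector [f x, g x, h x] :: real^3) has_derivative (%v. vector [f' v, g' v, h' v])) F"
 unfolding vector_3_sum by (intro derivative_intros assms)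

lemma continuous_vector_3 [continuous_intros]:
 assumes "continuous F f" "continuous F g" "continuous F h"
 shows "continuous F (%x. vector [f x, g x, h x] :: real^3)"
 unfolding vector_3_sum by (intro continuous_intros assms)

lemma continuous_on_vector_3 [continuous_intros]:
 assumes "continuous_on S f" "continuous_on S g" "continuous_on S h"
 shows "continuous_on S (%x. vector [f x, g x, h x] :: real^3)"
 unfolding vector_3_sum by (intro continuous_intros assms)

context gas begin

definition dflux_x :: "state => state => state" where
 "dflux_x U v = vector [v $ 2, 2 * U $ 2 * v $ 2 / U $ 1 - (U $ 2)\<^sup>2 * v $ 1 / (U $ 1)\<^sup>2 + deriv p (U $ 1) * v $ 1,
   (v $ 2 * U $ 3 + U $ 2 * v $ 3) / U $ 1 - U $ 2 * U $ 3 * v $ 1 / (U $ 1)\<^sup>2]"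

definition dflux_y :: "state => state => state" where
 "dflux_y U v = vector [v $ 3, (v $ 2 * U $ 3 + U $ 2 * v $ 3) / U $ 1 - U $ 2 * U $ 3 * v $ 1 / (U $ 1)\<^sup>2,
   2 * U $ 3 * v $ 3 / U $ 1 - (U $ 3)\<^sup>2 * v $ 1 / (U $ 1)\<^sup>2 + deriv p (U $ 1) * v $ 1]"

lemma nth_has_derivative: "((%U::state. U $ i) has_derivative (%v. v $ i)) F"
 by (rule bounded_linear_imp_has_derivative[OF bounded_linear_vec_nth])

lemma fun_density_has_derivative:
 assumes "(f has_real_derivative f') (at (U $ 1))"
 shows "((%U::state. f (U $ 1)) has_derivative (%v. f' * v $ 1)) (at U)"
 using DERIV_compose_FDERIV[OF assms nth_has_derivative] by (simp add: mult.commute)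

lemma open_states: "open states"
 unfolding states_def by (intro open_Collect_less continuous_intros)

lemma nth_quotient_has_derivative:
 assumes "U $ 1 ~= 0"
 shows "((%U::state. U $ i * U $ j / U $ 1) has_derivative
  (%v. (v $ i * U $ j + U $ i * v $ j) / U $ 1 - U $ i * U $ j * v $ 1 / (U $ 1)\<^sup>2)) (at U)"
 by (rule has_derivative_eq_rhs[OF has_derivative_divide[OF has_derivative_mult[OF nth_has_derivative
    nth_has_derivative] nth_has_derivative assms]])
   (use assms in \<open>simp add: fun_eq_iff field_simps power2_eq_square\<close>)

lemma flux_has_derivative:
 assumes U: "U : states"
 shows "(flux_x p has_derivative dflux_x U) (at U)" "(flux_y p has_derivative dflux_y U) (at U)"
proof -
 have r: "0 < U $ 1" using U by (simp add: states_def)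
 have P: "((%U::state. p (U $ 1)) has_derivative (%v. deriv p (U $ 1) * v $ 1)) (at U)"
  by (rule fun_density_has_derivative[OF p_has_deriv[OF r]])
 show "(flux_x p has_derivative dflux_x U) (at U)"
  by (rule has_derivative_eq_rhs, unfold flux_x_def[abs_def] power2_eq_square[of "_ $ _"],
    rule has_derivative_vector_3[OF nth_has_derivative has_derivative_add[OF nth_quotient_has_derivative P]
     nth_quotient_has_derivative])
    (use r in \<open>auto simp: dflux_x_def fun_eq_iff vec_eq_iff forall_3 power2_eq_square field_simps\<close>)
 show "(flux_y p has_derivative dflux_y U) (at U)"
  by (rule has_derivative_eq_rhs, unfold flux_y_def[abs_def] power2_eq_square[of "_ $ _"],
    rule has_derivative_vector_3[OF nth_has_derivative nth_quotient_has_derivative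
     has_derivative_add[OF nth_quotient_has_derivative P]])
    (use r in \<open>auto simp: dflux_y_def fun_eq_iff vec_eq_iff forall_3 power2_eq_square field_simps\<close>)
qed

definition dray_flux :: "real => state => state => state" where
 "dray_flux xi U v = dflux_y U v - xi *\<^sub>R dflux_x U v"

lemma ray_flux_has_derivative: "U : states ==> (ray_flux xi has_derivative dray_flux xi U) (at U)"
 unfolding ray_flux_def[abs_def] dray_flux_def[abs_def]
 by (intro derivative_intros flux_has_derivative)

lemma dray_flux_injective:
 assumes U: "U : states" and N: "mass_flux xi U ~= 0" and D: "sonic xi U ~= 0" and z: "dray_flux xi U v = 0"
 shows "v = 0"
proof -
 define r m n where "r = U $ 1" and "m = U $ 2" and "n = U $ 3"
 have r: "0 < r" using U by (simp add: states_def r_def)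
 define a b c where "a = v $ 1" and "b = v $ 2" and "c = v $ 3"
 define w where "w = mass_flux xi U"
 have w: "w = n - xi * m" by (simp add: w_def mass_flux_def n_def m_def)
 have "dray_flux xi U v $ 1 = 0" "dray_flux xi U v $ 2 = 0" "dray_flux xi U v $ 3 = 0" using z by auto
 then have e1: "c - xi * b = 0"
  and e2: "((b * n + m * c) / r - m * n * a / r\<^sup>2) - xi * (2 * m * b / r - m\<^sup>2 * a / r\<^sup>2 + deriv p r * a) = 0"
  and e3: "(2 * n * c / r - n\<^sup>2 * a / r\<^sup>2 + deriv p r * a) - xi * ((b * n + m * c) / r - m * n * a / r\<^sup>2) = 0"
  by (simp_all add: dray_flux_def dflux_x_def dflux_y_def r_def m_def n_def a_def b_def c_def)
 have c: "c = xi * b" using e1 by simp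
 have e2': "w * (b * r - m * a) = xi * (deriv p r * a) * r\<^sup>2"
 proof -
  have "((b * n + m * c) / r - m * n * a / r\<^sup>2) - xi * (2 * m * b / r - m\<^sup>2 * a / r\<^sup>2 + deriv p r * a)
   = ((b * n + m * c) * r - m * n * a - xi * (2 * m * b * r - m\<^sup>2 * a + deriv p r * a * r\<^sup>2)) / r\<^sup>2"
   using r by (simp add: field_simps power2_eq_square)
  then have "(b * n + m * c) * r - m * n * a - xi * (2 * m * b * r - m\<^sup>2 * a + deriv p r * a * r\<^sup>2) = 0"
   using e2 r by simp
  then show ?thesis unfolding c w by (simp add: power2_eq_square algebra_simps)
 qed
 have e3': "w * (c * r - n * a) = - (deriv p r * a) * r\<^sup>2"
 proof -
  have "(2 * n * c / r - n\<^sup>2 * a / r\<^sup>2 + deriv p r * a) - xi * ((b * n + m * c) / r - m * n * a / r\<^sup>2)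
   = (2 * n * c * r - n\<^sup>2 * a + deriv p r * a * r\<^sup>2 - xi * ((b * n + m * c) * r - m * n * a)) / r\<^sup>2"
   using r by (simp add: field_simps power2_eq_square)
  then have "2 * n * c * r - n\<^sup>2 * a + deriv p r * a * r\<^sup>2 - xi * ((b * n + m * c) * r - m * n * a) = 0"
   using e3 r by simp
  then show ?thesis unfolding c w by (simp add: power2_eq_square algebra_simps)
 qed
 have "w * ((b + xi * c) * r - (m + xi * n) * a) = 0"
 proof -
  have "xi * (w * (c * r - n * a)) = xi * (- (deriv p r * a) * r\<^sup>2)" using e3' by simp
  with e2' show ?thesis by (simp add: algebra_simps)
 qed
 then have t: "(b + xi * c) * r = (m + xi * n) * a" using N by (simp add: w_def)
 have "w * (- w * a) = - ((1 + xi\<^sup>2) * (deriv p r * a) * r\<^sup>2)"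
 proof -
  have "xi * (w * (b * r - m * a)) = xi * (xi * (deriv p r * a) * r\<^sup>2)" using e2' by simp
  with e3' have "w * (c * r - n * a) - xi * (w * (b * r - m * a)) = - ((1 + xi\<^sup>2) * (deriv p r * a) * r\<^sup>2)"
   by (simp add: power2_eq_square algebra_simps)
  moreover have "w * (c * r - n * a) - xi * (w * (b * r - m * a)) = w * (- w * a)"
   unfolding c w by (simp add: algebra_simps)
  ultimately show ?thesis by simp
 qed
 then have "a * ((1 + xi\<^sup>2) * (r\<^sup>2 * deriv p r) - w\<^sup>2) = 0" by (simp add: power2_eq_square algebra_simps)
 then have "a * sonic xi U = 0" using mass_speed_sq[OF r] by (simp add: sonic_def w_def r_def)
 then have a: "a = 0" using D by simp
 then have "(b * (1 + xi\<^sup>2)) * r = 0" using t c by (simp add: power2_eq_square algebra_simps)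
 then have "b * (1 + xi\<^sup>2) = 0" using r by simp
 moreover have "1 + xi\<^sup>2 ~= 0" by (smt (verit) zero_le_power2)
 ultimately have "b = 0" by simp
 with a c show ?thesis by (simp add: vec_eq_iff forall_3 a_def b_def c_def)
qed

end

text \<open>Strict differentiability with an injective derivative, uniformly in a parameter.\<close>

lemma strict_bounded_below:
 fixes A :: "real => 'a::euclidean_space => 'b::euclidean_space"
 assumes S: "open S" "c : S"
  and der: "!!t x. x : S ==> (A t has_derivative A' t x) (at x)"
  and cont: "!!v. isCont (%z. A' (fst z) (snd z) v) (t0, c)"
  and inj: "!!v. A' t0 c v = 0 ==> v = 0"
 obtains d e where "0 < d" "0 < e" "ball c e \<subseteq> S"
  "!!t x y. (abs (t - t0)) < e ==> x : ball c e ==> y : ball c e ==> d * norm (x - y) <= norm (A t x - A t y)"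
proof -
 have lin: "linear (A' t x)" if "x : S" for t x
  using der[OF that] has_derivative_linear by blast
 obtain B where B: "0 < B" "!!v. B * norm v <= norm (A' t0 c v)"
  using linear_inj_bounded_below_pos[OF lin[OF S(2)]] inj linear_injective_0[OF lin[OF S(2)]] by metis
 define \<eta> where "\<eta> = B / (2 * real DIM('a))"
 have \<eta>: "0 < \<eta>" using B(1) by (simp add: \<eta>_def)
 have "ALL b:Basis. EX e>0. ALL z. dist z (t0, c) < e --> dist (A' (fst z) (snd z) b) (A' t0 c b) < \<eta>"
  using cont \<eta> by (auto simp: continuous_at_eps_delta)
 then obtain eps where eps: "!!b. b : Basis ==> 0 < eps b"
  "!!b z. b : Basis ==> dist z (t0, c) < eps b ==> dist (A' (fst z) (snd z) b) (A' t0 c b) < \<eta>"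
  by metis
 obtain e0 where e0: "0 < e0" "ball c e0 \<subseteq> S" using S open_contains_ball by blast
 define e where "e = min e0 (Min (eps ` Basis)) / 2"
 have epos: "0 < e" using e0(1) eps(1) by (simp add: e_def)
 have eb: "2 * e <= eps b" if "b : Basis" for b
  using Min_le[of "eps ` Basis" "eps b"] that by (simp add: e_def min.coboundedI2)
 have sub: "ball c e \<subseteq> S" using e0 by (auto simp: e_def)
 show thesis
 proof (rule that[of "B / 2" e])
  fix t x y assume t: "(abs (t - t0)) < e" and x: "x : ball c e" and y: "y : ball c e"
  have near: "norm (A' t u v - A' t0 c v) <= B / 2 * norm v" if u: "u : ball c e" for u v
  proof -
   have d: "dist (t, u) (t0, c) < 2 * e"
   proof -
    have "dist (t, u) (t0, c) <= (abs (t - t0)) + dist u c"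
     unfolding dist_Pair_Pair dist_real_def by (intro order_trans[OF sqrt_sum_squares_le_sum]) auto
    then show ?thesis using t u by (auto simp: dist_commute)
   qed
   have "A' t u v - A' t0 c v = (\<Sum>b\<in>Basis. (v \<bullet> b) *\<^sub>R (A' t u b - A' t0 c b))"
   proof -
    have 1: "L v = (\<Sum>b\<in>Basis. (v \<bullet> b) *\<^sub>R L b)" if "linear L" for L :: "'a => 'b"
     using linear_sum[OF that, of "%b. (v \<bullet> b) *\<^sub>R b" Basis] linear_scale[OF that]
     by (simp add: euclidean_representation)
    show ?thesis
     using 1[OF lin[of u t]] 1[OF lin[OF S(2), of t0]] u sub
     by (auto simp: sum_subtractf[symmetric] scaleR_diff_right)
   qed
   also have "norm ... <= (\<Sum>b\<in>(Basis::'a set). norm v * \<eta>)"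
   proof (rule order_trans[OF norm_sum sum_mono])
    fix b :: 'a assume b: "b : Basis"
    have "norm (A' t u b - A' t0 c b) < \<eta>"
     using eps(2)[OF b, of "(t, u)"] d eb[OF b] by (simp add: dist_norm)
    then show "norm ((v \<bullet> b) *\<^sub>R (A' t u b - A' t0 c b)) <= norm v * \<eta>"
     using Basis_le_norm[OF b, of v] by (auto intro!: mult_mono)
   qed
   also have "... = B / 2 * norm v" by (simp add: \<eta>_def)
   finally show ?thesis .
  qed
  have "norm ((A t y - A' t0 c y) - (A t x - A' t0 c x)) <= (B / 2) * norm (y - x)"
  proof (rule differentiable_bound[OF convex_ball _ _ y x, where f = "%x. A t x - A' t0 c x"
     and f' = "%u v. A' t u v - A' t0 c v"])
   show "((%x. A t x - A' t0 c x) has_derivative (%v. A' t u v - A' t0 c v)) (at u within ball c e)"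
    if "u : ball c e" for u
    using that sub
    by (intro has_derivative_diff has_derivative_at_withinI[OF der] linear_imp_has_derivative[OF lin[OF S(2)]]) auto
   show "onorm (%v. A' t u v - A' t0 c v) <= B / 2" if "u : ball c e" for u
    by (rule onorm_le) (rule near[OF that])
  qed
  then have "norm ((A t x - A t y) - A' t0 c (x - y)) <= (B / 2) * norm (x - y)"
  proof -
   have "(A t x - A t y) - A' t0 c (x - y) = (A t x - A' t0 c x) - (A t y - A' t0 c y)"
    by (simp add: linear_diff[OF lin[OF S(2)]])
   then show "norm ((A t y - A' t0 c y) - (A t x - A' t0 c x)) <= (B / 2) * norm (y - x) ==> ?thesis"
    by (metis norm_minus_commute)
  qed
  moreover have "norm (A' t0 c (x - y)) <= norm (A t x - A t y) + norm ((A t x - A t y) - A' t0 c (x - y))"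
   using norm_triangle_sub[of "A' t0 c (x - y)" "A t x - A t y"] by (simp add: norm_minus_commute)
  ultimately show "B / 2 * norm (x - y) <= norm (A t x - A t y)" using B(2)[of "x - y"] by linarith
 qed (use B epos sub in auto)
qed

section \<open>The energy as an entropy\<close>

context gas begin

definition energy :: "state => real" where
 "energy U = ((U $ 2)\<^sup>2 + (U $ 3)\<^sup>2) / (2 * U $ 1) + (U $ 1 * enthalpy (U $ 1) - p (U $ 1))"

definition denergy :: "state => state => real" where
 "denergy U v = (U $ 2 * v $ 2 + U $ 3 * v $ 3) / U $ 1
   + (enthalpy (U $ 1) - ((U $ 2)\<^sup>2 + (U $ 3)\<^sup>2) / (2 * (U $ 1)\<^sup>2)) * v $ 1"

definition dbernoulli :: "state => state => real" where
 "dbernoulli U v = (U $ 2 * v $ 2 + U $ 3 * v $ 3) / (U $ 1)\<^sup>2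
   + (deriv p (U $ 1) / U $ 1 - ((U $ 2)\<^sup>2 + (U $ 3)\<^sup>2) / (U $ 1) ^ 3) * v $ 1"

lemma internal_energy_deriv:
 "0 < r ==> ((%r. r * enthalpy r - p r) has_real_derivative enthalpy r) (at r)"
 using DERIV_diff[OF DERIV_mult[OF DERIV_ident enthalpy_deriv] p_has_deriv, of r] by simp

lemma energy_has_derivative:
 assumes U: "U : states"
 shows "(energy has_derivative denergy U) (at U)"
proof -
 have r: "0 < U $ 1" using U by (simp add: states_def)
 have q: "((%U::state. U $ i * U $ i / U $ 1) has_derivative
  (%v. (v $ i * U $ i + U $ i * v $ i) / U $ 1 - U $ i * U $ i * v $ 1 / (U $ 1)\<^sup>2)) (at U)" for i
  by (rule nth_quotient_has_derivative) (use r in simp)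
 have e: "energy = (%U. (U $ 2 * U $ 2 / U $ 1 + U $ 3 * U $ 3 / U $ 1) * (1 / 2)
   + (U $ 1 * enthalpy (U $ 1) - p (U $ 1)))"
  by (simp add: energy_def fun_eq_iff power2_eq_square add_divide_distrib)
 show ?thesis unfolding e
  by (rule has_derivative_eq_rhs[OF has_derivative_add[OF has_derivative_mult_left[OF has_derivative_add[OF q q]]
     fun_density_has_derivative[OF internal_energy_deriv[OF r]]]])
    (use r in \<open>simp add: denergy_def fun_eq_iff field_simps power2_eq_square\<close>)
qed

lemma bernoulli_has_derivative:
 assumes U: "U : states"
 shows "(bernoulli has_derivative dbernoulli U) (at U)"
proof -
 have r: "0 < U $ 1" using U by (simp add: states_def)
 have "((%r. 1 / 2 * inverse r ^ 2) has_real_derivative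
   1 / 2 * (real 2 * (- (inverse (U $ 1) ^ Suc (Suc 0)) * inverse (U $ 1) ^ (2 - Suc 0)))) (at (U $ 1))"
  by (intro DERIV_cmult DERIV_power DERIV_inverse) (use r in simp)
 then have q: "((%r. 1 / 2 * inverse r ^ 2) has_real_derivative - 1 / (U $ 1) ^ 3) (at (U $ 1))"
  using r by (simp add: field_simps power2_eq_square power3_eq_cube)
 have e: "bernoulli = (%U. (U $ 2 * U $ 2 + U $ 3 * U $ 3) * (1 / 2 * inverse (U $ 1) ^ 2) + enthalpy (U $ 1))"
 proof
  fix U
  show "bernoulli U = (U $ 2 * U $ 2 + U $ 3 * U $ 3) * (1 / 2 * inverse (U $ 1) ^ 2) + enthalpy (U $ 1)"
   by (cases "U $ 1 = 0") (simp_all add: bernoulli_def power2_eq_square field_simps)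
 qed
 show ?thesis unfolding e
  by (rule has_derivative_eq_rhs[OF has_derivative_add[OF has_derivative_mult[OF has_derivative_add[OF
     has_derivative_mult[OF nth_has_derivative nth_has_derivative]
     has_derivative_mult[OF nth_has_derivative nth_has_derivative]] fun_density_has_derivative[OF q]]
     fun_density_has_derivative[OF enthalpy_deriv[OF r]]]])
    (use r in \<open>simp add: dbernoulli_def fun_eq_iff field_simps power2_eq_square power3_eq_cube\<close>)
qed

lemma smooth_on_nth: "smooth_on states (%U::state. U $ i)"
 by (intro smooth_on_linear open_states bounded_linear_vec_nth)

lemma smooth_on_density:
 fixes f :: "real => real"
 assumes "smooth_on {0<..} f"
 shows "smooth_on states (%U. f (U $ 1))"
 by (rule smooth_on_compose[OF open_states open_greaterThan assms smooth_on_nth]) (auto simp: states_def)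

lemma smooth_energy: "smooth_on states energy"
proof -
 have "smooth_on states (%U. (U $ 2 * U $ 2 + U $ 3 * U $ 3) * (1 / 2 * inverse (U $ 1))
   + (U $ 1 * enthalpy (U $ 1) + (- 1) * p (U $ 1)))"
  by (intro smooth_on_add smooth_on_mult smooth_on_const smooth_on_nth smooth_on_density
    smooth_on_inverse smooth_enthalpy p_smooth open_states)
 then show ?thesis
  by (rule smooth_on_cong[OF open_states, rotated]) (auto simp: energy_def states_def field_simps power2_eq_square)
qed

lemma smooth_bernoulli: "smooth_on states bernoulli"
proof -
 have "smooth_on states (%U. (U $ 2 * U $ 2 + U $ 3 * U $ 3) * (1 / 2 * (inverse (U $ 1) * inverse (U $ 1)))
   + enthalpy (U $ 1))"
  by (intro smooth_on_add smooth_on_mult smooth_on_const smooth_on_nth smooth_on_density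
    smooth_on_inverse smooth_enthalpy open_states)
 then show ?thesis
  by (rule smooth_on_cong[OF open_states, rotated]) (auto simp: bernoulli_def states_def field_simps power2_eq_square)
qed

lemma energy_flux_pair:
 "entropy_flux_pair p energy (%U. U $ 2 * bernoulli U) (%U. U $ 3 * bernoulli U)"
 unfolding entropy_flux_pair_def
proof (intro conjI ballI allI)
 show "smooth_on states energy" by (rule smooth_energy)
 show "smooth_on states (%U. U $ 2 * bernoulli U)" "smooth_on states (%U. U $ 3 * bernoulli U)"
  by (intro smooth_on_mult smooth_on_nth smooth_bernoulli open_states)+
 fix U v assume U: "U : states"
 have r: "0 < U $ 1" using U by (simp add: states_def)
 note fd = frechet_derivative_at[OF flux_has_derivative(1)[OF U], symmetric]
  frechet_derivative_at[OF flux_has_derivative(2)[OF U], symmetric]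
  frechet_derivative_at[OF energy_has_derivative[OF U], symmetric]
  frechet_derivative_at[OF has_derivative_mult[OF nth_has_derivative bernoulli_has_derivative[OF U]], symmetric]
 show "frechet_derivative (%U. U $ 2 * bernoulli U) (at U) v =
   frechet_derivative energy (at U) (frechet_derivative (flux_x p) (at U) v)"
  unfolding fd using r
  by (simp add: denergy_def dbernoulli_def bernoulli_def dflux_x_def field_simps power2_eq_square power3_eq_cube)
 show "frechet_derivative (%U. U $ 3 * bernoulli U) (at U) v =
   frechet_derivative energy (at U) (frechet_derivative (flux_y p) (at U) v)"
  unfolding fd using r
  by (simp add: denergy_def dbernoulli_def bernoulli_def dflux_y_def field_simps power2_eq_square power3_eq_cube)
qed

lemma quotient_square_convex:
 fixes a b r s t :: real
 assumes "0 < r" "0 < s" "0 < t" "t < 1"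
 shows "((1 - t) * a + t * b)\<^sup>2 / ((1 - t) * r + t * s) <= (1 - t) * (a\<^sup>2 / r) + t * (b\<^sup>2 / s)"
proof -
 define q where "q = (1 - t) * r + t * s"
 have q: "0 < q" unfolding q_def using assms by (intro add_pos_pos mult_pos_pos) auto
 have "((1 - t) * (a\<^sup>2 / r) + t * (b\<^sup>2 / s)) * (r * s * q) - ((1 - t) * a + t * b)\<^sup>2 * (r * s)
   = t * (1 - t) * (a * s - b * r)\<^sup>2"
 proof -
  have "((1 - t) * (a\<^sup>2 / r) + t * (b\<^sup>2 / s)) * (r * s * q) = ((1 - t) * a\<^sup>2 * s + t * b\<^sup>2 * r) * q"
   using assms by (simp add: field_simps)
  then show ?thesis unfolding q_def by (simp add: power2_eq_square algebra_simps)
 qed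
 moreover have "0 <= t * (1 - t) * (a * s - b * r)\<^sup>2" using assms by simp
 ultimately have "((1 - t) * a + t * b)\<^sup>2 * (r * s) <= ((1 - t) * (a\<^sup>2 / r) + t * (b\<^sup>2 / s)) * q * (r * s)"
  by (simp add: mult_ac)
 then have "((1 - t) * a + t * b)\<^sup>2 <= ((1 - t) * (a\<^sup>2 / r) + t * (b\<^sup>2 / s)) * q"
  using assms by (simp add: mult_le_cancel_right)
 then show ?thesis using q unfolding q_def[symmetric] by (simp add: divide_le_eq)
qed

lemma convex_energy: "convex_on states energy"
proof (rule convex_onI)
 show "convex states"
 proof (rule convexI)
  fix x y :: state and u v :: real
  assume *: "x : states" "y : states" "0 <= u" "0 <= v" "u + v = 1"
  then have "0 < u * x $ 1 + v * y $ 1" unfolding states_def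
   by (cases "u = 0") (auto intro: add_pos_nonneg)
  then show "u *\<^sub>R x + v *\<^sub>R y : states" by (simp add: states_def)
 qed
 have "convex_on {0<..} (%r. r * enthalpy r - p r)"
 proof (rule convex_on_realI)
  show "((%r. r * enthalpy r - p r) has_real_derivative enthalpy r) (at r)" if "r : {0<..}" for r
   using internal_energy_deriv that by simp
  show "enthalpy x <= enthalpy y" if "x : {0<..}" "y : {0<..}" "x <= y" for x y
  proof (rule DERIV_nonneg_imp_nondecreasing[OF that(3)])
   show "EX d. DERIV enthalpy z :> d & 0 <= d" if "x <= z" for z
    using enthalpy_deriv[of z] p_deriv[of z] that \<open>x : {0<..}\<close>
    by (intro exI[of _ "deriv p z / z"]) auto
  qed
 qed auto
 note H = convex_onD[OF this]
 fix t :: real and x y :: state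
 assume t: "0 < t" "t < 1" and xy: "x : states" "y : states"
 let ?z = "(1 - t) *\<^sub>R x + t *\<^sub>R y"
 have r: "0 < x $ 1" "0 < y $ 1" using xy by (auto simp: states_def)
 have "((?z $ i)\<^sup>2 / (?z $ 1)) <= (1 - t) * ((x $ i)\<^sup>2 / x $ 1) + t * ((y $ i)\<^sup>2 / y $ 1)" for i
  using quotient_square_convex[OF r t, of "x $ i" "y $ i"] by simp
 from this[of 2] this[of 3] have 1: "(?z $ 2)\<^sup>2 / (?z $ 1) + (?z $ 3)\<^sup>2 / (?z $ 1)
   <= (1 - t) * ((x $ 2)\<^sup>2 / x $ 1 + (x $ 3)\<^sup>2 / x $ 1) + t * ((y $ 2)\<^sup>2 / y $ 1 + (y $ 3)\<^sup>2 / y $ 1)"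
  unfolding distrib_left by linarith
 have 2: "?z $ 1 * enthalpy (?z $ 1) - p (?z $ 1)
   <= (1 - t) * (x $ 1 * enthalpy (x $ 1) - p (x $ 1)) + t * (y $ 1 * enthalpy (y $ 1) - p (y $ 1))"
  using H[of t "x $ 1" "y $ 1"] t r by simp
 have e: "energy U = ((U $ 2)\<^sup>2 / U $ 1 + (U $ 3)\<^sup>2 / U $ 1) / 2 + (U $ 1 * enthalpy (U $ 1) - p (U $ 1))" for U
  by (simp add: energy_def add_divide_distrib)
 have "c * energy U = (c * ((U $ 2)\<^sup>2 / U $ 1 + (U $ 3)\<^sup>2 / U $ 1)) / 2
   + c * (U $ 1 * enthalpy (U $ 1) - p (U $ 1))" for c U
  unfolding e by (simp only: distrib_left times_divide_eq_right)
 note e' = this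
 define X Y Z where "X = ((x $ 2)\<^sup>2 / x $ 1 + (x $ 3)\<^sup>2 / x $ 1)" and "Y = ((y $ 2)\<^sup>2 / y $ 1 + (y $ 3)\<^sup>2 / y $ 1)"
  and "Z = (?z $ 2)\<^sup>2 / (?z $ 1) + (?z $ 3)\<^sup>2 / (?z $ 1)"
 have "Z <= (1 - t) * X + t * Y" using 1 by (simp add: X_def Y_def Z_def)
 then show "energy ?z <= (1 - t) * energy x + t * energy y"
  using 2 unfolding e'[of "1 - t" x] e'[of t y] e[of ?z] X_def[symmetric] Y_def[symmetric] Z_def[symmetric]
  by linarith
qed

end

section \<open>Profiles of steady self-similar solutions\<close>

lemma AE_lborel_ex:
 assumes "AE x in lborel. P x" "a < (b::real)"
 shows "EX x. a < x & x < b & P x"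
proof (rule ccontr)
 assume "\<not> ?thesis"
 then have "AE x in lborel. x \<notin> {a<..<b}" using assms(1) by (auto elim!: eventually_mono)
 moreover have "{x. \<not> x \<notin> {a<..<b}} = {a<..<b}" by auto
 ultimately have "emeasure lborel {a<..<b} = 0"
  by (subst (asm) AE_iff_null) (auto simp del: not_not greaterThanLessThan_iff)
 then show False using assms(2) by simp
qed

lemma borel_measurable_vector_3:
 assumes "f : borel_measurable M" "g : borel_measurable M" "h : borel_measurable M"
 shows "(%x. vector [f x, g x, h x] :: real^3) : borel_measurable M"
 unfolding vector_3_sum using assms by measurable

lemma vector_3_nth: "vector [U $ 1, U $ 2, U $ 3] = (U :: real^3)"
 by (simp add: vec_eq_iff forall_3)

lemma borel_measurable_nth:
 fixes f :: "'a => real^3"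
 assumes "f : borel_measurable M" shows "(%x. f x $ i) : borel_measurable M"
 using assms by (rule measurable_compose) (auto intro!: borel_measurable_continuous_onI continuous_intros)

lemma lebesgue_measurable_borel_version:
 fixes f :: "'a::euclidean_space => real^3"
 assumes "f : borel_measurable lebesgue"
 obtains g where "g : borel_measurable borel" "AE z in lborel. f z = g z"
proof -
 have "EX g. g : borel_measurable lborel & (AE z in lborel. f z $ i = g z)" for i
  using completion_ex_borel_measurable_real[OF borel_measurable_nth[OF assms]] by blast
 then obtain g where g: "!!i. g i : borel_measurable lborel" "!!i. AE z in lborel. f z $ i = g i z" by metis
 show thesis
 proof (rule that)
  show "(%z. vector [g 1 z, g 2 z, g 3 z] :: real^3) : borel_measurable borel"
   by (intro borel_measurable_vector_3) (use g(1) in simp_all)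
  show "AE z in lborel. f z = vector [g 1 z, g 2 z, g 3 z]"
   using g(2)[of 1] g(2)[of 2] g(2)[of 3] by eventually_elim (simp add: vec_eq_iff forall_3)
 qed
qed

lemma AE_lborel_spacetime:
 fixes P :: "spacetime => bool"
 assumes "AE z in lborel. P z"
 shows "AE t in lborel. AE x in lborel. AE y in lborel. P (t, x, y)"
proof -
 have "AE z in lborel \<Otimes>\<^sub>M lborel. P z" unfolding lborel_prod by (rule assms)
 from lborel_pair.AE_pair[OF this] have "AE t in lborel. AE w in lborel. P (t, w)" .
 then show ?thesis
 proof eventually_elim
  fix t assume "AE w in lborel. P (t, w)"
  then have "AE w in lborel \<Otimes>\<^sub>M lborel. P (t, w)" unfolding lborel_prod .
  from lborel_pair.AE_pair[OF this] show "AE x in lborel. AE y in lborel. P (t, x, y)" .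
 qed
qed

lemma AE_lborel_spacetimeI:
 fixes P :: "spacetime => bool"
 assumes m: "{z. P z} : sets borel" and ae: "AE t in lborel. AE x in lborel. AE y in lborel. P (t, x, y)"
 shows "AE z in lborel. P z"
proof -
 have "AE t in lborel. AE w in lborel. P (t, w)"
  using ae
 proof eventually_elim
  fix t assume ae: "AE x in lborel. AE y in lborel. P (t, x, y)"
  have "(%w. (t, w)) : borel_measurable (borel :: (real \<times> real) measure)"
   by (auto intro!: borel_measurable_continuous_onI continuous_intros)
  from measurable_sets[OF this m] have "{w. P (t, w)} : sets borel" by (simp add: vimage_def)
  then have "{w : space (lborel \<Otimes>\<^sub>M lborel). P (t, w)} : sets (lborel \<Otimes>\<^sub>M lborel)"
   unfolding lborel_prod by simp
  from lborel_pair.AE_pair_measure[OF this ae] show "AE w in lborel. P (t, w)" unfolding lborel_prod .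
 qed
 moreover have "{z : space (lborel \<Otimes>\<^sub>M lborel). P z} : sets (lborel \<Otimes>\<^sub>M lborel)"
  using m unfolding lborel_prod by simp
 ultimately have "AE z in lborel \<Otimes>\<^sub>M lborel. P z" by (intro lborel_pair.AE_pair_measure)
 then show ?thesis unfolding lborel_prod .
qed

lemma AE_lborel_scale:
 assumes ae: "AE xi in lborel. P xi" and x: "x ~= 0"
 shows "AE y in lborel. P (y / x :: real)"
proof -
 obtain N where N: "{xi. \<not> P xi} \<subseteq> N" "N : null_sets lborel"
  using ae unfolding eventually_ae_filter by auto
 have [measurable]: "N : sets borel" using N(2) by auto
 have "AE xi in lborel. xi \<notin> N" using N(2) by (rule AE_not_in)
 then have "AE y in lborel. 0 + 1 / x * y \<notin> N"
  by (intro AE_borel_affine) (use x in auto)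
 then show ?thesis by eventually_elim (use N(1) in auto)
qed

text \<open>A property of almost every slope holds for almost every point of space-time.\<close>

lemma AE_slope:
 assumes "AE xi in lborel. P xi"
 shows "AE z in lborel. fst (snd z) ~= 0 --> P (snd (snd (z::spacetime)) / fst (snd z) :: real)"
proof -
 obtain N where N: "{xi. \<not> P xi} \<subseteq> N" "N : null_sets lborel"
  using assms unfolding eventually_ae_filter by auto
 have [measurable]: "N : sets borel" using N(2) by auto
 have "AE z in lborel. fst (snd z) ~= 0 --> snd (snd (z::spacetime)) / fst (snd z) \<notin> N"
 proof (rule AE_lborel_spacetimeI)
  show "{z::spacetime. fst (snd z) ~= 0 --> snd (snd z) / fst (snd z) \<notin> N} : sets borel" by measurable
  show "AE t in lborel. AE x in lborel. AE y in lborel.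
    fst (snd (t::real, x::real, y::real)) ~= 0 --> snd (snd (t, x, y)) / fst (snd (t, x, y)) \<notin> N"
  proof (rule AE_I2, rule AE_I2)
   fix t x :: real
   show "AE y in lborel. fst (snd (t::real, x, y)) ~= 0 --> snd (snd (t, x, y)) / fst (snd (t, x, y)) \<notin> N"
    using AE_lborel_scale[OF AE_not_in[OF N(2)], of x] by (cases "x = 0") auto
  qed
 qed
 then show ?thesis by eventually_elim (use N(1) in auto)
qed

text \<open>By Fubini, one instant and one vertical line that meet the exceptional null sets in null sets
 already determine the solution.\<close>

lemma profile_exists:
 fixes U :: "spacetime => state"
 assumes Um: "U : borel_measurable lebesgue" and steady: "steady U" and ss: "self_similar U"
  and K: "closed K" "K ~= {}" "AE z in lebesgue. U z : K" and sig: "sig : {1, -1}"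
 obtains v where "v : borel_measurable borel" "!!xi. v xi : K"
  "AE z in lebesgue. 0 < sig * fst (snd z) --> U z = v (snd (snd z) / fst (snd z))"
proof -
 obtain U' where U'[measurable]: "U' : borel_measurable borel" and UU': "AE z in lborel. U z = U' z"
  using lebesgue_measurable_borel_version[OF Um] .
 obtain V0 where "AE z in lebesgue. U z = V0 (snd z)" using steady by (auto simp: steady_def)
 then have V0: "AE z in lborel. U z = V0 (snd z)" by (simp add: AE_completion_iff)
 obtain W where "AE z in lebesgue. U z = W z" and Wr: "!!t. ray_constant (%w. W (t, w))"
  using ss by (auto simp: self_similar_def)
 then have W: "AE z in lborel. U z = W z" by (simp add: AE_completion_iff)
 have KU: "AE z in lborel. U z : K" using K(3) by (simp add: AE_completion_iff)
 have "AE z in lborel. U' z = V0 (snd z) & U' z = W z & U' z : K"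
  using UU' V0 W KU by eventually_elim auto
 from AE_lborel_spacetime[OF this]
 have ae: "AE t in lborel. AE x in lborel. AE y in lborel.
   U' (t, x, y) = V0 (x, y) & U' (t, x, y) = W (t, x, y) & U' (t, x, y) : K" by simp
 obtain t0 where t0: "AE x in lborel. AE y in lborel.
   U' (t0, x, y) = V0 (x, y) & U' (t0, x, y) = W (t0, x, y) & U' (t0, x, y) : K"
  using AE_lborel_ex[OF ae, of 0 1] by auto
 define w where "w xi = W (t0, sig, sig * xi)" for xi
 have ray: "W (t0, x, y) = w (y / x)" if "0 < sig * x" for x y
 proof -
  have "W (t0, (sig * x) *\<^sub>R (sig, sig * (y / x))) = W (t0, sig, sig * (y / x))"
   using Wr[of t0] sig that unfolding ray_constant_def by (metis (no_types, lifting) fst_conv fst_zero insertE singletonD zero_neq_neg_one zero_neq_one)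
  moreover have "(sig * x) *\<^sub>R (sig, sig * (y / x)) = (x, y)" using sig that by auto
  ultimately show ?thesis unfolding w_def by metis
 qed
 obtain a b :: real where ab: "a < b" "!!x. a < x ==> x < b ==> 0 < sig * x"
  using sig by (cases "sig = 1") (auto intro: that[of 0 1] that[of "-1" 0])
 obtain x0 where x0: "0 < sig * x0" "AE y in lborel.
   U' (t0, x0, y) = V0 (x0, y) & U' (t0, x0, y) = W (t0, x0, y) & U' (t0, x0, y) : K"
  using AE_lborel_ex[OF t0 ab(1)] ab(2) by blast
 then have x0n: "x0 ~= 0" by auto
 obtain k where k: "k : K" using K(2) by blast
 define v where "v xi = (let u = U' (t0, x0, x0 * xi) in if u : K then u else k)" for xi
 have "(%xi. (t0, x0, x0 * xi)) : borel_measurable borel"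
  by (auto intro!: borel_measurable_continuous_onI continuous_intros)
 from measurable_compose[OF this U'] have m1[measurable]: "(%xi. U' (t0, x0, x0 * xi)) : borel_measurable borel" .
 have [measurable]: "K : sets borel" using K(1) by (rule borel_closed)
 have vm: "v : borel_measurable borel" unfolding v_def Let_def by measurable
 have vK: "v xi : K" for xi using k by (simp add: v_def Let_def)
 have vw: "AE xi in lborel. v xi = w xi"
 proof -
  have "1 / x0 ~= 0" using x0n by simp
  from AE_lborel_scale[OF x0(2) this]
  have "AE xi in lborel. U' (t0, x0, xi / (1 / x0)) = W (t0, x0, xi / (1 / x0)) & U' (t0, x0, xi / (1 / x0)) : K"
   by eventually_elim auto
  then show ?thesis
  proof eventually_elim
   fix xi assume "U' (t0, x0, xi / (1 / x0)) = W (t0, x0, xi / (1 / x0)) & U' (t0, x0, xi / (1 / x0)) : K"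
   then show "v xi = w xi" using ray[OF x0(1), of "x0 * xi"] x0n by (auto simp: v_def Let_def mult.commute)
  qed
 qed
 have "AE z in lborel. 0 < sig * fst (snd z) --> U' z = v (snd (snd z) / fst (snd z))"
 proof (rule AE_lborel_spacetimeI)
  have "(%z::spacetime. snd (snd z) / fst (snd z)) : borel_measurable borel" by measurable
  from measurable_compose[OF this vm] have [measurable]:
   "(%z::spacetime. v (snd (snd z) / fst (snd z))) : borel_measurable borel" .
  show "{z. 0 < sig * fst (snd z) --> U' z = v (snd (snd z) / fst (snd z))} : sets borel" by measurable
  show "AE t in lborel. AE x in lborel. AE y in lborel. 0 < sig * fst (snd (t, x, y)) -->
    U' (t, x, y) = v (snd (snd (t, x, y)) / fst (snd (t, x, y)))"
   using ae
  proof eventually_elim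
   fix t assume "AE x in lborel. AE y in lborel.
     U' (t, x, y) = V0 (x, y) & U' (t, x, y) = W (t, x, y) & U' (t, x, y) : K"
   with t0 show "AE x in lborel. AE y in lborel. 0 < sig * fst (snd (t, x, y)) -->
     U' (t, x, y) = v (snd (snd (t, x, y)) / fst (snd (t, x, y)))"
   proof eventually_elim
    fix x assume 1: "AE y in lborel. U' (t0, x, y) = V0 (x, y) & U' (t0, x, y) = W (t0, x, y) & U' (t0, x, y) : K"
     and 2: "AE y in lborel. U' (t, x, y) = V0 (x, y) & U' (t, x, y) = W (t, x, y) & U' (t, x, y) : K"
    show "AE y in lborel. 0 < sig * fst (snd (t, x, y)) -->
     U' (t, x, y) = v (snd (snd (t, x, y)) / fst (snd (t, x, y)))"
    proof (cases "0 < sig * x")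
     case True
     then have "x ~= 0" by auto
     from AE_lborel_scale[OF vw this] 1 2 show ?thesis
      by eventually_elim (use ray[OF True] in auto)
    qed auto
   qed
  qed
 qed
 then have "AE z in lborel. 0 < sig * fst (snd z) --> U z = v (snd (snd z) / fst (snd z))"
  using UU' by eventually_elim auto
 then have "AE z in lebesgue. 0 < sig * fst (snd z) --> U z = v (snd (snd z) / fst (snd z))"
  by (simp add: AE_completion_iff)
 with vm vK show thesis by (rule that)
qed

lemma locally_integrable_measurable:
 fixes f :: "'a::euclidean_space => 'b::euclidean_space"
 assumes "locally_integrable f" shows "f : borel_measurable lebesgue"
proof (rule borel_measurable_LIMSEQ_metric)
 fix n :: nat
 have "set_integrable lebesgue (cball 0 (real n)) f"
  using assms compact_cball by (auto simp: locally_integrable_def)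
 then show "(%x. indicator (cball 0 (real n)) x *\<^sub>R f x) : borel_measurable lebesgue"
  unfolding set_integrable_def by (rule borel_measurable_integrable)
next
 fix x :: 'a
 obtain N :: nat where N: "norm x <= real N" using real_arch_simple by blast
 have "\<forall>\<^sub>F n in sequentially. indicator (cball 0 (real n)) x *\<^sub>R f x = f x"
  using eventually_ge_at_top[of N] by eventually_elim (use N in \<open>auto simp: indicator_def\<close>)
 then show "(%n. indicator (cball 0 (real n)) x *\<^sub>R f x) \<longlonglongrightarrow> f x" by (rule tendsto_eventually)
qed

lemma measurable_compose_continuous_on:
 assumes v: "v : borel_measurable borel" "!!xi. v xi : K" and f: "continuous_on K f"
 shows "(%xi. f (v xi)) : borel_measurable borel"
proof -
 have "v : borel \<rightarrow>\<^sub>M restrict_space borel K" using v by (intro measurable_restrict_space2) auto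
 from measurable_compose[OF this borel_measurable_continuous_on_restrict[OF f]] show ?thesis .
qed

context gas begin

text \<open>The integrated equations between almost all slopes \<open>x < y\<close>. The last inequality is the energy law; its
 orientation \<open>sig\<close> is that of the half plane.\<close>

definition ray_solution :: "real => state set => (real => state) => real set => bool" where
 "ray_solution sig K v G \<longleftrightarrow> v : borel_measurable borel & (ALL xi. v xi : K) & (AE xi in lborel. xi : G) &
   (ALL x:G. ALL y:G. x < y -->
    (ALL i. (ray_flux y (v y) - ray_flux x (v x)) $ i = - integral {x..y} (%s. flux_x p (v s) $ i)) &
    sig * (mass_flux y (v y) * bernoulli (v y)) - sig * (mass_flux x (v x) * bernoulli (v x))
     <= - integral {x..y} (%s. sig * (v s $ 2 * bernoulli (v s))))"

lemma flux_continuous_on: "continuous_on states (flux_x p)" "continuous_on states (flux_y p)"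
 by (intro continuous_at_imp_continuous_on ballI, erule has_derivative_continuous[OF flux_has_derivative(1)],
   intro continuous_at_imp_continuous_on ballI, erule has_derivative_continuous[OF flux_has_derivative(2)])

lemma bernoulli_continuous_on: "continuous_on states bernoulli"
 by (rule smooth_on_imp_continuous_on[OF smooth_bernoulli])

text \<open>Each scalar law is tested with a product in the coordinates \<open>(t, x, xi)\<close>, which leaves a weak differential
 inequality in \<open>xi\<close>. An equation is two inequalities.\<close>

lemma profile_equations:
 assumes U: "weak_solution p U" "entropy_admissible p U"
  and K: "compact K" "K \<subseteq> states" and v: "v : borel_measurable borel" "!!xi. v xi : K"
  and ae: "AE z in lebesgue. 0 < sig * fst (snd z) --> U z = v (snd (snd z) / fst (snd z))"
  and sig: "sig : {1, -1}"
 shows "EX G. ray_solution sig K v G"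
proof -
 have bd: "EX B. ALL xi. (abs (f (v xi))) <= B" if "continuous_on states f" for f :: "state => real"
 proof -
  have "compact (f ` K)" using K that by (intro compact_continuous_image continuous_on_subset[OF that])
  then obtain B where "ALL y:f ` K. norm y <= B" using compact_imp_bounded bounded_iff by metis
  then show ?thesis using v(2) by auto
 qed
 have meas: "(%xi. f (v xi)) : borel_measurable borel" if "continuous_on states f" for f :: "state => real"
  by (rule measurable_compose_continuous_on[OF v continuous_on_subset[OF that K(2)]])
 define c where "c = (LINT x|lborel. bump 0 1 x) * (LINT x|lborel. bump 1 2 x)"
 have c: "0 < c" unfolding c_def by (intro mult_pos_pos bump_integral_pos) auto
 text \<open>The scalar laws are those of the three momentum-flux components, with either sign, and of the
  energy.\<close>
 have law: "EX G. (AE x in lborel. x : G) &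
   (ALL x:G. ALL y:G. x < y --> (s * k (v y) - y * (s * h (v y))) - (s * k (v x) - x * (s * h (v x)))
    <= - integral {x..y} (%xi. s * h (v xi)))"
  if cont: "continuous_on states g" "continuous_on states h" "continuous_on states k"
  and li: "(%z. g (U z)) : borel_measurable lebesgue" "(%z. h (U z)) : borel_measurable lebesgue"
   "(%z. k (U z)) : borel_measurable lebesgue"
  and pair: "!!\<phi>. test_function \<phi> ==> (ALL z. 0 <= \<phi> z) ==>
    integrable lebesgue (%z. frechet_derivative \<phi> (at z) (1, 0, 0) * g (U z)
     + frechet_derivative \<phi> (at z) (0, 1, 0) * h (U z) + frechet_derivative \<phi> (at z) (0, 0, 1) * k (U z)) ==>
    0 <= s * sig * (LINT z|lebesgue. frechet_derivative \<phi> (at z) (1, 0, 0) * g (U z)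
     + frechet_derivative \<phi> (at z) (0, 1, 0) * h (U z) + frechet_derivative \<phi> (at z) (0, 0, 1) * k (U z))"
  for g h k :: "state => real" and s :: real
 proof -
  obtain B1 B2 B3 where "ALL xi. (abs (g (v xi))) <= B1" "ALL xi. (abs (h (v xi))) <= B2" "ALL xi. (abs (k (v xi))) <= B3"
   using bd cont by meson
  then obtain B where B: "!!xi. (abs (g (v xi))) <= B" "!!xi. (abs (h (v xi))) <= B" "!!xi. (abs (k (v xi))) <= B"
   by (intro that[of "max B1 (max B2 B3)"]) (auto simp: le_max_iff_disj)
  show ?thesis
  proof (rule AE_decreasing_of_weak[where B = "(abs s) * B"])
   show "(%xi. s * h (v xi)) : borel_measurable borel" "(%xi. s * k (v xi)) : borel_measurable borel"
    using meas cont by auto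
   show "(abs (s * h (v x))) <= (abs s) * B" "(abs (s * k (v x))) <= (abs s) * B" for x
    using B by (auto simp: abs_mult intro: mult_left_mono)
   fix gam gam' R
   assume gam: "smooth_on UNIV gam" "smooth_on UNIV gam'" "!!x. (gam has_real_derivative gam' x) (at x)"
    "0 < R" "!!x. R <= (abs x) ==> gam x = 0" "!!x. 0 <= gam x"
   let ?\<phi> = "chart_test sig gam"
   have ae': "AE z in lebesgue. 0 < sig * fst (snd z) --> g (U z) = g (v (snd (snd z) / fst (snd z))) &
     h (U z) = h (v (snd (snd z) / fst (snd z))) & k (U z) = k (v (snd (snd z) / fst (snd z)))"
    using ae by eventually_elim auto
   let ?J = "%z. frechet_derivative ?\<phi> (at z) (1, 0, 0) * g (U z)
     + frechet_derivative ?\<phi> (at z) (0, 1, 0) * h (U z) + frechet_derivative ?\<phi> (at z) (0, 0, 1) * k (U z)"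
   have cp: "integrable lebesgue ?J"
    "(LINT z|lebesgue. ?J z) = sig * c * (LINT xi|lborel. gam' xi * (k (v xi) - xi * h (v xi)) - gam xi * h (v xi))"
    unfolding c_def
    by (rule chart_pairing[OF gam(1,2,3) _ sig li ae' meas[OF cont(1)] meas[OF cont(2)] meas[OF cont(3)] B], rule gam(5), assumption)+
   have tt: "test_function ?\<phi>" by (rule chart_test_is_test[OF gam(1) sig], rule gam(5))
   have "0 <= s * sig * (sig * c * (LINT xi|lborel. gam' xi * (k (v xi) - xi * h (v xi)) - gam xi * h (v xi)))"
   proof -
    have "ALL z. 0 <= chart_test sig gam z" using gam(6) bump_nonneg by (simp add: chart_test_def)
    from pair[OF tt this cp(1)]
    show ?thesis unfolding cp(2) by (simp add: mult.assoc)
   qed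
   also have "... = c * (s * (LINT xi|lborel. gam' xi * (k (v xi) - xi * h (v xi)) - gam xi * h (v xi)))"
    using sig by auto
   finally have "0 <= s * (LINT xi|lborel. gam' xi * (k (v xi) - xi * h (v xi)) - gam xi * h (v xi))"
    using c by (simp add: zero_le_mult_iff)
   also have "... = (LINT xi|lborel. s * (gam' xi * (k (v xi) - xi * h (v xi)) - gam xi * h (v xi)))"
    by (rule integral_mult_right_zero[symmetric])
   also have "... = (LINT xi|lborel. gam' xi * (s * k (v xi) - xi * (s * h (v xi))) - gam xi * (s * h (v xi)))"
    by (simp add: algebra_simps)
   finally show "0 <= (LINT xi|lborel. gam' xi * (s * k (v xi) - xi * (s * h (v xi))) - gam xi * (s * h (v xi)))" .
  qed
 qed
 note dz = U(1)[unfolded weak_solution_def distrib_div_zero_def]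
 have lm: "(%z. U z) : borel_measurable lebesgue" "(%z. flux_x p (U z)) : borel_measurable lebesgue"
  "(%z. flux_y p (U z)) : borel_measurable lebesgue"
  using dz locally_integrable_measurable by auto
 text \<open>A scalar pairing is a component of the vector pairing once all components are integrable.\<close>
 have comp: "EX G. (AE x in lborel. x : G) &
   (ALL x:G. ALL y:G. x < y --> (s * flux_y p (v y) $ i - y * (s * flux_x p (v y) $ i)) - (s * flux_y p (v x) $ i - x * (s * flux_x p (v x) $ i))
    <= - integral {x..y} (%xi. s * flux_x p (v xi) $ i))" for i :: 3 and s :: real
 proof -
  have lim: "(%z. U z $ j) : borel_measurable lebesgue" "(%z. flux_x p (U z) $ j) : borel_measurable lebesgue"
   "(%z. flux_y p (U z) $ j) : borel_measurable lebesgue" for j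
   using lm by (auto intro: borel_measurable_nth)
  have lc: "continuous_on states (%U. U $ j)" "continuous_on states (%U. flux_x p U $ j)"
   "continuous_on states (%U. flux_y p U $ j)" for j
   by (intro continuous_intros flux_continuous_on)+
  obtain B where B: "!!j xi. (abs (v xi $ j)) <= B" "!!j xi. (abs (flux_x p (v xi) $ j)) <= B" "!!j xi. (abs (flux_y p (v xi) $ j)) <= B"
  proof -
   obtain b1 b2 b3 where b: "!!j. ALL xi. (abs (v xi $ j)) <= b1 j" "!!j. ALL xi. (abs (flux_x p (v xi) $ j)) <= b2 j"
    "!!j. ALL xi. (abs (flux_y p (v xi) $ j)) <= b3 j"
    using bd[OF lc(1)] bd[OF lc(2)] bd[OF lc(3)] by metis
   have le: "b j <= Max (range b)" for b :: "3 => real" and j by (rule Max_ge) auto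
   show thesis
    by (rule that[of "max (Max (range b1)) (max (Max (range b2)) (Max (range b3)))"])
      (use b le order_trans in \<open>(meson max.coboundedI1 max.coboundedI2)+\<close>)
  qed
  define I where "I \<phi> z = frechet_derivative \<phi> (at z) (1, 0, 0) *\<^sub>R U z + frechet_derivative \<phi> (at z) (0, 1, 0) *\<^sub>R flux_x p (U z)
    + frechet_derivative \<phi> (at z) (0, 0, 1) *\<^sub>R flux_y p (U z)" for \<phi> z
  have Ij: "I \<phi> z $ j = frechet_derivative \<phi> (at z) (1, 0, 0) * U z $ j
     + frechet_derivative \<phi> (at z) (0, 1, 0) * flux_x p (U z) $ j + frechet_derivative \<phi> (at z) (0, 0, 1) * flux_y p (U z) $ j"
   for \<phi> z j by (simp add: I_def)
  show ?thesis
  proof (rule AE_decreasing_of_weak[where B = "(abs s) * B"])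
   show "(%xi. s * flux_x p (v xi) $ i) : borel_measurable borel" "(%xi. s * flux_y p (v xi) $ i) : borel_measurable borel"
    using meas lc by auto
   show "(abs (s * flux_x p (v x) $ i)) <= (abs s) * B" "(abs (s * flux_y p (v x) $ i)) <= (abs s) * B" for x
    using B by (auto simp: abs_mult intro: mult_left_mono)
   fix gam gam' R
   assume gam: "smooth_on UNIV gam" "smooth_on UNIV gam'" "!!x. (gam has_real_derivative gam' x) (at x)"
    "0 < R" "!!x. R <= (abs x) ==> gam x = 0" "!!x. 0 <= gam x"
   have ae': "AE z in lebesgue. 0 < sig * fst (snd z) --> U z $ j = v (snd (snd z) / fst (snd z)) $ j &
     flux_x p (U z) $ j = flux_x p (v (snd (snd z) / fst (snd z))) $ j &
     flux_y p (U z) $ j = flux_y p (v (snd (snd z) / fst (snd z))) $ j" for j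
    using ae by eventually_elim auto
   have cp: "integrable lebesgue (%z. I (chart_test sig gam) z $ j)"
    "(LINT z|lebesgue. I (chart_test sig gam) z $ j) = sig * c *
      (LINT xi|lborel. gam' xi * (flux_y p (v xi) $ j - xi * flux_x p (v xi) $ j) - gam xi * flux_x p (v xi) $ j)" for j
    unfolding c_def Ij
    by (rule chart_pairing[OF gam(1,2,3) _ sig lim ae' meas[OF lc(1)] meas[OF lc(2)] meas[OF lc(3)] B], rule gam(5), assumption)+
   have tt: "test_function (chart_test sig gam)" by (rule chart_test_is_test[OF gam(1) sig], rule gam(5))
   have "integrable lebesgue (%z. vector [I (chart_test sig gam) z $ 1, I (chart_test sig gam) z $ 2, I (chart_test sig gam) z $ 3] :: state)"
    unfolding vector_3_sum using cp(1)
    by (intro Bochner_Integration.integrable_add integrable_scaleR_left) auto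
   then have int: "integrable lebesgue (I (chart_test sig gam))" by (simp add: vector_3_nth)
   have "(LINT z|lebesgue. I (chart_test sig gam) z) = 0"
    using dz tt by (simp add: div_pairing_def I_def)
   then have "(LINT z|lebesgue. I (chart_test sig gam) z $ i) = 0"
    using integral_bounded_linear[OF bounded_linear_vec_nth int, of i] by simp
   then have "(LINT xi|lborel. gam' xi * (flux_y p (v xi) $ i - xi * flux_x p (v xi) $ i) - gam xi * flux_x p (v xi) $ i) = 0"
    unfolding cp(2) using sig c by auto
   then have "(LINT xi|lborel. s * (gam' xi * (flux_y p (v xi) $ i - xi * flux_x p (v xi) $ i) - gam xi * flux_x p (v xi) $ i)) = 0"
    by simp
   then show "0 <= (LINT xi|lborel. gam' xi * (s * flux_y p (v xi) $ i - xi * (s * flux_x p (v xi) $ i)) - gam xi * (s * flux_x p (v xi) $ i))"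
    by (simp add: algebra_simps)
  qed
 qed
 have en: "EX G. (AE x in lborel. x : G) &
   (ALL x:G. ALL y:G. x < y --> (sig * (v y $ 3 * bernoulli (v y)) - y * (sig * (v y $ 2 * bernoulli (v y))))
     - (sig * (v x $ 3 * bernoulli (v x)) - x * (sig * (v x $ 2 * bernoulli (v x))))
    <= - integral {x..y} (%xi. sig * (v xi $ 2 * bernoulli (v xi))))"
 proof (rule law[where g = energy and h = "%U. U $ 2 * bernoulli U" and k = "%U. U $ 3 * bernoulli U"])
  have d: "distrib_div_nonpos (%z. energy (U z)) (%z. U z $ 2 * bernoulli (U z)) (%z. U z $ 3 * bernoulli (U z))"
   using U(2) energy_flux_pair convex_energy unfolding entropy_admissible_def by blast
  show "(%z. energy (U z)) : borel_measurable lebesgue" "(%z. U z $ 2 * bernoulli (U z)) : borel_measurable lebesgue"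
   "(%z. U z $ 3 * bernoulli (U z)) : borel_measurable lebesgue"
   using d locally_integrable_measurable unfolding distrib_div_nonpos_def by auto
  show "continuous_on states energy" "continuous_on states (%U. U $ 2 * bernoulli U)"
   "continuous_on states (%U. U $ 3 * bernoulli U)"
   using smooth_on_imp_continuous_on[OF smooth_energy]
   by (auto intro!: continuous_intros bernoulli_continuous_on)
  fix \<phi> :: "spacetime => real" assume \<phi>: "test_function \<phi>" "ALL z. 0 <= \<phi> z"
  have "div_pairing (%z. energy (U z)) (%z. U z $ 2 * bernoulli (U z)) (%z. U z $ 3 * bernoulli (U z)) \<phi> <= 0"
   using d \<phi> unfolding distrib_div_nonpos_def by blast
  moreover have "sig * sig = 1" using sig by auto
  ultimately show "0 <= sig * sig * (LINT z|lebesgue. frechet_derivative \<phi> (at z) (1, 0, 0) * energy (U z)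
     + frechet_derivative \<phi> (at z) (0, 1, 0) * (U z $ 2 * bernoulli (U z))
     + frechet_derivative \<phi> (at z) (0, 0, 1) * (U z $ 3 * bernoulli (U z)))"
   by (simp add: div_pairing_def)
 qed
 define Q where "Q i s G \<longleftrightarrow> (AE x in lborel. x : G) &
   (ALL x:G. ALL y:G. x < y --> (s * flux_y p (v y) $ i - y * (s * flux_x p (v y) $ i)) - (s * flux_y p (v x) $ i - x * (s * flux_x p (v x) $ i))
    <= - integral {x..y} (%xi. s * flux_x p (v xi) $ i))" for i :: 3 and s :: real and G
 have "EX G. Q i s G" for i s unfolding Q_def by (rule comp)
 then have Q: "Q i s (SOME G. Q i s G)" for i s by (rule someI_ex)
 define Gs where "Gs i s = (SOME G. Q i s G)" for i s
 have Gs: "AE x in lborel. x : Gs i s"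
  "!!x y. x : Gs i s ==> y : Gs i s ==> x < y ==>
   (s * flux_y p (v y) $ i - y * (s * flux_x p (v y) $ i)) - (s * flux_y p (v x) $ i - x * (s * flux_x p (v x) $ i))
    <= - integral {x..y} (%xi. s * flux_x p (v xi) $ i)" for i s
  using Q[of i s] unfolding Gs_def[symmetric] unfolding Q_def by blast+
 obtain Ge where Ge: "AE x in lborel. x : Ge" "!!x y. x : Ge ==> y : Ge ==> x < y ==>
   (sig * (v y $ 3 * bernoulli (v y)) - y * (sig * (v y $ 2 * bernoulli (v y))))
     - (sig * (v x $ 3 * bernoulli (v x)) - x * (sig * (v x $ 2 * bernoulli (v x))))
    <= - integral {x..y} (%xi. sig * (v xi $ 2 * bernoulli (v xi)))"
  using en by blast
 define G where "G = Ge \<inter> {x. ALL i. x : Gs i 1 & x : Gs i (-1)}"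
 have "AE x in lborel. ALL i:UNIV. x : Gs i 1 & x : Gs i (-1)"
  by (rule AE_finite_allI) (use Gs(1) in auto)
 with Ge(1) have aeG: "AE x in lborel. x : G" by eventually_elim (simp add: G_def)
 have "ray_solution sig K v G" unfolding ray_solution_def
 proof (intro conjI ballI impI allI v aeG)
  fix x y assume G: "x : G" "y : G" "x < y"
  show "(ray_flux y (v y) - ray_flux x (v x)) $ i = - integral {x..y} (%s. flux_x p (v s) $ i)" for i
   using Gs(2)[of x i 1 y] Gs(2)[of x i "-1" y] G
   by (auto simp: G_def ray_flux_def)
  show "sig * (mass_flux y (v y) * bernoulli (v y)) - sig * (mass_flux x (v x) * bernoulli (v x))
     <= - integral {x..y} (%s. sig * (v s $ 2 * bernoulli (v s)))"
   using Ge(2)[of x y] G by (simp add: G_def mass_flux_def algebra_simps)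
 qed
 then show ?thesis ..
qed

end

section \<open>Local structure of a profile\<close>

context gas begin

lemma deriv_p_isCont: "0 < r ==> isCont (deriv p) r"
 using smooth_on_imp_continuous_on[OF smooth_deriv_p] by (simp add: continuous_on_eq_continuous_at)

lemma dflux_isCont:
 assumes c: "c : states"
 shows "isCont (%U. dflux_x U v) c" "isCont (%U. dflux_y U v) c"
proof -
 have r: "c $ 1 ~= 0" "0 < c $ 1" using c by (auto simp: states_def)
 have n: "isCont (%U::state. U $ i) c" for i by (intro continuous_intros)
 have d: "isCont (%U. deriv p (U $ 1)) c" by (rule isCont_o2[OF n deriv_p_isCont[OF r(2)]])
 show "isCont (%U. dflux_x U v) c" "isCont (%U. dflux_y U v) c"
  unfolding dflux_x_def dflux_y_def by (intro continuous_intros n d; use r in simp)+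
qed

lemma dray_flux_isCont:
 assumes c: "c : states"
 shows "isCont (%z. dray_flux (fst z) (snd z) v) (t, c)"
proof -
 have "isCont (%z. dflux_x (snd z) v) (t, c)" "isCont (%z. dflux_y (snd z) v) (t, c)"
  using dflux_isCont[OF c, of v] by (auto intro!: isCont_o2[where f = snd] continuous_intros)
 then show ?thesis unfolding dray_flux_def by (intro continuous_intros)
qed

lemma flux_x_lipschitz:
 assumes K: "compact K" "convex K" "K \<subseteq> states"
 obtains L where "0 < L" "!!U V. U : K ==> V : K ==> norm (flux_x p U - flux_x p V) <= L * norm (U - V)"
proof -
 have "EX B. ALL U:K. norm (dflux_x U b) <= B" for b
 proof -
  have "continuous_on K (%U. dflux_x U b)"
   using dflux_isCont K(3) by (intro continuous_at_imp_continuous_on) blast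
  then have "bounded ((%U. dflux_x U b) ` K)"
   using compact_continuous_image K(1) compact_imp_bounded by blast
  then show ?thesis by (auto simp: bounded_iff)
 qed
 then obtain B where B: "!!b U. U : K ==> norm (dflux_x U b) <= B b" by metis
 define L where "L = (\<Sum>b\<in>Basis. (abs (B b))) + 1"
 have "0 <= (\<Sum>b\<in>Basis. (abs (B b)))" by (intro sum_nonneg) auto
 then have L0: "0 < L" unfolding L_def by linarith
 have on: "norm (dflux_x U v) <= L * norm v" if U: "U : K" for U v
 proof -
  have lin: "linear (dflux_x U)"
   using flux_has_derivative(1) U K(3) has_derivative_linear by blast
  have "dflux_x U v = (\<Sum>b\<in>Basis. (v \<bullet> b) *\<^sub>R dflux_x U b)"
   using linear_sum[OF lin, of "%b. (v \<bullet> b) *\<^sub>R b" Basis] linear_scale[OF lin]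
   by (simp add: euclidean_representation)
  also have "norm ... <= (\<Sum>b\<in>(Basis::state set). norm v * (abs (B b)))"
  proof (rule order_trans[OF norm_sum sum_mono])
   fix b :: state assume b: "b : Basis"
   have "norm (dflux_x U b) <= (abs (B b))" using B[OF U, of b] by linarith
   then show "norm ((v \<bullet> b) *\<^sub>R dflux_x U b) <= norm v * (abs (B b))"
    using Basis_le_norm[OF b, of v] by (auto intro!: mult_mono)
  qed
  also have "... <= L * norm v" by (simp add: L_def sum_distrib_left[symmetric] algebra_simps)
  finally show ?thesis .
 qed
 have "norm (flux_x p U - flux_x p V) <= L * norm (U - V)" if "U : K" "V : K" for U V
 proof (rule differentiable_bound[OF K(2) _ _ that, where f = "flux_x p" and f' = dflux_x])
  show "(flux_x p has_derivative dflux_x U) (at U within K)" if "U : K" for U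
   using flux_has_derivative(1) that K(3) by (auto intro: has_derivative_at_withinI)
  show "onorm (dflux_x U) <= L" if "U : K" for U by (rule onorm_le) (rule on[OF that])
 qed
 with L0 show thesis by (rule that)
qed

lemma ray_flux_change: "ray_flux y U = ray_flux x U - (y - x) *\<^sub>R flux_x p U"
 by (simp add: ray_flux_def algebra_simps)

lemma mass_flux_continuous: "continuous_on UNIV (%z. mass_flux (fst z) (snd z))"
 unfolding mass_flux_def by (intro continuous_intros)

lemma ray_flux_continuous_on: "continuous_on (UNIV \<times> states) (%z. ray_flux (fst z) (snd z))"
 unfolding ray_flux_def
 by (intro continuous_intros continuous_on_compose2[OF flux_continuous_on(1)]
   continuous_on_compose2[OF flux_continuous_on(2)]) auto

end

lemma norm_le_3: "norm (x :: real^3) <= (abs (x $ 1)) + (abs (x $ 2)) + (abs (x $ 3))"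
 using norm_le_l1_cart[of x] by (simp add: sum_3)

locale ray_profile = gas +
 fixes sig :: real and K :: "state set" and v :: "real => state" and G :: "real set"
 assumes sol: "ray_solution sig K v G" and sig: "sig : {1, -1}"
  and K: "compact K" "convex K" "K \<subseteq> states"
begin

lemma v_measurable: "v : borel_measurable borel" and vK: "v xi : K" and G: "AE xi in lborel. xi : G"
 using sol by (auto simp: ray_solution_def)

lemma G_dense: "a < b ==> EX x:G. a < x & x < b"
 using AE_lborel_ex[OF G] by blast

lemma bounded_on_K:
 assumes "continuous_on states (f :: state => real)"
 obtains B where "!!U. U : K ==> (abs (f U)) <= B" "0 < B"
proof -
 have "compact (f ` K)" using K assms by (auto intro: compact_continuous_image continuous_on_subset)
 then obtain B where "ALL y:f ` K. norm y <= B" using compact_imp_bounded bounded_iff by metis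
 then have "(abs (f U)) <= max B 1" if "U : K" for U using that by (auto simp: le_max_iff_disj)
 then show thesis by (intro that[of "max B 1"]) auto
qed

lemma profile_measurable:
 "continuous_on states (f :: state => real) ==> (%xi. f (v xi)) : borel_measurable borel"
 by (rule measurable_compose_continuous_on[OF v_measurable vK]) (use K continuous_on_subset in blast)

lemma profile_integrable:
 assumes f: "continuous_on states (f :: state => real)"
 shows "(%xi. f (v xi)) integrable_on {a..b}"
proof -
 obtain B where "!!U. U : K ==> (abs (f U)) <= B" using bounded_on_K[OF f] by blast
 then show ?thesis using vK
  by (intro borel_bounded_integrable_on(1)[where B = B] profile_measurable f) auto
qed

lemma flux_nth_continuous: "continuous_on states (%U. flux_x p U $ i)"
 by (intro continuous_intros flux_continuous_on)

definition base :: real where "base = (SOME x. x : G)"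

lemma base: "base : G"
proof -
 have "EX x. x : G" using G_dense[of 0 1] by auto
 then show ?thesis unfolding base_def by (rule someI_ex)
qed

text \<open>The continuous representative of the flux through the ray.\<close>

definition Flux :: "real => state" where
 "Flux xi = (\<chi> i. ray_flux base (v base) $ i + primitive (%s. flux_x p (v s) $ i) base
   - primitive (%s. flux_x p (v s) $ i) xi)"

lemma Flux_diff: "x <= y ==> (Flux y - Flux x) $ i = - integral {x..y} (%s. flux_x p (v s) $ i)"
 using primitive_diff[OF profile_integrable[OF flux_nth_continuous], of x y i] by (simp add: Flux_def)

lemma Flux_eq: "x : G ==> ray_flux x (v x) = Flux x"
proof -
 assume x: "x : G"
 have *: "(ray_flux b (v b) - ray_flux a (v a)) $ i = - integral {a..b} (%s. flux_x p (v s) $ i)"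
  if "a : G" "b : G" "a < b" for a b i
  using sol that unfolding ray_solution_def by blast
 note pd = primitive_diff[OF profile_integrable[OF flux_nth_continuous]]
 have "ray_flux x (v x) $ i = Flux x $ i" for i
  using *[OF base x, of i] *[OF x base, of i] pd[of base x i] pd[of x base i]
  by (cases x base rule: linorder_cases) (auto simp: Flux_def)
 then show ?thesis by (simp add: vec_eq_iff)
qed

lemma Flux_lipschitz: obtains C where "0 < C" "!!x y. norm (Flux y - Flux x) <= C * (abs (y - x))"
proof -
 have "EX B. (ALL U:K. (abs (flux_x p U $ i)) <= B) & 0 < B" for i
  using bounded_on_K[OF flux_nth_continuous, of i] by metis
 then obtain B where B: "!!i U. U : K ==> (abs (flux_x p U $ i)) <= B i" "!!i. 0 < B i" by metis
 have c: "(abs ((Flux y - Flux x) $ i)) <= B i * (abs (y - x))" for x y i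
  using primitive_lipschitz[OF profile_measurable[OF flux_nth_continuous[of i]] B(1)[OF vK], where x = x and y = y]
  by (simp add: Flux_def abs_minus_commute)
 show thesis
 proof (rule that[of "B 1 + B 2 + B 3"])
  show "0 < B 1 + B 2 + B 3" using B(2) by (simp add: add_pos_pos)
  fix x y
  show "norm (Flux y - Flux x) <= (B 1 + B 2 + B 3) * (abs (y - x))"
   using norm_le_3[of "Flux y - Flux x"] c[of y x 1] c[of y x 2] c[of y x 3]
   by (simp add: distrib_right)
 qed
qed

lemma Flux_isCont: "isCont Flux x"
proof -
 obtain C where C: "0 < C" "!!x y. norm (Flux y - Flux x) <= C * (abs (y - x))" using Flux_lipschitz by blast
 have "C-lipschitz_on UNIV Flux"
  using C by (intro lipschitz_onI) (auto simp: dist_norm)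
 then show ?thesis using lipschitz_on_continuous_on continuous_on_eq_continuous_at open_UNIV by blast
qed

lemma energy_law:
 obtains C where "0 < C" "!!x y. x : G ==> y : G ==> x < y ==>
   sig * (mass_flux y (v y) * bernoulli (v y)) - sig * (mass_flux x (v x) * bernoulli (v x)) <= C * (y - x)"
proof -
 have f: "continuous_on states (%U. sig * (U $ 2 * bernoulli U))"
  by (intro continuous_intros bernoulli_continuous_on)
 obtain B where B: "!!U. U : K ==> (abs (sig * (U $ 2 * bernoulli U))) <= B" "0 < B" using bounded_on_K[OF f] by blast
 show thesis
 proof (rule that[OF B(2)])
  fix x y assume xy: "x : G" "y : G" "x < y"
  have "integral {x..y} (%s. - B) <= integral {x..y} (%s. sig * (v s $ 2 * bernoulli (v s)))"
   using B(1) vK by (intro integral_le profile_integrable f) (auto simp: abs_le_iff minus_le_iff)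
  then have "- integral {x..y} (%s. sig * (v s $ 2 * bernoulli (v s))) <= B * (y - x)" using xy by (simp add: mult.commute minus_le_iff)
  moreover have "sig * (mass_flux y (v y) * bernoulli (v y)) - sig * (mass_flux x (v x) * bernoulli (v x))
    <= - integral {x..y} (%s. sig * (v s $ 2 * bernoulli (v s)))"
   using sol xy unfolding ray_solution_def by blast
  ultimately show "sig * (mass_flux y (v y) * bernoulli (v y)) - sig * (mass_flux x (v x) * bernoulli (v x)) <= B * (y - x)"
   by linarith
 qed
qed

definition roots :: "real => state set" where
 "roots xi = {U : K. ray_flux xi U = Flux xi}"

lemma roots_mass_flux: "U : roots xi ==> mass_flux xi U = Flux xi $ 1"
 using ray_flux_nth(1)[of xi U] by (auto simp: roots_def)

text \<open>By compactness: a limit of values at good slopes that converge to \<open>xi\<close> satisfies the equation at \<open>xi\<close>.\<close>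

lemma near_roots:
 assumes "0 < e"
 shows "EX h>0. ALL x:G. (abs (x - xi)) < h --> (EX U:roots xi. dist (v x) U < e)"
proof (rule ccontr)
 assume neg: "\<not> ?thesis"
 have "EX x:G. (abs (x - xi)) < 1 / real (Suc n) & (ALL U:roots xi. e <= dist (v x) U)" for n
 proof -
  have "0 < 1 / real (Suc n)" by simp
  then have "\<not> (ALL x:G. (abs (x - xi)) < 1 / real (Suc n) --> (EX U:roots xi. dist (v x) U < e))" using neg by blast
  then show ?thesis by (meson not_less)
 qed
 then obtain x where x: "!!n. x n : G" "!!n. (abs (x n - xi)) < 1 / real (Suc n)" "!!n U. U : roots xi ==> e <= dist (v (x n)) U"
  by metis
 have xl: "x \<longlonglongrightarrow> xi"
 proof (rule LIMSEQ_I)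
  fix r :: real assume "0 < r"
  then obtain N where "1 / real (Suc N) < r" using nat_approx_posE by blast
  then have "norm (x n - xi) < r" if "N <= n" for n
   using x(2)[of n] that frac_le[of 1 1 "real (Suc N)" "real (Suc n)"] by simp
  then show "EX no. ALL n>=no. norm (x n - xi) < r" by blast
 qed
 obtain U s where U: "U : K" "strict_mono s" "((%n. v (x n)) \<circ> s) \<longlonglongrightarrow> U"
  using K(1) vK unfolding compact_def by metis
 have xs: "(%n. x (s n)) \<longlonglongrightarrow> xi" using LIMSEQ_subseq_LIMSEQ[OF xl U(2)] by (simp add: o_def)
 have "((%n. ray_flux (x (s n)) (v (x (s n)))) \<longlonglongrightarrow> ray_flux xi U)"
 proof -
  have "((%n. (x (s n), v (x (s n)))) \<longlonglongrightarrow> (xi, U))" using xs U(3) by (auto intro: tendsto_Pair simp: o_def)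
  moreover have "(xi, U) : UNIV \<times> states" using U(1) K(3) by auto
  moreover have "\<forall>\<^sub>F n in sequentially. (x (s n), v (x (s n))) : UNIV \<times> states"
   using vK K(3) by (intro always_eventually) auto
  ultimately show ?thesis
   using continuous_on_tendsto_compose[OF ray_flux_continuous_on, of "%n. (x (s n), v (x (s n)))" "(xi, U)"]
   by simp
 qed
 moreover have "(%n. ray_flux (x (s n)) (v (x (s n)))) \<longlonglongrightarrow> Flux xi"
  using isCont_tendsto_compose[OF Flux_isCont xs] x(1) by (simp add: Flux_eq)
 ultimately have "ray_flux xi U = Flux xi" by (rule LIMSEQ_unique)
 then have "U : roots xi" using U(1) by (simp add: roots_def)
 then have "e <= dist (v (x (s n))) U" for n by (rule x(3))
 moreover have "(%n. dist (v (x (s n))) U) \<longlonglongrightarrow> 0" using U(3) by (simp add: tendsto_dist_iff[symmetric] o_def)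
 ultimately have "e <= 0" by (intro LIMSEQ_le_const) auto
 then show False using assms by simp
qed

lemma roots_nonempty: "roots xi ~= {}"
proof -
 obtain h where h: "0 < h" "ALL x:G. (abs (x - xi)) < h --> (EX U:roots xi. dist (v x) U < 1)" using near_roots[of 1 xi] by auto
 obtain x where "x : G" "xi < x" "x < xi + h" using G_dense[of xi "xi + h"] h(1) by auto
 then show ?thesis using h(2) by fastforce
qed

lemma roots_cases:
 assumes "U : roots xi" "V : roots xi" "Flux xi $ 1 ~= 0"
 obtains "U = V" | "U $ 1 < V $ 1" "sonic xi U < 0" "0 < sonic xi V" "bernoulli V < bernoulli U"
  | "V $ 1 < U $ 1" "sonic xi V < 0" "0 < sonic xi U" "bernoulli U < bernoulli V"
proof -
 have "U : states" "V : states" "ray_flux xi U = ray_flux xi V" "mass_flux xi U ~= 0"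
  using assms K(3) roots_mass_flux[OF assms(1)] by (auto simp: roots_def)
 then show thesis by (rule ray_flux_roots) (use that in blast)+
qed

text \<open>Energy may not be produced across a jump.\<close>

lemma forbidden_order:
 assumes U: "U : roots xi" and V: "V : roots xi" and less: "0 < sig * Flux xi $ 1 * (bernoulli V - bernoulli U)"
 shows "EX e>0. ALL x:G. ALL y:G. xi - e < x --> x < y --> y < xi + e --> dist (v x) U < e --> \<not> dist (v y) V < e"
proof -
 define f where "f z = sig * (mass_flux (fst z) (snd z) * bernoulli (snd z))" for z
 have fc: "continuous_on (UNIV \<times> states) f" unfolding f_def
  by (intro continuous_intros continuous_on_subset[OF mass_flux_continuous]
    continuous_on_compose2[OF bernoulli_continuous_on]) auto
 define g where "g = f (xi, V) - f (xi, U)"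
 have g: "0 < g" using less roots_mass_flux[OF U] roots_mass_flux[OF V] by (simp add: g_def f_def algebra_simps)
 have at: "EX d>0. ALL z. snd z : states --> dist z (xi, W) < d --> (abs (f z - f (xi, W))) < g / 3" if "W : roots xi" for W
 proof -
  have "(xi, W) : UNIV \<times> states" using that K(3) by (auto simp: roots_def)
  then obtain d where "0 < d" "ALL z:UNIV \<times> states. dist z (xi, W) < d --> dist (f z) (f (xi, W)) < g / 3"
   using fc g unfolding continuous_on_iff by (metis divide_pos_pos zero_less_numeral)
  then show ?thesis by (intro exI[of _ d]) (auto simp: dist_real_def mem_Times_iff)
 qed
 obtain d1 where d1: "0 < d1" "!!z. snd z : states ==> dist z (xi, U) < d1 ==> (abs (f z - f (xi, U))) < g / 3"
  using at[OF U] by blast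
 obtain d2 where d2: "0 < d2" "!!z. snd z : states ==> dist z (xi, V) < d2 ==> (abs (f z - f (xi, V))) < g / 3"
  using at[OF V] by blast
 obtain C where C: "0 < C" "!!x y. x : G ==> y : G ==> x < y ==> f (y, v y) - f (x, v x) <= C * (y - x)"
  using energy_law unfolding f_def by (metis fst_conv snd_conv)
 obtain e where e: "0 < e" "2 * e <= d1" "2 * e <= d2" "2 * C * e <= g / 3"
 proof -
  define e where "e = min (d1 / 2) (min (d2 / 2) (g / (6 * C)))"
  have le: "e <= d1 / 2" "e <= d2 / 2" "e <= g / (6 * C)" by (auto simp: e_def)
  have "2 * C * e <= g / 3" using le(3) C(1) by (simp add: field_simps)
  moreover have "0 < e" using d1(1) d2(1) C(1) g by (simp add: e_def)
  ultimately show thesis using le by (intro that[of e]) auto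
 qed
 have pd: "dist (x, W) (xi, W') < 2 * e" if "(abs (x - xi)) < e" "dist W W' < e" for x and W W' :: state
  using sqrt_sum_squares_le_sum[OF zero_le_dist[of x xi] zero_le_dist[of W W']] that unfolding dist_Pair_Pair dist_real_def by linarith
 show ?thesis
 proof (intro exI[of _ e] conjI ballI impI notI e(1))
  fix x y assume xy: "x : G" "y : G" "xi - e < x" "x < y" "y < xi + e" "dist (v x) U < e" "dist (v y) V < e"
  have ab: "(abs (x - xi)) < e" "(abs (y - xi)) < e" using xy(3-5) by arith+
  have 1: "(abs (f (x, v x) - f (xi, U))) < g / 3"
   using pd[OF ab(1) xy(6)] e vK[of x] K(3) by (intro d1(2)) auto
  have 2: "(abs (f (y, v y) - f (xi, V))) < g / 3"
   using pd[OF ab(2) xy(7)] e vK[of y] K(3) by (intro d2(2)) auto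
  have 3: "C * (y - x) <= C * (2 * e)" using xy C(1) by (intro mult_left_mono) auto
  have "f (x, v x) < f (xi, U) + g / 3" using 1 by linarith
  moreover have "f (xi, V) - g / 3 < f (y, v y)" using 2 by linarith
  moreover have "f (xi, V) - f (xi, U) = g" by (simp add: g_def)
  ultimately show False using C(2)[OF xy(1,2,4)] e(4) 3 by linarith
 qed
qed

text \<open>Near a non-sonic root the flux determines the state with a Lipschitz bound, so the oscillation
 over an interval is at most a small multiple of itself.\<close>

lemma locally_constant_near:
 assumes U: "U : states" and N: "mass_flux xi U ~= 0" and S: "sonic xi U ~= 0"
 shows "EX e>0. ALL a b. xi - e < a --> b < xi + e --> (ALL x:G. a < x --> x < b --> dist (v x) U < e) -->
   (ALL x:G. ALL y:G. a < x --> x < b --> a < y --> y < b --> v x = v y)"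
proof -
 obtain d e0 where d: "0 < d" "0 < e0" "ball U e0 \<subseteq> states"
  "!!t x y. (abs (t - xi)) < e0 ==> x : ball U e0 ==> y : ball U e0 ==> d * norm (x - y) <= norm (ray_flux t x - ray_flux t y)"
  using strict_bounded_below[OF open_states U ray_flux_has_derivative dray_flux_isCont[OF U]
    dray_flux_injective[OF U N S]] by blast
 obtain L where L: "0 < L" "!!U V. U : K ==> V : K ==> norm (flux_x p U - flux_x p V) <= L * norm (U - V)"
  using flux_x_lipschitz[OF K] by blast
 define e where "e = min e0 (d / (12 * L))"
 have "e <= d / (12 * L)" by (simp add: e_def)
 then have "12 * L * e <= d" using L(1) by (simp add: field_simps)
 then have e: "0 < e" "e <= e0" "12 * L * e <= d" using d(1,2) L(1) by (auto simp: e_def)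
 show ?thesis
 proof (intro exI[of _ e] conjI allI impI e(1) ballI)
  fix a b x y
  assume a: "xi - e < a" and b: "b < xi + e" and near: "ALL x:G. a < x --> x < b --> dist (v x) U < e"
   and x: "x : G" "a < x" "x < b" and y: "y : G" "a < y" "y < b"
  text \<open>Each application of the bound halves the oscillation.\<close>
  have step: "norm (v y - v x) <= B / 2"
   if xy: "x : G" "a < x" "x < b" "y : G" "a < y" "y < b" "x < y"
    and B: "!!x y. x : G ==> a < x ==> x < b ==> y : G ==> a < y ==> y < b ==> norm (v y - v x) <= B" for x y B
  proof -
   have B0: "0 <= B" using B[of x x] xy by simp
   have ci: "(abs ((ray_flux y (v y) - ray_flux y (v x)) $ i)) <= L * B * (y - x)" for i
   proof -
    let ?F = "%s. flux_x p (v s) $ i"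
    have Fi: "?F integrable_on {x..y}" by (rule profile_integrable[OF flux_nth_continuous])
    have "(ray_flux y (v y) - ray_flux y (v x)) $ i = (Flux y - Flux x) $ i + (y - x) * ?F x"
     unfolding ray_flux_change[of y "v x" x] using Flux_eq xy by simp
    also have "... = - integral {x..y} (%s. ?F s - ?F x)"
     using xy Flux_diff[of x y i] by (simp add: Henstock_Kurzweil_Integration.integral_diff[OF Fi integrable_const_ivl])
    finally have eq: "(ray_flux y (v y) - ray_flux y (v x)) $ i = - integral {x..y} (%s. ?F s - ?F x)" .
    define F' where "F' s = (if s : G then ?F s - ?F x else 0)" for s
    have neg: "negligible (- G)"
    proof -
     obtain Z where Z: "{x. x \<notin> G} \<subseteq> Z" "Z : null_sets lborel" using G unfolding eventually_ae_filter by auto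
     then have "negligible Z" by (simp add: negligible_iff_null_sets null_sets_completionI)
     then show ?thesis by (rule negligible_subset) (use Z(1) in auto)
    qed
    have "norm (integral {x..y} (%s. ?F s - ?F x)) <= L * B * (y - x)"
    proof -
     have 1: "((%s. ?F s - ?F x) has_integral integral {x..y} (%s. ?F s - ?F x)) {x..y}"
      using Fi by (intro integrable_integral integrable_diff) auto
     have 2: "(F' has_integral integral {x..y} (%s. ?F s - ?F x)) {x..y}"
      by (rule has_integral_spike[OF neg _ 1]) (auto simp: F'_def)
     have 3: "norm (F' s) <= L * B" if s: "s : {x..y}" for s
     proof (cases "s : G")
      case True
      have "(abs (?F s - ?F x)) <= norm (flux_x p (v s) - flux_x p (v x))"
       using component_le_norm_cart[of "flux_x p (v s) - flux_x p (v x)" i] by simp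
      also have "... <= L * norm (v s - v x)" by (rule L(2)[OF vK vK])
      also have "... <= L * B" using B[of x s] True s xy L(1) by (intro mult_left_mono) auto
      finally show ?thesis using True by (simp add: F'_def)
     next
      case False
      then show ?thesis using L(1) B0 by (simp add: F'_def)
     qed
     show ?thesis
      using has_integral_bound_real[OF _ finite.emptyI 2, of "L * B"] 3 L(1) B0 xy by simp
    qed
    then show ?thesis using eq by simp
   qed
   have "d * norm (v y - v x) <= norm (ray_flux y (v y) - ray_flux y (v x))"
    using xy a b e near by (intro d(4)) (auto simp: dist_commute)
   also have "... <= 3 * (L * B * (y - x))"
    using norm_le_3[of "ray_flux y (v y) - ray_flux y (v x)"] ci[of 1] ci[of 2] ci[of 3] by linarith
   also have "... <= 3 * (L * B * (2 * e))" using xy a b L(1) B0 by (intro mult_left_mono) auto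
   also have "... = (12 * L * e) * (B / 2)" by simp
   also have "... <= d * (B / 2)" using e(3) B0 by (intro mult_right_mono) auto
   finally show ?thesis using d(1) by simp
  qed
  have bound: "norm (v y - v x) <= 2 * e / 2 ^ n" if "x : G" "a < x" "x < b" "y : G" "a < y" "y < b" for n x y
   using that
  proof (induction n arbitrary: x y)
   case 0
   have "dist (v y) (v x) <= dist (v y) U + dist (v x) U" by (rule dist_triangle2)
   moreover have "dist (v x) U < e" "dist (v y) U < e" using near 0 by blast+
   ultimately show ?case by (simp add: dist_norm)
  next
   case (Suc n)
   have half: "norm (v y - v x) <= 2 * e / 2 ^ n / 2" if "x < y" "x : G" "a < x" "x < b" "y : G" "a < y" "y < b" for x y
    by (rule step[OF that(2-7,1)]) (rule Suc.IH)
   then have "norm (v y - v x) <= 2 * e / 2 ^ n / 2"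
    using Suc.prems e(1) half[of x y] half[of y x]
    by (cases x y rule: linorder_cases) (auto simp: norm_minus_commute)
   then show ?case by (simp add: field_simps)
  qed
  have "(%n. 2 * e / 2 ^ n) \<longlonglongrightarrow> 0"
   using LIMSEQ_divide_realpow_zero[of 2 "2 * e"] by simp
  then have "norm (v y - v x) <= 0" by (rule LIMSEQ_le_const) (use bound[OF x y] in auto)
  then show "v x = v y" by simp
 qed
qed

end

context ray_profile begin

lemma roots_eq_singleton:
 assumes "Flux xi $ 1 ~= 0" "U : roots xi" "sonic xi U = 0"
 shows "roots xi = {U}"
proof -
 have "V = U" if "V : roots xi" for V
  by (rule roots_cases[OF assms(2) that assms(1)]) (use assms(3) in auto)
 then show ?thesis using assms(2) by blast
qed

lemma roots_alternative:
 assumes N: "Flux xi $ 1 ~= 0"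
 obtains c where "roots xi = {c}"
 | U V where "roots xi = {U, V}" "U ~= V" "0 < sig * Flux xi $ 1 * (bernoulli V - bernoulli U)"
proof -
 obtain c where c: "c : roots xi" using roots_nonempty by blast
 show thesis
 proof (cases "EX d:roots xi. d ~= c")
  case False
  then show ?thesis using c that(1)[of c] by blast
 next
  case True
  then obtain d where d: "d : roots xi" "d ~= c" by blast
  have two: "roots xi = {c, d}"
  proof -
   have False if e: "e : roots xi" "e ~= c" "e ~= d" for e
    by (rule roots_cases[OF c d(1) N]; rule roots_cases[OF c e(1) N]; rule roots_cases[OF d(1) e(1) N])
      (use d(2) e in auto)
   then show ?thesis using c d(1) by blast
  qed
  have "bernoulli c ~= bernoulli d" by (rule roots_cases[OF c d(1) N]) (use d(2) in auto)
  then have "sig * Flux xi $ 1 * (bernoulli d - bernoulli c) ~= 0" using N sig by auto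
  then consider "0 < sig * Flux xi $ 1 * (bernoulli d - bernoulli c)" | "0 < sig * Flux xi $ 1 * (bernoulli c - bernoulli d)"
   by (smt (verit) minus_diff_eq mult_minus_right)
  then show ?thesis
  proof cases
   case 1 then show ?thesis using that(2)[of c d] two d(2) by blast
  next
   case 2 then show ?thesis using that(2)[of d c] two d(2) by (simp add: insert_commute)
  qed
 qed
qed

lemma constant_value_is_root:
 assumes a: "a < b" and c: "ALL x:G. a < x --> x < b --> v x = c" and xi: "xi : {a..b}"
 shows "c : roots xi"
proof -
 obtain x0 where "x0 : G" "a < x0" "x0 < b" using G_dense[OF a] by blast
 then have cK: "c : K" using c vK by metis
 define f where "f x = ray_flux x c - Flux x" for x
 have fc: "isCont f x" for x unfolding f_def ray_flux_def by (intro continuous_intros Flux_isCont)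
 have "f xi = 0"
 proof (rule ccontr)
  assume "f xi ~= 0"
  then obtain e where e: "0 < e" "ALL y. dist xi y < e --> f y ~= 0" using continuous_at_avoid[OF fc] by blast
  have "max a (xi - e) < min b (xi + e)" using a xi e(1) by auto
  then obtain x where "x : G" "max a (xi - e) < x" "x < min b (xi + e)" using G_dense by blast
  then have "f x = 0" "dist xi x < e" using c Flux_eq by (auto simp: f_def dist_real_def)
  then show False using e(2) by blast
 qed
 then show ?thesis using cK by (simp add: roots_def f_def)
qed

text \<open>Where no root is sonic the profile is constant on both sides: the roots are isolated, so close
 to the ray every value is close to one of at most two states, and these can alternate only in the one
 order which does not produce energy.\<close>

lemma piecewise_constant_at:
 assumes N: "Flux xi $ 1 ~= 0" and S: "ALL U:roots xi. sonic xi U ~= 0"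
 shows "EX h>0. EX cl:roots xi. EX cr:roots xi. (ALL x:G. xi - h < x --> x < xi --> v x = cl) &
   (ALL x:G. xi < x --> x < xi + h --> v x = cr) & \<not> 0 < sig * Flux xi $ 1 * (bernoulli cr - bernoulli cl)"
proof -
 define P where "P U e \<longleftrightarrow> 0 < e & (ALL a b. xi - e < a --> b < xi + e --> (ALL x:G. a < x --> x < b --> dist (v x) U < e) -->
   (ALL x:G. ALL y:G. a < x --> x < b --> a < y --> y < b --> v x = v y))" for U e
 have "EX e. P U e" if "U : roots xi" for U
  unfolding P_def by (rule locally_constant_near) (use that S N roots_mass_flux K(3) in \<open>auto simp: roots_def\<close>)
 then have "ALL U:roots xi. EX e. P U e" by (rule ballI)
 from bchoice[OF this] obtain E where PE: "ALL U:roots xi. P U (E U)" by (rule exE)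
 have E1: "0 < E U" if "U : roots xi" for U
  using PE[rule_format, OF that] unfolding P_def by (rule conjunct1)
 have E2: "v x = v y" if "U : roots xi" "xi - E U < a" "b < xi + E U" "ALL x:G. a < x --> x < b --> dist (v x) U < E U"
   "x : G" "y : G" "a < x" "x < b" "a < y" "y < b" for U a b x y
 proof -
  have "ALL a b. xi - E U < a --> b < xi + E U --> (ALL x:G. a < x --> x < b --> dist (v x) U < E U) -->
    (ALL x:G. ALL y:G. a < x --> x < b --> a < y --> y < b --> v x = v y)"
   using PE[rule_format, OF that(1)] unfolding P_def by (rule conjunct2)
  from this[THEN spec, THEN spec, THEN mp, OF that(2), THEN mp, OF that(3), THEN mp, OF that(4),
    THEN bspec, OF that(5), THEN bspec, OF that(6), THEN mp, OF that(7), THEN mp, OF that(8), THEN mp, OF that(9), THEN mp, OF that(10)]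
  show ?thesis .
 qed
 note E = E1 E2
 have const: "EX h>0. EX c:roots xi. ALL x:G. xi < x --> x < xi + h --> v x = c"
  if U: "U : roots xi" and h: "0 < h" "ALL x:G. xi < x --> x < xi + h --> dist (v x) U < E U" for U h
 proof -
  define k where "k = min h (E U / 2)"
  have k: "0 < k" "k <= h" "k < E U" using h(1) E(1)[OF U] by (auto simp: k_def)
  obtain x0 where x0: "x0 : G" "xi < x0" "x0 < xi + k" using G_dense[of xi "xi + k"] k(1) by auto
  have eq: "ALL x:G. xi < x --> x < xi + k --> v x = v x0"
  proof (intro ballI impI)
   fix x assume x: "x : G" "xi < x" "x < xi + k"
   have "ALL x:G. xi < x --> x < xi + k --> dist (v x) U < E U" using h(2) k(2) by auto
   then show "v x = v x0"
    by (rule E2[OF U _ _ _ x(1) x0(1) x(2,3) x0(2,3), rotated 2]) (use k E1[OF U] in auto)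
  qed
  have "v x0 : roots xi" by (rule constant_value_is_root[OF _ eq]) (use k in auto)
  then show ?thesis using eq k(1) by blast
 qed
 have const': "EX h>0. EX c:roots xi. ALL x:G. xi - h < x --> x < xi --> v x = c"
  if U: "U : roots xi" and h: "0 < h" "ALL x:G. xi - h < x --> x < xi --> dist (v x) U < E U" for U h
 proof -
  define k where "k = min h (E U / 2)"
  have k: "0 < k" "k <= h" "k < E U" using h(1) E(1)[OF U] by (auto simp: k_def)
  obtain x0 where x0: "x0 : G" "xi - k < x0" "x0 < xi" using G_dense[of "xi - k" xi] k(1) by auto
  have eq: "ALL x:G. xi - k < x --> x < xi --> v x = v x0"
  proof (intro ballI impI)
   fix x assume x: "x : G" "xi - k < x" "x < xi"
   have "ALL x:G. xi - k < x --> x < xi --> dist (v x) U < E U" using h(2) k(2) by auto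
   then show "v x = v x0"
    by (rule E2[OF U _ _ _ x(1) x0(1) x(2,3) x0(2,3), rotated 2]) (use k E1[OF U] in auto)
  qed
  have "v x0 : roots xi" by (rule constant_value_is_root[OF _ eq]) (use k in auto)
  then show ?thesis using eq k(1) by blast
 qed
 have "(EX h>0. EX c:roots xi. ALL x:G. xi < x --> x < xi + h --> v x = c) &
   (EX h>0. EX c:roots xi. ALL x:G. xi - h < x --> x < xi --> v x = c)"
 proof (rule roots_alternative[OF N])
  fix c assume c: "roots xi = {c}"
  obtain h where h: "0 < h" "ALL x:G. (abs (x - xi)) < h --> (EX U:roots xi. dist (v x) U < E c)"
   using near_roots[OF E(1)] c by blast
  then show ?thesis using const[of c h] const'[of c h] c by auto
 next
  fix U V assume UV: "roots xi = {U, V}" "U ~= V" and forb: "0 < sig * Flux xi $ 1 * (bernoulli V - bernoulli U)"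
  obtain e0 where e0: "0 < e0" "!!x y. x : G ==> y : G ==> xi - e0 < x ==> x < y ==> y < xi + e0 ==> dist (v x) U < e0 ==> \<not> dist (v y) V < e0"
   using forbidden_order[OF _ _ forb] UV(1) by blast
  define e where "e = min e0 (min (E U) (E V))"
  have e: "0 < e" "e <= e0" "e <= E U" "e <= E V" using e0(1) E(1) UV(1) by (auto simp: e_def)
  obtain h1 where h1: "0 < h1" "ALL x:G. (abs (x - xi)) < h1 --> (EX W:roots xi. dist (v x) W < e)"
   using near_roots[OF e(1)] by blast
  define h where "h = min h1 e"
  have h: "0 < h" "h <= e" "!!x. x : G ==> (abs (x - xi)) < h ==> dist (v x) U < e \<or> dist (v x) V < e"
   using h1 e(1) UV(1) by (auto simp: h_def)
  have no: False if "x : G" "y : G" "xi - h < x" "x < y" "y < xi + h" "dist (v x) U < e" "dist (v y) V < e" for x y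
   using e0(2)[of x y] that h(2) e(2) by auto
  have R: "EX h>0. EX c:roots xi. ALL x:G. xi < x --> x < xi + h --> v x = c"
  proof (cases "EX k>0. k <= h & (ALL x:G. xi < x --> x < xi + k --> dist (v x) V < e)")
   case True
   then obtain k where "0 < k" "ALL x:G. xi < x --> x < xi + k --> dist (v x) V < E V"
    using e(4) by (meson less_le_trans)
   then show ?thesis using const[of V k] UV(1) by auto
  next
   case False
   have "dist (v y) U < E U" if y: "y : G" "xi < y" "y < xi + h" for y
   proof -
    obtain x where x: "x : G" "xi < x" "x < xi + (y - xi)" "\<not> dist (v x) V < e"
    proof -
     have "0 < y - xi" "y - xi <= h" using y by auto
     then show thesis using False that by blast
    qed
    then have "dist (v x) U < e" using h(3)[of x] y by auto
    then have "\<not> dist (v y) V < e" using no[of x y] x y h(1) by auto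
    then show ?thesis using h(3)[of y] y e(3) by auto
   qed
   then show ?thesis using const[of U h] UV(1) h(1) by auto
  qed
  have L: "EX h>0. EX c:roots xi. ALL x:G. xi - h < x --> x < xi --> v x = c"
  proof (cases "EX k>0. k <= h & (ALL x:G. xi - k < x --> x < xi --> dist (v x) U < e)")
   case True
   then obtain k where "0 < k" "ALL x:G. xi - k < x --> x < xi --> dist (v x) U < E U"
    using e(3) by (meson less_le_trans)
   then show ?thesis using const'[of U k] UV(1) by auto
  next
   case False
   have "dist (v y) V < E V" if y: "y : G" "xi - h < y" "y < xi" for y
   proof -
    have "0 < xi - y" "xi - y <= h" using y by auto
    then obtain x where x: "x : G" "xi - (xi - y) < x" "x < xi" "\<not> dist (v x) U < e" using False by blast
    then have "dist (v x) V < e" using h(3)[of x] y by auto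
    then have "\<not> dist (v y) U < e" using no[of y x] x y h(1) by auto
    then show ?thesis using h(3)[of y] y e(4) by auto
   qed
   then show ?thesis using const'[of V h] UV(1) h(1) by auto
  qed
  show ?thesis using L R by blast
 qed
 then obtain h1 cr h2 cl where 1: "0 < h1" "cr : roots xi" "ALL x:G. xi < x --> x < xi + h1 --> v x = cr"
  "0 < h2" "cl : roots xi" "ALL x:G. xi - h2 < x --> x < xi --> v x = cl" by blast
 have nf: "\<not> 0 < sig * Flux xi $ 1 * (bernoulli cr - bernoulli cl)"
 proof
  assume "0 < sig * Flux xi $ 1 * (bernoulli cr - bernoulli cl)"
  from forbidden_order[OF 1(5,2) this] obtain e where e: "0 < e"
   "ALL x:G. ALL y:G. xi - e < x --> x < y --> y < xi + e --> dist (v x) cl < e --> \<not> dist (v y) cr < e" by blast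
  obtain x where x: "x : G" "max (xi - e) (xi - h2) < x" "x < xi" using G_dense[of "max (xi - e) (xi - h2)" xi] e(1) 1(4) by auto
  obtain y where y: "y : G" "xi < y" "y < min (xi + e) (xi + h1)" using G_dense[of xi "min (xi + e) (xi + h1)"] e(1) 1(1) by auto
  have vx: "v x = cl" using 1(6) x by auto
  have vy: "v y = cr" using 1(3) y by auto
  have "\<not> dist (v y) cr < e"
   using e(2)[THEN bspec, OF x(1), THEN bspec, OF y(1)] x(2,3) y(2,3) e(1) vx by auto
  then show False using e(1) vy by simp
 qed
 show ?thesis
  by (intro exI[of _ "min h1 h2"] conjI bexI[OF _ 1(5)] bexI[OF _ 1(2)] nf) (use 1 in auto)
qed

text \<open>The representative with limits from the right.\<close>

definition w :: "real => state" where
 "w xi = Lim (at xi within (G \<inter> {xi<..})) v"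

lemma right_nontrivial: "at xi within (G \<inter> {xi<..}) ~= bot"
 unfolding trivial_limit_within islimpt_approachable not_not
proof (intro allI impI)
 fix e :: real assume "0 < e"
 then obtain x where "x : G" "xi < x" "x < xi + e" using G_dense[of xi "xi + e"] by auto
 then show "EX x':G \<inter> {xi<..}. x' ~= xi & dist x' xi < e"
  by (intro bexI[of _ x]) (auto simp: dist_real_def)
qed

lemma w_eqI: "(v \<longlongrightarrow> c) (at xi within (G \<inter> {xi<..})) ==> w xi = c"
 unfolding w_def by (rule tendsto_Lim[OF right_nontrivial])

lemma w_constant:
 assumes c: "ALL x:G. a < x --> x < b --> v x = c" and x: "a <= x" "x < b"
 shows "w x = c"
proof (rule w_eqI, rule tendsto_eventually)
 show "\<forall>\<^sub>F y in at x within (G \<inter> {x<..}). v y = c"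
  unfolding eventually_at using c x by (intro exI[of _ "b - x"]) (auto simp: dist_real_def)
qed

lemma v_tendsto_sonic:
 assumes N: "Flux xi $ 1 ~= 0" and U: "U : roots xi" "sonic xi U = 0" and e: "0 < e"
 shows "EX h>0. ALL x:G. (abs (x - xi)) < h --> dist (v x) U < e"
 using near_roots[OF e, of xi] roots_eq_singleton[OF N U] by auto

lemma w_limit:
 assumes N: "Flux xi $ 1 ~= 0"
 shows "(v \<longlongrightarrow> w xi) (at xi within (G \<inter> {xi<..}))" "w xi : roots xi"
proof -
 have "EX c:roots xi. (v \<longlongrightarrow> c) (at xi within (G \<inter> {xi<..}))"
 proof (cases "ALL U:roots xi. sonic xi U ~= 0")
  case True
  from piecewise_constant_at[OF N True] obtain h cr where "0 < h" "cr : roots xi"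
   and c: "ALL x:G. xi < x --> x < xi + h --> v x = cr" by (elim exE conjE bexE)
  moreover have "(v \<longlongrightarrow> cr) (at xi within (G \<inter> {xi<..}))"
   by (rule tendsto_eventually) (use c \<open>0 < h\<close> in \<open>auto simp: eventually_at dist_real_def intro!: exI[of _ h]\<close>)
  ultimately show ?thesis by blast
 next
  case False
  then obtain U where U: "U : roots xi" "sonic xi U = 0" by blast
  have "(v \<longlongrightarrow> U) (at xi within (G \<inter> {xi<..}))"
  proof (rule tendstoI)
   fix e :: real assume "0 < e"
   from v_tendsto_sonic[OF N U this] obtain h where "0 < h" "ALL x:G. (abs (x - xi)) < h --> dist (v x) U < e" by blast
   then show "\<forall>\<^sub>F x in at xi within (G \<inter> {xi<..}). dist (v x) U < e"
    unfolding eventually_at by (auto simp: dist_real_def)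
  qed
  then show ?thesis using U(1) by blast
 qed
 then obtain c where c: "c : roots xi" "(v \<longlongrightarrow> c) (at xi within (G \<inter> {xi<..}))" by blast
 then show "(v \<longlongrightarrow> w xi) (at xi within (G \<inter> {xi<..}))" "w xi : roots xi" using w_eqI by auto
qed

text \<open>At a sonic root the two roots have merged, so nearby values have only one limit.\<close>

lemma w_continuous_at_sonic:
 assumes N: "Flux xi $ 1 ~= 0" and S: "sonic xi (w xi) = 0"
 shows "isCont w xi"
 unfolding continuous_at_eps_delta
proof (intro allI impI)
 fix e :: real assume e: "0 < e"
 have "isCont (%x. Flux x $ 1) xi" by (intro continuous_intros Flux_isCont)
 from continuous_at_avoid[OF this N] obtain k where k: "0 < k" "ALL y. dist xi y < k --> Flux y $ 1 ~= 0" by blast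
 obtain h where h: "0 < h" "ALL x:G. (abs (x - xi)) < h --> dist (v x) (w xi) < e / 2"
  using v_tendsto_sonic[OF N w_limit(2)[OF N] S, of "e / 2"] e by auto
 show "EX d>0. ALL x'. dist x' xi < d --> dist (w x') (w xi) < e"
 proof (intro exI[of _ "min h k"] conjI allI impI)
  fix y assume y: "dist y xi < min h k"
  then have "Flux y $ 1 ~= 0" using k(2) by (auto simp: dist_commute)
  from w_limit(1)[OF this] have lim: "(v \<longlongrightarrow> w y) (at y within (G \<inter> {y<..}))" .
  have "dist (w y) (w xi) <= e / 2"
  proof (rule tendsto_upperbound[OF tendsto_dist[OF lim tendsto_const] _ right_nontrivial])
   have d: "0 < h - (abs (y - xi))" using y by (auto simp: dist_real_def)
   show "\<forall>\<^sub>F x in at y within (G \<inter> {y<..}). dist (v x) (w xi) <= e / 2"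
    unfolding eventually_at
   proof (intro exI[of _ "h - (abs (y - xi))"] conjI d ballI impI)
    fix x assume "x : G \<inter> {y<..}" "x ~= y & dist x y < h - (abs (y - xi))"
    then have "x : G" "(abs (x - xi)) < h" by (auto simp: dist_real_def)
    then show "dist (v x) (w xi) <= e / 2" using h(2) by force
   qed
  qed
  then show "dist (w y) (w xi) < e" using e by simp
 qed (use h k in auto)
qed

lemma w_piecewise_constant:
 assumes N: "Flux xi $ 1 ~= 0" and S: "sonic xi (w xi) ~= 0"
 shows "EX h>0. EX cl:roots xi. (ALL x. xi - h < x --> x < xi --> w x = cl) & (ALL x. xi <= x --> x < xi + h --> w x = w xi) &
   \<not> 0 < sig * Flux xi $ 1 * (bernoulli (w xi) - bernoulli cl) &
   (ALL x:G. xi - h < x --> x < xi --> v x = cl) & (ALL x:G. xi < x --> x < xi + h --> v x = w xi)"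
proof -
 have "ALL U:roots xi. sonic xi U ~= 0"
 proof (intro ballI notI)
  fix U assume "U : roots xi" "sonic xi U = 0"
  from roots_eq_singleton[OF N this] have "w xi = U" using w_limit(2)[OF N] by simp
  with S \<open>sonic xi U = 0\<close> show False by simp
 qed
 from piecewise_constant_at[OF N this] obtain h cl cr where h: "0 < h" "cl : roots xi" "cr : roots xi"
  and l: "ALL x:G. xi - h < x --> x < xi --> v x = cl" and r: "ALL x:G. xi < x --> x < xi + h --> v x = cr"
  and nf: "\<not> 0 < sig * Flux xi $ 1 * (bernoulli cr - bernoulli cl)" by (elim exE conjE bexE)
 have wr: "w x = cr" if "xi <= x" "x < xi + h" for x by (rule w_constant[OF r that])
 have wl: "w x = cl" if "xi - h < x" "x < xi" for x by (rule w_constant[OF l]) (use that in auto)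
 have "w xi = cr" by (rule wr) (use h in auto)
 show ?thesis unfolding \<open>w xi = cr\<close>
 proof (intro exI conjI)
  show "0 < h" by (rule h(1))
  show "EX cl:roots xi. (ALL x. xi - h < x --> x < xi --> w x = cl) & (ALL x. xi <= x --> x < xi + h --> w x = cr) &
    \<not> 0 < sig * Flux xi $ 1 * (bernoulli cr - bernoulli cl) &
    (ALL x:G. xi - h < x --> x < xi --> v x = cl) & (ALL x:G. xi < x --> x < xi + h --> v x = cr)"
   by (rule bexI[OF _ h(2)], intro conjI allI impI nf l r; (rule wl wr; assumption))
 qed
qed

lemma w_AE_eq: "AE xi in lborel. Flux xi $ 1 ~= 0 --> w xi = v xi"
proof -
 define B where "B = {xi : G. Flux xi $ 1 ~= 0 & w xi ~= v xi}"
 have "EX U. openin (top_of_set B) U & xi : U & negligible U" if xi: "xi : B" for xi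
 proof -
  have N: "Flux xi $ 1 ~= 0" and G: "xi : G" "w xi ~= v xi" using xi by (auto simp: B_def)
  have "v xi : roots xi" using Flux_eq[OF G(1)] vK by (simp add: roots_def)
  then have "sonic xi (w xi) ~= 0" using roots_eq_singleton[OF N w_limit(2)[OF N]] G(2) by auto
  from w_piecewise_constant[OF N this] obtain h cl where h: "0 < h"
   "ALL x. xi - h < x --> x < xi --> w x = cl" "ALL x. xi <= x --> x < xi + h --> w x = w xi"
   "ALL x:G. xi - h < x --> x < xi --> v x = cl" "ALL x:G. xi < x --> x < xi + h --> v x = w xi" by (elim exE conjE bexE)
  have hl: "w x = v x" if "x : G" "xi - h < x" "x < xi" for x
   using h(2)[rule_format, OF that(2,3)] h(4)[rule_format, OF that] by simp
  have hr: "w x = v x" if "x : G" "xi < x" "x < xi + h" for x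
   using h(3)[rule_format, OF less_imp_le[OF that(2)] that(3)] h(5)[rule_format, OF that] by simp
  have "B \<inter> ball xi h \<subseteq> {xi}"
  proof
   fix x assume x: "x : B \<inter> ball xi h"
   then have "x : G" "w x ~= v x" "xi - h < x" "x < xi + h" by (auto simp: B_def dist_real_def)
   then show "x : {xi}" using hl[of x] hr[of x] by (cases x xi rule: linorder_cases) auto
  qed
  then have "negligible (B \<inter> ball xi h)" using negligible_sing negligible_subset by blast
  moreover have "openin (top_of_set B) (B \<inter> ball xi h)" by (rule openin_open_Int) simp
  ultimately show ?thesis using xi h(1) by (intro exI[of _ "B \<inter> ball xi h"]) auto
 qed
 then have "negligible B" using locally_negligible_alt by blast
 then have "AE xi in lebesgue. xi \<notin> B" by (simp add: negligible_iff_null_sets AE_not_in)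
 then have "AE xi in lborel. xi \<notin> B" by (simp add: AE_completion_iff)
 with G show ?thesis by eventually_elim (auto simp: B_def)
qed

end

section \<open>Continuation along constant states\<close>

lemma real_continuation:
 fixes P :: "real => bool"
 assumes "x < Y" and start: "EX h>0. ALL z. x < z --> z < x + h --> P z"
  and step: "!!y. x < y ==> y < Y ==> (ALL z. x < z --> z < y --> P z) ==> EX h>0. ALL z. y <= z --> z < y + h --> P z"
 shows "ALL z. x < z --> z < Y --> P z"
proof (rule ccontr)
 assume "\<not> ?thesis"
 then obtain b where b: "x < b" "b < Y" "\<not> P b" by blast
 define S where "S = {z. x < z & z < Y & \<not> P z}"
 have S: "b : S" "bdd_below S" using b by (auto simp: S_def intro: bdd_belowI[of _ x])
 define y where "y = Inf S"
 obtain h where h: "0 < h" "ALL z. x < z --> z < x + h --> P z" using start by blast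
 have "x + h <= y" unfolding y_def by (rule cInf_greatest) (use S(1) h(2) in \<open>auto simp: S_def not_less[symmetric]\<close>)
 then have xy: "x < y" using h(1) by simp
 have yb: "y <= b" unfolding y_def by (rule cInf_lower[OF S])
 have below: "ALL z. x < z --> z < y --> P z"
 proof (intro allI impI, rule ccontr)
  fix z assume "x < z" "z < y" "\<not> P z"
  then have "z : S" using yb b(2) by (auto simp: S_def)
  then show False using cInf_lower[OF _ S(2), of z] \<open>z < y\<close> by (simp add: y_def)
 qed
 have "y < Y" using yb b(2) by simp
 from step[OF xy this below] obtain k where k: "0 < k" "ALL z. y <= z --> z < y + k --> P z" by blast
 have "y + k <= Inf S"
 proof (rule cInf_greatest)
  fix z assume z: "z : S"
  then have "y <= z" using cInf_lower[OF z S(2)] by (simp add: y_def)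
  then show "y + k <= z" using k(2) z by (force simp: S_def)
 qed (use S(1) in blast)
 then show False using k(1) by (simp add: y_def)
qed

lemma real_continuation_left:
 fixes P :: "real => bool"
 assumes "Y < x" and start: "EX h>0. ALL z. x - h < z --> z < x --> P z"
  and step: "!!y. Y < y ==> y < x ==> (ALL z. y < z --> z < x --> P z) ==> EX h>0. ALL z. y - h < z --> z <= y --> P z"
 shows "ALL z. Y < z --> z < x --> P z"
proof -
 have "ALL z. -x < z --> z < -Y --> P (-z)"
 proof (rule real_continuation)
  show "-x < -Y" using assms(1) by simp
  obtain h where h: "0 < h" "ALL z. x - h < z --> z < x --> P z" using start by blast
  show "EX h>0. ALL z. -x < z --> z < -x + h --> P (-z)"
   by (rule exI[of _ h]) (use h in auto)
  fix y assume y: "-x < y" "y < -Y" "ALL z. -x < z --> z < y --> P (-z)"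
  have "ALL z. -y < z --> z < x --> P z" using y(3) by (metis minus_less_iff neg_less_iff_less minus_minus)
  with step[of "-y"] y obtain h where h: "0 < h" "ALL z. -y - h < z --> z <= -y --> P z" by auto
  show "EX h>0. ALL z. y <= z --> z < y + h --> P (-z)" by (rule exI[of _ h]) (use h in auto)
 qed
 then show ?thesis by (metis minus_less_iff neg_less_iff_less minus_minus)
qed

text \<open>A function of the slope which is locally constant off the zeros of an indicator \<open>D\<close>, where \<open>D\<close>
 increases along constant states and \<open>sig D\<close> jumps upwards only. For \<open>sig = 1\<close> (and where there are no
 jumps) positivity of \<open>D\<close> therefore persists to the right and negativity to the left; for \<open>sig = -1\<close> a
 constant state next to a jump persists until \<open>D\<close> vanishes on it.\<close>

locale fan =
 fixes W :: "real => 'b::metric_space" and D :: "real => 'b => real" and b0 sig :: real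
  and K :: "'b set" and R :: "real => 'b set"
 assumes WK: "xi < b0 ==> W xi : K" and RK: "R xi \<subseteq> K"
  and D_cont: "c : K ==> isCont (%xi. D xi c) xi"
  and sonic_cont: "xi < b0 ==> D xi (W xi) = 0 ==> isCont W xi"
  and nonsonic: "xi < b0 ==> D xi (W xi) ~= 0 ==> EX h>0. EX cl:R xi. EX cr:R xi. (ALL x. xi - h < x --> x < xi --> W x = cl) &
    (ALL x. xi < x --> x < xi + h --> W x = cr) & W xi : {cl, cr} & D xi cl ~= 0 & D xi cr ~= 0 &
    (cl ~= cr --> sig * D xi cl < 0 & 0 < sig * D xi cr)"
  and D_mono: "c : K ==> x < y ==> y < b0 ==> D x c < D y c"
begin

lemma nonsonicE:
 assumes "xi < b0" "D xi (W xi) ~= 0"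
 obtains h cl cr where "0 < h" "cl : K" "cr : K" "!!x. xi - h < x ==> x < xi ==> W x = cl"
  "!!x. xi < x ==> x < xi + h ==> W x = cr" "W xi : {cl, cr}" "D xi cl ~= 0" "D xi cr ~= 0"
  "cl ~= cr ==> sig * D xi cl < 0" "cl ~= cr ==> 0 < sig * D xi cr" "cl : R xi" "cr : R xi"
proof -
 from nonsonic[OF assms] obtain h cl cr where *: "0 < h" "cl : R xi" "cr : R xi" "ALL x. xi - h < x --> x < xi --> W x = cl"
  "ALL x. xi < x --> x < xi + h --> W x = cr" "W xi : {cl, cr}" "D xi cl ~= 0" "D xi cr ~= 0"
  "cl ~= cr --> sig * D xi cl < 0 & 0 < sig * D xi cr" by (elim exE conjE bexE)
 show thesis
  by (rule that[OF *(1) _ _ *(4)[rule_format] *(5)[rule_format] *(6-8)]) (use *(2,3,9) RK in auto)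
qed

lemma isCont_left_constant:
 assumes "isCont W y" "x < y" "!!z. x < z ==> z < y ==> W z = c"
 shows "W y = c"
proof -
 have "(W \<longlongrightarrow> W y) (at_left y)" using assms(1) by (simp add: isCont_def filterlim_at_split)
 moreover have "(W \<longlongrightarrow> c) (at_left y)"
  using assms(2,3) by (intro tendsto_eventually) (auto simp: eventually_at_left intro!: exI[of _ x])
 ultimately show ?thesis by (rule tendsto_unique[OF trivial_limit_at_left_real])
qed

lemma isCont_right_constant:
 assumes "isCont W y" "y < x" "!!z. y < z ==> z < x ==> W z = c"
 shows "W y = c"
proof -
 have "(W \<longlongrightarrow> W y) (at_right y)" using assms(1) by (simp add: isCont_def filterlim_at_split)
 moreover have "(W \<longlongrightarrow> c) (at_right y)"
  using assms(2,3) by (intro tendsto_eventually) (auto simp: eventually_at_right intro!: exI[of _ x])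
 ultimately show ?thesis by (rule tendsto_unique[OF trivial_limit_at_right_real])
qed

lemma continue_right:
 assumes xY: "x < Y" "Y <= b0" and h: "0 < h" "!!z. x < z ==> z < x + h ==> W z = c"
  and D: "!!y. x < y ==> y < Y ==> D y c ~= 0 & (0 < sig * D y c \<or> isCont W y)"
 shows "x < z ==> z < Y ==> W z = c"
proof -
 have "ALL z. x < z --> z < Y --> W z = c"
 proof (rule real_continuation[OF xY(1)])
  show "EX h>0. ALL z. x < z --> z < x + h --> W z = c" using h by blast
  fix y assume y: "x < y" "y < Y" "ALL z. x < z --> z < y --> W z = c"
  have yb: "y < b0" using y xY by simp
  have nz: "D y (W y) ~= 0"
  proof
   assume "D y (W y) = 0"
   then have "W y = c" using isCont_left_constant[OF sonic_cont[OF yb] y(1)] y(3) by auto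
   then show False using \<open>D y (W y) = 0\<close> D[OF y(1,2)] by simp
  qed
  obtain k cl cr where k: "0 < k" "!!x. y - k < x ==> x < y ==> W x = cl" "!!x. y < x ==> x < y + k ==> W x = cr"
   "W y : {cl, cr}" "cl ~= cr ==> sig * D y cl < 0" using nonsonicE[OF yb nz] by metis
  define z where "z = (max x (y - k) + y) / 2"
  have z: "x < z" "z < y" "y - k < z" using k(1) y(1) by (auto simp: z_def)
  have clc: "cl = c" using k(2)[OF z(3,2)] y(3) z(1,2) by auto
  have "cl = cr"
  proof (rule ccontr)
   assume ne: "cl ~= cr"
   then have "isCont W y" using k(5) D[OF y(1,2)] clc by auto
   then have "W y = cl" "W y = cr"
    using isCont_left_constant[of y "y - k" cl] isCont_right_constant[of y "y + k" cr] k(1-3) by auto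
   then show False using ne by simp
  qed
  then show "EX h>0. ALL z. y <= z --> z < y + h --> W z = c"
   using k(1,3,4) clc by (intro exI[of _ k]) (auto simp: le_less)
 qed
 then show "x < z ==> z < Y ==> W z = c" by blast
qed

lemma continue_left:
 assumes xY: "Y < x" "x <= b0" and h: "0 < h" "!!z. x - h < z ==> z < x ==> W z = c"
  and D: "!!y. Y < y ==> y < x ==> D y c ~= 0 & (sig * D y c < 0 \<or> isCont W y)"
 shows "Y < z ==> z < x ==> W z = c"
proof -
 have "ALL z. Y < z --> z < x --> W z = c"
 proof (rule real_continuation_left[OF xY(1)])
  show "EX h>0. ALL z. x - h < z --> z < x --> W z = c" using h by blast
  fix y assume y: "Y < y" "y < x" "ALL z. y < z --> z < x --> W z = c"
  have yb: "y < b0" using y xY by simp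
  have nz: "D y (W y) ~= 0"
  proof
   assume "D y (W y) = 0"
   then have "W y = c" using isCont_right_constant[OF sonic_cont[OF yb] y(2)] y(3) by auto
   then show False using \<open>D y (W y) = 0\<close> D[OF y(1,2)] by simp
  qed
  obtain k cl cr where k: "0 < k" "!!x. y - k < x ==> x < y ==> W x = cl" "!!x. y < x ==> x < y + k ==> W x = cr"
   "W y : {cl, cr}" "cl ~= cr ==> 0 < sig * D y cr" using nonsonicE[OF yb nz] by metis
  define z where "z = (min x (y + k) + y) / 2"
  have z: "y < z" "z < x" "z < y + k" using k(1) y(2) by (auto simp: z_def)
  have crc: "cr = c" using k(3)[OF z(1,3)] y(3) z(1,2) by auto
  have "cl = cr"
  proof (rule ccontr)
   assume ne: "cl ~= cr"
   then have "isCont W y" using k(5) D[OF y(1,2)] crc by auto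
   then have "W y = cl" "W y = cr"
    using isCont_left_constant[of y "y - k" cl] isCont_right_constant[of y "y + k" cr] k(1-3) by auto
   then show False using ne by simp
  qed
  then show "EX h>0. ALL z. y - h < z --> z <= y --> W z = c"
   using k(1,2,4) crc by (intro exI[of _ k]) (auto simp: le_less)
 qed
 then show "Y < z ==> z < x ==> W z = c" by blast
qed

context
 fixes r s :: real
 assumes s: "s <= b0" and good: "!!y. r < y ==> y < s ==> 0 < sig \<or> isCont W y"
begin

lemma jump_sign:
 assumes "r < x" "x < s" "0 < h" "!!z. x - h < z ==> z < x ==> W z = cl" "!!z. x < z ==> z < x + h ==> W z = cr" "cl ~= cr"
 shows "0 < sig"
proof (rule ccontr)
 assume "\<not> 0 < sig"
 then have "isCont W x" using good assms(1,2) by blast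
 then have "W x = cl" "W x = cr"
  using isCont_left_constant[of x "x - h" cl] isCont_right_constant[of x "x + h" cr] assms(3-5) by auto
 then show False using assms(6) by simp
qed

lemma positive_persists:
 assumes x: "r < x" "x < s" "0 < D x (W x)" and y: "x <= y" "y < s"
 shows "W y = W x" "0 < D y (W y)"
proof -
 have xb: "x < b0" using x s by simp
 obtain h cl cr where h: "0 < h" "!!z. x - h < z ==> z < x ==> W z = cl" "!!z. x < z ==> z < x + h ==> W z = cr"
  "W x : {cl, cr}" "cl ~= cr ==> sig * D x cl < 0" using nonsonicE[OF xb] x(3) by (metis less_irrefl)
 have cr: "cr = W x"
 proof (cases "cl = cr")
  case False
  then have "0 < sig" using jump_sign[OF x(1,2) h(1-3)] by blast
  then have "D x cl < 0" using h(5)[OF False] by (simp add: mult_less_0_iff)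
  then show ?thesis using h(4) x(3) by auto
 qed (use h(4) in auto)
 have pos: "0 < D z (W x)" if "x <= z" "z < s" for z
  using D_mono[OF WK[OF xb], of x z] x(3) that s by (cases "x = z") auto
 show "W y = W x"
 proof (cases "x = y")
  case False
  then have "x < y" using y by simp
  show ?thesis
  proof (rule continue_right[OF _ s h(1)])
   show "x < s" by (fact x(2))
   show "W z = W x" if "x < z" "z < x + h" for z using h(3) cr that by simp
   show "D z (W x) ~= 0 & (0 < sig * D z (W x) \<or> isCont W z)" if "x < z" "z < s" for z
    using pos[of z] good[of z] that x(1) by auto
  qed (use \<open>x < y\<close> y in auto)
 qed simp
 then show "0 < D y (W y)" using pos[of y] y by simp
qed

lemma negative_persists:
 assumes x: "r < x" "x < s" "D x (W x) < 0" and y: "r < y" "y <= x"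
 shows "W y = W x" "D y (W y) < 0"
proof -
 have xb: "x < b0" using x s by simp
 obtain h cl cr where h: "0 < h" "!!z. x - h < z ==> z < x ==> W z = cl" "!!z. x < z ==> z < x + h ==> W z = cr"
  "W x : {cl, cr}" "cl ~= cr ==> 0 < sig * D x cr" using nonsonicE[OF xb] x(3) by (metis less_irrefl)
 have cl: "cl = W x"
 proof (cases "cl = cr")
  case False
  then have "0 < sig" using jump_sign[OF x(1,2) h(1-3)] by blast
  then have "0 < D x cr" using h(5)[OF False] by (simp add: zero_less_mult_iff)
  then show ?thesis using h(4) x(3) by auto
 qed (use h(4) in auto)
 have neg: "D z (W x) < 0" if "z <= x" for z
  using D_mono[OF WK[OF xb], of z x] x(3) that xb by (cases "x = z") auto
 show "W y = W x"
 proof (cases "x = y")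
  case False
  then have "y < x" using y by simp
  show ?thesis
  proof (rule continue_left[of r x h "W x" y])
   show "r < x" "x <= b0" "0 < h" using x(1) xb h(1) by auto
   show "W z = W x" if "x - h < z" "z < x" for z using h(2) cl that by simp
   show "D z (W x) ~= 0 & (sig * D z (W x) < 0 \<or> isCont W z)" if "r < z" "z < x" for z
    using neg[of z] good[of z] that x(2) by (auto simp: mult_less_0_iff)
  qed (use y \<open>y < x\<close> in auto)
 qed simp
 then show "D y (W y) < 0" using neg[of y] y by simp
qed

text \<open>The three possible patterns: constant, one jump, one fan between two constant states.\<close>

lemma patterns:
 assumes rs: "r < s"
 obtains (const) "W constant_on {r<..<s}"
 | (jump) tau cl cr where "r < tau" "tau < s" "!!x. r < x ==> x < tau ==> W x = cl" "!!x. tau < x ==> x < s ==> W x = cr"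
   "cl ~= cr" "W tau : {cl, cr}" "D tau (W tau) ~= 0"
 | (wave) z1 z2 cl cr where "r < z1" "z1 < z2" "z2 < s" "D z1 (W z1) = 0" "D z2 (W z2) = 0"
   "!!x y z. r < x ==> x < y ==> y < z ==> z < s ==> D x (W x) = 0 ==> D z (W z) = 0 ==> D y (W y) = 0"
   "!!x. r < x ==> x < s ==> (!!z. r < z ==> z < s ==> D z (W z) = 0 ==> x < z) ==> W x = cl"
   "!!x. r < x ==> x < s ==> (!!z. r < z ==> z < s ==> D z (W z) = 0 ==> z < x) ==> W x = cr"
   "!!x. r < x ==> x < s ==> isCont W x"
proof -
 have order: "x < y" if "r < x" "x < s" "D x (W x) <= 0" "r < y" "y < s" "0 < D y (W y)" for x y
  using positive_persists(2)[OF that(4,5,6), of x] that by force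
 have order': "x < y" if "r < x" "x < s" "D x (W x) < 0" "r < y" "y < s" "0 <= D y (W y)" for x y
  using negative_persists(2)[OF that(1,2,3), of y] that by force
 have cp: "W x = W y" if "r < x" "x < s" "0 < D x (W x)" "r < y" "y < s" "0 < D y (W y)" for x y
 proof (cases "x <= y")
  case True show ?thesis by (rule positive_persists(1)[OF that(1-3) True that(5), symmetric])
 next
  case False
  then have "y <= x" by simp
  show ?thesis by (rule positive_persists(1)[OF that(4-6) \<open>y <= x\<close> that(2)])
 qed
 have cn: "W x = W y" if "r < x" "x < s" "D x (W x) < 0" "r < y" "y < s" "D y (W y) < 0" for x y
 proof (cases "y <= x")
  case True show ?thesis by (rule negative_persists(1)[OF that(1-3) that(4) True, symmetric])
 next
  case False
  then have "x <= y" by simp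
  show ?thesis by (rule negative_persists(1)[OF that(4-6) that(1) \<open>x <= y\<close>])
 qed
 define cl where "cl = (SOME c. EX x. r < x & x < s & D x (W x) < 0 & W x = c)"
 define cr where "cr = (SOME c. EX x. r < x & x < s & 0 < D x (W x) & W x = c)"
 have cl: "W x = cl" if "r < x" "x < s" "D x (W x) < 0" for x
 proof -
  have "EX x. r < x & x < s & D x (W x) < 0 & W x = cl"
   unfolding cl_def by (rule someI[of _ "W x"]) (use that in blast)
  then obtain y where "r < y" "y < s" "D y (W y) < 0" "W y = cl" by blast
  with cn[OF that, of y] show ?thesis by simp
 qed
 have cr: "W x = cr" if "r < x" "x < s" "0 < D x (W x)" for x
 proof -
  have "EX x. r < x & x < s & 0 < D x (W x) & W x = cr"
   unfolding cr_def by (rule someI[of _ "W x"]) (use that in blast)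
  then obtain y where "r < y" "y < s" "0 < D y (W y)" "W y = cr" by blast
  with cp[OF that, of y] show ?thesis by simp
 qed
 show thesis
 proof (cases "EX z. r < z & z < s & D z (W z) = 0")
  case False
  then have nz: "D x (W x) < 0 \<or> 0 < D x (W x)" if "r < x" "x < s" for x using that by force
  show thesis
  proof (cases "cl = cr \<or> (ALL x. r < x --> x < s --> D x (W x) < 0) \<or> (ALL x. r < x --> x < s --> 0 < D x (W x))")
   case True
   have "EX c. ALL x:{r<..<s}. W x = c" using True
   proof (elim disjE)
    assume "cl = cr" then show ?thesis using cl cr nz by (intro exI[of _ cl]) force
   qed (use cl cr in \<open>auto intro!: exI[of _ cl] exI[of _ cr]\<close>)
   then have "W constant_on {r<..<s}" by (simp add: constant_on_def)
   then show thesis by (rule const)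
  next
   case False
   then obtain a b where a: "r < a" "a < s" "D a (W a) < 0" and b: "r < b" "b < s" "0 < D b (W b)"
    using nz by (metis less_asym)
   define A where "A = {x. r < x & x < s & D x (W x) < 0}"
   have bd: "x <= b" if "x : A" for x using order[of x b] that b by (auto simp: A_def)
   then have bdd: "bdd_above A" by (rule bdd_aboveI)
   have aA: "a : A" using a by (simp add: A_def)
   define tau where "tau = Sup A"
   have tau: "a <= tau" "tau <= b" unfolding tau_def using cSup_upper[OF aA bdd] cSup_least[of A b] aA bd by auto
   have left: "W x = cl" if "r < x" "x < tau" for x
   proof -
    have "x < Sup A" using \<open>x < tau\<close> by (simp add: tau_def)
    then obtain y where y: "y : A" "x < y" using less_cSup_iff[OF _ bdd] aA by blast
    have "W x = W y" using negative_persists(1)[of y x] y that by (auto simp: A_def)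
    also have "W y = cl" using cl[of y] y by (auto simp: A_def)
    finally show ?thesis .
   qed
   have right: "W x = cr" if "tau < x" "x < s" for x
   proof -
    have "x \<notin> A" using cSup_upper[OF _ bdd] that(1) unfolding tau_def by force
    moreover have "r < x" using that tau(1) a(1) by simp
    ultimately show ?thesis using nz[of x] cr[of x] that by (auto simp: A_def)
   qed
   have rt: "r < tau" "tau < s" using tau a b by auto
   show thesis
    by (rule jump[OF rt left right]) (use False nz[OF rt] cl[OF rt] cr[OF rt] in auto)
  qed
 next
  case True
  then obtain z where z: "r < z" "z < s" "D z (W z) = 0" by blast
  have conv: "D y (W y) = 0" if "r < x" "x < y" "y < z" "z < s" "D x (W x) = 0" "D z (W z) = 0" for x y z
   using order[of z y] order'[of y x] that by (cases "D y (W y)" "0::real" rule: linorder_cases) auto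
  have lt: "W x = cl" if "r < x" "x < s" "D x (W x) ~= 0" "x < z" "r < z" "z < s" "D z (W z) = 0" for x z
   using that order[of z x] cl[of x] by (cases "D x (W x)" "0::real" rule: linorder_cases) auto
  have gt: "W x = cr" if "r < x" "x < s" "D x (W x) ~= 0" "z < x" "r < z" "z < s" "D z (W z) = 0" for x z
   using that order'[of x z] cr[of x] by (cases "D x (W x)" "0::real" rule: linorder_cases) auto
  show thesis
  proof (cases "EX z'. r < z' & z' < s & D z' (W z') = 0 & z' ~= z")
   case False
   have cz: "isCont W z" using sonic_cont z s by auto
   have only: "D x (W x) ~= 0" if "r < x" "x < s" "x ~= z" for x using False that by blast
   have L: "W x = cl" if "r < x" "x < z" for x
    by (rule lt[of x z]) (use that z only[of x] in simp_all)
   have R: "W x = cr" if "z < x" "x < s" for x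
    by (rule gt[of x z]) (use that z only[of x] in simp_all)
   have "W z = cl" by (rule isCont_left_constant[OF cz z(1) L])
   have "W z = cr" by (rule isCont_right_constant[OF cz z(2) R])
   then have "W constant_on {r<..<s}" unfolding constant_on_def
   proof (intro exI[of _ cl] ballI)
    fix x assume "x : {r<..<s}"
    then show "W x = cl" using L[of x] R[of x] \<open>W z = cl\<close> \<open>W z = cr\<close> by (cases x z rule: linorder_cases) auto
   qed
   then show thesis by (rule const)
  next
   case True
   then obtain z' where z': "r < z'" "z' < s" "D z' (W z') = 0" "z' ~= z" by blast
   have cont: "isCont W x" if x: "r < x" "x < s" for x
   proof (cases "D x (W x) = 0")
    case True then show ?thesis using sonic_cont x s by auto
   next
    case nz: False
    obtain h k1 k2 where h: "0 < h" "k1 : K" "k2 : K" "!!z. x - h < z ==> z < x ==> W z = k1" "!!z. x < z ==> z < x + h ==> W z = k2"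
     "W x : {k1, k2}" "k1 ~= k2 ==> sig * D x k1 < 0" "k1 ~= k2 ==> 0 < sig * D x k2"
     by (rule nonsonicE[OF less_le_trans[OF x(2) s] nz], rule that; assumption)
    have "k1 = k2"
    proof (rule ccontr)
     assume ne: "k1 ~= k2"
     then have sg: "0 < sig" using jump_sign[OF x h(1,4,5)] by blast
     have D1: "D x k1 < 0" and D2: "0 < D x k2" using h(7,8)[OF ne] sg by (auto simp: mult_less_0_iff zero_less_mult_iff)
     show False
     proof (cases "x < z")
      case True
      define y where "y = (x + min z (x + h)) / 2"
      have y: "x < y" "y < z" "y < x + h" using True h(1) by (auto simp: y_def)
      have "D x k2 < D y k2" using D_mono[OF h(3) y(1)] y(2) z(2) s by simp
      then have "0 < D y (W y)" using h(5)[OF y(1,3)] D2 by simp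
      then show False using order[of z y] z y x by simp
     next
      case False
      then have "z < x" using nz z(3) by (cases "x = z") auto
      define y where "y = (x + max z (x - h)) / 2"
      have y: "y < x" "z < y" "x - h < y" using \<open>z < x\<close> h(1) by (auto simp: y_def)
      have "D y k1 < D x k1" using D_mono[OF h(2) y(1)] x(2) s by simp
      then have "D y (W y) < 0" using h(4)[OF y(3,1)] D1 by simp
      then show False using order'[of y z] z y x by simp
     qed
    qed
    then have "\<forall>\<^sub>F u in nhds x. W u = k1"
     unfolding eventually_nhds_metric dist_real_def
    proof (intro exI[of _ h] conjI h(1) allI impI)
     fix u assume "(abs (u - x)) < h"
     then show "W u = k1" using h(4)[of u] h(5)[of u] h(6) \<open>k1 = k2\<close> by (cases u x rule: linorder_cases) auto
    qed
    then show ?thesis using isCont_cong[of W "%_. k1" x] by simp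
   qed
   show thesis
   proof (rule wave[of "min z z'" "max z z'" cl cr])
    show "W x = cl" if "r < x" "x < s" "!!z. r < z ==> z < s ==> D z (W z) = 0 ==> x < z" for x
     by (rule lt[of x z]) (use that z in force)+
    show "W x = cr" if "r < x" "x < s" "!!z. r < z ==> z < s ==> D z (W z) = 0 ==> z < x" for x
     by (rule gt[of x z]) (use that z in force)+
   qed (use z z' conv cont in \<open>auto simp: min_def max_def\<close>)
  qed
 qed
qed

end

lemma nonsonic_open:
 assumes "xi < b0" "D xi (W xi) ~= 0"
 shows "EX h>0. ALL x. (abs (x - xi)) < h --> D x (W x) ~= 0"
proof -
 obtain h cl cr where h: "0 < h" "cl : K" "cr : K" "!!x. xi - h < x ==> x < xi ==> W x = cl"
  "!!x. xi < x ==> x < xi + h ==> W x = cr" "D xi cl ~= 0" "D xi cr ~= 0" using nonsonicE[OF assms] by metis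
 obtain h1 where h1: "0 < h1" "!!x. dist xi x < h1 ==> D x cl ~= 0"
  using continuous_at_avoid[OF D_cont[OF h(2)] h(6)] by blast
 obtain h2 where h2: "0 < h2" "!!x. dist xi x < h2 ==> D x cr ~= 0"
  using continuous_at_avoid[OF D_cont[OF h(3)] h(7)] by blast
 show ?thesis
 proof (intro exI[of _ "min h (min h1 h2)"] conjI allI impI)
  fix x assume x: "(abs (x - xi)) < min h (min h1 h2)"
  then have d: "dist xi x < h1" "dist xi x < h2" by (auto simp: dist_real_def)
  show "D x (W x) ~= 0"
   using x assms(2) h(4)[of x] h(5)[of x] h1(2)[OF d(1)] h2(2)[OF d(2)]
   by (cases x xi rule: linorder_cases) auto
 qed (use h h1 h2 in auto)
qed

text \<open>One-sided Lipschitz bounds: \<open>f\<close> can decrease only along the zeros of \<open>D\<close>.\<close>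

lemma one_sided_lipschitz:
 fixes f :: "'b => real"
 assumes f: "continuous_on K f" and up: "!!xi cl cr. a < xi ==> xi < b0 ==> cl : R xi ==> cr : R xi ==>
   sig * D xi cl < 0 ==> 0 < sig * D xi cr ==> f cl <= f cr"
  and zeros: "!!x y. a < x ==> x < y ==> y < b0 ==> D x (W x) = 0 ==> D y (W y) = 0 ==> - L * (y - x) <= f (W y) - f (W x)"
  and L: "0 <= L" and x: "a < x" "x < y" "y < b0"
 shows "- L * (y - x) <= f (W y) - f (W x)"
proof -
 have mono: "f (W x) <= f (W y)" if xy: "a < x" "x <= y" "y < b0" and nz: "!!z. x <= z ==> z <= y ==> D z (W z) ~= 0" for x y
 proof (cases "x = y")
  case False
  have jl: "EX k>0. EX cl cr. (ALL z. u - k < z --> z < u --> W z = cl) & (ALL z. u < z --> z < u + k --> W z = cr) &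
    W u : {cl, cr} & f cl <= f cr" if u: "x <= u" "u <= y" for u
  proof -
   have ub: "u < b0" using u xy by simp
   obtain k cl cr where k: "0 < k" "!!x. u - k < x ==> x < u ==> W x = cl"
    "!!x. u < x ==> x < u + k ==> W x = cr" "W u : {cl, cr}" "cl ~= cr ==> sig * D u cl < 0" "cl ~= cr ==> 0 < sig * D u cr"
    "cl : R u" "cr : R u" using nonsonicE[OF ub nz[OF u]] by metis
   have "f cl <= f cr" using up[OF _ ub k(7,8)] k(5,6) u xy(1) by (cases "cl = cr") auto
   then show ?thesis using k(1-4) by blast
  qed
  have "ALL z. x < z --> z < b0 --> (z <= y --> f (W x) <= f (W z))"
  proof (rule real_continuation)
   show "x < b0" using xy by simp
   obtain k cl cr where k: "0 < k" "ALL z. x < z --> z < x + k --> W z = cr" "W x : {cl, cr}" "f cl <= f cr"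
    using jl[of x] xy by auto
   show "EX h>0. ALL z. x < z --> z < x + h --> z <= y --> f (W x) <= f (W z)"
    using k by (intro exI[of _ k]) auto
  next
   fix u assume u: "x < u" "u < b0" "ALL z. x < z --> z < u --> z <= y --> f (W x) <= f (W z)"
   show "EX h>0. ALL z. u <= z --> z < u + h --> z <= y --> f (W x) <= f (W z)"
   proof (cases "u <= y")
    case True
    obtain k cl cr where k: "0 < k" "ALL z. u - k < z --> z < u --> W z = cl" "ALL z. u < z --> z < u + k --> W z = cr"
     "W u : {cl, cr}" "f cl <= f cr" using jl[of u] u True by auto
    define z where "z = (max x (u - k) + u) / 2"
    have z: "x < z" "z < u" "u - k < z" using k(1) u(1) by (auto simp: z_def)
    have "f (W x) <= f cl" using u(3) k(2) z True by force
    then show ?thesis using k(1,3-5) by (intro exI[of _ k]) (auto simp: le_less)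
   qed (auto intro!: exI[of _ 1])
  qed
  then show ?thesis using False xy by simp
 qed simp
 show ?thesis
 proof (cases "EX z. x <= z & z <= y & D z (W z) = 0")
  case False
  then have "f (W x) <= f (W y)" using mono[of x y] x by auto
  moreover have "0 <= L * (y - x)" using L x by simp
  ultimately show ?thesis by linarith
 next
  case True
  define Z where "Z = {z : {x..y}. D z (W z) = 0}"
  have ne: "Z ~= {}" using True by (auto simp: Z_def)
  have "open {z. z < b0 & D z (W z) ~= 0}" unfolding open_dist
  proof
   fix u assume u: "u : {z. z < b0 & D z (W z) ~= 0}"
   then obtain k where k: "0 < k" "ALL x. (abs (x - u)) < k --> D x (W x) ~= 0" using nonsonic_open by blast
   show "EX e>0. ALL z. dist z u < e --> z : {z. z < b0 & D z (W z) ~= 0}"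
    using k u by (intro exI[of _ "min k (b0 - u)"]) (auto simp: dist_real_def)
  qed
  then have "closed ({x..y} - {z. z < b0 & D z (W z) ~= 0})" by (intro closed_Diff) auto
  moreover have "{x..y} - {z. z < b0 & D z (W z) ~= 0} = Z" using x by (auto simp: Z_def)
  ultimately have cl: "closed Z" by simp
  have bd: "bdd_below Z" "bdd_above Z" by (auto simp: Z_def intro: bdd_belowI[of _ x] bdd_aboveI[of _ y])
  define z1 z2 where "z1 = Inf Z" and "z2 = Sup Z"
  have zz: "z1 : Z" "z2 : Z" unfolding z1_def z2_def
   using closed_contains_Inf[OF ne bd(1) cl] closed_contains_Sup[OF ne bd(2) cl] by auto
  have lo: "z1 <= z" and hi: "z <= z2" if "z : Z" for z
   unfolding z1_def z2_def using cInf_lower[OF that bd(1)] cSup_upper[OF that bd(2)] by auto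
  have z12: "x <= z1" "z1 <= z2" "z2 <= y" using zz lo[OF zz(2)] by (auto simp: Z_def)
  have fc: "((%z. f (W z)) \<longlongrightarrow> f (W z)) (at z)" if "z : Z" for z
  proof -
   have zb: "z < b0" using that x by (auto simp: Z_def)
   have t: "(W \<longlongrightarrow> W z) (at z)" using sonic_cont[OF zb] that by (auto simp: Z_def isCont_def)
   have ev: "\<forall>\<^sub>F u in at z. W u : K"
    using zb WK by (auto simp: eventually_at dist_real_def intro!: exI[of _ "b0 - z"])
   show ?thesis by (rule continuous_on_tendsto_compose[OF f t WK[OF zb] ev])
  qed
  have "f (W x) <= f (W z1)"
  proof (cases "x = z1")
   case False
   then have xz: "x < z1" using z12 by simp
   have "\<forall>\<^sub>F u in at_left z1. f (W x) <= f (W u)"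
    unfolding eventually_at_left[OF xz]
   proof (intro exI[of _ x] conjI xz allI impI)
    fix u assume u: "x < u" "u < z1"
    show "f (W x) <= f (W u)"
    proof (rule mono)
     fix z assume z: "x <= z" "z <= u"
     show "D z (W z) ~= 0"
     proof
      assume "D z (W z) = 0"
      then have "z : Z" using z u z12 by (simp add: Z_def)
      from lo[OF this] show False using z u by simp
     qed
    qed (use u x z12 in auto)
   qed
   moreover have "((%z. f (W z)) \<longlongrightarrow> f (W z1)) (at_left z1)" using fc[OF zz(1)] by (simp add: filterlim_at_split)
   ultimately show ?thesis by (intro tendsto_lowerbound[OF _ _ trivial_limit_at_left_real])
  qed simp
  moreover have "f (W z2) <= f (W y)"
  proof (cases "z2 = y")
   case False
   then have zy: "z2 < y" using z12 by simp
   have "\<forall>\<^sub>F u in at_right z2. f (W u) <= f (W y)"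
    unfolding eventually_at_right[OF zy]
   proof (intro exI[of _ y] conjI zy allI impI)
    fix u assume u: "z2 < u" "u < y"
    show "f (W u) <= f (W y)"
    proof (rule mono)
     fix z assume z: "u <= z" "z <= y"
     show "D z (W z) ~= 0"
     proof
      assume "D z (W z) = 0"
      then have "z : Z" using z u z12 by (simp add: Z_def)
      from hi[OF this] show False using z u by simp
     qed
    qed (use u x z12 in auto)
   qed
   moreover have "((%z. f (W z)) \<longlongrightarrow> f (W z2)) (at_right z2)" using fc[OF zz(2)] by (simp add: filterlim_at_split)
   ultimately show ?thesis by (intro tendsto_upperbound[OF _ _ trivial_limit_at_right_real])
  qed simp
  moreover have "- L * (z2 - z1) <= f (W z2) - f (W z1)"
   using zeros[of z1 z2] zz z12 x by (cases "z1 = z2") (auto simp: Z_def)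
  moreover have "L * (z2 - z1) <= L * (y - x)" using z12 L by (intro mult_left_mono) auto
  ultimately show ?thesis by linarith
 qed
qed

end

section \<open>Profiles close to the background state\<close>

locale flow = gas +
 fixes \<rho>0 M :: real
 assumes rho0: "0 < \<rho>0" and supersonic: "1 < M"
begin

definition lam :: real where "lam = center_slope M FPlus"

abbreviation bg :: state where "bg \<equiv> background p \<rho>0 M"

lemma lam: "0 < lam" "lam\<^sup>2 * (M\<^sup>2 - 1) = 1" "center_slope M FMinus = - lam"
proof -
 have e: "lam = 1 / sqrt (M\<^sup>2 - 1)"
  unfolding lam_def using eigenvalue_background(2) supersonic rho0 p_deriv by blast
 have M2: "1 < M\<^sup>2" using supersonic by (simp add: one_less_power)
 show "0 < lam" "lam\<^sup>2 * (M\<^sup>2 - 1) = 1" using M2 by (auto simp: e power_divide)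
 show "center_slope M FMinus = - lam" by (simp add: lam_def)
qed

lemma bg: "bg $ 1 = \<rho>0" "bg $ 2 = M * mass_speed \<rho>0" "bg $ 3 = 0" "bg : states"
 using rho0 by (simp_all add: background_def mass_speed_def states_def)

lemma sonic_bg: "sonic xi bg = (mass_speed \<rho>0)\<^sup>2 * (1 - xi\<^sup>2 * (M\<^sup>2 - 1))"
 by (simp add: sonic_def mass_flux_def bg power_mult_distrib algebra_simps)

text \<open>The properties of the background state that are used. They say that the speed is supersonic, that the
 contact has slope less than \<open>dlt / 2\<close>, and that sonic slopes are within \<open>dlt / 2\<close> of \<open>\<plusminus>lam\<close>.\<close>

definition near :: "real => state => bool" where
 "near dlt U \<longleftrightarrow> U : states & 0 < U $ 2 & 0 < (U $ 2)\<^sup>2 - (mass_speed (U $ 1))\<^sup>2 &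
   (abs (U $ 2 * U $ 3)) < lam / 2 * ((U $ 2)\<^sup>2 - (mass_speed (U $ 1))\<^sup>2) & (abs (U $ 3)) < dlt / 2 * U $ 2 &
   0 < sonic (lam - dlt / 2) U & 0 < sonic (- (lam - dlt / 2)) U &
   sonic (lam + dlt / 2) U < 0 & sonic (- (lam + dlt / 2)) U < 0"

lemma near_ball:
 assumes dlt: "0 < dlt" "dlt < lam"
 shows "EX eps>0. ALL U:cball bg eps. near dlt U"
proof -
 have ev: "\<forall>\<^sub>F U in nhds bg. 0 < f U" if "continuous_on states f" "0 < f bg" for f :: "state => real"
 proof -
  have "isCont f bg" using that(1) bg(4) open_states by (simp add: continuous_on_eq_continuous_at)
  then have "(f \<longlongrightarrow> f bg) (nhds bg)" by (simp add: isCont_def tendsto_at_iff_tendsto_nhds)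
  then show ?thesis using that(2) by (rule order_tendstoD(1))
 qed
 have k: "continuous_on states (%U::state. mass_speed (U $ 1))"
 proof -
  obtain k' where "!!r. 0 < r ==> (mass_speed has_real_derivative k' r) (at r)"
   using mass_speed_deriv by metis
  then have "continuous_on {0<..} mass_speed"
   by (intro continuous_at_imp_continuous_on ballI DERIV_isCont) auto
  then show ?thesis by (rule continuous_on_compose2) (auto intro!: continuous_intros simp: states_def)
 qed
 have so: "continuous_on states (%U. sonic xi U)" for xi
  unfolding sonic_def mass_flux_def by (intro continuous_intros k)
 define k0 where "k0 = mass_speed \<rho>0"
 have k0: "0 < k0" using mass_speed_pos[OF rho0] by (simp add: k0_def)
 have M2: "0 < M\<^sup>2 - 1" using supersonic by (simp add: one_less_power)
 have A: "0 < (bg $ 2)\<^sup>2 - (mass_speed (bg $ 1))\<^sup>2"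
 proof -
  have "(bg $ 2)\<^sup>2 - (mass_speed (bg $ 1))\<^sup>2 = k0\<^sup>2 * (M\<^sup>2 - 1)"
   by (simp add: bg k0_def power_mult_distrib algebra_simps)
  then show ?thesis using k0 M2 by simp
 qed
 have sb: "sonic xi bg = k0\<^sup>2 * (1 - (xi / lam)\<^sup>2)" for xi
 proof -
  have "M\<^sup>2 - 1 = 1 / lam\<^sup>2" using lam(1,2) by (simp add: field_simps)
  then show ?thesis unfolding sonic_bg k0_def by (simp add: power_divide)
 qed
 have pos: "0 < sonic xi bg" if "(abs xi) < lam" for xi
 proof -
  have "(abs (xi / lam)) < 1" using that lam(1) by (simp add: abs_divide)
  then have "(xi / lam)\<^sup>2 < 1" by (simp add: abs_square_less_1)
  then show ?thesis unfolding sb using k0 by simp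
 qed
 have neg: "0 < - sonic xi bg" if "lam < (abs xi)" for xi
 proof -
  have "1 < (abs (xi / lam))" using that lam(1) by (simp add: abs_divide)
  then have "1 < (abs (xi / lam))\<^sup>2" by (simp add: one_less_power)
  then have "1 < (xi / lam)\<^sup>2" by (simp only: power2_abs)
  then show ?thesis unfolding sb using k0 by (simp add: mult_pos_neg)
 qed
 have "\<forall>\<^sub>F U in nhds bg. 0 < U $ 1 & 0 < U $ 2 & 0 < (U $ 2)\<^sup>2 - (mass_speed (U $ 1))\<^sup>2 &
   0 < lam / 2 * ((U $ 2)\<^sup>2 - (mass_speed (U $ 1))\<^sup>2) - (abs (U $ 2 * U $ 3)) & 0 < dlt / 2 * U $ 2 - (abs (U $ 3)) &
   0 < sonic (lam - dlt / 2) U & 0 < sonic (- (lam - dlt / 2)) U &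
   0 < - sonic (lam + dlt / 2) U & 0 < - sonic (- (lam + dlt / 2)) U"
  using A dlt lam(1) k0 supersonic rho0 pos[of "lam - dlt / 2"] pos[of "- (lam - dlt / 2)"] neg[of "lam + dlt / 2"] neg[of "- (lam + dlt / 2)"]
  by (intro eventually_conj ev continuous_intros k so) (auto simp: bg k0_def[symmetric])
 then obtain e where e: "0 < e" "!!U. dist U bg < e ==> near dlt U"
  unfolding eventually_nhds_metric near_def states_def by auto
 show ?thesis by (rule exI[of _ "e / 2"]) (use e in \<open>auto simp: dist_commute\<close>)
qed

lemma sonic_diff:
 "sonic y U - sonic x U = (y - x) * (2 * (U $ 2 * U $ 3) - (x + y) * ((U $ 2)\<^sup>2 - (mass_speed (U $ 1))\<^sup>2))"
 by (simp add: sonic_def mass_flux_def power2_eq_square algebra_simps)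

lemma near_sonic_increasing:
 assumes "near dlt U" "x < y" "y <= - lam / 2"
 shows "sonic x U < sonic y U"
proof -
 let ?A = "(U $ 2)\<^sup>2 - (mass_speed (U $ 1))\<^sup>2"
 have "lam * ?A <= - (x + y) * ?A" using assms by (intro mult_right_mono) (auto simp: near_def)
 moreover have "(abs (U $ 2 * U $ 3)) < lam / 2 * ?A" using assms(1) by (simp add: near_def)
 ultimately have "0 < 2 * (U $ 2 * U $ 3) - (x + y) * ?A" by linarith
 then have "0 < (y - x) * (2 * (U $ 2 * U $ 3) - (x + y) * ?A)" using assms(2) by (intro mult_pos_pos) auto
 then show ?thesis using sonic_diff[of y U x] by simp
qed

lemma near_sonic_decreasing:
 assumes "near dlt U" "x < y" "lam / 2 <= x"
 shows "sonic y U < sonic x U"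
proof -
 let ?A = "(U $ 2)\<^sup>2 - (mass_speed (U $ 1))\<^sup>2"
 have "lam * ?A <= (x + y) * ?A" using assms by (intro mult_right_mono) (auto simp: near_def)
 moreover have "(abs (U $ 2 * U $ 3)) < lam / 2 * ?A" using assms(1) by (simp add: near_def)
 ultimately have "2 * (U $ 2 * U $ 3) - (x + y) * ?A < 0" by linarith
 then have "(y - x) * (2 * (U $ 2 * U $ 3) - (x + y) * ?A) < 0" using assms(2) by (intro mult_pos_neg) auto
 then show ?thesis using sonic_diff[of y U x] by simp
qed

lemma near_subsonic:
 assumes n: "near dlt U" and dlt: "0 < dlt" "dlt < lam" and xi: "(abs xi) <= lam - dlt / 2"
 shows "0 < sonic xi U"
proof -
 define L where "L = lam - dlt / 2"
 have L: "0 < L" "(abs xi) <= L" using dlt xi by (auto simp: L_def)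
 let ?A = "(U $ 2)\<^sup>2 - (mass_speed (U $ 1))\<^sup>2"
 have "2 * L * sonic xi U = (L - xi) * sonic (- L) U + (L + xi) * sonic L U + 2 * L * (?A * (L\<^sup>2 - xi\<^sup>2))"
  by (simp add: sonic_def mass_flux_def power2_eq_square algebra_simps)
 moreover have "0 < (L - xi) * sonic (- L) U + (L + xi) * sonic L U"
 proof -
  have s: "0 < sonic (-L) U" "0 < sonic L U" using n by (auto simp: near_def L_def)
  have "0 <= L - xi" "0 <= L + xi" using L by auto
  then show ?thesis using s L(1) by (cases "L = xi") (auto intro: add_pos_nonneg)
 qed
 moreover have "0 <= 2 * L * (?A * (L\<^sup>2 - xi\<^sup>2))"
 proof -
  have "xi\<^sup>2 <= L\<^sup>2" using L by (metis abs_le_square_iff abs_of_pos)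
  then show ?thesis using n L(1) by (auto simp: near_def)
 qed
 ultimately have "0 < 2 * L * sonic xi U" by linarith
 then show ?thesis using L(1) by (simp add: zero_less_mult_iff)
qed

lemma near_supersonic:
 assumes n: "near dlt U" and dlt: "0 < dlt" and xi: "lam + dlt / 2 <= (abs xi)"
 shows "sonic xi U < 0"
proof (cases "0 <= xi")
 case True
 then have "sonic xi U <= sonic (lam + dlt / 2) U"
  using near_sonic_decreasing[OF n, of "lam + dlt / 2" xi] xi dlt lam(1) by (cases "xi = lam + dlt / 2") auto
 then show ?thesis using n by (auto simp: near_def)
next
 case False
 then have "sonic xi U <= sonic (- (lam + dlt / 2)) U"
  using near_sonic_increasing[OF n, of xi "- (lam + dlt / 2)"] xi dlt lam(1) by (cases "xi = - (lam + dlt / 2)") auto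
 then show ?thesis using n by (auto simp: near_def)
qed

lemma near_mass_flux:
 assumes n: "near dlt U"
 shows "dlt / 2 <= xi ==> mass_flux xi U < 0" "xi <= - dlt / 2 ==> 0 < mass_flux xi U"
proof -
 have U: "0 < U $ 2" "(abs (U $ 3)) < dlt / 2 * U $ 2" using n by (auto simp: near_def)
 show "mass_flux xi U < 0" if "dlt / 2 <= xi"
 proof -
  have "dlt / 2 * U $ 2 <= xi * U $ 2" using mult_right_mono[OF that, of "U $ 2"] U by simp
  then show ?thesis using U(2) unfolding mass_flux_def by linarith
 qed
 show "0 < mass_flux xi U" if "xi <= - dlt / 2"
 proof -
  have "xi * U $ 2 <= - dlt / 2 * U $ 2" using mult_right_mono[OF that, of "U $ 2"] U by simp
  then show ?thesis using U(2) unfolding mass_flux_def by linarith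
 qed
qed

end

locale near_profile = ray_profile p sig K v G + flow p \<rho>0 M
 for p sig K v G \<rho>0 M +
 fixes dlt :: real
 assumes dlt: "0 < dlt" "dlt < lam / 4" and near: "U : K ==> near dlt U"
begin

lemma momentum_bound: obtains \<mu> where "0 < \<mu>" "!!U. U : K ==> \<mu> <= U $ 2"
proof -
 have "K ~= {}" using vK by auto
 moreover have "continuous_on K (%U::state. U $ 2)" by (intro continuous_intros)
 ultimately obtain U0 where "U0 : K" "ALL U:K. U0 $ 2 <= U $ 2"
  using continuous_attains_inf[OF K(1)] by blast
 then show thesis using near[of U0] by (intro that[of "U0 $ 2"]) (auto simp: near_def)
qed

lemma Flux1_decreasing: assumes "x < y" shows "Flux y $ 1 < Flux x $ 1"
proof -
 obtain \<mu> where \<mu>: "0 < \<mu>" "!!U. U : K ==> \<mu> <= U $ 2" using momentum_bound by blast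
 have "integral {x..y} (%s. \<mu>) <= integral {x..y} (%s. flux_x p (v s) $ 1)"
  using \<mu>(2)[OF vK] by (intro integral_le profile_integrable flux_nth_continuous) (auto simp: flux_x_def)
 moreover have "0 < \<mu> * (y - x)" using \<mu>(1) assms by simp
 ultimately show ?thesis using Flux_diff[of x y 1] assms by (simp add: mult.commute)
qed

definition xi0 :: real where "xi0 = (SOME x. Flux x $ 1 = 0)"

lemma Flux1_zero: "Flux xi0 $ 1 = 0" "(abs xi0) < dlt"
proof -
 obtain x1 where x1: "x1 : G" "- dlt < x1" "x1 < - dlt / 2" using G_dense[of "- dlt" "- dlt / 2"] dlt(1) by auto
 obtain x2 where x2: "x2 : G" "dlt / 2 < x2" "x2 < dlt" using G_dense[of "dlt / 2" dlt] dlt(1) by auto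
 have "0 < Flux x1 $ 1" "Flux x2 $ 1 < 0"
  using near_mass_flux(2)[OF near[OF vK[of x1]], of x1] near_mass_flux(1)[OF near[OF vK[of x2]], of x2]
   x1 x2 Flux_eq[OF x1(1)] Flux_eq[OF x2(1)] ray_flux_nth(1)[of x1 "v x1"] ray_flux_nth(1)[of x2 "v x2"]
  by simp_all
 then have "EX x>=x1. x <= x2 & Flux x $ 1 = 0"
  using x1 x2 dlt(1) by (intro IVT2') (auto intro!: continuous_at_imp_continuous_on continuous_intros Flux_isCont)
 then obtain x where x: "x1 <= x" "x <= x2" "Flux x $ 1 = 0" by blast
 show z: "Flux xi0 $ 1 = 0" unfolding xi0_def by (rule someI[of _ x]) (rule x(3))
 have "xi0 = x" using Flux1_decreasing[of x xi0] Flux1_decreasing[of xi0 x] z x(3)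
  by (cases x xi0 rule: linorder_cases) auto
 then show "(abs xi0) < dlt" using x x1 x2 by auto
qed

lemma Flux1_sign: "x < xi0 ==> 0 < Flux x $ 1" "xi0 < x ==> Flux x $ 1 < 0"
 using Flux1_decreasing[of x xi0] Flux1_decreasing[of xi0 x] Flux1_zero(1) by auto

lemma near_roots_bg: "U : roots xi ==> near dlt U"
 using near by (simp add: roots_def)

definition region :: "real => bool" where
 "region xi \<longleftrightarrow> xi ~= xi0 & ((abs xi) <= lam - dlt / 2 \<or> lam + dlt / 2 <= (abs xi))"

lemma region_nonzero: "region xi ==> Flux xi $ 1 ~= 0"
 using Flux1_sign[of xi] by (cases xi xi0 rule: linorder_cases) (auto simp: region_def)

lemma w_locally_constant:
 assumes r: "region xi"
 shows "EX h>0. ALL x. (abs (x - xi)) < h --> w x = w xi"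
proof -
 have N: "Flux xi $ 1 ~= 0" by (rule region_nonzero[OF r])
 have sgs: "(ALL U:roots xi. 0 < sonic xi U) \<or> (ALL U:roots xi. sonic xi U < 0)"
 proof (cases "(abs xi) <= lam - dlt / 2")
  case True
  have "dlt < lam" using dlt lam(1) by simp
  then have "ALL U:roots xi. 0 < sonic xi U" using near_subsonic[OF near_roots_bg dlt(1) _ True] by simp
  then show ?thesis ..
 next
  case False
  then have "lam + dlt / 2 <= (abs xi)" using r by (simp add: region_def)
  then have "ALL U:roots xi. sonic xi U < 0" using near_supersonic[OF near_roots_bg dlt(1)] by simp
  then show ?thesis ..
 qed
 have sg: "\<not> (sonic xi U < 0 & 0 < sonic xi V)" if "U : roots xi" "V : roots xi" for U V
 proof
  assume *: "sonic xi U < 0 & 0 < sonic xi V"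
  from sgs show False
  proof
   assume "ALL U:roots xi. 0 < sonic xi U"
   from bspec[OF this that(1)] * show False by simp
  next
   assume "ALL U:roots xi. sonic xi U < 0"
   from bspec[OF this that(2)] * show False by simp
  qed
 qed
 have wr: "w xi : roots xi" by (rule w_limit(2)[OF N])
 have S: "sonic xi (w xi) ~= 0"
  using sgs
 proof
  assume "ALL U:roots xi. 0 < sonic xi U"
  from bspec[OF this wr] show ?thesis by simp
 next
  assume "ALL U:roots xi. sonic xi U < 0"
  from bspec[OF this wr] show ?thesis by simp
 qed
 from w_piecewise_constant[OF N S] obtain h cl where h: "0 < h" "cl : roots xi"
  "ALL x. xi - h < x --> x < xi --> w x = cl" "ALL x. xi <= x --> x < xi + h --> w x = w xi" by (elim exE conjE bexE)
 have "cl = w xi"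
  by (rule roots_cases[OF h(2) wr N]) (use sg[OF h(2) wr] sg[OF wr h(2)] in auto)
 show ?thesis
 proof (intro exI[of _ h] conjI h(1) allI impI)
  fix x assume "(abs (x - xi)) < h"
  then show "w x = w xi" using h(3)[rule_format, of x] h(4)[rule_format, of x] \<open>cl = w xi\<close> by (cases "x < xi") auto
 qed
qed

lemma w_constant_region:
 assumes "connected A" "!!x. x : A ==> region x" "x : A" "y : A"
 shows "w x = w y"
proof (rule connected_local_const[OF assms(1,3,4)])
 show "ALL a:A. \<forall>\<^sub>F b in at a within A. w a = w b"
 proof
  fix a assume "a : A"
  from w_locally_constant[OF assms(2)[OF this]] obtain h where h: "0 < h" "ALL x. (abs (x - a)) < h --> w x = w a" by (elim exE conjE)
  show "\<forall>\<^sub>F b in at a within A. w a = w b"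
   unfolding eventually_at
  proof (intro exI[of _ h] conjI h(1) ballI impI)
   fix x assume "x ~= a & dist x a < h"
   then have "(abs (x - a)) < h" by (simp add: dist_real_def)
   from h(2)[rule_format, OF this] show "w a = w x" by (rule sym)
  qed
 qed
qed

lemma region_far: "lam + dlt / 2 <= (abs x) ==> region x"
 using Flux1_zero(2) dlt lam(1) by (auto simp: region_def)

lemma w_constant_right: "lam + dlt / 2 < x ==> lam + dlt / 2 < y ==> w x = w y"
 by (rule w_constant_region[of "{lam + dlt / 2<..}"]) (use region_far lam(1) dlt(1) in auto)

lemma w_constant_left: "x < - (lam + dlt / 2) ==> y < - (lam + dlt / 2) ==> w x = w y"
 by (rule w_constant_region[of "{..<- (lam + dlt / 2)}"]) (use region_far lam(1) dlt(1) in auto)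

lemma w_constant_upper: "xi0 < x ==> x < lam - dlt / 2 ==> xi0 < y ==> y < lam - dlt / 2 ==> w x = w y"
 by (rule w_constant_region[of "{xi0<..<lam - dlt / 2}"]) (use Flux1_zero(2) dlt in \<open>auto simp: region_def\<close>)

lemma w_constant_lower: "x < xi0 ==> - (lam - dlt / 2) < x ==> y < xi0 ==> - (lam - dlt / 2) < y ==> w x = w y"
 by (rule w_constant_region[of "{- (lam - dlt / 2)<..<xi0}"]) (use Flux1_zero(2) dlt in \<open>auto simp: region_def\<close>)

lemma Flux1_sign_mach:
 assumes "tau : {1, -1}" "xi < - lam / 2"
 shows "0 < tau * Flux (tau * xi) $ 1"
 using assms Flux1_sign[of xi] Flux1_sign[of "- xi"] Flux1_zero(2) dlt lam(1) by auto

text \<open>In the sector of the \<open>-\<close> field (\<open>tau = 1\<close>), and after the reflection \<open>tau = -1\<close> in that of the \<open>+\<close>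
 field, the profile is a fan. The direction of the jumps is that of the energy law.\<close>

lemma mach_fan:
 assumes tau: "tau : {1, -1}"
 shows "fan (%xi. w (tau * xi)) (%xi. sonic (tau * xi)) (- lam / 2) sig K (%xi. roots (tau * xi))"
proof
 fix xi :: real
 show "roots (tau * xi) \<subseteq> K" by (auto simp: roots_def)
 show "isCont (%xi. sonic (tau * xi) c) xi" for c unfolding sonic_def mass_flux_def by (intro continuous_intros)
 show "sonic (tau * x) c < sonic (tau * y) c" if "c : K" "x < y" "y < - lam / 2" for c x y
  using near_sonic_increasing[OF near[OF that(1)], of x y] near_sonic_decreasing[OF near[OF that(1)], of "- y" "- x"] that tau by auto
 assume xi: "xi < - lam / 2"
 let ?x = "tau * xi"
 have N: "Flux ?x $ 1 ~= 0" "0 < tau * Flux ?x $ 1" using Flux1_sign_mach[OF tau xi] by auto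
 have wr: "w ?x : roots ?x" by (rule w_limit(2)[OF N(1)])
 then show "w ?x : K" by (simp add: roots_def)
 show "isCont (%xi. w (tau * xi)) xi" if "sonic ?x (w ?x) = 0"
  by (rule isCont_o2[where f = "%xi. tau * xi" and g = w, OF _ w_continuous_at_sonic[OF N(1) that]]) (intro continuous_intros)
 assume S: "sonic ?x (w ?x) ~= 0"
 from w_piecewise_constant[OF N(1) S] obtain h cl where h: "0 < h" "cl : roots ?x"
  "ALL x. ?x - h < x --> x < ?x --> w x = cl" "ALL x. ?x <= x --> x < ?x + h --> w x = w ?x"
  "\<not> 0 < sig * Flux ?x $ 1 * (bernoulli (w ?x) - bernoulli cl)" by (elim exE conjE bexE)
 have clS: "sonic ?x cl ~= 0" using roots_eq_singleton[OF N(1) h(2)] wr S by auto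
 have dir: "0 < sig * Flux ?x $ 1 * (sonic ?x (w ?x)) & sig * Flux ?x $ 1 * sonic ?x cl < 0" if "cl ~= w ?x"
 proof (rule roots_cases[OF h(2) wr N(1)])
  assume *: "sonic ?x cl < 0" "0 < sonic ?x (w ?x)" "bernoulli (w ?x) < bernoulli cl"
  have "0 < sig * Flux ?x $ 1"
  proof (rule ccontr)
   assume "\<not> 0 < sig * Flux ?x $ 1"
   then have "sig * Flux ?x $ 1 < 0" using sig N(1) by (auto simp: not_less le_less)
   then have "0 < sig * Flux ?x $ 1 * (bernoulli (w ?x) - bernoulli cl)" using *(3) by (intro mult_neg_neg) auto
   then show False using h(5) by blast
  qed
  then show ?thesis using * by (auto intro: mult_pos_neg)
 next
  assume *: "sonic ?x (w ?x) < 0" "0 < sonic ?x cl" "bernoulli cl < bernoulli (w ?x)"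
  have "sig * Flux ?x $ 1 < 0"
  proof (rule ccontr)
   assume "\<not> sig * Flux ?x $ 1 < 0"
   then have "0 < sig * Flux ?x $ 1" using sig N(1) by (auto simp: not_less le_less)
   from mult_pos_pos[OF this, of "bernoulli (w ?x) - bernoulli cl"]
   have "0 < sig * Flux ?x $ 1 * (bernoulli (w ?x) - bernoulli cl)" using *(3) by simp
   then show False using h(5) by blast
  qed
  then show ?thesis using * by (auto intro: mult_neg_pos mult_neg_neg)
 qed (use that in simp)
 text \<open>The sign of the mass flux is \<open>tau\<close>.\<close>
 have conv: "(0 < sig * Flux ?x $ 1 * s) = (0 < tau * (sig * s))" "(sig * Flux ?x $ 1 * s < 0) = (tau * (sig * s) < 0)" for s
  using N(2) tau sig by (auto simp: zero_less_mult_iff mult_less_0_iff)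
 show "EX h>0. EX cl:roots ?x. EX cr:roots ?x. (ALL x. xi - h < x --> x < xi --> w (tau * x) = cl) &
    (ALL x. xi < x --> x < xi + h --> w (tau * x) = cr) & w ?x : {cl, cr} & sonic ?x cl ~= 0 & sonic ?x cr ~= 0 &
    (cl ~= cr --> sig * sonic ?x cl < 0 & 0 < sig * sonic ?x cr)"
 proof (cases "tau = 1")
  case True
  have 1: "ALL x. xi - h < x --> x < xi --> w (tau * x) = cl"
  proof (intro allI impI)
   fix x assume "xi - h < x" "x < xi"
   then show "w (tau * x) = cl" using h(3)[rule_format, of "tau * x"] True by simp
  qed
  have 2: "ALL x. xi < x --> x < xi + h --> w (tau * x) = w ?x"
  proof (intro allI impI)
   fix x assume "xi < x" "x < xi + h"
   then show "w (tau * x) = w ?x" using h(4)[rule_format, of "tau * x"] True by simp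
  qed
  have 3: "cl ~= w ?x --> sig * sonic ?x cl < 0 & 0 < sig * sonic ?x (w ?x)"
  proof
   assume "cl ~= w ?x"
   then have "0 < tau * (sig * sonic ?x (w ?x)) & tau * (sig * sonic ?x cl) < 0" using dir unfolding conv by blast
   moreover have "tau * s = s" for s using True by simp
   ultimately show "sig * sonic ?x cl < 0 & 0 < sig * sonic ?x (w ?x)" by metis
  qed
  show ?thesis
   by (rule exI[of _ h], intro conjI h(1), rule bexI[OF _ h(2)], rule bexI[OF _ wr], intro conjI 1 2 S clS 3) simp
 next
  case False
  then have t: "tau = -1" using tau by auto
  have 1: "ALL x. xi - h < x --> x < xi --> w (tau * x) = w ?x"
  proof (intro allI impI)
   fix x assume "xi - h < x" "x < xi"
   then show "w (tau * x) = w ?x" using h(4)[rule_format, of "tau * x"] t by simp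
  qed
  have 2: "ALL x. xi < x --> x < xi + h --> w (tau * x) = cl"
  proof (intro allI impI)
   fix x assume "xi < x" "x < xi + h"
   then show "w (tau * x) = cl" using h(3)[rule_format, of "tau * x"] t by simp
  qed
  have 3: "w ?x ~= cl --> sig * sonic ?x (w ?x) < 0 & 0 < sig * sonic ?x cl"
  proof
   assume "w ?x ~= cl"
   then have "0 < tau * (sig * sonic ?x (w ?x)) & tau * (sig * sonic ?x cl) < 0" using dir[OF not_sym] unfolding conv by blast
   moreover have "tau * s = - s" for s using t by simp
   ultimately show "sig * sonic ?x (w ?x) < 0 & 0 < sig * sonic ?x cl" by (metis neg_0_less_iff_less neg_less_0_iff_less)
  qed
  show ?thesis
   by (rule exI[of _ h], intro conjI h(1), rule bexI[OF _ wr], rule bexI[OF _ h(2)], intro conjI 1 2 S clS 3) simp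
 qed
qed

end

section \<open>Jump sizes, gaps and variation\<close>

lemma compact_abs_bound:
 assumes "compact K" "continuous_on K (f :: 'a::metric_space => real)"
 obtains B where "0 < B" "!!U. U : K ==> (abs (f U)) <= B"
proof -
 have "bounded (f ` K)" using assms compact_continuous_image compact_imp_bounded by blast
 then obtain B where B: "0 < B" "ALL y:f ` K. norm y <= B" using bounded_pos by blast
 show thesis by (rule that[OF B(1)]) (use B(2) in auto)
qed

context gas begin

lemma density_range:
 assumes "compact K" "K \<subseteq> states"
 obtains a b where "0 < a" "a <= b" "!!U. U : K ==> a <= U $ 1 & U $ 1 <= b"
proof (cases "K = {}")
 case True then show thesis using that[of 1 1] by auto
next
 case False
 have c: "continuous_on K (%U::state. U $ 1)" by (intro continuous_intros)
 obtain U0 where U0: "U0 : K" "ALL U:K. U0 $ 1 <= U $ 1" using continuous_attains_inf[OF assms(1) False c] by blast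
 obtain U1 where U1: "U1 : K" "ALL U:K. U $ 1 <= U1 $ 1" using continuous_attains_sup[OF assms(1) False c] by blast
 show thesis by (rule that[of "U0 $ 1" "U1 $ 1"]) (use U0 U1 assms(2) in \<open>auto simp: states_def\<close>)
qed

lemma mass_speed_sq_growth:
 assumes "0 < a"
 obtains alf where "0 < alf" "!!r s. a <= r ==> r <= s ==> s <= b ==> alf * (s - r) <= (mass_speed s)\<^sup>2 - (mass_speed r)\<^sup>2"
proof -
 obtain k' where k': "!!r. 0 < r ==> (mass_speed has_real_derivative k' r) (at r)"
  "!!r. 0 < r ==> 0 < k' r" "continuous_on {0<..} k'" using mass_speed_deriv by metis
 have kc: "continuous_on {0<..} mass_speed"
  using k'(1) by (intro continuous_at_imp_continuous_on ballI DERIV_isCont) auto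
 let ?g = "%r. 2 * mass_speed r * k' r"
 show thesis
 proof (cases "a <= b")
  case False then show thesis by (intro that[of 1]) auto
 next
  case True
  have "continuous_on {a..b} ?g"
   using assms by (intro continuous_intros continuous_on_subset[OF kc] continuous_on_subset[OF k'(3)]) auto
  then obtain r0 where r0: "r0 : {a..b}" "ALL r:{a..b}. ?g r0 <= ?g r"
   using continuous_attains_inf[of "{a..b}" ?g] True by auto
  define alf where "alf = ?g r0"
  have alf: "0 < alf" using r0(1) assms k'(2)[of r0] mass_speed_pos[of r0] by (simp add: alf_def)
  have "alf * (s - r) <= (mass_speed s)\<^sup>2 - (mass_speed r)\<^sup>2" if rs: "a <= r" "r <= s" "s <= b" for r s
  proof -
   have "(mass_speed r)\<^sup>2 - alf * r <= (mass_speed s)\<^sup>2 - alf * s"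
   proof (rule DERIV_nonneg_imp_nondecreasing[OF rs(2), of "%r. (mass_speed r)\<^sup>2 - alf * r"])
    fix x assume x: "r <= x" "x <= s"
    then have x0: "0 < x" using rs assms by simp
    have "((%r. (mass_speed r)\<^sup>2 - alf * r) has_real_derivative ?g x - alf) (at x)"
     using k'(1)[OF x0] by (auto intro!: derivative_eq_intros)
    moreover have "0 <= ?g x - alf" using r0(2) x rs by (auto simp: alf_def)
    ultimately show "EX y. DERIV (%r. (mass_speed r)\<^sup>2 - alf * r) x :> y & 0 <= y" by blast
   qed
   then show ?thesis by (simp add: algebra_simps)
  qed
  with alf show thesis by (rule that)
 qed
qed

text \<open>As a function of the specific volume \<open>1 / r\<close> the normal momentum flux is uniformly convex, so
 its slopes at the end points of a chord of slope zero are at least proportional to the length.\<close>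

lemma jump_sonic_bound:
 assumes a: "0 < a" and alf: "0 < alf" "ALL r s. a <= r --> r <= s --> s <= b --> alf * (s - r) <= (mass_speed s)\<^sup>2 - (mass_speed r)\<^sup>2"
  and r: "a <= r1" "r1 < r2" "r2 <= b" and S: "1 <= S"
  and eq: "n\<^sup>2 / r1 + S * p r1 = n\<^sup>2 / r2 + S * p r2"
 shows "alf * a\<^sup>2 / (2 * b\<^sup>2) * (r2 - r1) <= S * (mass_speed r2)\<^sup>2 - n\<^sup>2"
  "S * (mass_speed r1)\<^sup>2 - n\<^sup>2 <= - (alf * a\<^sup>2 / (2 * b\<^sup>2) * (r2 - r1))"
proof -
 define D where "D r = S * (mass_speed r)\<^sup>2 - n\<^sup>2" for r
 define bet where "bet = alf * a\<^sup>2"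
 define G where "G r = n\<^sup>2 / r + S * p r" for r
 have bet: "0 < bet" using alf(1) a by (simp add: bet_def)
 have pos: "0 < r1" "0 < r2" using a r by auto
 have Gd: "(G has_real_derivative D r / r\<^sup>2) (at r)" if "0 < r" for r
  unfolding G_def D_def by (rule thrust_deriv[OF that])
 have Dg: "bet * (1 / u - 1 / v) <= D v - D u" if uv: "r1 <= u" "u <= v" "v <= r2" for u v
 proof -
  have u: "a <= u" "a <= v" "0 < u" "0 < v" using uv r a by auto
  have "1 / u - 1 / v = (v - u) / (u * v)" using u by (simp add: field_simps)
  also have "... <= (v - u) / (a * a)"
   using u uv a by (intro divide_left_mono mult_mono) auto
  finally have "bet * (1 / u - 1 / v) <= bet * ((v - u) / (a * a))" using bet by (intro mult_left_mono) auto
  also have "... = alf * (v - u)" using a by (simp add: bet_def power2_eq_square)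
  also have "... <= (mass_speed v)\<^sup>2 - (mass_speed u)\<^sup>2" using alf(2)[rule_format, of u v] uv r by auto
  also have "... <= S * ((mass_speed v)\<^sup>2 - (mass_speed u)\<^sup>2)"
  proof -
   have "0 <= (mass_speed v)\<^sup>2 - (mass_speed u)\<^sup>2"
    using alf(2)[rule_format, of u v] uv r mult_nonneg_nonneg[of alf "v - u", OF less_imp_le[OF alf(1)]] by linarith
   then show ?thesis using mult_right_mono[OF S] by force
  qed
  finally show ?thesis by (simp add: D_def algebra_simps)
 qed
 have id: "((%r. c * (1 / r - d)) has_real_derivative - (c / r\<^sup>2)) (at r)" if "0 < r" for c d r
 proof -
  have "((%r. c * (inverse r - d)) has_real_derivative c * (- (inverse r ^ Suc (Suc 0)) - 0)) (at r)"
   by (intro DERIV_cmult DERIV_diff DERIV_inverse DERIV_const) (use that in simp)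
  then show ?thesis by (simp add: inverse_eq_divide power2_eq_square)
 qed
 have sq: "((%r. bet / 2 * (1 / r - d)\<^sup>2) has_real_derivative - (bet * (1 / r - d) / r\<^sup>2)) (at r)" if "0 < r" for d r
 proof -
  have "((%r. bet / 2 * (1 * (1 / r - d)) ^ 2) has_real_derivative
    bet / 2 * (real 2 * (- (1 / r\<^sup>2) * (1 * (1 / r - d)) ^ (2 - Suc 0)))) (at r)"
   by (intro DERIV_cmult DERIV_power id that)
  moreover have "bet / 2 * (real 2 * (- (1 / r\<^sup>2) * (1 * (1 / r - d)) ^ (2 - Suc 0))) = - (bet * (1 / r - d) / r\<^sup>2)"
   by (simp del: right_diff_distrib_numeral) 
  ultimately show ?thesis by (simp only: mult_1_left)
 qed
 define l where "l = 1 / r1 - 1 / r2"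
 have l: "0 < l" using pos r by (simp add: l_def frac_less2)
 have lb: "(r2 - r1) / b\<^sup>2 <= l"
 proof -
  have "(r2 - r1) / (b * b) <= (r2 - r1) / (r1 * r2)"
   using pos r by (intro divide_left_mono mult_mono) auto
  then show ?thesis using pos by (simp add: l_def field_simps power2_eq_square)
 qed
 have upper: "bet / 2 * l\<^sup>2 <= D r2 * l"
 proof -
  let ?\<Theta> = "%r. G r + D r2 * (1 / r - 1 / r2) - bet / 2 * (1 / r - 1 / r2)\<^sup>2"
  have "?\<Theta> r2 <= ?\<Theta> r1"
  proof (rule DERIV_nonpos_imp_nonincreasing[of r1 r2 ?\<Theta>])
   fix x assume x: "r1 <= x" "x <= r2"
   then have x0: "0 < x" using pos by simp
   have "(?\<Theta> has_real_derivative D x / x\<^sup>2 + - (D r2 / x\<^sup>2) - - (bet * (1 / x - 1 / r2) / x\<^sup>2)) (at x)"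
    by (intro DERIV_diff DERIV_add Gd id sq x0)
   moreover have "D x / x\<^sup>2 + - (D r2 / x\<^sup>2) - - (bet * (1 / x - 1 / r2) / x\<^sup>2)
     = (D x - D r2 + bet * (1 / x - 1 / r2)) / x\<^sup>2" by (simp add: add_divide_distrib diff_divide_distrib)
   moreover have "(D x - D r2 + bet * (1 / x - 1 / r2)) / x\<^sup>2 <= 0"
    using Dg[OF x(1) x(2) order_refl] x0 by (intro divide_nonpos_pos) auto
   ultimately show "EX y. DERIV ?\<Theta> x :> y & y <= 0" by - (intro exI conjI, assumption, simp only:)
  qed (use r in auto)
  then show ?thesis using eq by (simp add: G_def l_def)
 qed
 have lower: "bet / 2 * l\<^sup>2 <= - D r1 * l"
 proof -
  let ?\<Theta> = "%r. G r + D r1 * (1 / r - 1 / r1) - bet / 2 * (1 / r - 1 / r1)\<^sup>2"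
  have "?\<Theta> r1 <= ?\<Theta> r2"
  proof (rule DERIV_nonneg_imp_nondecreasing[of r1 r2 ?\<Theta>])
   fix x assume x: "r1 <= x" "x <= r2"
   then have x0: "0 < x" using pos by simp
   have "(?\<Theta> has_real_derivative D x / x\<^sup>2 + - (D r1 / x\<^sup>2) - - (bet * (1 / x - 1 / r1) / x\<^sup>2)) (at x)"
    by (intro DERIV_diff DERIV_add Gd id sq x0)
   moreover have "D x / x\<^sup>2 + - (D r1 / x\<^sup>2) - - (bet * (1 / x - 1 / r1) / x\<^sup>2)
     = (D x - D r1 - bet * (1 / r1 - 1 / x)) / x\<^sup>2" by (simp add: diff_divide_distrib right_diff_distrib)
   moreover have "0 <= (D x - D r1 - bet * (1 / r1 - 1 / x)) / x\<^sup>2"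
    using Dg[OF order_refl x(1) x(2)] x0 by (intro divide_nonneg_pos) auto
   ultimately show "EX y. DERIV ?\<Theta> x :> y & 0 <= y" by - (intro exI conjI, assumption, simp only:)
  qed (use r in auto)
  moreover have "(1 / r2 - 1 / r1) = - l" by (simp add: l_def)
  ultimately show ?thesis using eq by (simp add: G_def)
 qed
 have "bet / 2 * l <= D r2" "bet / 2 * l <= - D r1"
  by (rule mult_right_le_imp_le[OF _ l], use upper lower in \<open>simp only: power2_eq_square mult.assoc\<close>)+
 moreover have "bet / 2 * ((r2 - r1) / b\<^sup>2) <= bet / 2 * l" using lb bet by (intro mult_left_mono) auto
 ultimately show "alf * a\<^sup>2 / (2 * b\<^sup>2) * (r2 - r1) <= S * (mass_speed r2)\<^sup>2 - n\<^sup>2"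
  "S * (mass_speed r1)\<^sup>2 - n\<^sup>2 <= - (alf * a\<^sup>2 / (2 * b\<^sup>2) * (r2 - r1))"
  by (simp_all add: D_def bet_def)
qed

lemma sonic_change:
 "sonic y U - sonic x U = (y - x) * (2 * (U $ 2 * U $ 3) - (x + y) * ((U $ 2)\<^sup>2 - (mass_speed (U $ 1))\<^sup>2))"
 by (simp add: sonic_def mass_flux_def power2_eq_square algebra_simps)

lemma mass_speed_density_continuous: "continuous_on states (%U::state. mass_speed (U $ 1))"
proof -
 obtain k' where "!!r. 0 < r ==> (mass_speed has_real_derivative k' r) (at r)"
  using mass_speed_deriv by metis
 then have "continuous_on {0<..} mass_speed"
  by (intro continuous_at_imp_continuous_on ballI DERIV_isCont) auto
 then show ?thesis by (rule continuous_on_compose2) (auto intro!: continuous_intros simp: states_def)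
qed

text \<open>Two roots have the same velocity along the ray and the same mass flux, so they differ by a multiple of
 their density difference.\<close>

lemma roots_distance:
 assumes K: "U : states" "V : states" and eq: "ray_flux xi U = ray_flux xi V" "mass_flux xi U ~= 0"
 shows "norm (U - V) <= (1 + (1 + (abs xi)) * (abs ((U $ 2 + xi * U $ 3) / U $ 1))) * (abs (U $ 1 - V $ 1))"
proof -
 define T where "T = (U $ 2 + xi * U $ 3) / U $ 1"
 define S where "S = 1 + xi\<^sup>2"
 have S: "1 <= S" by (simp add: S_def)
 note e = ray_flux_eqD[OF eq]
 have d: "U $ 2 + xi * U $ 3 = T * U $ 1" "V $ 2 + xi * V $ 3 = T * V $ 1"
  using K by (simp add: T_def states_def) (use K in \<open>simp add: T_def states_def e(2)\<close>)
 have n: "U $ 3 - V $ 3 = xi * (U $ 2 - V $ 2)" using e(1) by (simp add: mass_flux_def algebra_simps)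
 have "S * (U $ 2 - V $ 2) = T * (U $ 1 - V $ 1)"
 proof -
  have "(U $ 2 - V $ 2) + xi * (U $ 3 - V $ 3) = T * (U $ 1 - V $ 1)" using d by (simp add: algebra_simps)
  then show ?thesis unfolding n by (simp add: S_def power2_eq_square algebra_simps)
 qed
 then have "S * (abs (U $ 2 - V $ 2)) = (abs T) * (abs (U $ 1 - V $ 1))" using S by (metis abs_mult abs_of_nonneg order_trans zero_le_one)
 then have 2: "(abs (U $ 2 - V $ 2)) <= (abs T) * (abs (U $ 1 - V $ 1))"
  using mult_right_mono[OF S, of "(abs (U $ 2 - V $ 2))"] by simp
 have 3: "(abs (U $ 3 - V $ 3)) <= (abs xi) * ((abs T) * (abs (U $ 1 - V $ 1)))"
  unfolding n abs_mult using 2 by (intro mult_left_mono) auto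
 have "norm (U - V) <= (abs (U $ 1 - V $ 1)) + (abs (U $ 2 - V $ 2)) + (abs (U $ 3 - V $ 3))"
  using norm_le_3[of "U - V"] by simp
 also have "... <= (1 + (1 + (abs xi)) * (abs T)) * (abs (U $ 1 - V $ 1))" using 2 3 by (simp add: algebra_simps)
 finally show ?thesis by (simp add: T_def)
qed

text \<open>Next to a jump a state stays off the sonic line over a distance proportional to the jump, with a
 factor that depends on the compact set of states only.\<close>

lemma jump_gap:
 assumes K: "compact K" "K \<subseteq> states" and c: "0 < c" and R: "0 < R"
 shows "EX kap>0. ALL U:K. ALL V:K. kap * norm (U - V) <= c &
  (ALL xi. (abs xi) <= R --> ray_flux xi U = ray_flux xi V --> mass_flux xi U ~= 0 --> U $ 1 < V $ 1 -->
   (ALL y. (abs (y - xi)) <= kap * norm (U - V) --> sonic y U < 0 & 0 < sonic y V))"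
proof -
 obtain a b where ab: "0 < a" "a <= b" "!!U. U : K ==> a <= U $ 1 & U $ 1 <= b" using density_range[OF K] by blast
 obtain alf where alf: "0 < alf" "!!r s. a <= r ==> r <= s ==> s <= b ==> alf * (s - r) <= (mass_speed s)\<^sup>2 - (mass_speed r)\<^sup>2"
  using mass_speed_sq_growth[OF ab(1)] by metis
 have alf': "ALL r s. a <= r --> r <= s --> s <= b --> alf * (s - r) <= (mass_speed s)\<^sup>2 - (mass_speed r)\<^sup>2"
  using alf(2) by blast
 define c1 where "c1 = alf * a\<^sup>2 / (2 * b\<^sup>2)"
 have c1: "0 < c1" using alf(1) ab by (simp add: c1_def)
 obtain B0 where B0: "0 < B0" "ALL U:K. norm U <= B0" using compact_imp_bounded[OF K(1)] bounded_pos by blast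
 have "continuous_on K (%U::state. 2 * (U $ 2 * U $ 3))" by (intro continuous_intros)
 from compact_abs_bound[OF K(1) this] obtain B1 where B1: "0 < B1" "!!U. U : K ==> (abs (2 * (U $ 2 * U $ 3))) <= B1" by blast
 have "continuous_on K (%U. (U $ 2)\<^sup>2 - (mass_speed (U $ 1))\<^sup>2)"
  by (intro continuous_intros continuous_on_subset[OF mass_speed_density_continuous K(2)])
 from compact_abs_bound[OF K(1) this] obtain B2 where B2: "0 < B2"
  "!!U. U : K ==> (abs ((U $ 2)\<^sup>2 - (mass_speed (U $ 1))\<^sup>2)) <= B2" by blast
 define C2 where "C2 = B1 + (2 * R + c) * B2"
 have C2: "0 < C2" using B1(1) B2(1) R c by (simp add: C2_def add_pos_pos)
 define C1 where "C1 = 1 + (1 + R) * ((1 + R) * B0 / a)"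
 have C1: "0 < C1" using R B0(1) ab(1) by (simp add: C1_def add_pos_nonneg)
 define kap where "kap = min (c / (2 * B0)) (c1 / (2 * C1 * C2))"
 have kap: "0 < kap" using c B0(1) c1 C1 C2 by (simp add: kap_def)
 have small: "kap * norm (U - V) <= c" if "U : K" "V : K" for U V
 proof -
  have "norm U <= B0" "norm V <= B0" using B0(2) that by auto
  then have "norm (U - V) <= 2 * B0" using norm_triangle_ineq4[of U V] by linarith
  then have "kap * norm (U - V) <= (c / (2 * B0)) * (2 * B0)" using kap B0(1) by (intro mult_mono) (auto simp: kap_def)
  then show ?thesis using B0(1) by simp
 qed
 have main: "sonic y U < 0 & 0 < sonic y V"
  if UV: "U : K" "V : K" and xi: "(abs xi) <= R" and eq: "ray_flux xi U = ray_flux xi V" "mass_flux xi U ~= 0"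
   and less: "U $ 1 < V $ 1" and y: "(abs (y - xi)) <= kap * norm (U - V)" for U V xi y
 proof -
  have st: "U : states" "V : states" using UV K(2) by auto
  define \<Delta> where "\<Delta> = V $ 1 - U $ 1"
  have \<Delta>: "0 < \<Delta>" using less by (simp add: \<Delta>_def)
  have s1: "c1 * \<Delta> <= sonic xi V" "sonic xi U <= - (c1 * \<Delta>)"
   using jump_sonic_bound[OF ab(1) alf(1) alf' _ less, of "1 + xi\<^sup>2" "mass_flux xi U"] ab(3)[OF UV(1)] ab(3)[OF UV(2)]
    ray_flux_eqD[OF eq] by (auto simp: sonic_def c1_def \<Delta>_def)
  have "(abs ((U $ 2 + xi * U $ 3) / U $ 1)) <= (1 + R) * B0 / a"
  proof -
   have "(abs (U $ 2)) <= B0" "(abs (U $ 3)) <= B0"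
    using component_le_norm_cart[of U 2] component_le_norm_cart[of U 3] B0(2) UV(1) by (force intro: order_trans)+
   then have "(abs (U $ 2 + xi * U $ 3)) <= B0 + R * B0"
    using mult_mono[OF xi, of "(abs (U $ 3))" B0] R abs_triangle_ineq[of "U $ 2" "xi * U $ 3"] by (simp add: abs_mult)
   then show ?thesis
    unfolding abs_divide using ab(1) ab(3)[OF UV(1)] R B0(1) by (intro frac_le) (auto simp: algebra_simps)
  qed
  then have "1 + (1 + (abs xi)) * (abs ((U $ 2 + xi * U $ 3) / U $ 1)) <= C1"
   unfolding C1_def using xi R by (intro add_left_mono mult_mono) auto
  then have nJ: "norm (U - V) <= C1 * \<Delta>"
   using roots_distance[OF st eq] \<Delta> by (smt (verit) \<Delta>_def mult_right_mono)
  have d: "C2 * (abs (y - xi)) <= c1 * \<Delta> / 2"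
  proof -
   have "(abs (y - xi)) <= (c1 / (2 * C1 * C2)) * (C1 * \<Delta>)"
    using y nJ kap mult_mono[of kap "c1 / (2 * C1 * C2)" "norm (U - V)" "C1 * \<Delta>"] c1 C1 C2 by (simp add: kap_def)
   then have "C2 * (abs (y - xi)) <= C2 * ((c1 / (2 * C1 * C2)) * (C1 * \<Delta>))" using C2 by (intro mult_left_mono) auto
   also have "... = c1 * \<Delta> / 2" using C1 C2 by (simp add: field_simps)
   finally show ?thesis .
  qed
  have ch: "(abs (sonic y W - sonic xi W)) <= C2 * (abs (y - xi))" if W: "W : K" for W
  proof -
   have "(abs (xi + y)) <= 2 * R + c" using xi y small[OF UV] by linarith
   then have "(abs (2 * (W $ 2 * W $ 3) - (xi + y) * ((W $ 2)\<^sup>2 - (mass_speed (W $ 1))\<^sup>2))) <= C2"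
    unfolding C2_def using B1(2)[OF W] mult_mono[OF _ B2(2)[OF W], of "(abs (xi + y))" "2 * R + c"] R c
     abs_triangle_ineq4[of "2 * (W $ 2 * W $ 3)" "(xi + y) * ((W $ 2)\<^sup>2 - (mass_speed (W $ 1))\<^sup>2)"]
    by (simp add: abs_mult)
   then have "(abs (y - xi)) * (abs (2 * (W $ 2 * W $ 3) - (xi + y) * ((W $ 2)\<^sup>2 - (mass_speed (W $ 1))\<^sup>2))) <= (abs (y - xi)) * C2"
    by (rule mult_left_mono) simp
   then show ?thesis unfolding sonic_change abs_mult by (simp only: mult.commute)
  qed
  have "0 < c1 * \<Delta>" using c1 \<Delta> by simp
  then show ?thesis using ch[OF UV(1)] ch[OF UV(2)] d s1 by linarith
 qed
 show ?thesis
  by (intro exI[of _ kap] conjI kap ballI small allI impI; (assumption | (rule main[THEN conjunct1] main[THEN conjunct2]; assumption)))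
qed

end

section \<open>Total variation and rarefaction profiles\<close>

text \<open>Bounds of increments by those of a fixed function \<open>g\<close>: with \<open>g\<close> the identity this is the Lipschitz
 property, with a monotone \<open>g\<close> it bounds the total variation. Both are stable under the algebraic
 operations that recover a state from its fluxes and its density.\<close>

definition tame :: "(real => real) => real set => (real => real) => bool" where
 "tame g X f \<longleftrightarrow> (EX L>=0. ALL x:X. ALL y:X. x <= y --> (abs (f y - f x)) <= L * (g y - g x)) & (EX B. ALL x:X. (abs (f x)) <= B)"

lemma tameI:
 assumes "!!x y. x : X ==> y : X ==> x <= y ==> (abs (f y - f x)) <= L * (g y - g x)" "0 <= L" "!!x. x : X ==> (abs (f x)) <= B"
 shows "tame g X f"
 unfolding tame_def using assms by blast

lemma tameD:
 assumes "tame g X f"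
 shows "EX L B. 0 <= L & (ALL x:X. ALL y:X. x <= y --> (abs (f y - f x)) <= L * (g y - g x)) & 0 <= B & (ALL x:X. (abs (f x)) <= B)"
proof -
 from assms obtain L B where *: "0 <= L" "ALL x:X. ALL y:X. x <= y --> (abs (f y - f x)) <= L * (g y - g x)" "ALL x:X. (abs (f x)) <= B"
  unfolding tame_def by (elim conjE exE)
 have "(abs (f x)) <= max B 0" if "x : X" for x using *(3)[rule_format, OF that] by simp
 then show ?thesis by (intro exI[of _ L] exI[of _ "max B 0"] conjI * ballI) auto
qed

lemma tame_const: "tame g X (%x. c)"
 by (rule tameI[where L = 0 and B = "(abs c)"]) auto

lemma tame_add:
 assumes "tame g X f" "tame g X h" shows "tame g X (%x. f x + h x)"
proof -
 from tameD[OF assms(1)] obtain L B where f: "0 <= L" "ALL x:X. ALL y:X. x <= y --> (abs (f y - f x)) <= L * (g y - g x)"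
  "0 <= B" "ALL x:X. (abs (f x)) <= B" by (elim exE conjE)
 note f = f[rule_format]
 from tameD[OF assms(2)] obtain L' B' where h: "0 <= L'" "ALL x:X. ALL y:X. x <= y --> (abs (h y - h x)) <= L' * (g y - g x)"
  "0 <= B'" "ALL x:X. (abs (h x)) <= B'" by (elim exE conjE)
 note h = h[rule_format]
 show ?thesis
 proof (rule tameI[where L = "L + L'" and B = "B + B'"])
  fix x y assume xy: "x : X" "y : X" "x <= y"
  show "(abs (f y + h y - (f x + h x))) <= (L + L') * (g y - g x)"
   using f(2)[OF xy] h(2)[OF xy] unfolding distrib_right by linarith
 next
  fix x assume "x : X" then show "(abs (f x + h x)) <= B + B'" using f(4)[of x] h(4)[of x] by linarith
 qed (use f(1) h(1) in simp)
qed

lemma tame_mult: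
 assumes "tame g X f" "tame g X h" shows "tame g X (%x. f x * h x)"
proof -
 from tameD[OF assms(1)] obtain L B where f: "0 <= L" "ALL x:X. ALL y:X. x <= y --> (abs (f y - f x)) <= L * (g y - g x)"
  "0 <= B" "ALL x:X. (abs (f x)) <= B" by (elim exE conjE)
 note f = f[rule_format]
 from tameD[OF assms(2)] obtain L' B' where h: "0 <= L'" "ALL x:X. ALL y:X. x <= y --> (abs (h y - h x)) <= L' * (g y - g x)"
  "0 <= B'" "ALL x:X. (abs (h x)) <= B'" by (elim exE conjE)
 note h = h[rule_format]
 show ?thesis
 proof (rule tameI[where L = "B * L' + B' * L" and B = "B * B'"])
  fix x y assume xy: "x : X" "y : X" "x <= y"
  have "(abs (f y * h y - f x * h x)) = (abs (f y * (h y - h x) + h x * (f y - f x)))" by (simp add: algebra_simps)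
  also have "... <= (abs (f y)) * (abs (h y - h x)) + (abs (h x)) * (abs (f y - f x))"
   using abs_triangle_ineq[of "f y * (h y - h x)" "h x * (f y - f x)"] unfolding abs_mult .
  also have "... <= B * (L' * (g y - g x)) + B' * (L * (g y - g x))"
   by (intro add_mono mult_mono f(4)[OF xy(2)] h(4)[OF xy(1)] f(2)[OF xy] h(2)[OF xy] f(3) h(3) abs_ge_zero)
  finally show "(abs (f y * h y - f x * h x)) <= (B * L' + B' * L) * (g y - g x)" by (simp add: algebra_simps)
 next
  fix x assume x: "x : X"
  show "(abs (f x * h x)) <= B * B'" unfolding abs_mult by (intro mult_mono f(4)[OF x] h(4)[OF x] f(3) abs_ge_zero)
 qed (use f(1,3) h(1,3) in simp)
qed

lemma tame_diff:
 assumes "tame g X f" "tame g X h" shows "tame g X (%x. f x - h x)"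
 using tame_add[OF assms(1) tame_mult[OF tame_const[of g X "-1"] assms(2)]] by simp

lemma tame_inverse:
 assumes "tame g X f" and \<nu>: "0 < \<nu>" "!!x. x : X ==> \<nu> <= (abs (f x))"
 shows "tame g X (%x. inverse (f x))"
proof -
 from tameD[OF assms(1)] obtain L B where f: "0 <= L" "ALL x:X. ALL y:X. x <= y --> (abs (f y - f x)) <= L * (g y - g x)"
  "0 <= B" "ALL x:X. (abs (f x)) <= B"
  by (elim exE conjE)
 note f = f[rule_format]
 have inv: "(abs (inverse (f x))) <= 1 / \<nu>" if "x : X" for x
  using \<nu>(2)[OF that] \<nu>(1) by (simp add: inverse_eq_divide frac_le)
 show ?thesis
 proof (rule tameI[where L = "1 / \<nu> * (1 / \<nu>) * L" and B = "1 / \<nu>"])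
  fix x y assume xy: "x : X" "y : X" "x <= y"
  have nz: "f x ~= 0" "f y ~= 0" using \<nu>(2)[OF xy(1)] \<nu>(2)[OF xy(2)] \<nu>(1) by auto
  have "(abs (inverse (f y) - inverse (f x))) = (abs (inverse (f y))) * (abs (inverse (f x))) * (abs (f y - f x))"
   using nz unfolding inverse_diff_inverse[OF nz(2,1)] abs_minus_cancel abs_mult by (simp add: mult_ac)
  also have "... <= 1 / \<nu> * (1 / \<nu>) * (L * (g y - g x))"
   using \<nu>(1) by (intro mult_mono inv xy f(2) mult_nonneg_nonneg abs_ge_zero) auto
  finally show "(abs (inverse (f y) - inverse (f x))) <= 1 / \<nu> * (1 / \<nu>) * L * (g y - g x)" by (simp only: mult.assoc)
 qed (use f(1) \<nu>(1) inv in auto)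
qed

text \<open>Domination by the increments of a bounded function: a form of bounded variation that passes to
 unions of consecutive sets and to monotone changes of the variable.\<close>

definition controlled :: "real set => (real => 'b::real_normed_vector) => bool" where
 "controlled X f \<longleftrightarrow> (EX g B. (ALL x:X. ALL y:X. x <= y --> norm (f y - f x) <= g y - g x) & (ALL x:X. (abs (g x)) <= (B::real)))"

lemma controlledI:
 fixes g :: "real => real"
 assumes "!!x y. x : X ==> y : X ==> x <= y ==> norm (f y - f x) <= g y - g x" "!!x. x : X ==> (abs (g x)) <= B"
 shows "controlled X f"
 unfolding controlled_def using assms by blast

lemma controlledD:
 "controlled X f ==> EX g B. (ALL x:X. ALL y:X. x <= y --> norm (f y - f x) <= g y - g x) & (ALL x:X. (abs (g x)) <= (B::real))"
 unfolding controlled_def .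

lemma controlled_const: "(!!x. x : X ==> f x = c) ==> controlled X f"
 by (rule controlledI[where g = "%_. 0" and B = 0]) auto

lemma controlled_cong: "controlled X f ==> (!!x. x : X ==> h x = f x) ==> controlled X h"
 unfolding controlled_def by simp

lemma controlled_compose:
 assumes "controlled Y f" "!!x. x : X ==> h x : Y" "!!x y. x : X ==> y : X ==> x <= y ==> h x <= h y"
 shows "controlled X (%x. f (h x))"
proof -
 from controlledD[OF assms(1)] obtain g B where g: "ALL x:Y. ALL y:Y. x <= y --> norm (f y - f x) <= g y - g x" "ALL x:Y. (abs (g x)) <= (B::real)"
  by (elim exE conjE)
 note g = g[rule_format]
 show ?thesis by (rule controlledI[where g = "%x. g (h x)" and B = B]) (auto intro: g assms)
qed

lemma controlled_join:
 assumes "controlled A f" "controlled B f" and AB: "!!a b. a : A ==> b : B ==> a < b"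
 shows "controlled (A \<union> B) f"
proof -
 have bd: "EX C. ALL x:X. norm (f x) <= C" if "controlled X f" for X
 proof (cases "X = {}")
  case False
  then obtain x0 where x0: "x0 : X" by blast
  from controlledD[OF that] obtain g C where g: "ALL x:X. ALL y:X. x <= y --> norm (f y - f x) <= g y - g x" "ALL x:X. (abs (g x)) <= (C::real)"
   by (elim exE conjE)
  note g = g[rule_format]
  have "norm (f x) <= norm (f x0) + 2 * C" if x: "x : X" for x
  proof -
   have "norm (f x - f x0) <= 2 * C"
   proof (cases "x <= x0")
    case True
    show ?thesis using g(1)[OF x x0 True] g(2)[OF x] g(2)[OF x0] by (simp add: norm_minus_commute)
   next
    case False
    then show ?thesis using g(1)[OF x0 x] g(2)[OF x] g(2)[OF x0] by simp
   qed
   then show ?thesis using norm_triangle_sub[of "f x" "f x0"] by simp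
  qed
  then show ?thesis by blast
 qed simp
 obtain C1 where C1: "ALL x:A. norm (f x) <= C1" using bd[OF assms(1)] by blast
 obtain C2 where C2: "ALL x:B. norm (f x) <= C2" using bd[OF assms(2)] by blast
 from controlledD[OF assms(1)] obtain g1 B1 where g1: "ALL x:A. ALL y:A. x <= y --> norm (f y - f x) <= g1 y - g1 x" "ALL x:A. (abs (g1 x)) <= (B1::real)"
  by (elim exE conjE)
 note g1 = g1[rule_format]
 from controlledD[OF assms(2)] obtain g2 B2 where g2: "ALL x:B. ALL y:B. x <= y --> norm (f y - f x) <= g2 y - g2 x" "ALL x:B. (abs (g2 x)) <= (B2::real)"
  by (elim exE conjE)
 note g2 = g2[rule_format]
 define k where "k = B1 + B2 + C1 + C2"
 define g where "g x = (if x : A then g1 x else g2 x + k)" for x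
 have disj: "x \<notin> A" if "x : B" for x using AB[OF _ that] by blast
 show ?thesis
 proof (rule controlledI[where g = g and B = "(abs B1) + (abs B2) + (abs k)"])
  fix x y assume xy: "x : A \<union> B" "y : A \<union> B" "x <= y"
  consider "x : A" "y : A" | "x : A" "y : B" | "x : B" "y : B"
   using xy AB[of y x] by fastforce
  then show "norm (f y - f x) <= g y - g x"
  proof cases
   case 1 then show ?thesis using g1(1) xy(3) by (simp add: g_def)
  next
   case 2
   have "norm (f y - f x) <= C1 + C2" using C1[rule_format, OF 2(1)] C2[rule_format, OF 2(2)] norm_triangle_ineq4[of "f y" "f x"] by linarith
   moreover have "g y - g x = g2 y + k - g1 x" using 2 disj by (simp add: g_def)
   ultimately show ?thesis using g1(2)[OF 2(1)] g2(2)[OF 2(2)] by (simp add: k_def)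
  next
   case 3 then show ?thesis using g2(1) xy(3) disj by (simp add: g_def)
  qed
 next
  fix x assume "x : A \<union> B"
  then show "(abs (g x)) <= (abs B1) + (abs B2) + (abs k)" using g1(2)[of x] g2(2)[of x] by (auto simp: g_def)
 qed
qed

lemma controlled_join_Icc:
 fixes a b c :: real
 assumes abc: "0 < a" "a < b" "b < c"
  and A: "controlled {0..<a} f" "controlled {a} f" "controlled {a<..<b} f" "controlled {b} f" "controlled {b<..c} f"
 shows "controlled {0..c} f"
proof -
 have "controlled ({0..<a} \<union> ({a} \<union> ({a<..<b} \<union> ({b} \<union> {b<..c})))) f"
  by (intro controlled_join A) (use abc in auto)
 moreover have "{0..<a} \<union> ({a} \<union> ({a<..<b} \<union> ({b} \<union> {b<..c}))) = {0..c}"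
 proof (rule set_eqI)
  fix x
  show "x : {0..<a} \<union> ({a} \<union> ({a<..<b} \<union> ({b} \<union> {b<..c}))) \<longleftrightarrow> x : {0..c}"
   using abc by (cases x a rule: linorder_cases; cases x b rule: linorder_cases) auto
 qed
 ultimately show ?thesis by simp
qed

lemma controlled_bounded_variation:
 assumes "controlled S f" shows "bounded_variation_on S f"
proof -
 from controlledD[OF assms] obtain g B where g: "ALL x:S. ALL y:S. x <= y --> norm (f y - f x) <= g y - g x" "ALL x:S. (abs (g x)) <= (B::real)"
  by (elim exE conjE)
 note g = g[rule_format]
 show ?thesis
  unfolding bounded_variation_on_def
 proof (intro exI[of _ "2 * B"] allI impI)
  fix n :: nat and t :: "nat => real"
  assume t: "(ALL i<=n. t i : S) & (ALL i<n. t i <= t (Suc i))"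
  have "(\<Sum>i<n. norm (f (t (Suc i)) - f (t i))) <= (\<Sum>i<n. g (t (Suc i)) - g (t i))"
   by (rule sum_mono, rule g(1)) (use t in auto)
  also have "... = g (t n) - g (t 0)" by (rule sum_lessThan_telescope)
  also have "... <= 2 * B" using g(2)[of "t n"] g(2)[of "t 0"] t by fastforce
  finally show "(\<Sum>i<n. norm (f (t (Suc i)) - f (t i))) <= 2 * B" .
 qed
qed

lemma DERIV_of_compose:
 fixes f r :: "real => real"
 assumes f: "DERIV f (r x) :> d" "d ~= 0" and r: "isCont r x" and fr: "DERIV (%y. f (r y)) x :> e"
 shows "DERIV r x :> e / d"
proof -
 obtain \<phi> where \<phi>: "ALL z. f z - f (r x) = \<phi> z * (z - r x)" "isCont \<phi> (r x)" "\<phi> (r x) = d" using f(1) CARAT_DERIV by metis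
 have lim: "((%y. \<phi> (r y)) \<longlongrightarrow> d) (at x)" using isCont_o2[OF r \<phi>(2)] \<phi>(3) by (simp add: isCont_def)
 have "\<forall>\<^sub>F y in at x. \<phi> (r y) ~= 0" using tendsto_imp_eventually_ne[OF lim f(2)] .
 moreover have "\<forall>\<^sub>F y in at x. y ~= x" by (simp add: eventually_at_filter)
 ultimately have "\<forall>\<^sub>F y in at x. (f (r y) - f (r x)) / (y - x) / \<phi> (r y) = (r y - r x) / (y - x)"
  by eventually_elim (use \<phi>(1) in simp)
 moreover have "((%y. (f (r y) - f (r x)) / (y - x) / \<phi> (r y)) \<longlongrightarrow> e / d) (at x)"
  using fr unfolding has_field_derivative_iff by (intro tendsto_divide lim f(2))
 ultimately have "((%y. (r y - r x) / (y - x)) \<longlongrightarrow> e / d) (at x)" by (rule Lim_transform_eventually[rotated])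
 then show ?thesis unfolding has_field_derivative_iff .
qed

context near_profile begin

text \<open>Where the mass flux does not vanish, the state is a smooth function of slope, flux and density.\<close>

lemma decode:
 assumes N: "Flux x $ 1 ~= 0"
 shows "w x $ 2 = (w x $ 1 * ((Flux x $ 2 + x * Flux x $ 3) * inverse (Flux x $ 1)) - x * Flux x $ 1) * inverse (1 + x * x)"
  and "w x $ 3 = x * w x $ 2 + Flux x $ 1" and "ray_flux x (w x) = Flux x" and "w x : K" and "0 < w x $ 1"
proof -
 have wr: "w x : roots x" by (rule w_limit(2)[OF N])
 then show F: "ray_flux x (w x) = Flux x" and "w x : K" by (auto simp: roots_def)
 then show pos: "0 < w x $ 1" using K(3) by (auto simp: states_def)
 have n: "w x $ 3 - x * w x $ 2 = Flux x $ 1" using roots_mass_flux[OF wr] by (simp add: mass_flux_def)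
 then show "w x $ 3 = x * w x $ 2 + Flux x $ 1" by simp
 have "Flux x $ 2 + x * Flux x $ 3 = Flux x $ 1 * ((w x $ 2 + x * w x $ 3) / w x $ 1)"
  using ray_flux_tangential[of x "w x"] roots_mass_flux[OF wr] F by simp
 then have "w x $ 1 * ((Flux x $ 2 + x * Flux x $ 3) * inverse (Flux x $ 1)) = w x $ 2 + x * w x $ 3"
  using N pos by (simp add: field_simps)
 moreover have "w x $ 2 + x * w x $ 3 - x * Flux x $ 1 = w x $ 2 * (1 + x * x)" using n by (simp add: algebra_simps)
 moreover have "1 + x * x ~= 0" using zero_le_square[of x] by linarith
 ultimately show "w x $ 2 = (w x $ 1 * ((Flux x $ 2 + x * Flux x $ 3) * inverse (Flux x $ 1)) - x * Flux x $ 1) * inverse (1 + x * x)"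
  by simp
qed

lemma tame_basic:
 assumes X: "X \<subseteq> {-R..R}" and g: "!!x y. x : X ==> y : X ==> x <= y ==> y - x <= g y - g x"
 shows "tame g X (%x. x)" "tame g X (%x. Flux x $ i)" "tame g X (%x. inverse (1 + x * x))"
proof -
 show id: "tame g X (%x. x)"
  by (rule tameI[where L = 1 and B = R]) (use X g in fastforce)+
 obtain C where C: "0 < C" "!!x y. norm (Flux y - Flux x) <= C * (abs (y - x))" using Flux_lipschitz by blast
 have c: "(abs (Flux y $ i - Flux x $ i)) <= C * (abs (y - x))" for x y
  using component_le_norm_cart[of "Flux y - Flux x" i] C(2)[of y x] by simp
 show "tame g X (%x. Flux x $ i)"
 proof (rule tameI[where L = C and B = "(abs (Flux 0 $ i)) + C * R"])
  fix x y assume xy: "x : X" "y : X" "x <= y"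
  have "C * (abs (y - x)) <= C * (g y - g x)" using g[OF xy] xy(3) C(1) by (intro mult_left_mono) auto
  then show "(abs (Flux y $ i - Flux x $ i)) <= C * (g y - g x)" using c[of y x] by linarith
 next
  fix x assume "x : X"
  then have "x : {-R..R}" using X by blast
  then have "(abs x) <= R" by auto
  then have "C * (abs (x - 0)) <= C * R" using C(1) by (intro mult_left_mono) auto
  then show "(abs (Flux x $ i)) <= (abs (Flux 0 $ i)) + C * R" using c[of x 0] by linarith
 qed (use C(1) in simp)
 show "tame g X (%x. inverse (1 + x * x))"
  by (rule tame_inverse[where \<nu> = 1, OF tame_add[OF tame_const tame_mult[OF id id]]]) auto
qed

lemma state_tame:
 assumes X: "X \<subseteq> {-R..R}" and g: "!!x y. x : X ==> y : X ==> x <= y ==> y - x <= g y - g x"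
  and \<nu>: "0 < \<nu>" "!!x. x : X ==> \<nu> <= (abs (Flux x $ 1))" and \<rho>: "tame g X (%x. w x $ 1)"
 shows "tame g X (%x. w x $ i)"
proof -
 have cong: "tame g X h" if "tame g X f" "!!x. x : X ==> h x = f x" for f h
  using that(1) unfolding tame_def by (simp add: that(2))
 have N: "Flux x $ 1 ~= 0" if "x : X" for x using \<nu>(2)[OF that] \<nu>(1) by auto
 have b1: "tame g X (%x. x)" "tame g X (%x. Flux x $ j)" "tame g X (%x. inverse (1 + x * x))" for j
  by (rule tame_basic[OF X g]; assumption)+
 have 2: "tame g X (%x. w x $ 2)"
  by (rule cong[OF _ decode(1)[OF N]])
    (intro tame_mult tame_diff tame_add b1 \<rho> tame_inverse[OF b1(2) \<nu>]; assumption)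
 have 3: "tame g X (%x. w x $ 3)"
  by (rule cong[OF tame_add[OF tame_mult[OF b1(1) 2] b1(2)[of 1]] decode(2)[OF N]])
 show ?thesis using exhaust_3[of i] \<rho> 2 3 by auto
qed

text \<open>On the sonic set the mass speed, hence the density, is determined by the mass flux.\<close>

lemma density_tame_sonic:
 assumes X: "X \<subseteq> {-R..R}" and z: "!!x. x : X ==> Flux x $ 1 ~= 0 & sonic x (w x) = 0"
 shows "tame (%x. x) X (%x. w x $ 1)"
proof -
 obtain a b where ab: "0 < a" "a <= b" "!!U. U : K ==> a <= U $ 1 & U $ 1 <= b" using density_range[OF K(1) K(3)] by blast
 obtain alf where alf: "0 < alf" "!!r s. a <= r ==> r <= s ==> s <= b ==> alf * (s - r) <= (mass_speed s)\<^sup>2 - (mass_speed r)\<^sup>2"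
  using mass_speed_sq_growth[OF ab(1)] by metis
 have b1: "tame (%x. x) X (%x. Flux x $ 1)" "tame (%x. x) X (%x. inverse (1 + x * x))"
  by (rule tame_basic[OF X], simp)+
 have t: "tame (%x. x) X (%x. Flux x $ 1 * Flux x $ 1 * inverse (1 + x * x))" by (intro tame_mult b1)
 from tameD[OF t] obtain L B where L: "0 <= L" "ALL x:X. ALL y:X. x <= y --> (abs (Flux y $ 1 * Flux y $ 1 * inverse (1 + y * y) - Flux x $ 1 * Flux x $ 1 * inverse (1 + x * x))) <= L * (y - x)"
  "0 <= B" "ALL x:X. (abs (Flux x $ 1 * Flux x $ 1 * inverse (1 + x * x))) <= B"
  by (elim exE conjE)
 note L = L[rule_format]
 have k: "(mass_speed (w x $ 1))\<^sup>2 = Flux x $ 1 * Flux x $ 1 * inverse (1 + x * x)" if "x : X" for x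
 proof -
  have "mass_flux x (w x) = Flux x $ 1" using roots_mass_flux w_limit(2) z[OF that] by blast
  then have "(1 + x * x) * (mass_speed (w x $ 1))\<^sup>2 = Flux x $ 1 * Flux x $ 1"
   using z[OF that] by (simp add: sonic_def power2_eq_square)
  moreover have "1 + x * x ~= 0" using zero_le_square[of x] by linarith
  ultimately show ?thesis by (simp add: field_simps)
 qed
 have K: "a <= w x $ 1 & w x $ 1 <= b" if "x : X" for x using ab(3)[OF decode(4)] z[OF that] by blast
 show ?thesis
 proof (rule tameI[where L = "L / alf" and B = b])
  fix x y assume xy: "x : X" "y : X" "x <= y"
  have "alf * (abs (w y $ 1 - w x $ 1)) <= (abs ((mass_speed (w y $ 1))\<^sup>2 - (mass_speed (w x $ 1))\<^sup>2))"
  proof (cases "w x $ 1 <= w y $ 1")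
   case True then show ?thesis using alf(2)[OF _ True] K[OF xy(1)] K[OF xy(2)] by simp
  next
   case False
   then have le: "w y $ 1 <= w x $ 1" by simp
   show ?thesis using alf(2)[OF _ le] K[OF xy(1)] K[OF xy(2)] le by (simp add: abs_minus_commute[of "w y $ 1"])
  qed
  also have "... <= L * (y - x)" unfolding k[OF xy(1)] k[OF xy(2)] by (rule L(2)[OF xy])
  finally show "(abs (w y $ 1 - w x $ 1)) <= L / alf * (y - x)" using alf(1) by (simp add: field_simps)
 next
  fix x assume "x : X" then show "(abs (w x $ 1)) <= b" using K[of x] ab(1) by auto
 qed (use L(1) alf(1) in simp)
qed

lemma Flux1_lower_bound: obtains \<nu> where "0 < \<nu>" "!!x. lam / 2 <= (abs x) ==> \<nu> <= (abs (Flux x $ 1))"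
proof (rule that[of "min (Flux (- lam / 2) $ 1) (- Flux (lam / 2) $ 1)"])
 show "0 < min (Flux (- lam / 2) $ 1) (- Flux (lam / 2) $ 1)"
  using Flux1_sign[of "- lam / 2"] Flux1_sign[of "lam / 2"] Flux1_zero(2) dlt lam(1) by auto
 fix x assume x: "lam / 2 <= (abs x)"
 consider "x <= - lam / 2" | "lam / 2 <= x" using x by linarith
 then show "min (Flux (- lam / 2) $ 1) (- Flux (lam / 2) $ 1) <= (abs (Flux x $ 1))"
 proof cases
  case 1
  then have "Flux (- lam / 2) $ 1 <= Flux x $ 1" using Flux1_decreasing[of x "- lam / 2"] by (metis less_eq_real_def)
  then show ?thesis by linarith
 next
  case 2
  then have "Flux x $ 1 <= Flux (lam / 2) $ 1" using Flux1_decreasing[of "lam / 2" x] by (metis less_eq_real_def)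
  then show ?thesis by linarith
 qed
qed

text \<open>The jumps of \<open>sig \<rho>\<close> are upward and \<open>\<rho>\<close> is Lipschitz on the sonic set, so \<open>sig \<rho>\<close> becomes monotone after the
 addition of a linear function; this function controls the other components.\<close>

lemma w_controlled_mach:
 assumes tau: "tau : {1, -1}"
 shows "controlled {x. - (lam + dlt) < tau * x & tau * x < - lam / 2} w"
proof -
 define X where "X = {x. - (lam + dlt) < tau * x & tau * x < - lam / 2}"
 define R where "R = lam + dlt"
 have XR: "X \<subseteq> {-R..R}" using tau lam(1) dlt(1) by (auto simp: X_def R_def)
 have big: "lam / 2 <= (abs x)" if "x : X" for x using that tau by (auto simp: X_def)
 obtain \<nu> where \<nu>: "0 < \<nu>" "!!x. lam / 2 <= (abs x) ==> \<nu> <= (abs (Flux x $ 1))" using Flux1_lower_bound by blast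
 have N: "Flux x $ 1 ~= 0" if "x : X" for x using \<nu>(2)[OF big[OF that]] \<nu>(1) by auto
 define Z where "Z = {x : X. sonic x (w x) = 0}"
 have t: "tame (%x. x) Z (%x. w x $ 1)" by (rule density_tame_sonic[of Z R]) (use XR N in \<open>auto simp: Z_def\<close>)
 from tameD[OF t] obtain L C where L: "0 <= L" "ALL x:Z. ALL y:Z. x <= y --> (abs (w y $ 1 - w x $ 1)) <= L * (y - x)"
  "0 <= C" "ALL x:Z. (abs (w x $ 1)) <= C" by (elim exE conjE)
 note L = L[rule_format]
 interpret f: fan "%xi. w (tau * xi)" "%xi. sonic (tau * xi)" "- lam / 2" sig K "%xi. roots (tau * xi)" by (rule mach_fan[OF tau])
 have tau2: "tau * (tau * x) = x" for x using tau by auto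
 have ol: "- L * (y - x) <= sig * w (tau * y) $ 1 - sig * w (tau * x) $ 1"
  if xy: "- (lam + dlt) < x" "x < y" "y < - lam / 2" for x y
 proof (rule f.one_sided_lipschitz[where f = "%U. sig * U $ 1" and a = "- (lam + dlt)", OF _ _ _ L(1) xy])
  show "continuous_on K (%U. sig * U $ 1)" by (intro continuous_intros)
 next
  fix xi cl cr assume *: "- (lam + dlt) < xi" "xi < - lam / 2" "cl : roots (tau * xi)" "cr : roots (tau * xi)"
   "sig * sonic (tau * xi) cl < 0" "0 < sig * sonic (tau * xi) cr"
  have "tau * xi : X" using *(1,2) by (simp add: X_def tau2)
  from *(3,4) N[OF this] show "sig * cl $ 1 <= sig * cr $ 1"
   by (rule roots_cases) (use *(5,6) sig in auto)
 next
  fix x y assume *: "- (lam + dlt) < x" "x < y" "y < - lam / 2" "sonic (tau * x) (w (tau * x)) = 0" "sonic (tau * y) (w (tau * y)) = 0"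
  have Z: "tau * x : Z" "tau * y : Z" using * by (auto simp: Z_def X_def tau2)
  have "(abs (w (tau * y) $ 1 - w (tau * x) $ 1)) <= L * (y - x)"
   using L(2)[OF Z(1) Z(2)] L(2)[OF Z(2) Z(1)] tau *(2) by (auto simp: abs_minus_commute)
  then show "- L * (y - x) <= sig * w (tau * y) $ 1 - sig * w (tau * x) $ 1" using sig by auto
 qed
 define g where "g x = tau * (sig * w x $ 1) + (L + 1) * x" for x
 have dg: "y - x <= g y - g x" if "x : X" "y : X" "x <= y" for x y
 proof (cases "x = y")
  case False
  have "- (L * (y - x)) <= tau * (sig * w y $ 1) - tau * (sig * w x $ 1)"
   using ol[of x y] ol[of "- y" "- x"] that False tau by (auto simp: X_def)
  then show ?thesis by (simp add: g_def algebra_simps)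
 qed simp
 obtain a b where ab: "0 < a" "a <= b" "!!U. U : K ==> a <= U $ 1 & U $ 1 <= b" using density_range[OF K(1) K(3)] by blast
 have wb: "(abs (w x $ 1)) <= b" if "x : X" for x using ab(3)[OF decode(4)[OF N[OF that]]] ab(1) by auto
 have \<rho>: "tame g X (%x. w x $ 1)"
 proof (rule tameI[where L = "L + 2", OF _ _ wb])
  fix x y assume xy: "x : X" "y : X" "x <= y"
  have "(abs (w y $ 1 - w x $ 1)) = (abs (tau * (sig * w y $ 1) - tau * (sig * w x $ 1)))" using tau sig by auto
  also have "... <= (g y - g x) + (L + 1) * (y - x)"
   using dg[OF xy] mult_nonneg_nonneg[of "L + 1" "y - x"] L(1) xy(3) unfolding g_def by (simp add: algebra_simps)
  also have "(L + 1) * (y - x) <= (L + 1) * (g y - g x)" using dg[OF xy] L(1) by (intro mult_left_mono) auto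
  finally show "(abs (w y $ 1 - w x $ 1)) <= (L + 2) * (g y - g x)" by (simp add: algebra_simps)
 qed (use L(1) in auto)
 have t: "tame g X (%x. w x $ i)" for i
  by (rule state_tame[OF XR dg \<nu>(1) \<nu>(2)[OF big] \<rho>]; assumption)
 have "EX l>=0. ALL x:X. ALL y:X. x <= y --> (abs (w y $ i - w x $ i)) <= l * (g y - g x)" for i
  using t[of i] unfolding tame_def by (elim conjE)
 then obtain l where l: "!!i. 0 <= l i" "!!i. ALL x:X. ALL y:X. x <= y --> (abs (w y $ i - w x $ i)) <= l i * (g y - g x)" by metis
 define c where "c = l 1 + l 2 + l 3"
 show ?thesis
  unfolding X_def[symmetric]
 proof (rule controlledI[where g = "%x. c * g x" and B = "c * (b + (L + 1) * R)"])
  fix x y assume xy: "x : X" "y : X" "x <= y"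
  have "norm (w y - w x) <= (abs (w y $ 1 - w x $ 1)) + (abs (w y $ 2 - w x $ 2)) + (abs (w y $ 3 - w x $ 3))"
   using norm_le_3[of "w y - w x"] by simp
  also have "... <= l 1 * (g y - g x) + l 2 * (g y - g x) + l 3 * (g y - g x)"
   by (intro add_mono l(2)[rule_format] xy)
  finally show "norm (w y - w x) <= c * g y - c * g x" by (simp add: c_def algebra_simps)
 next
  fix x assume x: "x : X"
  have "(abs (tau * (sig * w x $ 1))) <= b" using wb[OF x] tau sig by auto
  moreover have "x : {-R..R}" using XR x by blast
  then have "(abs x) <= R" by auto
  then have "(abs ((L + 1) * x)) <= (L + 1) * R" unfolding abs_mult using L(1) by (intro mult_mono) auto
  ultimately have "(abs (g x)) <= b + (L + 1) * R" unfolding g_def by linarith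
  moreover have "0 <= c" using l(1) by (simp add: c_def)
  ultimately show "(abs (c * g x)) <= c * (b + (L + 1) * R)" unfolding abs_mult by (simp add: mult_left_mono)
 qed
qed

lemma w_controlled: "controlled UNIV (%x. if x = xi0 then c else w x)"
proof -
 let ?f = "%x. if x = xi0 then c else w x"
 have x0: "- (lam / 2) < xi0" "xi0 < lam / 2" using Flux1_zero(2) dlt lam(1) by auto
 have k: "controlled A ?f" if "!!x. x : A ==> x ~= xi0" "!!x. x : A ==> w x = w z" for A z
  by (rule controlled_const[where c = "w z"]) (use that in auto)
 have A1: "controlled {..- (lam + dlt)} ?f"
  by (rule k[where z = "- (lam + dlt)"]) (use x0 dlt lam(1) in \<open>auto intro!: w_constant_left\<close>)
 have A2: "controlled {- (lam + dlt)<..<- lam / 2} ?f"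
 proof (rule controlled_cong[where f = w])
  have "{x. - (lam + dlt) < 1 * x & 1 * x < - lam / 2} = {- (lam + dlt)<..<- lam / 2}" by auto
  then show "controlled {- (lam + dlt)<..<- lam / 2} w" using w_controlled_mach[of 1] by simp
 qed (use x0 in auto)
 have A3: "controlled {- lam / 2..<xi0} ?f"
  by (rule k[where z = "- lam / 2"]) (use x0 dlt lam(1) in \<open>auto intro!: w_constant_lower\<close>)
 have A4: "controlled {xi0} ?f" by (rule controlled_const[where c = c]) auto
 have A5: "controlled {xi0<..lam / 2} ?f"
  by (rule k[where z = "lam / 2"]) (use x0 dlt lam(1) in \<open>auto intro!: w_constant_upper\<close>)
 have A6: "controlled {lam / 2<..<lam + dlt} ?f"
 proof (rule controlled_cong[where f = w])
  have "{x. - (lam + dlt) < -1 * x & -1 * x < - lam / 2} = {lam / 2<..<lam + dlt}" by auto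
  then show "controlled {lam / 2<..<lam + dlt} w" using w_controlled_mach[of "-1"] by simp
 qed (use x0 in auto)
 have A7: "controlled {lam + dlt..} ?f"
  by (rule k[where z = "lam + dlt"]) (use x0 dlt lam(1) in \<open>auto intro!: w_constant_right\<close>)
 have "controlled ({..- (lam + dlt)} \<union> ({- (lam + dlt)<..<- lam / 2} \<union> ({- lam / 2..<xi0} \<union> ({xi0} \<union> ({xi0<..lam / 2} \<union>
   ({lam / 2<..<lam + dlt} \<union> {lam + dlt..})))))) ?f"
  by (intro controlled_join A1 A2 A3 A4 A5 A6 A7) (use x0 dlt lam(1) in auto)
 moreover have "{..- (lam + dlt)} \<union> ({- (lam + dlt)<..<- lam / 2} \<union> ({- lam / 2..<xi0} \<union> ({xi0} \<union> ({xi0<..lam / 2} \<union>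
   ({lam / 2<..<lam + dlt} \<union> {lam + dlt..}))))) = UNIV"
  by auto
 ultimately show ?thesis by simp
qed

end

section \<open>Simple waves\<close>

context gas begin

lemma jacobian_flux:
 assumes U: "U : states"
 shows "jacobian (flux_x p) (at U) *v h = dflux_x U h" "jacobian (flux_y p) (at U) *v h = dflux_y U h"
proof -
 have "(flux_x p has_derivative (%h. jacobian (flux_x p) (at U) *v h)) (at U)"
  "(flux_y p has_derivative (%h. jacobian (flux_y p) (at U) *v h)) (at U)"
  using flux_has_derivative[OF U] jacobian_works by (blast intro: differentiableI)+
 then show "jacobian (flux_x p) (at U) *v h = dflux_x U h" "jacobian (flux_y p) (at U) *v h = dflux_y U h"
  using has_derivative_unique[OF _ flux_has_derivative(1)[OF U]] has_derivative_unique[OF _ flux_has_derivative(2)[OF U]]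
  by metis+
qed

lemma jacobian_ray_flux:
 assumes "U : states"
 shows "(jacobian (flux_y p) (at U) - xi *\<^sub>R jacobian (flux_x p) (at U)) *v h = dray_flux xi U h"
 by (simp add: matrix_vector_mult_diff_rdistrib scaleR_matrix_vector_assoc[symmetric] jacobian_flux[OF assms] dray_flux_def)

end

context flow begin

text \<open>On a sonic ray the slope solves the quadratic equation of the two acoustic eigenvalues.\<close>

lemma eigenvalue_sonic:
 assumes n: "near dlt U" and S: "sonic xi U = 0" and xi: "lam / 2 < (abs xi)"
 shows "eigenvalue p (if 0 < xi then FPlus else FMinus) U = xi"
proof -
 define k m q where "k = mass_speed (U $ 1)" and "m = U $ 2" and "q = U $ 3"
 define A where "A = m\<^sup>2 - k\<^sup>2"
 have A: "0 < A" "(abs (m * q)) < lam / 2 * A" using n by (auto simp: near_def A_def m_def q_def k_def)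
 have k: "0 < k" using n mass_speed_pos by (simp add: near_def states_def k_def)
 define X where "X = xi * A - m * q"
 have "(1 + xi\<^sup>2) * k\<^sup>2 = (q - xi * m)\<^sup>2" using S by (simp add: sonic_def mass_flux_def k_def m_def q_def)
 moreover have "X\<^sup>2 - k\<^sup>2 * (m\<^sup>2 + q\<^sup>2 - k\<^sup>2) = - A * ((1 + xi\<^sup>2) * k\<^sup>2 - (q - xi * m)\<^sup>2)"
  by (simp add: X_def A_def power2_eq_square algebra_simps)
 ultimately have "X\<^sup>2 = k\<^sup>2 * (m\<^sup>2 + q\<^sup>2 - k\<^sup>2)" by simp
 then have "sqrt (X\<^sup>2) = sqrt (k\<^sup>2 * (m\<^sup>2 + q\<^sup>2 - k\<^sup>2))" by simp
 then have X: "k * sqrt (m\<^sup>2 + q\<^sup>2 - k\<^sup>2) = (abs X)" using k by (simp add: real_sqrt_mult)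
 have kc: "U $ 1 * sound_speed p (U $ 1) = k" by (simp add: k_def mass_speed_def)
 show ?thesis
 proof (cases "0 < xi")
  case True
  then have "lam / 2 * A < xi * A" using xi A(1) by (intro mult_strict_right_mono) auto
  then have "0 < X" using A(2) by (simp add: X_def)
  then have "(m * q + k * sqrt (m\<^sup>2 + q\<^sup>2 - k\<^sup>2)) / A = xi" using A(1) unfolding X by (simp add: X_def)
  then show ?thesis using True unfolding A_def by (simp add: Let_def kc m_def[symmetric] q_def[symmetric])
 next
  case False
  then have "xi * A < - (lam / 2) * A" using xi A(1) by (intro mult_strict_right_mono) auto
  then have "X < 0" using A(2) by (simp add: X_def)
  then have "(m * q - k * sqrt (m\<^sup>2 + q\<^sup>2 - k\<^sup>2)) / A = xi" using A(1) unfolding X by (simp add: X_def)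
  then show ?thesis using False unfolding A_def by (simp add: Let_def kc m_def[symmetric] q_def[symmetric])
 qed
qed

end

context near_profile begin

text \<open>The root \<open>w\<close> is not determined at the contact slope, where the mass flux vanishes; the value from the
 right is taken.\<close>

definition prof :: "real => state" where "prof x = (if x = xi0 then w (lam / 2) else w x)"

lemma prof_eq: "lam / 4 <= (abs x) ==> prof x = w x"
 using Flux1_zero(2) dlt by (auto simp: prof_def)

lemma Flux_has_derivative:
 assumes ab: "a < xi" "xi < b" and N: "!!y. a < y ==> y < b ==> Flux y $ 1 ~= 0" and w: "continuous_on {a<..<b} w"
 shows "((%y. Flux y $ i) has_real_derivative - flux_x p (w xi) $ i) (at xi)"
proof -
 obtain c d where cd: "a < c" "c < xi" "xi < d" "d < b" using dense ab by meson
 have "AE y in lebesgue. Flux y $ 1 ~= 0 --> w y = v y" using w_AE_eq by (rule AE_completion)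
 then obtain S where S0: "S : null_sets lebesgue" "{y : space lebesgue. \<not> (Flux y $ 1 ~= 0 --> w y = v y)} \<subseteq> S"
  unfolding eventually_ae_filter by (elim bexE)
 have S: "!!y. y : space lebesgue - S ==> Flux y $ 1 ~= 0 --> w y = v y" "S : null_sets lebesgue"
  using S0 by auto
 have neg: "negligible S" using S(2) negligible_iff_null_sets by blast
 have wst: "w y : states" if "a < y" "y < b" for y using decode(4)[OF N[OF that]] K(3) by blast
 have cont: "continuous_on {c..d} (%s. flux_x p (w s) $ i)"
  by (rule continuous_on_compose2[OF flux_nth_continuous continuous_on_subset[OF w]]) (use cd wst in auto)
 have "Flux y $ i = Flux c $ i - integral {c..y} (%s. flux_x p (w s) $ i)" if "y : {c<..<d}" for y
 proof -
  have "integral {c..y} (%s. flux_x p (v s) $ i) = integral {c..y} (%s. flux_x p (w s) $ i)"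
   by (rule integral_spike[OF neg]) (use S(1) N cd that in auto)
  then show ?thesis using Flux_diff[of c y i] that by simp
 qed
 moreover have "((%y. Flux c $ i - integral {c..y} (%s. flux_x p (w s) $ i)) has_real_derivative 0 - flux_x p (w xi) $ i) (at xi)"
 proof (intro DERIV_diff DERIV_const)
  have "((%y. integral {c..y} (%s. flux_x p (w s) $ i)) has_real_derivative flux_x p (w xi) $ i) (at xi within {c..d})"
   by (rule integral_has_real_derivative[OF cont]) (use cd in auto)
  then show "((%y. integral {c..y} (%s. flux_x p (w s) $ i)) has_real_derivative flux_x p (w xi) $ i) (at xi)"
   using cd by (simp add: at_within_Icc_at)
 qed
 ultimately show ?thesis
  using has_field_derivative_transform_within_open[of "%y. Flux c $ i - integral {c..y} (%s. flux_x p (w s) $ i)"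
   "0 - flux_x p (w xi) $ i" xi "{c<..<d}" "%y. Flux y $ i"] cd by simp
qed

text \<open>Where the profile is sonic its density is the inverse image, under the increasing mass speed, of a
 differentiable function; differentiating the relation between state and flux yields the kernel
 condition.\<close>

lemma wave_derivative:
 assumes ab: "a < xi" "xi < b" and z: "!!y. a < y ==> y < b ==> Flux y $ 1 ~= 0 & sonic y (w y) = 0"
 shows "EX D. (w has_vector_derivative D) (at xi) & dray_flux xi (w xi) D = 0"
proof -
 have N: "Flux y $ 1 ~= 0" if "a < y" "y < b" for y using z[OF that] ..
 have wc: "isCont w y" if "a < y" "y < b" for y using w_continuous_at_sonic z[OF that] by blast
 then have w: "continuous_on {a<..<b} w" by (intro continuous_at_imp_continuous_on) auto
 note dF = Flux_has_derivative[OF ab N w]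
 have F: "(%y. Flux y $ i) differentiable (at xi)" for i using dF[of i] real_differentiable_def by blast
 have S: "1 + xi * xi ~= 0" using zero_le_square[of xi] by linarith
 have k: "(mass_speed (w y $ 1))\<^sup>2 = Flux y $ 1 * Flux y $ 1 / (1 + y * y)" if "y : {a<..<b}" for y
 proof -
  have "mass_flux y (w y) = Flux y $ 1" using roots_mass_flux w_limit(2) z[of y] that by auto
  then have "(1 + y * y) * (mass_speed (w y $ 1))\<^sup>2 = Flux y $ 1 * Flux y $ 1"
   using z[of y] that by (simp add: sonic_def power2_eq_square)
  moreover have "1 + y * y ~= 0" using zero_le_square[of y] by linarith
  ultimately show ?thesis by (simp add: field_simps)
 qed
 have tr: "f differentiable (at xi)" if "g differentiable (at xi)" "!!y. y : {a<..<b} ==> f y = g y" for f g :: "real => real"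
 proof -
  from that(1) obtain e where "(g has_real_derivative e) (at xi)" unfolding real_differentiable_def by (elim exE)
  then have "(f has_real_derivative e) (at xi)"
   by (rule has_field_derivative_transform_within_open[where S = "{a<..<b}"]) (use ab that(2) in auto)
  then show ?thesis using real_differentiable_def by blast
 qed
 have id: "(%y::real. y) differentiable (at xi)" by simp
 have "(%y. (mass_speed (w y $ 1))\<^sup>2) differentiable (at xi)"
  by (rule tr[OF _ k]) (intro derivative_intros F id S | assumption)+
 then obtain e where e: "((%y. (mass_speed (w y $ 1))\<^sup>2) has_real_derivative e) (at xi)"
  unfolding real_differentiable_def by (elim exE)
 have r: "0 < w xi $ 1" by (rule decode(5)[OF N[OF ab]])
 obtain k' where k': "!!r. 0 < r ==> (mass_speed has_real_derivative k' r) (at r)" "!!r. 0 < r ==> 0 < k' r"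
  using mass_speed_deriv by metis
 have "((%y. w y $ 1) has_real_derivative e / (2 * mass_speed (w xi $ 1) * k' (w xi $ 1))) (at xi)"
 proof (rule DERIV_of_compose[where f = "%r. (mass_speed r)\<^sup>2"])
  show "((%r. (mass_speed r)\<^sup>2) has_real_derivative 2 * mass_speed (w xi $ 1) * k' (w xi $ 1)) (at (w xi $ 1))"
   using DERIV_power[OF k'(1)[OF r], of 2] by (simp add: mult_ac)
  show "isCont (%y. w y $ 1) xi" using wc[OF ab] by (intro continuous_intros)
 qed (use e mass_speed_pos[OF r] k'(2)[OF r] in auto)
 then have 1: "(%y. w y $ 1) differentiable (at xi)" using real_differentiable_def by blast
 have 2: "(%y. w y $ 2) differentiable (at xi)"
 proof (rule tr)
  show "(%x. (w x $ 1 * ((Flux x $ 2 + x * Flux x $ 3) / Flux x $ 1) - x * Flux x $ 1) / (1 + x * x)) differentiable (at xi)"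
   by (intro derivative_intros F id S 1 N[OF ab])
 qed (use decode(1)[OF N] in \<open>simp add: divide_inverse\<close>)
 have 3: "(%y. w y $ 3) differentiable (at xi)"
  by (rule tr[where g = "%x. x * w x $ 2 + Flux x $ 1"]) (use decode(2)[OF N] in \<open>auto intro!: derivative_intros F id 2\<close>)
 have "(%y. w y $ i) differentiable (at xi)" for i using exhaust_3[of i] 1 2 3 by auto
 then have "w differentiable (at xi)"
  unfolding differentiable_componentwise_within[of w] by (auto simp: Basis_vec_def inner_axis)
 then obtain D where D: "(w has_vector_derivative D) (at xi)" using vector_derivative_works by blast
 have st: "w xi : states" using decode(4)[OF N[OF ab]] K(3) by blast
 note chain = vector_derivative_diff_chain_within[where S = UNIV, OF D has_derivative_at_withinI, unfolded o_def]
 have "dray_flux xi (w xi) D $ i = 0" for i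
 proof -
  have "((%y. flux_y p (w y) $ i) has_real_derivative dflux_y (w xi) D $ i) (at xi)"
   "((%y. flux_x p (w y) $ i) has_real_derivative dflux_x (w xi) D $ i) (at xi)"
   unfolding has_real_derivative_iff_has_vector_derivative
   by (rule bounded_linear.has_vector_derivative[OF bounded_linear_vec_nth chain[OF flux_has_derivative(2)[OF st]]]
     bounded_linear.has_vector_derivative[OF bounded_linear_vec_nth chain[OF flux_has_derivative(1)[OF st]]])+
  then have "((%y. flux_y p (w y) $ i - y * flux_x p (w y) $ i) has_real_derivative
    dflux_y (w xi) D $ i - (1 * flux_x p (w xi) $ i + dflux_x (w xi) D $ i * xi)) (at xi)"
   by (intro DERIV_diff DERIV_mult DERIV_ident)
  then have "((%y. Flux y $ i) has_real_derivative
    dflux_y (w xi) D $ i - (1 * flux_x p (w xi) $ i + dflux_x (w xi) D $ i * xi)) (at xi)"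
  proof (rule has_field_derivative_transform_within_open[where S = "{a<..<b}"])
   fix y assume "y : {a<..<b}"
   then have "ray_flux y (w y) $ i = Flux y $ i" using decode(3)[OF N] by simp
   then show "flux_y p (w y) $ i - y * flux_x p (w y) $ i = Flux y $ i" by (simp add: ray_flux_def)
  qed (use ab in auto)
  from DERIV_unique[OF this dF] show ?thesis by (simp add: dray_flux_def mult.commute)
 qed
 then have "dray_flux xi (w xi) D = 0" by (simp add: vec_eq_iff)
 then show ?thesis using D by blast
qed

text \<open>The frontier of an interval is a null set, so differentiability in the interior suffices.\<close>

lemma sonic_simple_wave:
 assumes tau: "tau : {1, -1}" and J: "is_interval J" "r : J" "s : J" "r < s" "J \<subseteq> {-R..R}"
  and z: "!!xi. xi : J ==> tau * xi < - lam / 2 & sonic xi (w xi) = 0"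
 shows "simple_wave p (if tau = 1 then FMinus else FPlus) prof J"
proof -
 have big: "lam / 2 < (abs xi)" if "xi : J" for xi using z[OF that] tau by auto
 have pw: "prof xi = w xi" if "xi : J" for xi using prof_eq big[OF that] lam(1) by simp
 obtain \<nu> where \<nu>: "0 < \<nu>" "!!x. lam / 2 <= (abs x) ==> \<nu> <= (abs (Flux x $ 1))" using Flux1_lower_bound by blast
 have N: "\<nu> <= (abs (Flux xi $ 1))" if "xi : J" for xi using \<nu>(2) big[OF that] by simp
 have N0: "Flux xi $ 1 ~= 0" if "xi : J" for xi using N[OF that] \<nu>(1) by auto
 have t: "tame (%x. x) J (%x. w x $ i)" for i
  by (rule state_tame[OF J(5) _ \<nu>(1) N density_tame_sonic[OF J(5)]]) (use z N0 in auto)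
 have "EX l>=0. ALL x:J. ALL y:J. x <= y --> (abs (w y $ i - w x $ i)) <= l * (y - x)" for i
  using t[of i] unfolding tame_def by (elim conjE)
 then obtain l where l: "!!i. 0 <= l i" "!!i. ALL x:J. ALL y:J. x <= y --> (abs (w y $ i - w x $ i)) <= l i * (y - x)" by metis
 define c where "c = l 1 + l 2 + l 3"
 have le: "norm (w y - w x) <= c * (y - x)" if xy: "x : J" "y : J" "x <= y" for x y
 proof -
  have "norm (w y - w x) <= (abs (w y $ 1 - w x $ 1)) + (abs (w y $ 2 - w x $ 2)) + (abs (w y $ 3 - w x $ 3))"
   using norm_le_3[of "w y - w x"] by simp
  also have "... <= l 1 * (y - x) + l 2 * (y - x) + l 3 * (y - x)" by (intro add_mono l(2)[rule_format] xy)
  finally show ?thesis by (simp add: c_def algebra_simps)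
 qed
 have lip: "c-lipschitz_on J prof"
 proof (rule lipschitz_onI)
  show "0 <= c" using l(1) by (simp add: c_def)
  show "dist (prof x) (prof y) <= c * dist x y" if "x : J" "y : J" for x y
   using le[of x y] le[of y x] that by (cases "x <= y") (auto simp: pw dist_norm norm_minus_commute)
 qed
 have "negligible (frontier J)" using J(1) by (intro negligible_convex_frontier) (simp add: is_interval_convex)
 then have fr: "AE xi in lebesgue. xi \<notin> frontier J" by (intro AE_not_in) (simp add: negligible_iff_null_sets)
 have "AE xi in lebesgue. xi : J --> (EX D. (prof has_vector_derivative D) (at xi) &
   (jacobian (flux_y p) (at (prof xi)) - xi *\<^sub>R jacobian (flux_x p) (at (prof xi))) *v D = 0)"
  using fr
 proof eventually_elim
  fix xi assume "xi \<notin> frontier J"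
  show "xi : J --> (EX D. (prof has_vector_derivative D) (at xi) &
   (jacobian (flux_y p) (at (prof xi)) - xi *\<^sub>R jacobian (flux_x p) (at (prof xi))) *v D = 0)"
  proof
   assume xi: "xi : J"
   then have "xi : interior J" using \<open>xi \<notin> frontier J\<close> closure_subset by (auto simp: frontier_def)
   then obtain e where e: "0 < e" "ball xi e \<subseteq> J" using mem_interior by blast
   have in_J: "y : J" if "xi - e < y" "y < xi + e" for y using e(2) that by (auto simp: ball_def dist_real_def)
   have "EX D. (w has_vector_derivative D) (at xi) & dray_flux xi (w xi) D = 0"
    by (rule wave_derivative[of "xi - e" xi "xi + e"]) (use e(1) z in_J N0 in auto)
   then obtain D where D: "(w has_vector_derivative D) (at xi)" "dray_flux xi (w xi) D = 0" by (elim exE conjE)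
   have "(prof has_vector_derivative D) (at xi)"
    by (rule has_vector_derivative_transform_within_open[OF D(1), of "{xi - e<..<xi + e}"]) (use e(1) pw in_J in auto)
   moreover have "w xi : states" using decode(4)[OF N0[OF xi]] K(3) by blast
   ultimately show "EX D. (prof has_vector_derivative D) (at xi) &
     (jacobian (flux_y p) (at (prof xi)) - xi *\<^sub>R jacobian (flux_x p) (at (prof xi))) *v D = 0"
    using D(2) pw[OF xi] by (intro exI[of _ D]) (simp add: jacobian_ray_flux)
  qed
 qed
 moreover have "prof xi : states & eigenvalue p (if tau = 1 then FMinus else FPlus) (prof xi) = xi" if xi: "xi : J" for xi
 proof -
  have K: "w xi : K" by (rule decode(4)[OF N0[OF xi]])
  have "(if tau = 1 then FMinus else FPlus) = (if 0 < xi then FPlus else FMinus)"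
   using z[OF xi] tau lam(1) by auto
  then show ?thesis using eigenvalue_sonic[OF near[OF K] conjunct2[OF z[OF xi]] big[OF xi]] K(1) near[OF K] pw[OF xi]
   by (simp add: near_def)
 qed
 ultimately show ?thesis
  unfolding simple_wave_def using J(1-4) lip by (intro conjI) auto
qed

end

section \<open>The field of a discontinuity\<close>

definition cubic :: "(real => real) => bool" where
 "cubic f \<longleftrightarrow> (EX c0 c1 c2 c3. ALL x. f x = c0 + c1 * x + c2 * x^2 + c3 * x^3)"

lemma cubic_add: assumes "cubic f" "cubic g" shows "cubic (%x. f x + g x)"
proof -
 from assms obtain a0 a1 a2 a3 b0 b1 b2 b3 where
  "ALL x. f x = a0 + a1 * x + a2 * x^2 + a3 * x^3" "ALL x. g x = b0 + b1 * x + b2 * x^2 + b3 * x^3"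
  unfolding cubic_def by (elim exE)
 then have "ALL x. f x + g x = (a0 + b0) + (a1 + b1) * x + (a2 + b2) * x^2 + (a3 + b3) * x^3"
  by (simp add: algebra_simps)
 then show ?thesis unfolding cubic_def by (intro exI)
qed

lemma cubic_prod:
 "cubic (%x. (a - x * b) * (c - x * d) * (e - x * f))" "cubic (%x. - ((a - x * b) * (c - x * d) * (e - x * f)))"
proof -
 have "ALL x. (a - x * b) * (c - x * d) * (e - x * f) =
   a * c * e + - (a * c * f + a * d * e + b * c * e) * x + (a * d * f + b * c * f + b * d * e) * x^2 + - (b * d * f) * x^3"
  by (simp add: algebra_simps power2_eq_square power3_eq_cube)
 then show "cubic (%x. (a - x * b) * (c - x * d) * (e - x * f))" unfolding cubic_def by (intro exI)
 have "ALL x. - ((a - x * b) * (c - x * d) * (e - x * f)) =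
   - (a * c * e) + (a * c * f + a * d * e + b * c * e) * x + - (a * d * f + b * c * f + b * d * e) * x^2 + (b * d * f) * x^3"
  by (simp add: algebra_simps power2_eq_square power3_eq_cube)
 then show "cubic (%x. - ((a - x * b) * (c - x * d) * (e - x * f)))" unfolding cubic_def by (intro exI)
qed

lemma cubic_det: "cubic (%xi. det (A - xi *\<^sub>R B :: real^3^3))"
proof -
 have "(%xi. det (A - xi *\<^sub>R B)) = (%xi.
   ((((((A$1$1 - xi * B$1$1) * (A$2$2 - xi * B$2$2) * (A$3$3 - xi * B$3$3) +
   (A$1$2 - xi * B$1$2) * (A$2$3 - xi * B$2$3) * (A$3$1 - xi * B$3$1)) +
   (A$1$3 - xi * B$1$3) * (A$2$1 - xi * B$2$1) * (A$3$2 - xi * B$3$2)) +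
   - ((A$1$1 - xi * B$1$1) * (A$2$3 - xi * B$2$3) * (A$3$2 - xi * B$3$2))) +
   - ((A$1$2 - xi * B$1$2) * (A$2$1 - xi * B$2$1) * (A$3$3 - xi * B$3$3))) +
   - ((A$1$3 - xi * B$1$3) * (A$2$2 - xi * B$2$2) * (A$3$1 - xi * B$3$1))))"
  by (rule ext) (simp add: det_3)
 then show ?thesis by (simp only: cubic_add cubic_prod)
qed

lemma cubic_continuous: "cubic f ==> continuous_on S f"
proof -
 assume "cubic f"
 then obtain c0 c1 c2 c3 where "ALL x. f x = c0 + c1 * x + c2 * x^2 + c3 * x^3" unfolding cubic_def by (elim exE)
 then have "f = (%x. c0 + c1 * x + c2 * x^2 + c3 * x^3)" by (intro ext) (rule spec)
 then show ?thesis by (simp only:) (intro continuous_intros)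
qed

lemma cubic_zeros:
 assumes f: "cubic f" and nz: "f y ~= 0" and l: "l1 < l2" "l2 < l3" "f l1 = 0" "f l2 = 0" "f l3 = 0"
 shows "{x. f x = 0} = {l1, l2, l3}"
proof -
 from f obtain c0 c1 c2 c3 where c: "ALL x. f x = c0 + c1 * x + c2 * x^2 + c3 * x^3" unfolding cubic_def by (elim exE)
 define C where "C i = (if i = 0 then c0 else if i = 1 then c1 else if i = 2 then c2 else c3)" for i :: nat
 have s: "(\<Sum>i\<le>3. C i * x ^ i) = f x" for x
  unfolding c[rule_format] by (simp add: C_def eval_nat_numeral)
 have "EX k<=3. C k ~= 0"
 proof (rule ccontr)
  assume "\<not> (EX k<=3. C k ~= 0)"
  then have "(\<Sum>i\<le>3. C i * y ^ i) = 0" by (intro sum.neutral) auto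
  then show False using nz s by simp
 qed
 then obtain k where k: "k <= 3" "C k ~= 0" by (elim exE conjE)
 then have "EX k<=3. C k ~= 0" by blast
 from polyfun_rootbound[OF this] have "finite {x. f x = 0}" "card {x. f x = 0} <= 3" by (simp_all only: s)
 moreover have "card {l1, l2, l3} = 3" using l(1,2) by auto
 moreover have "{l1, l2, l3} \<subseteq> {x. f x = 0}" using l by auto
 ultimately show ?thesis using card_seteq[of "{x. f x = 0}" "{l1, l2, l3}"] by simp
qed

context gas begin

lemma jacobian_matrix:
 assumes "U : states"
 shows "jacobian (flux_x p) (at U) = matrix (dflux_x U)" "jacobian (flux_y p) (at U) = matrix (dflux_y U)"
 using frechet_derivative_at[OF flux_has_derivative(1)[OF assms]] frechet_derivative_at[OF flux_has_derivative(2)[OF assms]]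
 by (simp_all add: jacobian_def)

lemma jacobian_continuous_on:
 "continuous_on states (%U. jacobian (flux_x p) (at U))" "continuous_on states (%U. jacobian (flux_y p) (at U))"
proof -
 have "continuous_on states (%U. matrix (dflux_x U))" "continuous_on states (%U. matrix (dflux_y U))"
  unfolding matrix_def
  by (intro continuous_on_vec_lambda continuous_intros continuous_at_imp_continuous_on ballI dflux_isCont; assumption)+
 then show "continuous_on states (%U. jacobian (flux_x p) (at U))" "continuous_on states (%U. jacobian (flux_y p) (at U))"
  using continuous_on_cong[OF refl jacobian_matrix(1), of states] continuous_on_cong[OF refl jacobian_matrix(2), of states]
  by simp_all
qed

text \<open>The averaged Jacobian maps the jump of the state to the jump of the flux, and it is close to the
 Jacobian at a state near which both states lie.\<close>

lemma avg_jacobian: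
 fixes f :: "state => state"
 assumes Jc: "continuous_on states (%U. jacobian f (at U))"
  and J: "!!U. U : states ==> (f has_derivative (%h. jacobian f (at U) *v h)) (at U)"
  and S: "convex S" "S \<subseteq> states" "Um : S" "Up : S"
  and close: "!!U. U : S ==> norm (jacobian f (at U) - A) <= e"
 shows "avg_jacobian f Um Up *v (Up - Um) = f Up - f Um" "norm (avg_jacobian f Um Up - A) <= e"
proof -
 define gam where "gam s = Um + s *\<^sub>R (Up - Um)" for s :: real
 have gamS: "gam s : S" if "s : {0..1}" for s
 proof -
  have "gam s = (1 - s) *\<^sub>R Um + s *\<^sub>R Up" by (simp add: gam_def algebra_simps)
  then show ?thesis using that convexD_alt[OF S(1) S(3,4), of s] by simp
 qed
 have cont: "continuous_on {0..1} (%s. jacobian f (at (gam s)))"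
  by (rule continuous_on_compose2[OF Jc]) (use gamS S(2) in \<open>auto simp: gam_def intro!: continuous_intros\<close>)
 note int = integrable_continuous_real[OF cont]
 have avg: "avg_jacobian f Um Up = integral {0..1} (%s. jacobian f (at (gam s)))" by (simp add: avg_jacobian_def gam_def)
 have bl: "bounded_linear (%M::real^3^3. M *v (Up - Um))"
  by (intro linear_conv_bounded_linear[THEN iffD1] linearI) (simp_all add: matrix_vector_mult_add_rdistrib scaleR_matrix_vector_assoc)
 have "((%s. jacobian f (at (gam s)) *v (Up - Um)) has_integral f (gam 1) - f (gam 0)) {0..1}"
 proof (rule fundamental_theorem_of_calculus)
  fix s :: real assume s: "s : {0..1}"
  have "(gam has_vector_derivative (Up - Um)) (at s within {0..1})"
   unfolding gam_def by (auto intro!: derivative_eq_intros)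
  from vector_derivative_diff_chain_within[OF this has_derivative_at_withinI[OF J]] gamS[OF s] S(2)
  show "((%s. f (gam s)) has_vector_derivative jacobian f (at (gam s)) *v (Up - Um)) (at s within {0..1})"
   by (auto simp: o_def)
 qed simp
 then show "avg_jacobian f Um Up *v (Up - Um) = f Up - f Um"
  using integral_linear[OF int bl] unfolding avg o_def by (simp add: integral_unique gam_def)
 have "norm (integral {0..1} (%s. jacobian f (at (gam s)) - A)) <= e * (1 - 0)"
  by (rule integral_bound) (use close gamS in \<open>auto intro!: continuous_intros cont\<close>)
 moreover have "integral {0..1} (%s. jacobian f (at (gam s)) - A) = avg_jacobian f Um Up - A"
  using Henstock_Kurzweil_Integration.integral_diff[OF int integrable_const_ivl[of A 0 1]] by (simp add: avg)
 ultimately show "norm (avg_jacobian f Um Up - A) <= e" by simp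
qed

end

context flow begin

lemma det_background:
 "det (jacobian (flux_y p) (at bg) - xi *\<^sub>R jacobian (flux_x p) (at bg))
   = M * sound_speed p \<rho>0 * (sound_speed p \<rho>0)\<^sup>2 * xi * (1 - xi\<^sup>2 * (M\<^sup>2 - 1))"
proof -
 define c where "c = sound_speed p \<rho>0"
 have c: "deriv p \<rho>0 = c\<^sup>2" using p_deriv[OF rho0] by (simp add: c_def sound_speed_def)
 have b: "bg $ 1 = \<rho>0" "bg $ 2 = \<rho>0 * (M * c)" "bg $ 3 = 0" by (simp_all add: background_def c_def)
 show ?thesis
  unfolding jacobian_matrix[OF bg(4)] c_def[symmetric] det_3
  using rho0 by (simp add: matrix_def dflux_x_def dflux_y_def b c axis_def power2_eq_square)
   (simp add: algebra_simps power2_eq_square)?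
qed

text \<open>At the background state the determinant is a cubic polynomial with the simple zeros \<open>0, \<plusminus> lam\<close>. Its
 signs at the ends of the three intervals of slopes persist for averaged Jacobians nearby, so each
 interval contains exactly one of their generalized eigenvalues.\<close>

lemma jump_field:
 assumes dlt: "0 < dlt" "dlt < lam / 4"
 shows "EX eps>0. ALL Um:cball bg eps. ALL Up:cball bg eps. Um : states & Up : states &
  (ALL xi a. Um ~= Up --> ray_flux xi Um = ray_flux xi Up --> xi : slopes M dlt a --> belongs_to_field p a xi Um Up)"
proof -
 define A0 B0 where "A0 = jacobian (flux_y p) (at bg)" and "B0 = jacobian (flux_x p) (at bg)"
 define q where "q z xi = det (fst z - xi *\<^sub>R snd z)" for z :: "(real^3^3) \<times> (real^3^3)" and xi
 define kap where "kap = M * sound_speed p \<rho>0 * (sound_speed p \<rho>0)\<^sup>2"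
 have kap: "0 < kap" using p_deriv[OF rho0] supersonic by (simp add: kap_def sound_speed_def)
 have q0: "q (A0, B0) xi = kap * xi * (1 - xi\<^sup>2 * (M\<^sup>2 - 1))" for xi
  using det_background by (simp add: q_def A0_def B0_def kap_def)
 have M2: "0 < M\<^sup>2 - 1" using supersonic by (simp add: one_less_power)
 have low: "0 < 1 - xi\<^sup>2 * (M\<^sup>2 - 1)" if "(abs xi) < lam" for xi
 proof -
  have "xi\<^sup>2 < lam\<^sup>2" using that power_strict_mono[of "(abs xi)" lam 2] by simp
  then show ?thesis using lam(2) mult_strict_right_mono[OF _ M2] by fastforce
 qed
 have high: "1 - xi\<^sup>2 * (M\<^sup>2 - 1) < 0" if "lam < (abs xi)" for xi
 proof -
  have "lam\<^sup>2 < xi\<^sup>2" using that lam(1) power_strict_mono[of lam "(abs xi)" 2] by simp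
  then show ?thesis using lam(2) mult_strict_right_mono[OF _ M2] by fastforce
 qed
 have s0: "0 < q (A0, B0) (- lam - dlt)" "q (A0, B0) (- lam + dlt) < 0" "q (A0, B0) (- dlt) < 0"
  "0 < q (A0, B0) dlt" "0 < q (A0, B0) (lam - dlt)" "q (A0, B0) (lam + dlt) < 0"
 proof -
  show "0 < q (A0, B0) (- lam - dlt)" unfolding q0
   by (rule mult_neg_neg[OF mult_pos_neg[OF kap] high]) (use dlt lam(1) in auto)
  show "q (A0, B0) (- lam + dlt) < 0" unfolding q0
   by (rule mult_neg_pos[OF mult_pos_neg[OF kap] low]) (use dlt lam(1) in auto)
  show "q (A0, B0) (- dlt) < 0" unfolding q0
   by (rule mult_neg_pos[OF mult_pos_neg[OF kap] low]) (use dlt lam(1) in auto)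
  show "0 < q (A0, B0) dlt" unfolding q0
   by (rule mult_pos_pos[OF mult_pos_pos[OF kap] low]) (use dlt lam(1) in auto)
  show "0 < q (A0, B0) (lam - dlt)" unfolding q0
   by (rule mult_pos_pos[OF mult_pos_pos[OF kap] low]) (use dlt lam(1) in auto)
  show "q (A0, B0) (lam + dlt) < 0" unfolding q0
   by (rule mult_pos_neg[OF mult_pos_pos[OF kap] high]) (use dlt lam(1) in auto)
 qed
 have qc: "((%z. q z xi) \<longlongrightarrow> q (A0, B0) xi) (nhds (A0, B0))" for xi
 proof -
  have "isCont (%z. q z xi) (A0, B0)" unfolding q_def det_3 by (intro continuous_intros)
  then show ?thesis unfolding isCont_def by (rule tendsto_at_iff_tendsto_nhds[THEN iffD1])
 qed
 have "\<forall>\<^sub>F z in nhds (A0, B0). 0 < q z (- lam - dlt) & q z (- lam + dlt) < 0 & q z (- dlt) < 0 &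
   0 < q z dlt & 0 < q z (lam - dlt) & q z (lam + dlt) < 0"
  by (intro eventually_conj order_tendstoD(1)[OF qc] order_tendstoD(2)[OF qc] s0)
 then obtain \<eta> where \<eta>: "0 < \<eta>" "ALL z. dist z (A0, B0) < \<eta> --> 0 < q z (- lam - dlt) & q z (- lam + dlt) < 0 & q z (- dlt) < 0 &
   0 < q z dlt & 0 < q z (lam - dlt) & q z (lam + dlt) < 0"
  unfolding eventually_nhds_metric by (elim exE conjE)
 have "EX e>0. ALL U. dist U bg < e --> U : states & norm (jacobian (flux_y p) (at U) - A0) < \<eta> / 3 &
   norm (jacobian (flux_x p) (at U) - B0) < \<eta> / 3"
 proof -
  have "isCont (%U. jacobian (flux_y p) (at U)) bg" "isCont (%U. jacobian (flux_x p) (at U)) bg"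
   using jacobian_continuous_on open_states bg(4) by (auto simp: continuous_on_eq_continuous_at)
  then have "((%U. jacobian (flux_y p) (at U)) \<longlongrightarrow> A0) (nhds bg)" "((%U. jacobian (flux_x p) (at U)) \<longlongrightarrow> B0) (nhds bg)"
   unfolding isCont_def A0_def B0_def
   by (simp_all only: tendsto_at_iff_tendsto_nhds[of "%U. jacobian (flux_y p) (at U)" bg]
     tendsto_at_iff_tendsto_nhds[of "%U. jacobian (flux_x p) (at U)" bg])
  from tendstoD[OF this(1), of "\<eta> / 3"] tendstoD[OF this(2), of "\<eta> / 3"]
  have "\<forall>\<^sub>F U in nhds bg. dist (jacobian (flux_y p) (at U)) A0 < \<eta> / 3" "\<forall>\<^sub>F U in nhds bg. dist (jacobian (flux_x p) (at U)) B0 < \<eta> / 3"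
   using \<eta>(1) by auto
  moreover have "\<forall>\<^sub>F U in nhds bg. U : states" using open_states bg(4) by (rule eventually_nhds_in_open)
  ultimately have "\<forall>\<^sub>F U in nhds bg. U : states & norm (jacobian (flux_y p) (at U) - A0) < \<eta> / 3 &
   norm (jacobian (flux_x p) (at U) - B0) < \<eta> / 3"
   by eventually_elim (simp add: dist_norm)
  then show ?thesis unfolding eventually_nhds_metric .
 qed
 then obtain e where e: "0 < e" "!!U. dist U bg < e ==> U : states & norm (jacobian (flux_y p) (at U) - A0) < \<eta> / 3 &
   norm (jacobian (flux_x p) (at U) - B0) < \<eta> / 3" by blast
 have near: "U : states" "norm (jacobian (flux_y p) (at U) - A0) <= \<eta> / 3" "norm (jacobian (flux_x p) (at U) - B0) <= \<eta> / 3"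
  if "U : cball bg (e / 2)" for U
  using e(2)[of U] e(1) that by (auto simp: dist_commute)
 have main: "belongs_to_field p a xi Um Up"
  if U: "Um : cball bg (e / 2)" "Up : cball bg (e / 2)" "Um ~= Up" "ray_flux xi Um = ray_flux xi Up" "xi : slopes M dlt a" for Um Up xi a
 proof -
  define A B where "A = avg_jacobian (flux_y p) Um Up" and "B = avg_jacobian (flux_x p) Um Up"
  have sub: "cball bg (e / 2) \<subseteq> states" using near(1) by blast
  have d: "(flux_y p has_derivative (%h. jacobian (flux_y p) (at U) *v h)) (at U)"
   "(flux_x p has_derivative (%h. jacobian (flux_x p) (at U) *v h)) (at U)" if "U : states" for U
   using flux_has_derivative[OF that] jacobian_works by (blast intro: differentiableI)+
  note aA = avg_jacobian[OF jacobian_continuous_on(2) d(1) convex_cball sub U(1,2) near(2), folded A_def]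
  note aB = avg_jacobian[OF jacobian_continuous_on(1) d(2) convex_cball sub U(1,2) near(3), folded B_def]
  have "dist (A, B) (A0, B0) <= dist A A0 + dist B B0"
   unfolding dist_Pair_Pair by (rule sqrt_sum_squares_le_sum) simp_all
  also have "... < \<eta>" using aA(2) aB(2) \<eta>(1) by (simp add: dist_norm)
  finally have s: "0 < q (A, B) (- lam - dlt)" "q (A, B) (- lam + dlt) < 0" "q (A, B) (- dlt) < 0"
   "0 < q (A, B) dlt" "0 < q (A, B) (lam - dlt)" "q (A, B) (lam + dlt) < 0"
   using \<eta>(2) by blast+
  have cub: "cubic (q (A, B))" unfolding q_def[abs_def] fst_conv snd_conv by (rule cubic_det)
  note qcont = cubic_continuous[OF cub]
  obtain l1 where l1: "- lam - dlt <= l1" "l1 <= - lam + dlt" "q (A, B) l1 = 0"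
   using IVT2'[of "q (A, B)" "- lam + dlt" 0 "- lam - dlt", OF _ _ _ qcont] s dlt by auto
  obtain l2 where l2: "- dlt <= l2" "l2 <= dlt" "q (A, B) l2 = 0"
   using IVT'[of "q (A, B)" "- dlt" 0 dlt, OF _ _ _ qcont] s dlt by auto
  obtain l3 where l3: "lam - dlt <= l3" "l3 <= lam + dlt" "q (A, B) l3 = 0"
   using IVT2'[of "q (A, B)" "lam + dlt" 0 "lam - dlt", OF _ _ _ qcont] s dlt by auto
  have ord: "l1 < l2" "l2 < l3" using l1 l2 l3 dlt lam(1) by auto
  have Z: "{x. q (A, B) x = 0} = {l1, l2, l3}"
   by (rule cubic_zeros[OF cub less_imp_neq[OF s(1), symmetric] ord l1(3) l2(3) l3(3)])
  have a1: "A *v (Up - Um) = flux_y p Up - flux_y p Um" and a2: "B *v (Up - Um) = flux_x p Up - flux_x p Um"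
   by (rule aA(1) aB(1); assumption)+
  have "(A - xi *\<^sub>R B) *v (Up - Um) = 0"
  proof -
   have "(A - xi *\<^sub>R B) *v (Up - Um) = A *v (Up - Um) - xi *\<^sub>R (B *v (Up - Um))"
    by (simp add: matrix_vector_mult_diff_rdistrib scaleR_matrix_vector_assoc)
   also have "... = ray_flux xi Up - ray_flux xi Um" unfolding a1 a2 ray_flux_def scaleR_diff_right by simp
   finally show ?thesis using U(4) by simp
  qed
  then have "q (A, B) xi = 0"
   using U(3) matrix_left_invertible_ker[of "A - xi *\<^sub>R B"] invertible_det_nz[of "A - xi *\<^sub>R B"]
   unfolding q_def invertible_def by (metis eq_iff_diff_eq_0 fst_conv snd_conv)
  then have "xi : {l1, l2, l3}" using Z by blast
  moreover have "center_slope M a - dlt < xi" "xi < center_slope M a + dlt" using U(5) by (auto simp: slopes_def)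
  ultimately have "xi = (case a of FMinus => l1 | FZero => l2 | FPlus => l3)"
   using lam(3) lam_def l1(1,2) l2(1,2) l3(1,2) dlt lam(1) by (cases a) auto
  then show ?thesis
   unfolding belongs_to_field_def A_def[symmetric] B_def[symmetric]
   using ord Z by (intro exI[of _ l1] exI[of _ l2] exI[of _ l3] conjI) (auto simp: q_def)
 qed
 show ?thesis
  by (intro exI[of _ "e / 2"] conjI ballI allI impI near(1) main) (use e(1) in auto)
qed

end

section \<open>The states on the two sides of the vertical axis\<close>

lemma bump_derivE:
 assumes "l < u"
 obtains b' where "!!x. (bump l u has_real_derivative b' x) (at x)" "continuous_on UNIV b'"
  "!!x. x \<notin> {l..u} ==> b' x = 0"
proof -
 obtain b' where b': "!!x. (bump l u has_real_derivative b' x) (at x)" "smooth_on UNIV b'"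
  using smooth_on_real_derivE[OF smooth_on_bump] by (metis UNIV_I)
 show thesis
 proof (rule that[OF b'(1) smooth_on_imp_continuous_on[OF b'(2)]])
  fix x assume x: "x \<notin> {l..u}"
  show "b' x = 0"
   by (rule deriv_zero_of_zero_near[OF b'(1), where S = "- {l..u}"]) (use x in \<open>auto intro!: bump_eq_0\<close>)
 qed
qed

lemma integrable_of_support:
 fixes f :: "real => real"
 assumes c: "continuous_on UNIV f" and 0: "!!x. x \<notin> {l..u} ==> f x = 0"
 shows "integrable lborel f"
proof -
 have m: "f : borel_measurable lborel" using borel_measurable_continuous_onI[OF c] by simp
 have "compact (f ` {l..u})" by (intro compact_continuous_image continuous_on_subset[OF c]) auto
 then obtain B where "ALL y:f ` {l..u}. norm y <= B" using compact_imp_bounded bounded_iff by metis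
 then show ?thesis
  by (intro integrableI_bounded_set[where A = "{l..u}" and B = B] m AE_I2 impI) (use 0 in \<open>auto simp: emeasure_lborel_Icc_eq\<close>)
qed

lemma lborel_product:
 fixes f :: "'a::euclidean_space => real" and g :: "'b::euclidean_space => real"
 assumes f: "integrable lborel f" and g: "integrable lborel g"
 shows "integrable lborel (%z. f (fst z) * g (snd z))"
  "(LINT z|lborel. f (fst z) * g (snd z)) = (LINT x|lborel. f x) * (LINT y|lborel. g y)"
proof -
 let ?P = "%z. f (fst z) * g (snd z)"
 have [measurable]: "f : borel_measurable lborel" "g : borel_measurable lborel" using f g by auto
 have i: "integrable (lborel \<Otimes>\<^sub>M lborel) ?P"
 proof (rule lborel_pair.Fubini_integrable)
  show "?P : borel_measurable (lborel \<Otimes>\<^sub>M lborel)" by measurable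
  show "integrable lborel (%x. LINT y|lborel. norm (?P (x, y)))"
   using f by (simp add: abs_mult)
  show "AE x in lborel. integrable lborel (%y. ?P (x, y))" using g by simp
 qed
 then show "integrable lborel ?P" unfolding lborel_prod .
 show "(LINT z|lborel. ?P z) = (LINT x|lborel. f x) * (LINT y|lborel. g y)"
  using lborel_pair.integral_fst'[OF i] unfolding lborel_prod by simp
qed

lemma AE_off_axis: "AE z::spacetime in lebesgue. fst (snd z) ~= 0"
proof -
 have "negligible {z::spacetime. z \<bullet> (0, 1, 0) = 0}"
  by (rule negligible_standard_hyperplane) (simp add: Basis_prod_def)
 then have "{z::spacetime. z \<bullet> (0, 1, 0) = 0} : null_sets lebesgue" by (simp only: negligible_iff_null_sets)
 from AE_not_in[OF this] show ?thesis by (simp add: inner_prod_def)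
qed

text \<open>Testing the equations with a bump whose support meets the vertical axis: the jump of the
 horizontal flux across the axis vanishes.\<close>

lemma (in gas) vertical_join:
 assumes U: "weak_solution p U" and lu: "l < u"
  and ae: "AE z in lebesgue. (0 < fst (snd z) & fst (snd z) <= 1 & l <= snd (snd z) & snd (snd z) <= u --> U z = A) &
   (fst (snd z) < 0 & -1 <= fst (snd z) & l <= snd (snd z) & snd (snd z) <= u --> U z = B)"
 shows "flux_x p A = flux_x p B"
proof -
 obtain alf' where alf': "!!x. (bump 0 1 has_real_derivative alf' x) (at x)" "continuous_on UNIV alf'" "!!x. x \<notin> {0..1} ==> alf' x = 0"
  using bump_derivE[of 0 1] by auto
 obtain bet' where bet': "!!x. (bump (-1) 1 has_real_derivative bet' x) (at x)" "continuous_on UNIV bet'" "!!x. x \<notin> {-1..1} ==> bet' x = 0"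
  using bump_derivE[of "-1" 1] by auto
 obtain gam' where gam': "!!x. (bump l u has_real_derivative gam' x) (at x)" "continuous_on UNIV gam'" "!!x. x \<notin> {l..u} ==> gam' x = 0"
  using bump_derivE[OF lu] by blast
 let ?a = "bump 0 1" and ?b = "bump (-1) 1" and ?c = "bump l u"
 have bc: "continuous_on UNIV (bump v w)" for v w by (rule smooth_on_imp_continuous_on[OF smooth_on_bump])
 have b0: "bump v w x = 0" if "x \<notin> {v..w}" for v w x using that by (intro bump_eq_0) auto
 define \<phi> where "\<phi> z = ?a (fst z) * (?b (fst (snd z)) * ?c (snd (snd z)))" for z :: spacetime
 have d: "(\<phi> has_derivative (%v. ?a (fst z) * (?b (fst (snd z)) * (snd (snd v) * gam' (snd (snd z))) +
   fst (snd v) * bet' (fst (snd z)) * ?c (snd (snd z))) + fst v * alf' (fst z) * (?b (fst (snd z)) * ?c (snd (snd z))))) (at z)" for z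
  unfolding \<phi>_def
  by (intro has_derivative_mult DERIV_compose_FDERIV[OF alf'(1)] DERIV_compose_FDERIV[OF bet'(1)] DERIV_compose_FDERIV[OF gam'(1)]
    bounded_linear_imp_has_derivative spacetime_coord_linear)
 note fd = frechet_derivative_at[OF d, symmetric]
 have tt: "test_function \<phi>"
  unfolding test_function_def
 proof
  show "smooth_on UNIV \<phi>"
   unfolding \<phi>_def
   by (intro smooth_on_mult open_UNIV smooth_on_compose[OF open_UNIV open_UNIV smooth_on_bump]
     smooth_on_linear spacetime_coord_linear subset_UNIV)
  have "{z. \<phi> z ~= 0} \<subseteq> cbox (0, -1, l) (1, 1, u)"
   using b0 by (force simp: \<phi>_def cbox_Pair_iff)
  then show "compact (closure {z. \<phi> z ~= 0})"
   using bounded_subset[OF bounded_cbox] by (simp add: compact_closure)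
 qed
 note dz = U[unfolded weak_solution_def distrib_div_zero_def]
 have lm: "U : borel_measurable lebesgue" "(%z. flux_x p (U z)) : borel_measurable lebesgue"
  "(%z. flux_y p (U z)) : borel_measurable lebesgue"
  using dz locally_integrable_measurable by auto
 define I where "I z = frechet_derivative \<phi> (at z) (1, 0, 0) *\<^sub>R U z + frechet_derivative \<phi> (at z) (0, 1, 0) *\<^sub>R flux_x p (U z)
    + frechet_derivative \<phi> (at z) (0, 0, 1) *\<^sub>R flux_y p (U z)" for z
 have I0: "(LINT z|lebesgue. I z) = 0" using dz tt by (simp add: div_pairing_def I_def)
 have Ii: "I z $ i = alf' (fst z) * (?b (fst (snd z)) * ?c (snd (snd z))) * U z $ i +
   ?a (fst z) * (bet' (fst (snd z)) * ?c (snd (snd z))) * flux_x p (U z) $ i +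
   ?a (fst z) * (?b (fst (snd z)) * gam' (snd (snd z))) * flux_y p (U z) $ i" for z i
  by (simp add: I_def fd)
 note x0 = AE_off_axis
 text \<open>The integrand is almost everywhere a sum of products of functions of one variable.\<close>
 define S where "S P Q x = P * indicator {0..1} x + Q * indicator {-1..0} x" for P Q x :: real
 have Sx: "S P Q x = (if 0 < x then P else Q)" if "x ~= 0" "x : {-1..1}" for P Q x
  using that by (auto simp: S_def indicator_def)
 define F where "F i z = alf' (fst z) * ((?b (fst (snd z)) * S (A $ i) (B $ i) (fst (snd z))) * ?c (snd (snd z))) +
   ?a (fst z) * ((bet' (fst (snd z)) * S (flux_x p A $ i) (flux_x p B $ i) (fst (snd z))) * ?c (snd (snd z))) +
   ?a (fst z) * ((?b (fst (snd z)) * S (flux_y p A $ i) (flux_y p B $ i) (fst (snd z))) * gam' (snd (snd z)))" for i and z :: spacetime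
 have IF: "AE z in lebesgue. I z $ i = F i z" for i
  using x0 ae
 proof eventually_elim
  fix z :: spacetime
  assume x: "fst (snd z) ~= 0" and *: "(0 < fst (snd z) & fst (snd z) <= 1 & l <= snd (snd z) & snd (snd z) <= u --> U z = A) &
   (fst (snd z) < 0 & -1 <= fst (snd z) & l <= snd (snd z) & snd (snd z) <= u --> U z = B)"
  show "I z $ i = F i z"
  proof (cases "fst (snd z) : {-1..1} & snd (snd z) : {l..u}")
   case True
   have "U z = (if 0 < fst (snd z) then A else B)" using * True x by auto
   then show ?thesis using Sx[OF x conjunct1[OF True]] by (simp add: Ii F_def)
  next
   case False
   then show ?thesis
    using b0[of "fst (snd z)" "-1" 1] bet'(3)[of "fst (snd z)"] b0[of "snd (snd z)" l u] gam'(3)[of "snd (snd z)"]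
    by (cases "fst (snd z) : {-1..1}") (simp_all add: Ii F_def)
  qed
 qed
 have int1: "integrable lborel (bump v w)" for v w by (rule integrable_of_support[OF bc b0])
 have int2: "integrable lborel alf'" "integrable lborel bet'" "integrable lborel gam'"
  using integrable_of_support alf'(2,3) bet'(2,3) gam'(2,3) by metis+
 have Sint: "integrable lborel (%x. f x * S P Q x)" if "integrable lborel f" for f P Q
 proof -
  have "integrable lborel (%x. P * (f x * indicator {0..1} x) + Q * (f x * indicator {-1..0} x))"
   by (intro Bochner_Integration.integrable_add integrable_mult_right integrable_real_mult_indicator that) auto
  then show ?thesis by (simp add: S_def algebra_simps)
 qed
 have prod: "integrable lborel (%z::spacetime. f (fst z) * (g (fst (snd z)) * h (snd (snd z))))"
  "(LINT z::spacetime|lborel. f (fst z) * (g (fst (snd z)) * h (snd (snd z)))) = (LINT x|lborel. f x) * ((LINT x|lborel. g x) * (LINT x|lborel. h x))"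
  if "integrable lborel f" "integrable lborel g" "integrable lborel h" for f g h :: "real => real"
  using lborel_product[OF that(1) lborel_product(1)[OF that(2,3)]] lborel_product(2)[OF that(2,3)] by simp_all
 have FTC: "(LINT x|lborel. f' x * indicator {v..w} x) = f w - f v"
  if "!!x. (f has_real_derivative f' x) (at x)" "continuous_on UNIV f'" "v <= w" for f f' :: "real => real" and v w
  by (rule integral_FTC_Icc_real[OF that(3)]) (use that(1,2) in \<open>auto simp: continuous_on_eq_continuous_at\<close>)
 have z1: "(LINT x|lborel. alf' x) = 0"
 proof -
  have "alf' x = alf' x * indicator {0..1} x" for x using alf'(3)[of x] by (auto simp: indicator_def)
  then have "(LINT x|lborel. alf' x) = (LINT x|lborel. alf' x * indicator {0..1} x)" by presburger
  then show ?thesis using FTC[OF alf'(1,2), of 0 1] by (simp add: bump_eq_0)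
 qed
 have z2: "(LINT x|lborel. gam' x) = 0"
 proof -
  have "gam' x = gam' x * indicator {l..u} x" for x using gam'(3)[of x] by (auto simp: indicator_def)
  then have "(LINT x|lborel. gam' x) = (LINT x|lborel. gam' x * indicator {l..u} x)" by presburger
  then show ?thesis using FTC[OF gam'(1,2), of l u] lu by (simp add: bump_eq_0)
 qed
 have jump: "(LINT x|lborel. bet' x * S P Q x) = (Q - P) * ?b 0" for P Q
 proof -
  have i: "integrable lborel (%x. bet' x * indicator X x)" if "X : sets borel" for X
   by (rule integrable_real_mult_indicator[OF _ int2(2)]) (use that in simp)
  have "(LINT x|lborel. bet' x * S P Q x) = (LINT x|lborel. P * (bet' x * indicator {0..1} x) + Q * (bet' x * indicator {-1..0} x))"
   by (simp add: S_def algebra_simps)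
  also have "... = P * (LINT x|lborel. bet' x * indicator {0..1} x) + Q * (LINT x|lborel. bet' x * indicator {-1..0} x)"
   using i by (subst Bochner_Integration.integral_add) (auto intro!: integrable_mult_right)
  also have "... = (Q - P) * ?b 0"
   using FTC[OF bet'(1,2), of 0 1] FTC[OF bet'(1,2), of "-1" 0] by (simp add: bump_eq_0 algebra_simps)
  finally show ?thesis .
 qed
 have Fi: "integrable lborel (F i)" and Fv: "(LINT z|lborel. F i z) =
   (LINT x|lborel. ?a x) * ((flux_x p B $ i - flux_x p A $ i) * ?b 0 * (LINT x|lborel. ?c x))" for i
 proof -
  note P1 = prod[OF int2(1) Sint[OF int1] int1]
  note P2 = prod[OF int1 Sint[OF int2(2)] int1]
  note P3 = prod[OF int1 Sint[OF int1] int2(3)]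
  show "integrable lborel (F i)" unfolding F_def by (intro Bochner_Integration.integrable_add P1(1) P2(1) P3(1))
  have "(LINT z|lborel. F i z) = (LINT x|lborel. ?a x) * ((LINT x|lborel. bet' x * S (flux_x p A $ i) (flux_x p B $ i) x) * (LINT x|lborel. ?c x))"
   unfolding F_def
   by (subst Bochner_Integration.integral_add[OF Bochner_Integration.integrable_add[OF P1(1) P2(1)] P3(1)],
     subst Bochner_Integration.integral_add[OF P1(1) P2(1)], unfold P1(2) P2(2) P3(2) z1 z2, simp)
  then show "(LINT z|lborel. F i z) =
   (LINT x|lborel. ?a x) * ((flux_x p B $ i - flux_x p A $ i) * ?b 0 * (LINT x|lborel. ?c x))" unfolding jump .
 qed
 have mI: "(%z. I z $ i) : borel_measurable lebesgue" for i
 proof -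
  have m: "(%z::spacetime. f (fst z) * (g (fst (snd z)) * h (snd (snd z)))) : borel_measurable lebesgue"
   if "continuous_on UNIV f" "continuous_on UNIV g" "continuous_on UNIV h" for f g h :: "real => real"
   by (rule measurable_completion)
    (auto intro!: borel_measurable_continuous_onI continuous_intros continuous_on_compose2[OF that(1)]
     continuous_on_compose2[OF that(2)] continuous_on_compose2[OF that(3)])
  show ?thesis
   unfolding Ii by (intro borel_measurable_add borel_measurable_times m alf'(2) bet'(2) gam'(2) bc borel_measurable_nth lm)
 qed
 have Fl: "integrable lebesgue (F i)" "(LINT z|lebesgue. F i z) = (LINT z|lborel. F i z)" for i
  using Fi[of i] by (auto simp: integrable_completion integral_completion)
 have ii: "integrable lebesgue (%z. I z $ i)" "(LINT z|lebesgue. I z $ i) = (LINT z|lborel. F i z)" for i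
  using integrable_cong_AE[OF mI[of i] _ IF[of i]] integral_cong_AE[OF mI[of i] _ IF[of i]] Fl[of i] by auto
 have "integrable lebesgue (%z. vector [I z $ 1, I z $ 2, I z $ 3] :: state)"
  unfolding vector_3_sum using ii(1) by (intro Bochner_Integration.integrable_add integrable_scaleR_left) auto
 then have int: "integrable lebesgue I" by (simp add: vector_3_nth)
 have "flux_x p A $ i = flux_x p B $ i" for i
 proof -
  have "(LINT z|lebesgue. I z $ i) = 0" using integral_bounded_linear[OF bounded_linear_vec_nth int, of i] I0 by simp
  moreover have "0 < (LINT x|lborel. ?a x)" "0 < (LINT x|lborel. ?c x)" using bump_integral_pos lu by auto
  moreover have "0 < ?b 0" by (simp add: bump_pos_iff)
  ultimately show ?thesis using ii(2)[of i] Fv[of i] by simp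
 qed
 then show ?thesis by (simp add: vec_eq_iff)
qed

section \<open>The structure of a half plane profile\<close>

lemma (in gas) discontinuityI:
 assumes h: "0 < h" "!!x. xi - h < x ==> x < xi ==> u x = L" "!!x. xi < x ==> x < xi + h ==> u x = R"
  and ne: "L ~= R" and st: "L : states" "R : states" and eq: "ray_flux xi L = ray_flux xi R"
 shows "discontinuity_at p u xi L R"
proof -
 have "\<forall>\<^sub>F x in at_left xi. u x = L"
  unfolding eventually_at_left_field by (rule exI[of _ "xi - h"]) (use h(1,2) in auto)
 moreover have "\<forall>\<^sub>F x in at_right xi. u x = R"
  unfolding eventually_at_right_field by (rule exI[of _ "xi + h"]) (use h(1,3) in auto)
 ultimately have "(u \<longlongrightarrow> L) (at_left xi)" "(u \<longlongrightarrow> R) (at_right xi)" by (auto intro: tendsto_eventually)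
 moreover have "flux_y p R - flux_y p L = xi *\<^sub>R (flux_x p R - flux_x p L)"
  using eq by (simp add: ray_flux_def algebra_simps)
 ultimately show ?thesis using ne st by (simp add: discontinuity_at_def)
qed

lemma discontinuity_not_isCont:
 assumes "discontinuity_at p u xi L R" shows "\<not> isCont u xi"
proof
 assume "isCont u xi"
 then have "(u \<longlongrightarrow> u xi) (at_left xi)" "(u \<longlongrightarrow> u xi) (at_right xi)" by (simp_all add: isCont_def filterlim_at_split)
 then have "L = u xi" "R = u xi"
  using assms unfolding discontinuity_at_def by (auto intro: tendsto_unique[OF trivial_limit_at_left_real] tendsto_unique[OF trivial_limit_at_right_real])
 then show False using assms by (simp add: discontinuity_at_def)
qed

lemma discontinuity_unique:
 assumes "discontinuity_at p u xi L R" "discontinuity_at p u xi L' R'" shows "L' = L & R' = R"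
 using assms unfolding discontinuity_at_def
 by (auto intro: tendsto_unique[OF trivial_limit_at_left_real] tendsto_unique[OF trivial_limit_at_right_real])

text \<open>The reflection \<open>xi \<mapsto> tau xi\<close> maps the slopes of either Mach field to those of the \<open>-\<close> field.\<close>

definition mach :: "real => wave_field" where "mach tau = (if tau = 1 then FMinus else FPlus)"

locale wave_profile = near_profile p sig K v G \<rho>0 M dlt for p sig K v G \<rho>0 M dlt +
 fixes kap :: real
 assumes field: "U : K ==> V : K ==> U ~= V ==> ray_flux xi U = ray_flux xi V ==> xi : slopes M dlt a ==> belongs_to_field p a xi U V"
  and kap: "0 < kap" "U : K ==> V : K ==> kap * norm (U - V) <= lam / 4"
   "U : K ==> V : K ==> (abs xi) <= lam + dlt ==> ray_flux xi U = ray_flux xi V ==> mass_flux xi U ~= 0 ==> U $ 1 < V $ 1 ==>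
     (abs (y - xi)) <= kap * norm (U - V) ==> sonic y U < 0 & 0 < sonic y V"
begin

lemma mach_slopes: "tau : {1, -1} ==> xi : slopes M dlt (mach tau) \<longleftrightarrow> - lam - dlt < tau * xi & tau * xi < - lam + dlt"
 using lam(3) by (auto simp: mach_def slopes_def lam_def[symmetric])

lemma prof_left: "- lam / 2 <= x ==> x < xi0 ==> prof x = w (- lam / 2)"
 using w_constant_lower[of x "- lam / 2"] Flux1_zero(2) dlt lam(1) by (auto simp: prof_def)

lemma prof_right: "xi0 <= x ==> x <= lam / 2 ==> prof x = w (lam / 2)"
 using w_constant_upper[of x "lam / 2"] Flux1_zero(2) dlt lam(1) by (auto simp: prof_def)

lemma ray_flux_limit:
 assumes "F ~= bot" "filterlim (%x. x) (nhds xi) F" "\<forall>\<^sub>F x in F. ray_flux x U = Flux x"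
 shows "ray_flux xi U = Flux xi"
proof (rule tendsto_unique[OF assms(1)])
 show "(Flux \<longlongrightarrow> Flux xi) F" by (rule isCont_tendsto_compose[OF Flux_isCont assms(2)])
 have "((%x. ray_flux x U) \<longlongrightarrow> ray_flux xi U) F" unfolding ray_flux_def by (intro tendsto_intros assms(2))
 then show "(Flux \<longlongrightarrow> ray_flux xi U) F" by (rule Lim_transform_eventually) (use assms(3) in simp)
qed

text \<open>At the ray of vanishing mass flux the momentum balance forces equal pressures: a contact.\<close>

lemma contact_structure:
 "prof constant_on slopes M dlt FZero \<or>
  (EX xi0 Um Up. contact_at p prof xi0 Um Up & const_off_jump prof (slopes M dlt FZero) xi0)"
proof -
 let ?L = "w (- lam / 2)" and ?R = "w (lam / 2)"
 have x0: "- lam / 2 < xi0" "xi0 < lam / 2" using Flux1_zero(2) dlt lam(1) by auto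
 have sl: "slopes M dlt FZero = {- dlt<..<dlt}" by (simp add: slopes_def)
 have in_sl: "x : slopes M dlt FZero ==> - lam / 2 <= x & x <= lam / 2" for x using dlt lam(1) by (auto simp: sl)
 have N: "Flux (- lam / 2) $ 1 ~= 0" "Flux (lam / 2) $ 1 ~= 0" using Flux1_sign(1)[OF x0(1)] Flux1_sign(2)[OF x0(2)] by auto
 have K: "?L : K" "?R : K" using decode(4) N by auto
 show ?thesis
 proof (cases "?L = ?R")
  case True
  have "prof x = ?R" if "x : slopes M dlt FZero" for x
   using prof_left[of x] prof_right[of x] in_sl[OF that] True by (cases "x < xi0") auto
  then show ?thesis unfolding constant_on_def by blast
 next
  case False
  have "\<forall>\<^sub>F x in at_left xi0. - lam / 2 < x" "\<forall>\<^sub>F x in at_left xi0. x < xi0"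
   using x0 by (auto simp: eventually_at_left_field intro!: exI[of _ "- lam / 2"])
  then have "\<forall>\<^sub>F x in at_left xi0. ray_flux x ?L = Flux x"
  proof eventually_elim
   fix x assume x: "- lam / 2 < x" "x < xi0"
   then have "w x = ?L" using prof_left[of x] by (auto simp: prof_def)
   then show "ray_flux x ?L = Flux x" using decode(3)[of x] Flux1_sign(1)[of x] x by auto
  qed
  then have L: "ray_flux xi0 ?L = Flux xi0"
   by (rule ray_flux_limit[rotated 2]) (auto simp: filterlim_def at_within_le_nhds tendsto_def intro!: filter_leD)
  have "\<forall>\<^sub>F x in at_right xi0. x < lam / 2" "\<forall>\<^sub>F x in at_right xi0. xi0 < x"
   using x0 by (auto simp: eventually_at_right_field intro!: exI[of _ "lam / 2"])
  then have "\<forall>\<^sub>F x in at_right xi0. ray_flux x ?R = Flux x"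
  proof eventually_elim
   fix x assume x: "x < lam / 2" "xi0 < x"
   then have "w x = ?R" using prof_right[of x] by (auto simp: prof_def)
   then show "ray_flux x ?R = Flux x" using decode(3)[of x] Flux1_sign(2)[of x] x by auto
  qed
  then have R: "ray_flux xi0 ?R = Flux xi0"
   by (rule ray_flux_limit[rotated 2]) (auto simp: filterlim_def at_within_le_nhds tendsto_def intro!: filter_leD)
  have m: "mass_flux xi0 U = 0" if "ray_flux xi0 U = Flux xi0" for U
   using that ray_flux_nth(1)[of xi0 U] Flux1_zero(1) by simp
  have ev: "eigenvalue p FZero U = xi0" if "U : K" "ray_flux xi0 U = Flux xi0" for U
   using m[OF that(2)] near[OF that(1)] by (simp add: mass_flux_def near_def field_simps)
  have "xi0 : slopes M dlt FZero" using Flux1_zero(2) by (auto simp: sl)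
  moreover have "discontinuity_at p prof xi0 ?L ?R"
  proof (rule discontinuityI[where h = "lam / 2 - (abs xi0)"])
   show "prof x = ?L" if "xi0 - (lam / 2 - (abs xi0)) < x" "x < xi0" for x by (rule prof_left) (use that in linarith)+
   show "prof x = ?R" if "xi0 < x" "x < xi0 + (lam / 2 - (abs xi0))" for x by (rule prof_right) (use that in linarith)+
  qed (use False K K(1) L R x0 near near_def in auto)
  moreover have "const_off_jump prof (slopes M dlt FZero) xi0"
   unfolding const_off_jump_def constant_on_def
   using prof_left prof_right in_sl \<open>xi0 : slopes M dlt FZero\<close> by (intro conjI exI[of _ ?L] exI[of _ ?R] ballI) auto
  ultimately show ?thesis
   using field[OF K False] L R ev K unfolding contact_at_def by (intro disjI2 exI[of _ xi0] exI conjI) auto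
 qed
qed

context
 fixes tau :: real
 assumes tau: "tau : {1, -1}"
begin

interpretation f: fan "%xi. w (tau * xi)" "%xi. sonic (tau * xi)" "- lam / 2" sig K "%xi. roots (tau * xi)" by (rule mach_fan[OF tau])

lemma tau2: "tau * (tau * x) = x" using tau by auto

lemma mach_prof: "tau * x < - lam / 4 ==> prof x = w x"
 using tau by (intro prof_eq) auto

lemma prof_isCont: "x < - lam / 4 ==> isCont (%xi. w (tau * xi)) x \<longleftrightarrow> isCont prof (tau * x)"
proof -
 assume x: "x < - lam / 4"
 have "isCont (%xi. w (tau * xi)) x \<longleftrightarrow> isCont w (tau * x)"
  using isCont_o2[of x "%xi. tau * xi" w] isCont_o2[of "tau * x" "%xi. tau * xi" "%xi. w (tau * xi)"] by (auto simp: tau2)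
 also have "... \<longleftrightarrow> isCont prof (tau * x)"
 proof (rule isCont_cong)
  have "((%y. tau * y) \<longlongrightarrow> tau * (tau * x)) (nhds (tau * x))" by (intro tendsto_mult tendsto_const filterlim_ident)
  from order_tendstoD(2)[OF this, of "- lam / 4"] have "\<forall>\<^sub>F y in nhds (tau * x). tau * y < - lam / 4" using x by (simp add: tau2)
  then show "\<forall>\<^sub>F y in nhds (tau * x). w y = prof y" by eventually_elim (simp add: mach_prof)
 qed
 finally show ?thesis .
qed

text \<open>A discontinuity is a shock between the constant states next to it. In a backward sector the lower
 density is on its right, in the coordinate \<open>tau xi\<close>, and the gap estimate keeps both neighbours off the sonic line.\<close>

lemma jump_structure:
 assumes x: "x : slopes M dlt (mach tau)" and nc: "\<not> isCont prof x"
 shows "EX Um Up. shock_at p (mach tau) prof x Um Up & (sig = -1 -->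
  (ALL y. x - kap * norm (Up - Um) < y --> y < x --> prof y = Um) & (ALL y. x < y --> y < x + kap * norm (Up - Um) --> prof y = Up))"
proof -
 define xi where "xi = tau * x"
 have xi: "- lam - dlt < xi" "xi < - lam + dlt" using x mach_slopes[OF tau] by (auto simp: xi_def)
 have xx: "tau * xi = x" by (simp add: xi_def tau2)
 have b: "xi < - lam / 2" using xi dlt lam(1) by simp
 have ncW: "\<not> isCont (%xi. w (tau * xi)) xi" using prof_isCont[of xi] nc b lam(1) by (simp add: xx)
 then have nz: "sonic (tau * xi) (w (tau * xi)) ~= 0" using f.sonic_cont[OF b] by blast
 from f.nonsonic[OF b nz] obtain h cl cr where h: "0 < h" "cl : roots x" "cr : roots x"
  "ALL y. xi - h < y --> y < xi --> w (tau * y) = cl" "ALL y. xi < y --> y < xi + h --> w (tau * y) = cr" "w (tau * xi) : {cl, cr}"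
  "cl ~= cr --> sig * sonic x cl < 0 & 0 < sig * sonic x cr"
  unfolding xx by (elim exE conjE bexE)
 note W = h(4)[rule_format] h(5)[rule_format]
 have ne: "cl ~= cr"
 proof
  assume eq: "cl = cr"
  have "\<forall>\<^sub>F y in nhds xi. w (tau * y) = cl"
   unfolding eventually_nhds_metric
  proof (intro exI[of _ h] conjI h(1) allI impI)
   fix y assume "dist y xi < h"
   then have y: "xi - h < y" "y < xi + h" by (auto simp: dist_real_def)
   show "w (tau * y) = cl"
   proof (cases y xi rule: linorder_cases)
    case less show ?thesis by (rule W(1)[OF y(1) less])
   next
    case equal show ?thesis using h(6) eq equal by simp
   next
    case greater show ?thesis using W(2)[OF greater y(2)] eq by simp
   qed
  qed
  then have "isCont (%xi. w (tau * xi)) xi" by (subst isCont_cong[where g = "%_. cl"]) auto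
  then show False using ncW by blast
 qed
 have K: "cl : K" "cr : K" and eq: "ray_flux x cl = ray_flux x cr" using h(2,3) by (auto simp: roots_def)
 have N: "Flux x $ 1 ~= 0" using Flux1_sign_mach[OF tau b] xx by auto
 define Um Up where "Um = (if tau = 1 then cl else cr)" and "Up = (if tau = 1 then cr else cl)"
 have UK: "Um : K" "Up : K" "Um ~= Up" "ray_flux x Um = ray_flux x Up" using K ne eq by (auto simp: Um_def Up_def)
 define l where "l = min h (lam / 4)"
 have pW: "prof (tau * y) = w (tau * y)" if "y < - lam / 4" for y by (rule mach_prof) (use that in \<open>simp add: tau2\<close>)
 have pm: "prof y = Um" if "x - l < y" "y < x" for y
  using that W(1)[of "tau * y"] W(2)[of "tau * y"] pW[of "tau * y"] tau xi dlt lam(1) by (auto simp: Um_def l_def xi_def)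
 have pp: "prof y = Up" if "x < y" "y < x + l" for y
  using that W(1)[of "tau * y"] W(2)[of "tau * y"] pW[of "tau * y"] tau xi dlt lam(1) by (auto simp: Up_def l_def xi_def)
 have disc: "discontinuity_at p prof x Um Up"
  by (rule discontinuityI[of l, OF _ pm pp UK(3) _ _ UK(4)]) (use h(1) lam(1) near[OF UK(1)] near[OF UK(2)] in \<open>auto simp: l_def near_def\<close>)
 have shock: "shock_at p (mach tau) prof x Um Up"
  unfolding shock_at_def using disc field[OF UK x] by (simp add: mach_def)
 have gap: "(ALL y. x - kap * norm (Up - Um) < y --> y < x --> prof y = Um) & (ALL y. x < y --> y < x + kap * norm (Up - Um) --> prof y = Up)"
  if s: "sig = -1"
 proof -
  define k where "k = kap * norm (cr - cl)"
  have k: "0 < k" "k <= lam / 4" using kap(1) kap(2)[OF K(2,1)] ne by (auto simp: k_def)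
  have kn: "kap * norm (Up - Um) = k" by (auto simp: k_def Um_def Up_def norm_minus_commute)
  have S: "0 < sonic x cl" "sonic x cr < 0" using h(7) ne s by auto
  have lt: "cr $ 1 < cl $ 1" using h(3,2) N by (rule roots_cases) (use S ne in auto)
  have mf: "mass_flux x cr ~= 0" using roots_mass_flux[OF h(3)] N by simp
  have xb: "(abs x) <= lam + dlt" using xi tau lam(1) dlt by (auto simp: xi_def)
  have G: "sonic (tau * y) cr < 0 & 0 < sonic (tau * y) cl" if "(abs (y - xi)) <= k" for y
  proof (rule kap(3)[OF K(2,1) xb eq[symmetric] mf lt])
   show "(abs (tau * y - x)) <= kap * norm (cr - cl)" using that tau by (auto simp: k_def xi_def)
  qed
  have R: "w (tau * y) = cr" if "xi < y" "y < xi + k" for y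
  proof (rule f.continue_right[OF _ _ h(1) W(2) _ that])
   show "sonic (tau * z) cr ~= 0 & (0 < sig * sonic (tau * z) cr \<or> isCont (%xi. w (tau * xi)) z)" if "xi < z" "z < xi + k" for z
    using G[of z] that s by auto
  qed (use k xi dlt lam(1) in auto)
  have L: "w (tau * y) = cl" if "xi - k < y" "y < xi" for y
  proof (rule f.continue_left[OF _ _ h(1) W(1) _ that])
   show "sonic (tau * z) cl ~= 0 & (sig * sonic (tau * z) cl < 0 \<or> isCont (%xi. w (tau * xi)) z)" if "xi - k < z" "z < xi" for z
    using G[of z] that s by auto
  qed (use k b in auto)
  have "prof y = Um" if "x - k < y" "y < x" for y
   using that R[of "tau * y"] L[of "tau * y"] pW[of "tau * y"] tau xi dlt k lam(1) by (auto simp: Um_def xi_def)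
  moreover have "prof y = Up" if "x < y" "y < x + k" for y
   using that R[of "tau * y"] L[of "tau * y"] pW[of "tau * y"] tau xi dlt k lam(1) by (auto simp: Up_def xi_def)
  ultimately show ?thesis unfolding kn by blast
 qed
 show ?thesis using shock gap by blast
qed

text \<open>The patterns of a fan. In a backward sector only intervals of continuity are considered, where
 no jump can break the monotonicity.\<close>

lemma sector_structure:
 assumes rs: "r < s" "{r<..<s} \<subseteq> slopes M dlt (mach tau)" and good: "sig = 1 \<or> continuous_on {r<..<s} prof"
 shows "prof constant_on {r<..<s} \<or> (EX x Um Up. shock_at p (mach tau) prof x Um Up & const_off_jump prof {r<..<s} x) \<or>
  const_off_wave p (mach tau) prof {r<..<s}"
proof -
 define r' s' where "r' = (if tau = 1 then r else - s)" and "s' = (if tau = 1 then s else - r)"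
 have r's': "r' < s'" using rs(1) by (simp add: r'_def s'_def)
 have in_iff: "x : {r<..<s} \<longleftrightarrow> r' < tau * x & tau * x < s'" for x using tau by (auto simp: r'_def s'_def)
 have in_iff': "tau * y : {r<..<s} \<longleftrightarrow> r' < y & y < s'" for y by (simp only: in_iff tau2)
 have sl: "- lam - dlt < y & y < - lam + dlt" if "r' < y" "y < s'" for y
  using mach_slopes[OF tau, of "tau * y"] in_iff'[of y] rs(2) that by (auto simp: tau2)
 have s'le: "s' <= - lam + dlt" by (rule dense_le_bounded[OF r's']) (use sl in force)
 then have s'b: "s' <= - lam / 2" using dlt lam(1) by simp
 have q: "y < - lam / 4" if "y < s'" for y using that s'b lam(1) by simp
 have pw: "prof x = w x" if "x : {r<..<s}" for x using mach_prof[of x] in_iff[of x] that q by blast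
 have good': "0 < sig \<or> isCont (%xi. w (tau * xi)) y" if "r' < y" "y < s'" for y
  using good
 proof
  assume "continuous_on {r<..<s} prof"
  then have "isCont prof (tau * y)" using in_iff'[of y] that by (simp add: continuous_on_eq_continuous_at)
  then show ?thesis using prof_isCont[OF q[OF that(2)]] by blast
 qed simp
 show ?thesis
 proof (rule f.patterns[OF s'b good' r's'])
  assume "(%xi. w (tau * xi)) constant_on {r'<..<s'}"
  then obtain c where c: "ALL y:{r'<..<s'}. w (tau * y) = c" unfolding constant_on_def by (elim exE)
  have "prof x = c" if "x : {r<..<s}" for x
   using c[rule_format, of "tau * x"] pw[OF that] in_iff[of x] that by (simp add: tau2)
  then have "prof constant_on {r<..<s}" unfolding constant_on_def by (intro exI[of _ c] ballI)
  then show ?thesis ..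
 next
  fix t cl cr
  assume t: "r' < t" "t < s'" and cl: "!!x. r' < x ==> x < t ==> w (tau * x) = cl" and cr: "!!x. t < x ==> x < s' ==> w (tau * x) = cr"
   and ne: "cl ~= cr" and nz: "sonic (tau * t) (w (tau * t)) ~= 0"
  have xI: "tau * t : {r<..<s}" using in_iff' t by blast
  have "\<not> isCont prof (tau * t)"
  proof
   assume "isCont prof (tau * t)"
   then have "isCont (%xi. w (tau * xi)) t" using prof_isCont[OF q[OF t(2)]] by blast
   from f.isCont_left_constant[OF this t(1) cl] f.isCont_right_constant[OF this t(2) cr] show False using ne by simp
  qed
  from jump_structure[OF _ this] xI rs(2) obtain Um Up where "shock_at p (mach tau) prof (tau * t) Um Up" by blast
  moreover have "prof constant_on {x:{r<..<s}. x < tau * t}"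
   unfolding constant_on_def
  proof (intro exI[of _ "if tau = 1 then cl else cr"] ballI)
   fix x assume "x : {x:{r<..<s}. x < tau * t}"
   then show "prof x = (if tau = 1 then cl else cr)"
    using cl[of "tau * x"] cr[of "tau * x"] pw[of x] in_iff[of x] tau by (auto simp: tau2)
  qed
  moreover have "prof constant_on {x:{r<..<s}. tau * t < x}"
   unfolding constant_on_def
  proof (intro exI[of _ "if tau = 1 then cr else cl"] ballI)
   fix x assume "x : {x:{r<..<s}. tau * t < x}"
   then show "prof x = (if tau = 1 then cr else cl)"
    using cl[of "tau * x"] cr[of "tau * x"] pw[of x] in_iff[of x] tau by (auto simp: tau2)
  qed
  ultimately show ?thesis using xI unfolding const_off_jump_def by blast
 next
  fix z1 z2 cl cr
  assume z: "r' < z1" "z1 < z2" "z2 < s'" "sonic (tau * z1) (w (tau * z1)) = 0" "sonic (tau * z2) (w (tau * z2)) = 0"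
   and conv: "!!x y z. r' < x ==> x < y ==> y < z ==> z < s' ==> sonic (tau * x) (w (tau * x)) = 0 ==> sonic (tau * z) (w (tau * z)) = 0 ==> sonic (tau * y) (w (tau * y)) = 0"
   and cl: "!!x. r' < x ==> x < s' ==> (!!z. r' < z ==> z < s' ==> sonic (tau * z) (w (tau * z)) = 0 ==> x < z) ==> w (tau * x) = cl"
   and cr: "!!x. r' < x ==> x < s' ==> (!!z. r' < z ==> z < s' ==> sonic (tau * z) (w (tau * z)) = 0 ==> z < x) ==> w (tau * x) = cr"
   and cont: "!!x. r' < x ==> x < s' ==> isCont (%xi. w (tau * xi)) x"
  define J where "J = {x : {r<..<s}. sonic x (w x) = 0}"
  have Jmem: "x : J \<longleftrightarrow> r' < tau * x & tau * x < s' & sonic x (w x) = 0" for x by (simp only: J_def mem_Collect_eq in_iff conj_assoc)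
  have JI: "is_interval J"
   unfolding is_interval_1
  proof (intro ballI allI impI)
   fix a b x assume a: "a : J" and b: "b : J" and x: "a <= x & x <= b"
   show "x : J"
   proof (cases "a = x \<or> x = b")
    case False
    then have ax: "a < x" "x < b" using x by auto
    have xI: "x : {r<..<s}" using a b ax by (auto simp: J_def)
    have "sonic x (w x) = 0"
    proof (cases "tau = 1")
     case True
     then show ?thesis using conv[of a x b] a b ax by (simp add: Jmem)
    next
     case False
     then have "tau = -1" using tau by auto
     then show ?thesis using conv[of "- b" "- x" "- a"] a b ax by (simp add: Jmem)
    qed
    then show ?thesis using xI by (simp add: J_def)
   qed (use a b in auto)
  qed
  have zJ: "tau * z1 : J" "tau * z2 : J" using z by (auto simp: Jmem tau2)
  have neq: "tau * z1 < tau * z2 \<or> tau * z2 < tau * z1" using z(2) tau by auto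
  have JR: "J \<subseteq> {- (lam + dlt)..lam + dlt}"
  proof
   fix x assume "x : J"
   then have "- lam - dlt < tau * x" "tau * x < - lam + dlt" using sl[of "tau * x"] by (auto simp: Jmem)
   then show "x : {- (lam + dlt)..lam + dlt}" using tau lam(1) dlt by auto
  qed
  have Jz: "tau * x < - lam / 2 & sonic x (w x) = 0" if "x : J" for x using that s'b by (auto simp: Jmem)
  have sw: "simple_wave p (mach tau) prof J"
   using neq
  proof
   assume "tau * z1 < tau * z2"
   from sonic_simple_wave[OF tau JI zJ(1,2) this JR Jz] show ?thesis by (simp add: mach_def)
  next
   assume "tau * z2 < tau * z1"
   from sonic_simple_wave[OF tau JI zJ(2,1) this JR Jz] show ?thesis by (simp add: mach_def)
  qed
  have pc: "continuous_on {r<..<s} prof"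
  proof (intro continuous_at_imp_continuous_on ballI)
   fix x assume x: "x : {r<..<s}"
   then show "isCont prof x" using prof_isCont[OF q, of "tau * x"] cont[of "tau * x"] in_iff[of x] by (simp add: tau2)
  qed
  have lo: "prof x = cl" if x: "x : {r<..<s}" "ALL \<zeta>:J. tau * x < tau * \<zeta>" for x
  proof -
   have "w (tau * (tau * x)) = cl"
   proof (rule cl)
    show "tau * x < z" if "r' < z" "z < s'" "sonic (tau * z) (w (tau * z)) = 0" for z
     using x(2)[rule_format, of "tau * z"] that by (simp add: Jmem tau2)
   qed (use x(1) in_iff in blast)+
   then show ?thesis using pw[OF x(1)] by (simp add: tau2)
  qed
  have hi: "prof x = cr" if x: "x : {r<..<s}" "ALL \<zeta>:J. tau * \<zeta> < tau * x" for x
  proof -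
   have "w (tau * (tau * x)) = cr"
   proof (rule cr)
    show "z < tau * x" if "r' < z" "z < s'" "sonic (tau * z) (w (tau * z)) = 0" for z
     using x(2)[rule_format, of "tau * z"] that by (simp add: Jmem tau2)
   qed (use x(1) in_iff in blast)+
   then show ?thesis using pw[OF x(1)] by (simp add: tau2)
  qed
  have "prof constant_on {x:{r<..<s}. ALL \<zeta>:J. x < \<zeta>}" "prof constant_on {x:{r<..<s}. ALL \<zeta>:J. \<zeta> < x}"
  proof -
   show "prof constant_on {x:{r<..<s}. ALL \<zeta>:J. x < \<zeta>}"
    unfolding constant_on_def
    by (rule exI[of _ "if tau = 1 then cl else cr"]) (use lo hi tau in auto)
   show "prof constant_on {x:{r<..<s}. ALL \<zeta>:J. \<zeta> < x}"
    unfolding constant_on_def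
    by (rule exI[of _ "if tau = 1 then cr else cl"]) (use lo hi tau in auto)
  qed
  then have "const_off_wave p (mach tau) prof {r<..<s}"
   unfolding const_off_wave_def using pc sw by (intro conjI exI[of _ J]) (auto simp: J_def)
  then show ?thesis by blast
 qed
qed

lemma backward_structure:
 assumes s: "sig = -1" and I: "I = slopes M dlt (mach tau)"
 shows "ALL r s. r < s & {r<..<s} \<subseteq> I & continuous_on {r<..<s} prof -->
    prof constant_on {r<..<s} \<or> const_off_wave p (mach tau) prof {r<..<s}"
  "ALL xi0:I. \<not> isCont prof xi0 --> (EX Um Up. shock_at p (mach tau) prof xi0 Um Up)"
  "discrete {xi0:I. EX Um Up. shock_at p (mach tau) prof xi0 Um Up}"
  "ALL xi0:I. ALL Um Up. shock_at p (mach tau) prof xi0 Um Up -->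
    prof constant_on {xi0 - kap * norm (Up - Um)<..<xi0} & prof constant_on {xi0<..<xi0 + kap * norm (Up - Um)}"
proof -
 have nc: "\<not> isCont prof x" if "shock_at p (mach tau) prof x Um Up" for x Um Up
  using that discontinuity_not_isCont unfolding shock_at_def by blast
 show "ALL r s. r < s & {r<..<s} \<subseteq> I & continuous_on {r<..<s} prof -->
    prof constant_on {r<..<s} \<or> const_off_wave p (mach tau) prof {r<..<s}"
 proof (intro allI impI, elim conjE)
  fix r s assume rs: "r < s" "{r<..<s} \<subseteq> I" "continuous_on {r<..<s} prof"
  have "\<not> (EX x Um Up. shock_at p (mach tau) prof x Um Up & const_off_jump prof {r<..<s} x)"
  proof (intro notI, elim exE conjE)
   fix x Um Up assume x: "shock_at p (mach tau) prof x Um Up" "const_off_jump prof {r<..<s} x"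
   then have "isCont prof x" using rs(3) by (simp add: const_off_jump_def continuous_on_eq_continuous_at)
   then show False using nc[OF x(1)] by blast
  qed
  then show "prof constant_on {r<..<s} \<or> const_off_wave p (mach tau) prof {r<..<s}"
   using sector_structure[OF rs(1) rs(2)[unfolded I] disjI2[OF rs(3)]] by blast
 qed
 show "ALL xi0:I. \<not> isCont prof xi0 --> (EX Um Up. shock_at p (mach tau) prof xi0 Um Up)"
  using jump_structure unfolding I by blast
 have gap: "(ALL y. x - kap * norm (Up - Um) < y --> y < x --> prof y = Um) & (ALL y. x < y --> y < x + kap * norm (Up - Um) --> prof y = Up)"
  if x: "x : I" "shock_at p (mach tau) prof x Um Up" for x Um Up
 proof -
  from jump_structure[OF x(1)[unfolded I] nc[OF x(2)]] s obtain L R where L: "shock_at p (mach tau) prof x L R"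
   "(ALL y. x - kap * norm (R - L) < y --> y < x --> prof y = L) & (ALL y. x < y --> y < x + kap * norm (R - L) --> prof y = R)" by blast
  have "Um = L & Up = R" using discontinuity_unique L(1) x(2) unfolding shock_at_def by blast
  then show ?thesis using L(2) by simp
 qed
 show "ALL xi0:I. ALL Um Up. shock_at p (mach tau) prof xi0 Um Up -->
    prof constant_on {xi0 - kap * norm (Up - Um)<..<xi0} & prof constant_on {xi0<..<xi0 + kap * norm (Up - Um)}"
 proof (intro ballI allI impI conjI)
  fix x Um Up assume x: "x : I" "shock_at p (mach tau) prof x Um Up"
  note g = gap[OF x]
  show "prof constant_on {x - kap * norm (Up - Um)<..<x}" "prof constant_on {x<..<x + kap * norm (Up - Um)}"
   unfolding constant_on_def using g by (auto intro!: exI[of _ Um] exI[of _ Up])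
 qed
 show "discrete {xi0:I. EX Um Up. shock_at p (mach tau) prof xi0 Um Up}"
 proof (rule discreteI)
  fix x assume "x : {xi0:I. EX Um Up. shock_at p (mach tau) prof xi0 Um Up}"
  then obtain Um Up where x: "x : I" "shock_at p (mach tau) prof x Um Up" by blast
  define k where "k = kap * norm (Up - Um)"
  have k: "0 < k" using kap(1) x(2) by (auto simp: k_def shock_at_def discontinuity_at_def)
  have "isCont prof y" if y: "y : {x - k<..<x + k}" "y ~= x" for y
  proof -
   have c: "isCont prof y" if "open A" "y : A" "!!z. z : A ==> prof z = c" for A c
   proof -
    have "\<forall>\<^sub>F z in nhds y. prof z = c" using eventually_nhds_in_open[OF that(1,2)] by eventually_elim (rule that(3))
    then show ?thesis by (subst isCont_cong[where g = "%_. c"]) auto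
   qed
   show ?thesis
   proof (cases "y < x")
    case True
    show ?thesis by (rule c[of "{x - k<..<x}" Um]) (use True y gap[OF x] in \<open>auto simp: k_def\<close>)
   next
    case False
    show ?thesis by (rule c[of "{x<..<x + k}" Up]) (use False y gap[OF x] in \<open>auto simp: k_def\<close>)
   qed
  qed
  then have iso: "y = x" if "y : {x - k<..<x + k}" "shock_at p (mach tau) prof y L R" for y L R
   using nc[OF that(2)] that(1) by blast
  have "{x - k<..<x + k} \<inter> {xi0:I. EX Um Up. shock_at p (mach tau) prof xi0 Um Up} = {x}"
  proof (intro equalityI subsetI)
   fix y assume "y : {x - k<..<x + k} \<inter> {xi0:I. EX Um Up. shock_at p (mach tau) prof xi0 Um Up}"
   then show "y : {x}" using iso by blast
  next
   fix y assume "y : {x}"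
   then show "y : {x - k<..<x + k} \<inter> {xi0:I. EX Um Up. shock_at p (mach tau) prof xi0 Um Up}" using x k by auto
  qed
  then show "x isolated_in {xi0:I. EX Um Up. shock_at p (mach tau) prof xi0 Um Up}"
   unfolding isolated_in_def using x by (intro conjI exI[of _ "{x - k<..<x + k}"]) auto
 qed
qed

end

end

section \<open>The self-similar flow\<close>

context near_profile begin

lemma prof_AE: "AE xi in lborel. prof xi = v xi"
 using w_AE_eq AE_lborel_singleton[of xi0]
proof eventually_elim
 fix xi assume *: "Flux xi $ 1 ~= 0 --> w xi = v xi" "xi ~= xi0"
 then have "Flux xi $ 1 ~= 0" using Flux1_sign[of xi] by (cases xi xi0 rule: linorder_cases) auto
 then show "prof xi = v xi" using * by (simp add: prof_def)
qed

lemma prof_controlled: "controlled UNIV prof"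
 unfolding prof_def[abs_def] by (rule w_controlled)

lemma prof_far: "lam + dlt <= x ==> prof x = w (lam + dlt)" "x <= - (lam + dlt) ==> prof x = w (- (lam + dlt))"
 using w_constant_right[of x "lam + dlt"] w_constant_left[of x "- (lam + dlt)"] prof_eq[of x] lam(1) dlt by auto

lemma far_K: "w (lam + dlt) : K" "w (- (lam + dlt)) : K"
 using decode(4)[OF region_nonzero[OF region_far]] dlt lam(1) by auto

text \<open>Outside the open sectors a slope keeps the distance \<open>dlt / 2\<close> from all sonic slopes.\<close>

lemma prof_locally_constant:
 assumes "!!a. xi \<notin> slopes M dlt a"
 shows "EX h>0. ALL x. (abs (x - xi)) < h --> prof x = prof xi"
proof -
 have s: "dlt <= (abs xi)" "dlt <= (abs (xi - lam))" "dlt <= (abs (xi + lam))"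
  using assms[of FZero] assms[of FPlus] assms[of FMinus] lam(3) by (auto simp: slopes_def lam_def[symmetric])
 have r: "region xi" unfolding region_def using s Flux1_zero(2) dlt lam(1) by linarith
 then have ne: "xi ~= xi0" by (simp add: region_def)
 from w_locally_constant[OF r] obtain h where h: "0 < h" "ALL x. (abs (x - xi)) < h --> w x = w xi" by (elim exE conjE)
 show ?thesis
 proof (intro exI[of _ "min h (abs (xi - xi0))"] conjI allI impI)
  fix x assume x: "(abs (x - xi)) < min h (abs (xi - xi0))"
  then have "x ~= xi0" by auto
  moreover have "w x = w xi" using h(2)[rule_format, of x] x by simp
  ultimately show "prof x = prof xi" using ne by (simp add: prof_def)
 qed (use h(1) ne in simp)
qed

end

definition wave_structure :: "(real => real) => real => real => real => (spacetime => state) => bool" where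
 "wave_structure p M dlt kap U \<longleftrightarrow> (EX V. (AE z in lebesgue. U z = V (snd z)) & ray_constant V &
    bounded_variation_on {0..2 * pi} (%\<theta>. V (cos \<theta>, sin \<theta>)) &
    (ALL C : components (- {0} - (\<Union>a. forward_sector M dlt a \<union> backward_sector M dlt a)).
      V constant_on C) &
    (ALL u : {forward_part V, backward_part V}.
      u constant_on slopes M dlt FZero \<or>
      (EX xi0 Um Up. contact_at p u xi0 Um Up & const_off_jump u (slopes M dlt FZero) xi0)) &
    (ALL a : {FPlus, FMinus}. let u = forward_part V; I = slopes M dlt a in
      u constant_on I \<or>
      (EX xi0 Um Up. shock_at p a u xi0 Um Up & const_off_jump u I xi0) \<or>
      const_off_wave p a u I) &
    (ALL a : {FPlus, FMinus}. let u = backward_part V; I = slopes M dlt a in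
      (ALL r s. r < s & {r<..<s} \<subseteq> I & continuous_on {r<..<s} u -->
       u constant_on {r<..<s} \<or> const_off_wave p a u {r<..<s}) &
      (ALL xi0:I. \<not> isCont u xi0 --> (EX Um Up. shock_at p a u xi0 Um Up)) &
      discrete {xi0:I. EX Um Up. shock_at p a u xi0 Um Up} &
      (ALL xi0:I. ALL Um Up. shock_at p a u xi0 Um Up -->
       u constant_on {xi0 - kap * norm (Up - Um)<..<xi0} &
       u constant_on {xi0<..<xi0 + kap * norm (Up - Um)})))"

context flow begin

text \<open>Both states are supersonic in the horizontal direction, where the horizontal momentum flux
 is a decreasing function of the density at fixed mass flux.\<close>

lemma flux_x_injective:
 assumes A: "near dlt A" and B: "near dlt B" and eq: "flux_x p A = flux_x p B"
 shows "A = B"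
proof -
 have e: "A $ 2 = B $ 2" "(A $ 2)\<^sup>2 / A $ 1 + 1 * p (A $ 1) = (B $ 2)\<^sup>2 / B $ 1 + 1 * p (B $ 1)"
  "A $ 2 * A $ 3 / A $ 1 = B $ 2 * B $ 3 / B $ 1"
  using arg_cong[OF eq, of "%U. U $ 1"] arg_cong[OF eq, of "%U. U $ 2"] arg_cong[OF eq, of "%U. U $ 3"]
  by (simp_all add: flux_x_def)
 have pos: "0 < A $ 1" "0 < B $ 1" "0 < A $ 2" and sup: "(mass_speed (A $ 1))\<^sup>2 < (A $ 2)\<^sup>2" "(mass_speed (B $ 1))\<^sup>2 < (B $ 2)\<^sup>2"
  using A B by (auto simp: near_def states_def)
 have dec: "m\<^sup>2 / s + 1 * p s < m\<^sup>2 / r + 1 * p r" if r: "0 < r" "r < s" and m: "(mass_speed s)\<^sup>2 < m\<^sup>2" for r s m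
 proof (rule DERIV_neg_imp_decreasing[OF r(2)])
  fix x assume x: "r <= x" "x <= s"
  have "mass_speed x <= mass_speed s" using mass_speed_strict_mono[of x s] r x by (cases "x = s") auto
  then have "(mass_speed x)\<^sup>2 <= (mass_speed s)\<^sup>2" using mass_speed_pos[of x] r x by (intro power_mono) auto
  then have "(1 * (mass_speed x)\<^sup>2 - m\<^sup>2) / x\<^sup>2 < 0" using m r x by (intro divide_neg_pos) auto
  moreover have "((%r. m\<^sup>2 / r + 1 * p r) has_real_derivative (1 * (mass_speed x)\<^sup>2 - m\<^sup>2) / x\<^sup>2) (at x)"
   by (rule thrust_deriv) (use r x in simp)
  ultimately show "EX y. ((%r. m\<^sup>2 / r + 1 * p r) has_real_derivative y) (at x) & y < 0" by blast
 qed
 have 1: "A $ 1 = B $ 1"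
  using dec[OF pos(1) _ sup(2)] dec[OF pos(2) _ sup(1)] e(1,2) by (cases "A $ 1" "B $ 1" rule: linorder_cases) auto
 moreover have "A $ 3 = B $ 3" using e(1,3) 1 pos by simp
 ultimately show ?thesis using e(1) by (simp add: vec_eq_iff forall_3)
qed

text \<open>Off the vertical axis the flow is given by the two half plane profiles; the axis itself lies in the
 constant regions of slopes beyond the Mach slopes.\<close>

lemma flow_structure:
 assumes dlt: "0 < dlt" "dlt < lam / 4" and K: "compact K" "convex K" "K \<subseteq> states" and near: "!!U. U : K ==> near dlt U"
  and field: "!!U V xi a. U : K ==> V : K ==> U ~= V ==> ray_flux xi U = ray_flux xi V ==> xi : slopes M dlt a ==> belongs_to_field p a xi U V"
  and kap: "0 < kap" "!!U V. U : K ==> V : K ==> kap * norm (U - V) <= lam / 4"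
   "!!U V xi y. U : K ==> V : K ==> (abs xi) <= lam + dlt ==> ray_flux xi U = ray_flux xi V ==> mass_flux xi U ~= 0 ==> U $ 1 < V $ 1 ==>
     (abs (y - xi)) <= kap * norm (U - V) ==> sonic y U < 0 & 0 < sonic y V"
  and Kne: "K ~= {}" and U: "weak_solution p U" "entropy_admissible p U" "steady U" "self_similar U" "AE z in lebesgue. U z : K"
 shows "wave_structure p M dlt kap U"
proof -
 have Um: "U : borel_measurable lebesgue" using U(1) by (simp add: weak_solution_def)
 obtain vf where vf: "vf : borel_measurable borel" "!!xi. vf xi : K"
  "AE z in lebesgue. 0 < 1 * fst (snd z) --> U z = vf (snd (snd z) / fst (snd z))"
  using profile_exists[OF Um U(3,4) compact_imp_closed[OF K(1)] Kne U(5), of 1] by auto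
 obtain vb where vb: "vb : borel_measurable borel" "!!xi. vb xi : K"
  "AE z in lebesgue. 0 < - 1 * fst (snd z) --> U z = vb (snd (snd z) / fst (snd z))"
  using profile_exists[OF Um U(3,4) compact_imp_closed[OF K(1)] Kne U(5), of "-1"] by auto
 obtain Gf where Gf: "ray_solution 1 K vf Gf" using profile_equations[OF U(1,2) K(1,3) vf] by auto
 obtain Gb where Gb: "ray_solution (-1) K vb Gb" using profile_equations[OF U(1,2) K(1,3) vb] by auto
 interpret f: wave_profile p 1 K vf Gf \<rho>0 M dlt kap
  by unfold_locales (assumption | rule Gf K dlt near field kap | simp)+
 interpret b: wave_profile p "-1" K vb Gb \<rho>0 M dlt kap
  by unfold_locales (assumption | rule Gb K dlt near field kap | simp)+
 let ?t = "lam + dlt"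
 have t: "0 < ?t" using lam(1) dlt by simp
 have fU: "AE z in lebesgue. 0 < fst (snd z) --> U z = f.prof (snd (snd z) / fst (snd z))"
  using vf(3) AE_completion[OF AE_slope[OF f.prof_AE]] by eventually_elim auto
 have bU: "AE z in lebesgue. fst (snd z) < 0 --> U z = b.prof (snd (snd z) / fst (snd z))"
  using vb(3) AE_completion[OF AE_slope[OF b.prof_AE]] by eventually_elim auto
 have top: "f.w ?t = b.w (- ?t)"
 proof (rule flux_x_injective[OF near[OF f.far_K(1)] near[OF b.far_K(2)]], rule vertical_join[OF U(1), of ?t "?t + 1"])
  show "AE z in lebesgue. (0 < fst (snd z) & fst (snd z) <= 1 & ?t <= snd (snd z) & snd (snd z) <= ?t + 1 --> U z = f.w ?t) &
   (fst (snd z) < 0 & -1 <= fst (snd z) & ?t <= snd (snd z) & snd (snd z) <= ?t + 1 --> U z = b.w (- ?t))"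
   using fU bU
  proof eventually_elim
   fix z :: spacetime
   assume *: "0 < fst (snd z) --> U z = f.prof (snd (snd z) / fst (snd z))"
    "fst (snd z) < 0 --> U z = b.prof (snd (snd z) / fst (snd z))"
   obtain s x y where z: "z = (s, x, y)" by (cases z)
   have 1: "U z = f.w ?t" if "0 < x" "x <= 1" "?t <= y"
   proof -
    have "?t * x <= ?t * 1" using that t by (intro mult_left_mono) auto
    then have "?t <= y / x" using that by (simp add: pos_le_divide_eq)
    then show ?thesis using *(1) f.prof_far(1) that by (simp add: z)
   qed
   have 2: "U z = b.w (- ?t)" if "x < 0" "-1 <= x" "?t <= y"
   proof -
    have "?t * - x <= ?t * 1" using that t by (intro mult_left_mono) auto
    then have "?t * - x <= y" using that(3) by simp
    then have "- ?t * x <= y" by (simp only: mult_minus_left mult_minus_right)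
    then have "y / x <= - ?t" using that(1) by (simp only: neg_divide_le_eq)
    then show ?thesis using *(2) b.prof_far(2) that by (simp add: z)
   qed
   show "(0 < fst (snd z) & fst (snd z) <= 1 & ?t <= snd (snd z) & snd (snd z) <= ?t + 1 --> U z = f.w ?t) &
    (fst (snd z) < 0 & -1 <= fst (snd z) & ?t <= snd (snd z) & snd (snd z) <= ?t + 1 --> U z = b.w (- ?t))"
    using 1 2 by (simp add: z)
  qed
 qed simp
 have bot: "f.w (- ?t) = b.w ?t"
 proof (rule flux_x_injective[OF near[OF f.far_K(2)] near[OF b.far_K(1)]], rule vertical_join[OF U(1), of "- ?t - 1" "- ?t"])
  show "AE z in lebesgue. (0 < fst (snd z) & fst (snd z) <= 1 & - ?t - 1 <= snd (snd z) & snd (snd z) <= - ?t --> U z = f.w (- ?t)) &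
   (fst (snd z) < 0 & -1 <= fst (snd z) & - ?t - 1 <= snd (snd z) & snd (snd z) <= - ?t --> U z = b.w ?t)"
   using fU bU
  proof eventually_elim
   fix z :: spacetime
   assume *: "0 < fst (snd z) --> U z = f.prof (snd (snd z) / fst (snd z))"
    "fst (snd z) < 0 --> U z = b.prof (snd (snd z) / fst (snd z))"
   obtain s x y where z: "z = (s, x, y)" by (cases z)
   have 1: "U z = f.w (- ?t)" if "0 < x" "x <= 1" "y <= - ?t"
   proof -
    have "?t * x <= ?t * 1" using that t by (intro mult_left_mono) auto
    then have "y <= - (?t * x)" using that(3) by simp
    then have "y <= - ?t * x" by (simp only: mult_minus_left)
    then have "y / x <= - ?t" using that by (simp add: pos_divide_le_eq)
    then show ?thesis using *(1) f.prof_far(2) that by (simp add: z)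
   qed
   have 2: "U z = b.w ?t" if "x < 0" "-1 <= x" "y <= - ?t"
   proof -
    have "?t * - x <= ?t * 1" using that t by (intro mult_left_mono) auto
    then have "y <= ?t * x" using that by simp
    then have "?t <= y / x" using that by (simp add: neg_le_divide_eq)
    then show ?thesis using *(2) b.prof_far(1) that by (simp add: z)
   qed
   show "(0 < fst (snd z) & fst (snd z) <= 1 & - ?t - 1 <= snd (snd z) & snd (snd z) <= - ?t --> U z = f.w (- ?t)) &
    (fst (snd z) < 0 & -1 <= fst (snd z) & - ?t - 1 <= snd (snd z) & snd (snd z) <= - ?t --> U z = b.w ?t)"
    using 1 2 by (simp add: z)
  qed
 qed simp
 define V where "V w = (if 0 < fst w then f.prof (snd w / fst w) else if fst w < 0 then b.prof (snd w / fst w)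
   else if 0 < snd w then f.w ?t else f.w (- ?t))" for w :: "real \<times> real"
 have fV: "forward_part V = f.prof" by (rule ext) (simp add: forward_part_def V_def)
 have bV: "backward_part V = b.prof" by (rule ext) (simp add: backward_part_def V_def)
 have ae: "AE z in lebesgue. U z = V (snd z)"
  using fU bU AE_off_axis by eventually_elim (auto simp: V_def)
 have ray: "ray_constant V"
  unfolding ray_constant_def
 proof (intro allI impI, elim conjE)
  fix w :: "real \<times> real" and s :: real assume "w ~= 0" "0 < s"
  then show "V (s *\<^sub>R w) = V w" by (auto simp: V_def zero_less_mult_iff mult_less_0_iff)
 qed
 have bv: "bounded_variation_on {0..2 * pi} (%\<theta>. V (cos \<theta>, sin \<theta>))"
 proof -
  let ?g = "%\<theta>. V (cos \<theta>, sin \<theta>)"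
  have A1: "controlled {0..<pi / 2} ?g"
  proof (rule controlled_cong[OF controlled_compose[OF f.prof_controlled, of _ tan]])
   show "tan x <= tan y" if "x : {0..<pi / 2}" "y : {0..<pi / 2}" "x <= y" for x y
    by (rule tan_mono_le) (use that pi_gt_zero in auto)
   show "V (cos x, sin x) = f.prof (tan x)" if "x : {0..<pi / 2}" for x
    using cos_gt_zero_pi[of x] that pi_gt_zero by (simp add: V_def tan_def)
  qed auto
  have A2: "controlled {pi / 2} ?g" and A4: "controlled {3 * pi / 2} ?g"
   by (rule controlled_const[where c = "?g (pi / 2)"], simp only: singleton_iff)
    (rule controlled_const[where c = "?g (3 * pi / 2)"], simp only: singleton_iff)
  have A3: "controlled {pi / 2<..<3 * pi / 2} ?g"
  proof (rule controlled_cong[OF controlled_compose[OF b.prof_controlled, of _ "%\<theta>. tan (\<theta> - pi)"]])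
   show "tan (x - pi) <= tan (y - pi)" if "x : {pi / 2<..<3 * pi / 2}" "y : {pi / 2<..<3 * pi / 2}" "x <= y" for x y
    by (rule tan_mono_le) (use that in auto)
   show "V (cos x, sin x) = b.prof (tan (x - pi))" if "x : {pi / 2<..<3 * pi / 2}" for x
    using cos_gt_zero_pi[of "x - pi"] cos_periodic_pi[of "x - pi"] tan_periodic_pi[of "x - pi"] that by (simp add: V_def tan_def)
  qed auto
  have A5: "controlled {3 * pi / 2<..2 * pi} ?g"
  proof (rule controlled_cong[OF controlled_compose[OF f.prof_controlled, of _ "%\<theta>. tan (\<theta> - 2 * pi)"]])
   show "tan (x - 2 * pi) <= tan (y - 2 * pi)" if "x : {3 * pi / 2<..2 * pi}" "y : {3 * pi / 2<..2 * pi}" "x <= y" for x y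
    by (rule tan_mono_le) (use that pi_gt_zero in auto)
   show "V (cos x, sin x) = f.prof (tan (x - 2 * pi))" if "x : {3 * pi / 2<..2 * pi}" for x
    using cos_gt_zero_pi[of "x - 2 * pi"] cos_periodic[of "x - 2 * pi"] sin_periodic[of "x - 2 * pi"] that pi_gt_zero
    by (simp add: V_def tan_def)
  qed auto
  have "0 < pi / 2" "pi / 2 < 3 * pi / 2" "3 * pi / 2 < 2 * pi" using pi_gt_zero by simp_all
  from controlled_join_Icc[OF this A1 A2 A3 A4 A5] show ?thesis by (rule controlled_bounded_variation)
 qed
 define S where "S = - {0} - (\<Union>a. forward_sector M dlt a \<union> backward_sector M dlt a)"
 have loc: "\<forall>\<^sub>F c in nhds a. V c = V a" if a: "a : S" for a
 proof -
  obtain x y where xy: "a = (x, y)" by (cases a)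
  have fst: "((%c. fst c) \<longlongrightarrow> x) (nhds a)" using tendsto_fst[OF filterlim_ident, of a] by (simp add: xy)
  have snd: "((%c. snd c) \<longlongrightarrow> y) (nhds a)" using tendsto_snd[OF filterlim_ident, of a] by (simp add: xy)
  consider "0 < x" | "x < 0" | "x = 0" "0 < y" | "x = 0" "y < 0" using a by (fastforce simp: S_def xy zero_prod_def)
  then show ?thesis
  proof cases
   case 1
   have "y / x \<notin> slopes M dlt i" for i using a 1 by (auto simp: S_def xy forward_sector_def)
   from f.prof_locally_constant[OF this] obtain h where h: "0 < h" "ALL z. (abs (z - y / x)) < h --> f.prof z = f.prof (y / x)" by (elim exE conjE)
   have "((%c. snd c / fst c) \<longlongrightarrow> y / x) (nhds a)" using tendsto_divide[OF snd fst] 1 by simp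
   from tendstoD[OF this h(1)] order_tendstoD(1)[OF fst 1]
   show ?thesis
   proof eventually_elim
    fix c :: "real \<times> real" assume c: "dist (snd c / fst c) (y / x) < h" "0 < fst c"
    have "f.prof (snd c / fst c) = f.prof (y / x)"
     by (rule h(2)[rule_format]) (use c(1) in \<open>simp only: dist_real_def\<close>)
    then show "V c = V a" using c(2) 1 by (simp add: V_def xy)
   qed
  next
   case 2
   have "y / x \<notin> slopes M dlt i" for i using a 2 by (auto simp: S_def xy backward_sector_def)
   from b.prof_locally_constant[OF this] obtain h where h: "0 < h" "ALL z. (abs (z - y / x)) < h --> b.prof z = b.prof (y / x)" by (elim exE conjE)
   have "((%c. snd c / fst c) \<longlongrightarrow> y / x) (nhds a)" using tendsto_divide[OF snd fst] 2 by simp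
   from tendstoD[OF this h(1)] order_tendstoD(2)[OF fst 2]
   show ?thesis
   proof eventually_elim
    fix c :: "real \<times> real" assume c: "dist (snd c / fst c) (y / x) < h" "fst c < 0"
    have "b.prof (snd c / fst c) = b.prof (y / x)"
     by (rule h(2)[rule_format]) (use c(1) in \<open>simp only: dist_real_def\<close>)
    then show "V c = V a" using c(2) 2 by (simp add: V_def xy)
   qed
  next
   case 3
   have "((%c. snd c - ?t * (abs (fst c))) \<longlongrightarrow> y - ?t * (abs x)) (nhds a)" by (intro tendsto_intros fst snd)
   from order_tendstoD(1)[OF this, of 0] have "\<forall>\<^sub>F c in nhds a. 0 < snd c - ?t * (abs (fst c))" using 3 by simp
   then show ?thesis
   proof eventually_elim
    fix c :: "real \<times> real" assume c: "0 < snd c - ?t * (abs (fst c))"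
    have "V c = f.w ?t"
    proof (cases "fst c" "0 :: real" rule: linorder_cases)
     case less
     have "- (?t * fst c) = ?t * (abs (fst c))" using less by (simp only: abs_of_neg mult_minus_right)
     then have "- ?t * fst c <= snd c" using c unfolding mult_minus_left by linarith
     then have "snd c / fst c <= - ?t" using less by (simp only: neg_divide_le_eq)
     then show ?thesis using less b.prof_far(2) top by (simp add: V_def)
    next
     case equal then show ?thesis using c by (simp add: V_def)
    next
     case greater
     then have "?t <= snd c / fst c" using c by (simp add: pos_le_divide_eq algebra_simps)
     then show ?thesis using greater f.prof_far(1) by (simp add: V_def)
    qed
    then show "V c = V a" using 3 by (simp add: V_def xy)
   qed
  next
   case 4
   have "((%c. snd c + ?t * (abs (fst c))) \<longlongrightarrow> y + ?t * (abs x)) (nhds a)" by (intro tendsto_intros fst snd)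
   from order_tendstoD(2)[OF this, of 0] have "\<forall>\<^sub>F c in nhds a. snd c + ?t * (abs (fst c)) < 0" using 4 by simp
   then show ?thesis
   proof eventually_elim
    fix c :: "real \<times> real" assume c: "snd c + ?t * (abs (fst c)) < 0"
    have "V c = f.w (- ?t)"
    proof (cases "fst c" "0 :: real" rule: linorder_cases)
     case less
     then have "?t <= snd c / fst c" using c by (simp add: neg_le_divide_eq algebra_simps)
     then show ?thesis using less b.prof_far(1) bot by (simp add: V_def)
    next
     case equal then show ?thesis using c by (simp add: V_def)
    next
     case greater
     then have "?t * fst c = ?t * (abs (fst c))" by (simp only: abs_of_pos)
     then have "snd c <= - ?t * fst c" using c unfolding mult_minus_left by linarith
     then have "snd c / fst c <= - ?t" using greater by (simp only: pos_divide_le_eq)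
     then show ?thesis using greater f.prof_far(2) by (simp add: V_def)
    qed
    then show "V c = V a" using 4 by (simp add: V_def xy)
   qed
  qed
 qed
 have comp: "V constant_on C" if C: "C : components S" for C
 proof -
  obtain c where c: "c : C" using in_components_nonempty[OF C] by blast
  have "V x = V c" if x: "x : C" for x
  proof (rule connected_local_const[OF in_components_connected[OF C] x c])
   show "ALL a:C. \<forall>\<^sub>F b in at a within C. V a = V b"
   proof
    fix a assume "a : C"
    then have "a : S" using in_components_subset[OF C] by blast
    from loc[OF this] show "\<forall>\<^sub>F b in at a within C. V a = V b"
     unfolding eventually_at_filter by eventually_elim simp
   qed
  qed
  then show ?thesis unfolding constant_on_def by blast
 qed
 have field_of: "EX tau:{1, -1}. a = mach tau" if "a : {FPlus, FMinus}" for a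
  using that by (auto simp: mach_def intro: bexI[of _ 1] bexI[of _ "-1"])
 show ?thesis
  unfolding wave_structure_def
 proof (intro exI[of _ V] conjI ae ray bv)
  show "ALL C:components (- {0} - (\<Union>a. forward_sector M dlt a \<union> backward_sector M dlt a)). V constant_on C"
   using comp unfolding S_def by blast
  show "ALL u:{forward_part V, backward_part V}. u constant_on slopes M dlt FZero \<or>
    (EX xi0 Um Up. contact_at p u xi0 Um Up & const_off_jump u (slopes M dlt FZero) xi0)"
   using f.contact_structure b.contact_structure by (simp add: fV bV)
  show "ALL a:{FPlus, FMinus}. let u = forward_part V; I = slopes M dlt a in u constant_on I \<or>
    (EX xi0 Um Up. shock_at p a u xi0 Um Up & const_off_jump u I xi0) \<or> const_off_wave p a u I"
   unfolding Let_def fV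
  proof
   fix a assume "a : {FPlus, FMinus}"
   from field_of[OF this] obtain tau where tau: "tau : {1, -1}" "a = mach tau" by blast
   show "f.prof constant_on slopes M dlt a \<or> (EX xi0 Um Up. shock_at p a f.prof xi0 Um Up & const_off_jump f.prof (slopes M dlt a) xi0) \<or>
     const_off_wave p a f.prof (slopes M dlt a)"
    using f.sector_structure[OF tau(1), of "center_slope M a - dlt" "center_slope M a + dlt"] dlt(1)
    unfolding tau(2) slopes_def by simp
  qed
  show "ALL a:{FPlus, FMinus}. let u = backward_part V; I = slopes M dlt a in
      (ALL r s. r < s & {r<..<s} \<subseteq> I & continuous_on {r<..<s} u -->
       u constant_on {r<..<s} \<or> const_off_wave p a u {r<..<s}) &
      (ALL xi0:I. \<not> isCont u xi0 --> (EX Um Up. shock_at p a u xi0 Um Up)) &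
      discrete {xi0:I. EX Um Up. shock_at p a u xi0 Um Up} &
      (ALL xi0:I. ALL Um Up. shock_at p a u xi0 Um Up -->
       u constant_on {xi0 - kap * norm (Up - Um)<..<xi0} &
       u constant_on {xi0<..<xi0 + kap * norm (Up - Um)})"
   unfolding Let_def bV
  proof
   fix a assume "a : {FPlus, FMinus}"
   from field_of[OF this] obtain tau where tau: "tau : {1, -1}" "a = mach tau" by blast
   show "(ALL r s. r < s & {r<..<s} \<subseteq> slopes M dlt a & continuous_on {r<..<s} b.prof -->
       b.prof constant_on {r<..<s} \<or> const_off_wave p a b.prof {r<..<s}) &
      (ALL xi0:slopes M dlt a. \<not> isCont b.prof xi0 --> (EX Um Up. shock_at p a b.prof xi0 Um Up)) &
      discrete {xi0:slopes M dlt a. EX Um Up. shock_at p a b.prof xi0 Um Up} &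
      (ALL xi0:slopes M dlt a. ALL Um Up. shock_at p a b.prof xi0 Um Up -->
       b.prof constant_on {xi0 - kap * norm (Up - Um)<..<xi0} &
       b.prof constant_on {xi0<..<xi0 + kap * norm (Up - Um)})"
    unfolding tau(2) by (intro conjI b.backward_structure[OF tau(1) refl refl])
  qed
 qed
qed

end

theorem mainTheorem1:
  fixes p :: "real \<Rightarrow> real" and \<rho>0 M :: real
  assumes p_smooth: "smooth_on {0<..} p"
    and p_deriv: "\<And>\<rho>. 0 < \<rho> \<Longrightarrow> 0 < deriv p \<rho>"
    and rho_c: "\<And>\<rho>. 0 < \<rho> \<Longrightarrow> 0 < deriv (\<lambda>r. r * sound_speed p r) \<rho>"
    and rho0: "0 < \<rho>0"
    and supersonic: "1 < M"
  shows "\<exists>\<delta>0>0. \<forall>\<delta>. 0 < \<delta> \<and> \<delta> < \<delta>0 \<longrightarrow> (\<exists>\<epsilon>>0. \<exists>\<kappa>>0. \<forall>U :: spacetime \<Rightarrow> state.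
     in_Linf U \<and> weak_solution p U \<and> entropy_admissible p U \<and> steady U \<and> self_similar U \<and>
     (AE z in lebesgue. norm (U z - background p \<rho>0 M) \<le> \<epsilon>) \<longrightarrow>
     (\<exists>V. (AE z in lebesgue. U z = V (snd z)) \<and> ray_constant V \<and>
        bounded_variation_on {0..2 * pi} (\<lambda>\<theta>. V (cos \<theta>, sin \<theta>)) \<and>
        (\<forall>C \<in> components (- {0} - (\<Union>a. forward_sector M \<delta> a \<union> backward_sector M \<delta> a)).
           V constant_on C) \<and>
        (\<forall>u \<in> {forward_part V, backward_part V}.
           u constant_on slopes M \<delta> FZero \<or>
           (\<exists>\<xi>0 Um Up. contact_at p u \<xi>0 Um Up \<and> const_off_jump u (slopes M \<delta> FZero) \<xi>0)) \<and>
        (\<forall>a \<in> {FPlus, FMinus}. let u = forward_part V; I = slopes M \<delta> a in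
           u constant_on I \<or>
           (\<exists>\<xi>0 Um Up. shock_at p a u \<xi>0 Um Up \<and> const_off_jump u I \<xi>0) \<or>
           const_off_wave p a u I) \<and>
        (\<forall>a \<in> {FPlus, FMinus}. let u = backward_part V; I = slopes M \<delta> a in
           (\<forall>r s. r < s \<and> {r<..<s} \<subseteq> I \<and> continuous_on {r<..<s} u \<longrightarrow>
              u constant_on {r<..<s} \<or> const_off_wave p a u {r<..<s}) \<and>
           (\<forall>\<xi>0\<in>I. \<not> isCont u \<xi>0 \<longrightarrow> (\<exists>Um Up. shock_at p a u \<xi>0 Um Up)) \<and>
           discrete {\<xi>0\<in>I. \<exists>Um Up. shock_at p a u \<xi>0 Um Up} \<and>
           (\<forall>\<xi>0\<in>I. \<forall>Um Up. shock_at p a u \<xi>0 Um Up \<longrightarrow>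
              u constant_on {\<xi>0 - \<kappa> * norm (Up - Um)<..<\<xi>0} \<and>
              u constant_on {\<xi>0<..<\<xi>0 + \<kappa> * norm (Up - Um)}))))"
proof -
 interpret flow p \<rho>0 M by unfold_locales (use assms in auto)
 have main: "ALL dlt. 0 < dlt & dlt < lam / 4 --> (EX eps>0. EX kap>0. ALL U :: spacetime => state.
   in_Linf U & weak_solution p U & entropy_admissible p U & steady U & self_similar U &
   (AE z in lebesgue. norm (U z - bg) <= eps) --> wave_structure p M dlt kap U)"
 proof (intro allI impI)
  fix dlt assume "0 < dlt & dlt < lam / 4"
  then have dlt: "0 < dlt" "dlt < lam / 4" "dlt < lam" using lam(1) by auto
  obtain eps1 where eps1: "0 < eps1" "ALL U:cball bg eps1. near dlt U" using near_ball[OF dlt(1,3)] by blast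
  from jump_field[OF dlt(1,2)] obtain eps2 where eps2: "0 < eps2" "ALL Um:cball bg eps2. ALL Up:cball bg eps2. Um : states & Up : states &
   (ALL xi a. Um ~= Up --> ray_flux xi Um = ray_flux xi Up --> xi : slopes M dlt a --> belongs_to_field p a xi Um Up)"
   by (elim exE conjE)
  define eps where "eps = min eps1 eps2"
  define K where "K = cball bg eps"
  have eps: "0 < eps" using eps1(1) eps2(1) by (simp add: eps_def)
  have near: "near dlt U" if "U : K" for U using eps1(2) that by (simp add: K_def eps_def)
  have K: "compact K" "convex K" "K \<subseteq> states" "K ~= {}" using near eps by (auto simp: K_def near_def)
  have field: "belongs_to_field p a xi U V"
   if "U : K" "V : K" "U ~= V" "ray_flux xi U = ray_flux xi V" "xi : slopes M dlt a" for U V xi a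
  proof -
   have "U : cball bg eps2" "V : cball bg eps2" using that(1,2) by (auto simp: K_def eps_def)
   from eps2(2)[rule_format, OF this] that(3-5) show ?thesis by simp
  qed
  have pos: "0 < lam / 4" "0 < lam + dlt" using lam(1) dlt(1) by auto
  from jump_gap[OF K(1,3) pos] obtain kap where kap: "0 < kap" "ALL U:K. ALL V:K. kap * norm (U - V) <= lam / 4 &
   (ALL xi. (abs xi) <= lam + dlt --> ray_flux xi U = ray_flux xi V --> mass_flux xi U ~= 0 --> U $ 1 < V $ 1 -->
    (ALL y. (abs (y - xi)) <= kap * norm (U - V) --> sonic y U < 0 & 0 < sonic y V))"
   by (elim exE conjE)
  have kap1: "kap * norm (U - V) <= lam / 4" if "U : K" "V : K" for U V
   using kap(2)[rule_format, OF that] by (rule conjunct1)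
  have kap2: "sonic y U < 0 & 0 < sonic y V" if UV: "U : K" "V : K" "(abs xi) <= lam + dlt" "ray_flux xi U = ray_flux xi V" "mass_flux xi U ~= 0"
   "U $ 1 < V $ 1" "(abs (y - xi)) <= kap * norm (U - V)" for U V xi y
   by (rule kap(2)[rule_format, OF UV(1,2), THEN conjunct2, rule_format, OF UV(3-7)])
  have UK: "AE z in lebesgue. U z : K" if "AE z in lebesgue. norm (U z - bg) <= eps" for U
   using that by eventually_elim (simp add: K_def dist_norm norm_minus_commute)
  show "EX eps>0. EX kap>0. ALL U :: spacetime => state.
   in_Linf U & weak_solution p U & entropy_admissible p U & steady U & self_similar U &
   (AE z in lebesgue. norm (U z - bg) <= eps) --> wave_structure p M dlt kap U"
  proof (rule exI[of _ eps], rule conjI[OF eps], rule exI[of _ kap], rule conjI[OF kap(1)], intro allI impI, elim conjE)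
   fix U :: "spacetime => state"
   assume U: "weak_solution p U" "entropy_admissible p U" "steady U" "self_similar U"
    "AE z in lebesgue. norm (U z - bg) <= eps"
   show "wave_structure p M dlt kap U"
    by (rule flow_structure[OF dlt(1,2) K(1-3) near field kap(1) kap1 kap2 K(4) U(1-4) UK[OF U(5)]])
  qed
 qed
 show ?thesis
 proof (rule exI[of _ "lam / 4"], rule conjI)
  show "0 < lam / 4" using lam(1) by simp
 qed (rule main[unfolded wave_structure_def])
qed

end
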